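(* Let the discrete initial velocity $\boldsymbol u_{0,h}\in\boldsymbol V_h^{\mathrm{div}}$ of the scheme (G) be the one constructed in (IV), and let $\widetilde p_{\tau,h}$ be the pressure post-processed by collocation (PP). Then there is a constant $C>0$, independent of the mesh sizes in space and time, such that $$\Big(\int_0^T\|p(t)-\widetilde p_{\tau,h}(t)\|^2\,dt\Big)^{1/2}\le C\,(\tau^2+h^r).$$
   Context: Let $d\in\{2,3\}$, $\Omega\subset\mathbb R^d$ an open bounded domain, $T>0$, $I=(0,T]$, $\overline I=[0,T]$; $\langle\cdot,\cdot\rangle$ and $\|\cdot\|$ are the inner product and norm of $L^2(\Omega)$ (scalar-, vector- or matrix-valued), $\|\cdot\|_m$ the norm of $H^m(\Omega)$. $\boldsymbol V=H^1_0(\Omega)^d$, $Q=\{q\in L^2(\Omega):\int_\Omega q\,dx=0\}$, $\boldsymbol V^{\mathrm{div}}=\{\boldsymbol v\in\boldsymbol V:\langle\nabla\cdot\boldsymbol v,q\rangle=0\ \forall q\in Q\}$. Time mesh: $0=t_0<\dots<t_N=T$, $I_n=(t_{n-1},t_n]$, $\tau_n=t_n-t_{n-1}$, $\tau=\max_n\tau_n$, $\bar t_n=(t_{n-1}+t_n)/2$. $\mathbb P_k(J;B)$: $B$-valued polynomials in $t\in J$ of degree at most $k$. $w^+$ denotes right-sided limits. Continuous problem: $\partial_t\boldsymbol u-\Delta\boldsymbol u+\nabla p=\boldsymbol f$, $\nabla\cdot\boldsymbol u=0$ in $\Omega\times(0,T]$, $\boldsymbol u(0)=\boldsymbol u_0$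 in $\Omega$, $\boldsymbol u=\boldsymbol 0$ on $\partial\Omega\times[0,T]$, with $\boldsymbol u(t)\in\boldsymbol V^{\mathrm{div}}$, $p(t)\in Q$. Standing assumptions: the solution is sufficiently regular up to $t=0$, i.e. $\boldsymbol u\in C^k(\overline I;H^k(\Omega)^d)$, $p\in C^k(\overline I;H^k(\Omega))$ for a sufficiently large $k$ depending only on $r$ (and $\boldsymbol f$ is correspondingly regular); in particular $\partial_t\boldsymbol u(0)\in\boldsymbol V^{\mathrm{div}}$. The stationary Stokes problem on $\Omega$ is $H^2$-regular, i.e. for every $\boldsymbol g\in L^2(\Omega)^d$ the solution $(\boldsymbol w,s)\in\boldsymbol V\times Q$ of $-\Delta\boldsymbol w+\nabla s=\boldsymbol g$, $\nabla\cdot\boldsymbol w=0$ lies in $H^2\times H^1$ and $\|\boldsymbol w\|_2+\|s\|_1\le C\|\boldsymbol g\|$. Constants $C$ are independent of $h$ and of the time mesh, but may depend on $T$, the data (including $\Omega$), the solution $(\boldsymbol u,p)$, the shape regularity of the space meshes, and the polynomial degree in space. Finite elements: $\{\mathcal T_h\}$ is a shape-regular family of meshes of $\Omega$ with mesh size $h$, and $\boldsymbol V_h=\{\boldsymbol v\in\boldsymbol V:\boldsymbol v|_K\in\boldsymbol V(K)\ \forall K\in\mathcal T_h\}$, $Q_h=\{q\in Q:q|_K\in Q(K)\ \forall K\in\mathcal T_h\}$ with local spaces of mapped polynomials of uniformly bounded degree. Assumption: with $\beta$ independent of $h$, $0<\beta\le\inf_{q_h\in Q_h\setminus\{0\}}\sup_{\boldsymbol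 v_h\in\boldsymbol V_h\setminus\{0\}}\frac{-\langle\nabla\cdot\boldsymbol v_h,q_h\rangle}{\|\boldsymbol v_h\|_1\|q_h\|}$; and for $\boldsymbol v\in\boldsymbol V\cap H^{r+1}(\Omega)^d$, $q\in Q\cap H^r(\Omega)$ there are $i_h\boldsymbol v\in\boldsymbol V_h$, $j_hq\in Q_h$ with $\|\boldsymbol v-i_h\boldsymbol v\|+h\|\nabla(\boldsymbol v-i_h\boldsymbol v)\|\le Ch^{r+1}\|\boldsymbol v\|_{r+1}$, $\|q-j_hq\|\le Ch^r\|q\|_r$. $\boldsymbol V_h^{\mathrm{div}}=\{\boldsymbol v_h\in\boldsymbol V_h:\langle\nabla\cdot\boldsymbol v_h,q_h\rangle=0\ \forall q_h\in Q_h\}$. Operators: $\langle A_h\boldsymbol u,\boldsymbol v_h\rangle=\langle\nabla\boldsymbol u,\nabla\boldsymbol v_h\rangle$, $\langle B_h\boldsymbol v,q_h\rangle=-\langle\nabla\cdot\boldsymbol v,q_h\rangle$, $\langle B_h'q,\boldsymbol v_h\rangle=-\langle\nabla\cdot\boldsymbol v_h,q\rangle$. Initial value (IV): with $\boldsymbol f_0=\boldsymbol f(0)$, let $(\boldsymbol a_{0,h},s_h)\in\boldsymbol V_h\times Q_h$ be the unique solution of $\langle A_h\boldsymbol a_{0,h}+B_h's_h,\boldsymbol v_h\rangle=\langle\nabla(\boldsymbol f_0+\Delta\boldsymbol u_0),\nabla\boldsymbol v_h\rangle$, $\langle B_h\boldsymbol a_{0,h},q_h\rangle=0$ for all $\boldsymbol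 v_h\in\boldsymbol V_h$, $q_h\in Q_h$; then $(\boldsymbol u_{0,h},p_{0,h})\in\boldsymbol V_h^{\mathrm{div}}\times Q_h$ is the solution of $\langle A_h\boldsymbol u_{0,h}+B_h'p_{0,h},\boldsymbol v_h\rangle=\langle\boldsymbol f_0-\boldsymbol a_{0,h},\boldsymbol v_h\rangle$, $\langle B_h\boldsymbol u_{0,h},q_h\rangle=0$ for all $\boldsymbol v_h\in\boldsymbol V_h$, $q_h\in Q_h$. Scheme (G): $\boldsymbol u_{\tau,h}(0)=\boldsymbol u_{0,h}$. Successively for $n=1,\dots,N$, $(\boldsymbol u_{\tau,h},p_{\tau,h})|_{I_n}\in\mathbb P_1(I_n;\boldsymbol V_h)\times\mathbb P_1(I_n;Q_h)$ satisfies $\boldsymbol u_{\tau,h}^+(t_{n-1})=\boldsymbol u_{\tau,h}(t_{n-1})$ and $$\int_{I_n}\langle\partial_t\boldsymbol u_{\tau,h}+A_h\boldsymbol u_{\tau,h}+B_h'p_{\tau,h},\boldsymbol v_h\rangle dt=\tfrac{\tau_n}{2}\langle\boldsymbol f(t_{n-1})+\boldsymbol f(t_n),\boldsymbol v_h\rangle,\qquad\int_{I_n}\langle B_h\boldsymbol u_{\tau,h},q_h\rangle dt=0$$ for all $(\boldsymbol v_h,q_h)\in\boldsymbol V_h\times Q_h$. The velocity $\boldsymbol u_{\tau,h}$ and the values $p_{\tau,h}(\bar t_n)$ are uniquely determined, while $p^+_{\tau,h}(t_{n-1})\in Q_h$ is arbitrary; $p_{\tau,h}$ denotes any of the resulting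 pressure solutions. Post-processing by collocation (PP): on $I_n$ set $\widetilde{\boldsymbol u}_{\tau,h}(t)=\boldsymbol u_{\tau,h}(t)+\boldsymbol c_n^{\boldsymbol u}\vartheta_n(t)$, $\widetilde p_{\tau,h}(t)=p_{\tau,h}(t)+d_n^p\vartheta_n'(t)$, where $\vartheta_n(t)=\alpha_n(t-t_{n-1})(t-t_n)$ with $\alpha_n\in\mathbb R$ such that $\vartheta_n'(t_{n-1})=1$, and $\boldsymbol c_n^{\boldsymbol u}\in\boldsymbol V_h^{\mathrm{div}}$, $d_n^p\in Q_h$ are chosen such that $\langle\partial_t\widetilde{\boldsymbol u}_{\tau,h}(t_{n-1})+A_h\widetilde{\boldsymbol u}_{\tau,h}(t_{n-1})+B_h'\widetilde p_{\tau,h}(t_{n-1}),\boldsymbol v_h\rangle=\langle\boldsymbol f(t_{n-1}),\boldsymbol v_h\rangle$ for all $\boldsymbol v_h\in\boldsymbol V_h$ (values at $t_{n-1}$ being right-sided limits from $I_n$). The result is uniquely determined and independent of the choice of $p^+_{\tau,h}(t_{n-1})$. *)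

theory Defs
  imports "HOL-Analysis.Analysis"
begin

section \<open>Lebesgue and Sobolev spaces on a domain\<close>

text \<open>
  Elements of function spaces are represented by functions; two representatives of the same
  element agree almost everywhere on \<open>\<Omega>\<close>, and norms are accordingly seminorms on representatives.
\<close>

definition l2_space :: "(real^'d) set \<Rightarrow> (real^'d \<Rightarrow> 'b::euclidean_space) set" where
  "l2_space \<Omega> = {v \<in> borel_measurable (lebesgue_on \<Omega>).
     integrable (lebesgue_on \<Omega>) (\<lambda>x. (norm (v x))\<^sup>2)}"

definition l2_inner ::
  "(real^'d) set \<Rightarrow> (real^'d \<Rightarrow> 'b::euclidean_space) \<Rightarrow> (real^'d \<Rightarrow> 'b) \<Rightarrow> real" where
  "l2_inner \<Omega> v w = (LINT x|lebesgue_on \<Omega>. v x \<bullet> w x)"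

definition l2_norm :: "(real^'d) set \<Rightarrow> (real^'d \<Rightarrow> 'b::euclidean_space) \<Rightarrow> real" where
  "l2_norm \<Omega> v = sqrt (l2_inner \<Omega> v v)"

definition ae_eq :: "(real^'d) set \<Rightarrow> (real^'d \<Rightarrow> 'b) \<Rightarrow> (real^'d \<Rightarrow> 'b) \<Rightarrow> bool" where
  "ae_eq \<Omega> v w \<longleftrightarrow> (AE x in lebesgue_on \<Omega>. v x = w x)"

text \<open>A list of coordinate indices encodes an iterated partial derivative; its length is the order.\<close>

fun partials :: "'d list \<Rightarrow> (real^'d \<Rightarrow> 'b::euclidean_space) \<Rightarrow> real^'d \<Rightarrow> 'b" where
  "partials [] \<phi> = \<phi>"
| "partials (i # is) \<phi> = (\<lambda>x. frechet_derivative (partials is \<phi>) (at x) (axis i 1))"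

definition test_functions :: "(real^'d) set \<Rightarrow> (real^'d \<Rightarrow> 'b::euclidean_space) set" where
  "test_functions \<Omega> = {\<phi>. (\<forall>is x. partials is \<phi> differentiable (at x)) \<and>
     compact (closure {x. \<phi> x \<noteq> 0}) \<and> closure {x. \<phi> x \<noteq> 0} \<subseteq> \<Omega>}"

definition locally_integrable :: "(real^'d) set \<Rightarrow> (real^'d \<Rightarrow> 'b::euclidean_space) \<Rightarrow> bool" where
  "locally_integrable \<Omega> v \<longleftrightarrow> (\<forall>K. compact K \<and> K \<subseteq> \<Omega> \<longrightarrow> set_integrable lebesgue K v)"

definition has_weak_deriv :: "(real^'d) set \<Rightarrow> 'd list \<Rightarrow>
    (real^'d \<Rightarrow> 'b::euclidean_space) \<Rightarrow> (real^'d \<Rightarrow> 'b) \<Rightarrow> bool" where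
  "has_weak_deriv \<Omega> is v g \<longleftrightarrow> locally_integrable \<Omega> v \<and> locally_integrable \<Omega> g \<and>
     (\<forall>\<phi> :: real^'d \<Rightarrow> real. \<phi> \<in> test_functions \<Omega> \<longrightarrow>
        (LINT x|lebesgue_on \<Omega>. partials is \<phi> x *\<^sub>R v x) =
        (-1) ^ length is *\<^sub>R (LINT x|lebesgue_on \<Omega>. \<phi> x *\<^sub>R g x))"

text \<open>The weak derivative is unique almost everywhere; a representative is chosen.\<close>

definition weak_deriv :: "(real^'d) set \<Rightarrow> 'd list \<Rightarrow>
    (real^'d \<Rightarrow> 'b::euclidean_space) \<Rightarrow> real^'d \<Rightarrow> 'b" where
  "weak_deriv \<Omega> is v = (SOME g. has_weak_deriv \<Omega> is v g)"

definition sobolev :: "(real^'d) set \<Rightarrow> nat \<Rightarrow> (real^'d \<Rightarrow> 'b::euclidean_space) set" where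
  "sobolev \<Omega> m = {v \<in> l2_space \<Omega>.
     \<forall>is. length is \<le> m \<longrightarrow> (\<exists>g \<in> l2_space \<Omega>. has_weak_deriv \<Omega> is v g)}"

text \<open>
  The squared norm is the sum over \<open>j \<le> m\<close> of the squared \<open>L\<^sup>2\<close> norms of the full tensors of
  \<open>j\<close>-th order derivatives.
\<close>

definition sobolev_norm ::
  "(real^'d) set \<Rightarrow> nat \<Rightarrow> (real^'d \<Rightarrow> 'b::euclidean_space) \<Rightarrow> real" where
  "sobolev_norm \<Omega> m v =
     sqrt (\<Sum>is | length is \<le> m. (l2_norm \<Omega> (weak_deriv \<Omega> is v))\<^sup>2)"

definition sobolev10 :: "(real^'d) set \<Rightarrow> (real^'d \<Rightarrow> 'b::euclidean_space) set" where
  "sobolev10 \<Omega> = {v \<in> sobolev \<Omega> 1.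
     \<forall>\<epsilon>>0. \<exists>\<phi> \<in> test_functions \<Omega>. sobolev_norm \<Omega> 1 (\<lambda>x. v x - \<phi> x) < \<epsilon>}"

definition grad_s :: "(real^'d) set \<Rightarrow> (real^'d \<Rightarrow> real) \<Rightarrow> real^'d \<Rightarrow> real^'d" where
  "grad_s \<Omega> q x = (\<chi> j. weak_deriv \<Omega> [j] q x)"

definition grad_v :: "(real^'d) set \<Rightarrow> (real^'d \<Rightarrow> real^'d) \<Rightarrow> real^'d \<Rightarrow> real^'d^'d" where
  "grad_v \<Omega> v x = (\<chi> i j. weak_deriv \<Omega> [j] v x $ i)"

definition divg :: "(real^'d) set \<Rightarrow> (real^'d \<Rightarrow> real^'d) \<Rightarrow> real^'d \<Rightarrow> real" where
  "divg \<Omega> v x = (\<Sum>i\<in>UNIV. weak_deriv \<Omega> [i] v x $ i)"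

definition laplacian :: "(real^'d) set \<Rightarrow> (real^'d \<Rightarrow> real^'d) \<Rightarrow> real^'d \<Rightarrow> real^'d" where
  "laplacian \<Omega> v x = (\<Sum>i\<in>UNIV. weak_deriv \<Omega> [i, i] v x)"

abbreviation velocity_space :: "(real^'d) set \<Rightarrow> (real^'d \<Rightarrow> real^'d) set" where
  "velocity_space \<Omega> \<equiv> sobolev10 \<Omega>"

definition pressure_space :: "(real^'d) set \<Rightarrow> (real^'d \<Rightarrow> real) set" where
  "pressure_space \<Omega> = {q \<in> l2_space \<Omega>. (LINT x|lebesgue_on \<Omega>. q x) = 0}"

definition velocity_div_space :: "(real^'d) set \<Rightarrow> (real^'d \<Rightarrow> real^'d) set" where
  "velocity_div_space \<Omega> =
     {v \<in> velocity_space \<Omega>. \<forall>q \<in> pressure_space \<Omega>. l2_inner \<Omega> (divg \<Omega> v) q = 0}"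

definition form_a ::
  "(real^'d) set \<Rightarrow> (real^'d \<Rightarrow> real^'d) \<Rightarrow> (real^'d \<Rightarrow> real^'d) \<Rightarrow> real" where
  "form_a \<Omega> u v = l2_inner \<Omega> (grad_v \<Omega> u) (grad_v \<Omega> v)"

definition form_b ::
  "(real^'d) set \<Rightarrow> (real^'d \<Rightarrow> real^'d) \<Rightarrow> (real^'d \<Rightarrow> real) \<Rightarrow> real" where
  "form_b \<Omega> v q = - l2_inner \<Omega> (divg \<Omega> v) q"


section \<open>The continuous problem\<close>

definition bounded_domain :: "(real^'d) set \<Rightarrow> bool" where
  "bounded_domain \<Omega> \<longleftrightarrow> open \<Omega> \<and> connected \<Omega> \<and> bounded \<Omega> \<and> \<Omega> \<noteq> {}"

text \<open>The difference quotients of \<open>w\<close> at \<open>t\<close> within \<open>J\<close> converge to \<open>g\<close> in the norm \<open>\<N>\<close>.\<close>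

definition has_time_deriv :: "((real^'d \<Rightarrow> 'b::euclidean_space) \<Rightarrow> real) \<Rightarrow> real set \<Rightarrow>
    (real \<Rightarrow> real^'d \<Rightarrow> 'b) \<Rightarrow> (real^'d \<Rightarrow> 'b) \<Rightarrow> real \<Rightarrow> bool" where
  "has_time_deriv \<N> J w g t \<longleftrightarrow>
     ((\<lambda>s. \<N> (\<lambda>x. (w s x - w t x) /\<^sub>R (s - t) - g x)) \<longlongrightarrow> 0) (at t within J)"

definition time_continuous_on :: "((real^'d \<Rightarrow> 'b::euclidean_space) \<Rightarrow> real) \<Rightarrow> real set \<Rightarrow>
    (real \<Rightarrow> real^'d \<Rightarrow> 'b) \<Rightarrow> bool" where
  "time_continuous_on \<N> J w \<longleftrightarrow>
     (\<forall>t\<in>J. ((\<lambda>s. \<N> (\<lambda>x. w s x - w t x)) \<longlongrightarrow> 0) (at t within J))"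

text \<open>\<open>C\<^sup>k([0,T]; H\<^sup>m(\<Omega>))\<close>: \<open>W j\<close> is the \<open>j\<close>-th time derivative.\<close>

definition time_Ck_sobolev ::
  "nat \<Rightarrow> nat \<Rightarrow> (real^'d) set \<Rightarrow> real \<Rightarrow> (real \<Rightarrow> real^'d \<Rightarrow> 'b::euclidean_space) set" where
  "time_Ck_sobolev k m \<Omega> T = {w. \<exists>W. (\<forall>t\<in>{0..T}. W 0 t = w t) \<and>
     (\<forall>j\<le>k. (\<forall>t\<in>{0..T}. W j t \<in> sobolev \<Omega> m) \<and>
             time_continuous_on (sobolev_norm \<Omega> m) {0..T} (W j)) \<and>
     (\<forall>j<k. \<forall>t\<in>{0..T}.
        has_time_deriv (sobolev_norm \<Omega> m) {0..T} (W j) (W (Suc j) t) t)}"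

text \<open>The time derivative on \<open>[0,T]\<close> (one-sided at the end points) in the sense of \<open>L\<^sup>2(\<Omega>)\<close>.\<close>

definition time_deriv ::
  "(real^'d) set \<Rightarrow> real \<Rightarrow> (real \<Rightarrow> real^'d \<Rightarrow> 'b::euclidean_space) \<Rightarrow> real \<Rightarrow> real^'d \<Rightarrow> 'b" where
  "time_deriv \<Omega> T w t = (SOME g. g \<in> l2_space \<Omega> \<and> has_time_deriv (l2_norm \<Omega>) {0..T} w g t)"

definition nonstationary_stokes_solution ::
  "(real^'d) set \<Rightarrow> real \<Rightarrow> (real \<Rightarrow> real^'d \<Rightarrow> real^'d) \<Rightarrow> (real^'d \<Rightarrow> real^'d) \<Rightarrow>
   (real \<Rightarrow> real^'d \<Rightarrow> real^'d) \<Rightarrow> (real \<Rightarrow> real^'d \<Rightarrow> real) \<Rightarrow> bool" where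
  "nonstationary_stokes_solution \<Omega> T f u0 u p \<longleftrightarrow>
     (\<forall>t\<in>{0..T}. u t \<in> velocity_div_space \<Omega> \<and> p t \<in> pressure_space \<Omega>) \<and>
     (\<forall>t\<in>{0<..T}.
        ae_eq \<Omega> (\<lambda>x. time_deriv \<Omega> T u t x - laplacian \<Omega> (u t) x + grad_s \<Omega> (p t) x) (f t) \<and>
        ae_eq \<Omega> (divg \<Omega> (u t)) (\<lambda>x. 0)) \<and>
     ae_eq \<Omega> (u 0) u0"

definition regular_data :: "nat \<Rightarrow> (real^'d) set \<Rightarrow> real \<Rightarrow> (real \<Rightarrow> real^'d \<Rightarrow> real^'d) \<Rightarrow>
   (real \<Rightarrow> real^'d \<Rightarrow> real^'d) \<Rightarrow> (real \<Rightarrow> real^'d \<Rightarrow> real) \<Rightarrow> bool" where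
  "regular_data k \<Omega> T f u p \<longleftrightarrow>
     u \<in> time_Ck_sobolev k k \<Omega> T \<and> p \<in> time_Ck_sobolev k k \<Omega> T \<and>
     f \<in> time_Ck_sobolev k k \<Omega> T \<and> time_deriv \<Omega> T u 0 \<in> velocity_div_space \<Omega>"

definition stationary_stokes_solution :: "(real^'d) set \<Rightarrow> (real^'d \<Rightarrow> real^'d) \<Rightarrow>
   (real^'d \<Rightarrow> real^'d) \<Rightarrow> (real^'d \<Rightarrow> real) \<Rightarrow> bool" where
  "stationary_stokes_solution \<Omega> g w s \<longleftrightarrow>
     w \<in> velocity_space \<Omega> \<and> s \<in> pressure_space \<Omega> \<and>
     (\<forall>v \<in> velocity_space \<Omega>. form_a \<Omega> w v + form_b \<Omega> v s = l2_inner \<Omega> g v) \<and>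
     ae_eq \<Omega> (divg \<Omega> w) (\<lambda>x. 0)"

text \<open>
  On a connected domain the pair \<open>(w, s)\<close> is unique (almost everywhere), so that the existential
  quantifier refers to the solution.
\<close>

definition stokes_H2_regular :: "(real^'d) set \<Rightarrow> bool" where
  "stokes_H2_regular \<Omega> \<longleftrightarrow> (\<exists>C. \<forall>g \<in> l2_space \<Omega>.
     \<exists>w s. stationary_stokes_solution \<Omega> g w s \<and> w \<in> sobolev \<Omega> 2 \<and> s \<in> sobolev \<Omega> 1 \<and>
       sobolev_norm \<Omega> 2 w + sobolev_norm \<Omega> 1 s \<le> C * l2_norm \<Omega> g)"


section \<open>Finite element spaces\<close>

text \<open>
  A mesh together with the reference cell and the reference map of each cell, and the local
  velocity and pressure spaces. Only the values of local functions on their cell matter.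
\<close>

record ('d::finite) fe_discretization =
  cells :: "(real^'d) set set"
  ref_cell :: "(real^'d) set \<Rightarrow> (real^'d) set"
  cell_map :: "(real^'d) set \<Rightarrow> real^'d \<Rightarrow> real^'d"
  local_velocity :: "(real^'d) set \<Rightarrow> (real^'d \<Rightarrow> real^'d) set"
  local_pressure :: "(real^'d) set \<Rightarrow> (real^'d \<Rightarrow> real) set"

definition mesh_of :: "(real^'d) set \<Rightarrow> 'd fe_discretization \<Rightarrow> bool" where
  "mesh_of \<Omega> D \<longleftrightarrow> finite (cells D) \<and> cells D \<noteq> {} \<and> \<Union>(cells D) = closure \<Omega> \<and>
     (\<forall>K\<in>cells D. interior K \<subseteq> \<Omega>) \<and>
     (\<forall>K\<in>cells D. \<forall>L\<in>cells D. K \<noteq> L \<longrightarrow> interior K \<inter> interior L = {}) \<and>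
     (\<forall>K\<in>cells D. inj_on (cell_map D K) (ref_cell D K) \<and>
                   cell_map D K ` ref_cell D K = K)"

definition mesh_size :: "'d::finite fe_discretization \<Rightarrow> real" where
  "mesh_size D = Max (diameter ` cells D)"

text \<open>
  The reference cells come from a finite collection of polytopes, and the reference maps are
  continuously differentiable with derivatives and inverses of derivatives of size
  \<open>h\<^sub>K\<close> and \<open>1 / h\<^sub>K\<close>, uniformly over the family. For affine maps this is the usual bound on the
  ratio of the diameter and the inradius of the cells.
\<close>

definition shape_regular_family :: "(real^'d) set \<Rightarrow> 'd fe_discretization set \<Rightarrow> bool" where
  "shape_regular_family \<Omega> \<F> \<longleftrightarrow> (\<forall>D\<in>\<F>. mesh_of \<Omega> D) \<and>
     (\<exists>R \<sigma>. finite R \<and> (\<forall>P\<in>R. polytope P \<and> interior P \<noteq> {}) \<and> \<sigma> > 0 \<and>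
       (\<forall>D\<in>\<F>. \<forall>K\<in>cells D. ref_cell D K \<in> R \<and>
          (\<exists>F'. (\<forall>v. continuous_on (ref_cell D K) (\<lambda>x. F' x v)) \<and>
             (\<forall>x\<in>ref_cell D K.
                (cell_map D K has_derivative F' x) (at x within ref_cell D K) \<and>
                (\<forall>v. diameter K / \<sigma> * norm v \<le> norm (F' x v) \<and>
                     norm (F' x v) \<le> \<sigma> * diameter K * norm v)))))"

definition poly_functions :: "nat \<Rightarrow> (real^'d \<Rightarrow> 'b::euclidean_space) set" where
  "poly_functions m = {w. \<exists>c :: ('d \<Rightarrow> nat) \<Rightarrow> 'b. \<forall>x.
     w x = (\<Sum>\<alpha> | (\<Sum>i\<in>UNIV. \<alpha> i) \<le> m. (\<Prod>i\<in>UNIV. (x $ i) ^ \<alpha> i) *\<^sub>R c \<alpha>)}"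

definition function_subspace :: "(real^'d \<Rightarrow> 'b::euclidean_space) set \<Rightarrow> bool" where
  "function_subspace S \<longleftrightarrow> (\<lambda>x. 0) \<in> S \<and>
     (\<forall>v\<in>S. \<forall>w\<in>S. \<forall>a b. (\<lambda>x. a *\<^sub>R v x + b *\<^sub>R w x) \<in> S)"

text \<open>Each \<open>v\<close> in the local space is \<open>v' \<circ> F\<^sup>-\<^sup>1\<close> on the cell for a polynomial \<open>v'\<close> on the reference cell.\<close>

definition mapped_poly_space :: "nat \<Rightarrow> (real^'d) set \<Rightarrow> (real^'d \<Rightarrow> real^'d) \<Rightarrow>
    (real^'d \<Rightarrow> 'b::euclidean_space) set \<Rightarrow> bool" where
  "mapped_poly_space m P F S \<longleftrightarrow> function_subspace S \<and>
     (\<forall>v\<in>S. \<exists>v' \<in> poly_functions m. \<forall>x\<in>P. v (F x) = v' x)"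

definition local_spaces_bounded_degree :: "'d::finite fe_discretization set \<Rightarrow> bool" where
  "local_spaces_bounded_degree \<F> \<longleftrightarrow> (\<exists>m. \<forall>D\<in>\<F>. \<forall>K\<in>cells D.
     mapped_poly_space m (ref_cell D K) (cell_map D K) (local_velocity D K) \<and>
     mapped_poly_space m (ref_cell D K) (cell_map D K) (local_pressure D K))"

definition Vh :: "(real^'d) set \<Rightarrow> 'd fe_discretization \<Rightarrow> (real^'d \<Rightarrow> real^'d) set" where
  "Vh \<Omega> D = {v \<in> velocity_space \<Omega>. \<forall>K\<in>cells D. \<exists>w \<in> local_velocity D K. ae_eq K v w}"

definition Qh :: "(real^'d) set \<Rightarrow> 'd fe_discretization \<Rightarrow> (real^'d \<Rightarrow> real) set" where
  "Qh \<Omega> D = {q \<in> pressure_space \<Omega>. \<forall>K\<in>cells D. \<exists>w \<in> local_pressure D K. ae_eq K q w}"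

definition Vh_div :: "(real^'d) set \<Rightarrow> 'd fe_discretization \<Rightarrow> (real^'d \<Rightarrow> real^'d) set" where
  "Vh_div \<Omega> D = {v \<in> Vh \<Omega> D. \<forall>q \<in> Qh \<Omega> D. l2_inner \<Omega> (divg \<Omega> v) q = 0}"

text \<open>
  Infimum and supremum are taken in the extended reals, where those over the empty set have their
  usual values. Nonzero elements are those which do not vanish almost everywhere.
\<close>

definition uniform_inf_sup :: "(real^'d) set \<Rightarrow> 'd fe_discretization set \<Rightarrow> bool" where
  "uniform_inf_sup \<Omega> \<F> \<longleftrightarrow> (\<exists>\<beta>>0. \<forall>D\<in>\<F>.
     ereal \<beta> \<le> (INF q \<in> {q \<in> Qh \<Omega> D. \<not> ae_eq \<Omega> q (\<lambda>x. 0)}.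
                 SUP v \<in> {v \<in> Vh \<Omega> D. \<not> ae_eq \<Omega> v (\<lambda>x. 0)}.
                   ereal (- l2_inner \<Omega> (divg \<Omega> v) q / (sobolev_norm \<Omega> 1 v * l2_norm \<Omega> q))))"

definition approximation_order ::
  "nat \<Rightarrow> (real^'d) set \<Rightarrow> 'd fe_discretization set \<Rightarrow> bool" where
  "approximation_order r \<Omega> \<F> \<longleftrightarrow> (\<exists>C. \<forall>D\<in>\<F>.
     (\<forall>v \<in> velocity_space \<Omega> \<inter> sobolev \<Omega> (r + 1). \<exists>v' \<in> Vh \<Omega> D.
        l2_norm \<Omega> (\<lambda>x. v x - v' x) + mesh_size D * l2_norm \<Omega> (grad_v \<Omega> (\<lambda>x. v x - v' x))
          \<le> C * mesh_size D ^ (r + 1) * sobolev_norm \<Omega> (r + 1) v) \<and>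
     (\<forall>q \<in> pressure_space \<Omega> \<inter> sobolev \<Omega> r. \<exists>q' \<in> Qh \<Omega> D.
        l2_norm \<Omega> (\<lambda>x. q x - q' x) \<le> C * mesh_size D ^ r * sobolev_norm \<Omega> r q))"


section \<open>The fully discrete scheme\<close>

text \<open>
  The discrete operators enter only in products with test functions. These are written out:
  \<open>\<langle>A\<^sub>h u, v\<rangle> = form_a \<Omega> u v\<close>, \<open>\<langle>B\<^sub>h v, q\<rangle> = form_b \<Omega> v q\<close> and \<open>\<langle>B\<^sub>h' q, v\<rangle> = form_b \<Omega> v q\<close>.
\<close>

definition discrete_initial_velocity :: "(real^'d) set \<Rightarrow> 'd fe_discretization \<Rightarrow>
   (real^'d \<Rightarrow> real^'d) \<Rightarrow> (real^'d \<Rightarrow> real^'d) \<Rightarrow> (real^'d \<Rightarrow> real^'d) \<Rightarrow> bool" where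
  "discrete_initial_velocity \<Omega> D f0 u0 u0h \<longleftrightarrow>
     (\<exists>a0h \<in> Vh \<Omega> D. \<exists>sh \<in> Qh \<Omega> D. \<exists>p0h \<in> Qh \<Omega> D.
        (\<forall>v \<in> Vh \<Omega> D. form_a \<Omega> a0h v + form_b \<Omega> v sh =
           l2_inner \<Omega> (grad_v \<Omega> (\<lambda>x. f0 x + laplacian \<Omega> u0 x)) (grad_v \<Omega> v)) \<and>
        (\<forall>q \<in> Qh \<Omega> D. form_b \<Omega> a0h q = 0) \<and>
        u0h \<in> Vh_div \<Omega> D \<and>
        (\<forall>v \<in> Vh \<Omega> D. form_a \<Omega> u0h v + form_b \<Omega> v p0h = l2_inner \<Omega> (\<lambda>x. f0 x - a0h x) v) \<and>
        (\<forall>q \<in> Qh \<Omega> D. form_b \<Omega> u0h q = 0))"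

definition time_mesh :: "real \<Rightarrow> nat \<Rightarrow> (nat \<Rightarrow> real) \<Rightarrow> bool" where
  "time_mesh T N t \<longleftrightarrow> N \<ge> 1 \<and> t 0 = 0 \<and> t N = T \<and> (\<forall>n\<in>{1..N}. t (n - 1) < t n)"

definition step :: "(nat \<Rightarrow> real) \<Rightarrow> nat \<Rightarrow> real" where
  "step t n = t n - t (n - 1)"

definition max_step :: "nat \<Rightarrow> (nat \<Rightarrow> real) \<Rightarrow> real" where
  "max_step N t = Max (step t ` {1..N})"

definition subinterval :: "(nat \<Rightarrow> real) \<Rightarrow> nat \<Rightarrow> real set" where
  "subinterval t n = {t (n - 1)<..t n}"

definition time_polys :: "nat \<Rightarrow> real set \<Rightarrow> (real^'d \<Rightarrow> 'b::euclidean_space) set \<Rightarrow>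
    (real \<Rightarrow> real^'d \<Rightarrow> 'b) set" where
  "time_polys k J B = {w. \<exists>c. (\<forall>i\<le>k. c i \<in> B) \<and>
     (\<forall>s\<in>J. \<forall>x. w s x = (\<Sum>i\<le>k. s ^ i *\<^sub>R c i x))}"

text \<open>
  Discrete functions are polynomials in time on each subinterval, with fixed representatives of
  the coefficients. Hence their time derivatives and one-sided limits, which are meant in the norm
  of the function space, can be computed pointwise in \<open>x\<close>.
\<close>

definition piece_deriv :: "real set \<Rightarrow> (real \<Rightarrow> real^'d \<Rightarrow> 'b::euclidean_space) \<Rightarrow>
    real \<Rightarrow> real^'d \<Rightarrow> 'b" where
  "piece_deriv J w s x = vector_derivative (\<lambda>s. w s x) (at s within J)"

definition right_limit ::
  "(real \<Rightarrow> real^'d \<Rightarrow> 'b::euclidean_space) \<Rightarrow> real \<Rightarrow> real^'d \<Rightarrow> 'b" where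
  "right_limit w s x = Lim (at_right s) (\<lambda>s. w s x)"

definition scheme_solution :: "(real^'d) set \<Rightarrow> 'd fe_discretization \<Rightarrow> nat \<Rightarrow> (nat \<Rightarrow> real) \<Rightarrow>
   (real \<Rightarrow> real^'d \<Rightarrow> real^'d) \<Rightarrow> (real^'d \<Rightarrow> real^'d) \<Rightarrow>
   (real \<Rightarrow> real^'d \<Rightarrow> real^'d) \<Rightarrow> (real \<Rightarrow> real^'d \<Rightarrow> real) \<Rightarrow> bool" where
  "scheme_solution \<Omega> D N t f u0h uh ph \<longleftrightarrow> ae_eq \<Omega> (uh 0) u0h \<and>
     (\<forall>n\<in>{1..N}. let J = subinterval t n in
        uh \<in> time_polys 1 J (Vh \<Omega> D) \<and> ph \<in> time_polys 1 J (Qh \<Omega> D) \<and>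
        ae_eq \<Omega> (right_limit uh (t (n - 1))) (uh (t (n - 1))) \<and>
        (\<forall>v \<in> Vh \<Omega> D.
           (LINT s:J|lebesgue.
              l2_inner \<Omega> (piece_deriv J uh s) v + form_a \<Omega> (uh s) v + form_b \<Omega> v (ph s)) =
           step t n / 2 * l2_inner \<Omega> (\<lambda>x. f (t (n - 1)) x + f (t n) x) v) \<and>
        (\<forall>q \<in> Qh \<Omega> D. (LINT s:J|lebesgue. form_b \<Omega> (uh s) q) = 0))"

definition bubble :: "(nat \<Rightarrow> real) \<Rightarrow> (nat \<Rightarrow> real) \<Rightarrow> nat \<Rightarrow> real \<Rightarrow> real" where
  "bubble \<alpha> t n s = \<alpha> n * (s - t (n - 1)) * (s - t n)"

definition collocation_postprocessing ::
  "(real^'d) set \<Rightarrow> 'd fe_discretization \<Rightarrow> nat \<Rightarrow> (nat \<Rightarrow> real) \<Rightarrow>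
   (real \<Rightarrow> real^'d \<Rightarrow> real^'d) \<Rightarrow>
   (real \<Rightarrow> real^'d \<Rightarrow> real^'d) \<Rightarrow> (real \<Rightarrow> real^'d \<Rightarrow> real) \<Rightarrow>
   (real \<Rightarrow> real^'d \<Rightarrow> real^'d) \<Rightarrow> (real \<Rightarrow> real^'d \<Rightarrow> real) \<Rightarrow> bool" where
  "collocation_postprocessing \<Omega> D N t f uh ph uh' ph' \<longleftrightarrow>
     (\<exists>\<alpha> c d. \<forall>n\<in>{1..N}. let J = subinterval t n; t' = t (n - 1) in
        deriv (bubble \<alpha> t n) t' = 1 \<and> c n \<in> Vh_div \<Omega> D \<and> d n \<in> Qh \<Omega> D \<and>
        (\<forall>s\<in>J. \<forall>x. uh' s x = uh s x + bubble \<alpha> t n s *\<^sub>R c n x \<and>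
                    ph' s x = ph s x + d n x * deriv (bubble \<alpha> t n) s) \<and>
        (\<forall>v \<in> Vh \<Omega> D.
           l2_inner \<Omega> (right_limit (piece_deriv J uh') t') v +
           form_a \<Omega> (right_limit uh' t') v + form_b \<Omega> v (right_limit ph' t') =
           l2_inner \<Omega> (f t') v))"

end

theory Submission
  imports Defs "HOL-Library.Function_Algebras"
begin

text \<open>
  The proof compares nodal values. On a subinterval the velocity is affine in time, so the scheme is
  an equation for averages over the two end points, with the right-hand side of the trapezoidal
  rule. The post-processing enforces the equation at the left end point, and the two equations
  together give it at the right end point as well. Hence, if \<open>U\<close>, \<open>Z\<close> and \<open>P\<close> are the one-sided
  nodal values of the post-processed velocity, of its time derivative and of the post-processed
  pressure, then \<open>Z + A\<^sub>h U + B\<^sub>h' P = f\<close> holds at both ends of every subinterval, and the increment of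
  \<open>U\<close> is exactly the trapezoidal rule for \<open>Z\<close>, since the derivative of a quadratic polynomial is
  affine (\<open>scheme_on_interval\<close>). Tested with discretely divergence-free functions the equation
  determines \<open>Z\<close> from \<open>U\<close>, so that the two values of \<open>Z\<close> at an interior node agree although the
  pressure may jump.

  Subtracting the equations at consecutive nodes eliminates \<open>U\<close> and leaves a Crank-Nicolson scheme
  for \<open>Z\<close>. It is stable in \<open>L\<^sup>2\<close>, and its consistency error consists of the trapezoidal error of the
  exact velocity, of order \<open>\<tau>\<^sup>3\<close> in \<open>H\<^sup>1\<close> on each step, and of best approximation errors of order
  \<open>h\<^sup>r\<close>. The discrete initial velocity is made so that \<open>Z\<close> starts from the vector \<open>a\<^sub>0\<^sub>,\<^sub>h\<close>, which is a
  Stokes projection of \<open>\<partial>\<^sub>t u(0)\<close>: integration by parts turns its defining right-hand side into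
  that of \<open>\<partial>\<^sub>t u(0)\<close> with \<open>- \<Delta> p(0)\<close> in the place of a pressure (\<open>initial_time_derivative\<close>). Therefore
  \<open>Z\<close> approximates \<open>\<partial>\<^sub>t u\<close> in \<open>L\<^sup>2\<close> at every node with an error of order \<open>\<tau>\<^sup>2 + h\<^sup>r\<close>
  (\<open>time_derivative_error\<close>).

  At each node this makes \<open>(U, P)\<close> the solution of a perturbed stationary Stokes problem. Quasi-optimality
  bounds \<open>U - u\<close> in \<open>H\<^sup>1\<close>, and the inf-sup condition then bounds \<open>P - p\<close>
  (\<open>nodal_pressure_errors\<close>). Between the nodes the post-processed pressure is the
  linear interpolant of its one-sided nodal values, which costs another \<open>\<tau>\<^sup>2\<close>
  (\<open>pressure_error_pointwise\<close>). The resulting bound is uniform in time and implies the one in \<open>L\<^sup>2\<close>.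

  The rest relates the spaces of the problem to this algebra. Functions which differ on a null set
  are different vectors, so that all inner products are treated as positive semidefinite forms, and
  finite element spaces are finite dimensional only modulo null functions. Weak derivatives need the
  fundamental lemma of the calculus of variations, and the integrations by parts, including the
  symmetry of second derivatives that the initial value rests on, are reduced to test functions by
  density.
\<close>


instantiation "fun" :: (type, real_vector) real_vector
begin

definition scaleR_fun :: "real \<Rightarrow> ('a \<Rightarrow> 'b) \<Rightarrow> 'a \<Rightarrow> 'b"
  where "scaleR_fun c f = (\<lambda>x. c *\<^sub>R f x)"

instance
  by standard (simp_all add: scaleR_fun_def fun_eq_iff scaleR_add_right scaleR_add_left)

end

lemma scaleR_fun_apply [simp]: "(c *\<^sub>R f) x = c *\<^sub>R f x"
  by (simp add: scaleR_fun_def)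

lemma sum_fun_apply: "(\<Sum>i\<in>I. f i) x = (\<Sum>i\<in>I. f i x)"
  by (induction I rule: infinite_finite_induct) simp_all

section \<open>Positive semidefinite forms\<close>

text \<open>
  The form is constrained on \<open>S\<close> only, because inner products of function spaces are integrals
  that have no meaning outside of these spaces.
\<close>

locale psd_form =
  fixes S :: "'a::real_vector set" and A :: "'a \<Rightarrow> 'a \<Rightarrow> real"
  assumes subspace: "subspace S"
    and sym: "x \<in> S \<Longrightarrow> y \<in> S \<Longrightarrow> A x y = A y x"
    and add: "x \<in> S \<Longrightarrow> y \<in> S \<Longrightarrow> z \<in> S \<Longrightarrow> A (x + y) z = A x z + A y z"
    and scale: "x \<in> S \<Longrightarrow> z \<in> S \<Longrightarrow> A (c *\<^sub>R x) z = c * A x z"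
    and nonneg: "x \<in> S \<Longrightarrow> 0 \<le> A x x"

definition nrm :: "('a \<Rightarrow> 'a \<Rightarrow> real) \<Rightarrow> 'a \<Rightarrow> real" where
  "nrm A x = sqrt (A x x)"

context psd_form
begin

lemmas mem_simps = subspace_0[OF subspace] subspace_add[OF subspace] subspace_diff[OF subspace]
  subspace_scale[OF subspace]

lemma diff: "x \<in> S \<Longrightarrow> y \<in> S \<Longrightarrow> z \<in> S \<Longrightarrow> A (x - y) z = A x z - A y z"
  using add[of "x - y" y z] by (simp add: mem_simps)

lemma add_right: "x \<in> S \<Longrightarrow> y \<in> S \<Longrightarrow> z \<in> S \<Longrightarrow> A z (x + y) = A z x + A z y"
  using add[of x y z] sym by (simp add: mem_simps)

lemma diff_right: "x \<in> S \<Longrightarrow> y \<in> S \<Longrightarrow> z \<in> S \<Longrightarrow> A z (x - y) = A z x - A z y"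
  using diff[of x y z] sym by (simp add: mem_simps)

lemma scale_right: "x \<in> S \<Longrightarrow> z \<in> S \<Longrightarrow> A z (c *\<^sub>R x) = c * A z x"
  using scale[of x z c] sym by (simp add: mem_simps)

lemma zero: "x \<in> S \<Longrightarrow> A 0 x = 0"
  using scale[of 0 x 0] by (simp add: mem_simps)

lemmas form_simps = add diff scale add_right diff_right scale_right mem_simps

lemma nrm_nonneg: "x \<in> S \<Longrightarrow> 0 \<le> nrm A x"
  by (simp add: nrm_def nonneg)

lemma nrm_sq: "x \<in> S \<Longrightarrow> (nrm A x)\<^sup>2 = A x x"
  by (simp add: nrm_def nonneg)

lemma nrm_zero [simp]: "nrm A 0 = 0"
  using zero[of 0] by (simp add: nrm_def mem_simps)

lemma nrm_scale: "x \<in> S \<Longrightarrow> nrm A (c *\<^sub>R x) = \<bar>c\<bar> * nrm A x"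
proof -
  assume x: "x \<in> S"
  have "A (c *\<^sub>R x) (c *\<^sub>R x) = c\<^sup>2 * A x x"
    using x by (simp add: form_simps power2_eq_square)
  then show ?thesis by (simp add: nrm_def real_sqrt_mult)
qed

lemma cauchy_schwarz:
  assumes x: "x \<in> S" and y: "y \<in> S"
  shows "\<bar>A x y\<bar> \<le> nrm A x * nrm A y"
proof -
  have q: "0 \<le> A x x + 2 * c * A x y + c\<^sup>2 * A y y" for c
  proof -
    have "0 \<le> A (x + c *\<^sub>R y) (x + c *\<^sub>R y)"
      using x y by (intro nonneg) (simp add: mem_simps)
    also have "\<dots> = A x x + 2 * c * A x y + c\<^sup>2 * A y y"
      using x y sym[of x y] by (simp add: form_simps power2_eq_square algebra_simps)
    finally show ?thesis .
  qed
  have "(A x y)\<^sup>2 \<le> A x x * A y y"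
  proof (cases "A y y = 0")
    case True
    have "A x y = 0"
    proof (rule ccontr)
      assume "A x y \<noteq> 0"
      then show False
        using q[of "- (A x x + 1) / (2 * A x y)"] True by (simp add: field_simps)
    qed
    then show ?thesis using True by simp
  next
    case False
    then have pos: "A y y > 0" using nonneg[OF y] by simp
    have "0 \<le> A x x - (A x y)\<^sup>2 / A y y"
      using q[of "- A x y / A y y"] pos
      by (simp add: field_simps power2_eq_square)
    then show ?thesis using pos by (simp add: field_simps)
  qed
  then have "sqrt ((A x y)\<^sup>2) \<le> sqrt (A x x * A y y)" by (rule real_sqrt_le_mono)
  then show ?thesis by (simp add: nrm_def real_sqrt_mult)
qed

lemma nrm_add:
  assumes x: "x \<in> S" and y: "y \<in> S"
  shows "nrm A (x + y) \<le> nrm A x + nrm A y"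
proof (rule power2_le_imp_le)
  have "(nrm A (x + y))\<^sup>2 = A x x + 2 * A x y + A y y"
    using x y sym[of x y] by (simp add: nrm_sq form_simps)
  also have "\<dots> \<le> (nrm A x)\<^sup>2 + 2 * (nrm A x * nrm A y) + (nrm A y)\<^sup>2"
    using cauchy_schwarz[OF x y] by (simp add: nrm_sq x y)
  also have "\<dots> = (nrm A x + nrm A y)\<^sup>2" by (simp add: power2_eq_square algebra_simps)
  finally show "(nrm A (x + y))\<^sup>2 \<le> (nrm A x + nrm A y)\<^sup>2" .
qed (simp add: nrm_nonneg x y)

lemma nrm_minus: "x \<in> S \<Longrightarrow> y \<in> S \<Longrightarrow> nrm A (x - y) = nrm A (y - x)"
  using nrm_scale[of "y - x" "-1"] by (simp add: mem_simps)

lemma nrm_diff_le: "x \<in> S \<Longrightarrow> y \<in> S \<Longrightarrow> nrm A (x - y) \<le> nrm A x + nrm A y"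
  using nrm_add[of x "(-1) *\<^sub>R y"] nrm_scale[of y "-1"] mem_simps(4)[of y "-1"] by simp

lemma nrm_triangle: "x \<in> S \<Longrightarrow> y \<in> S \<Longrightarrow> z \<in> S \<Longrightarrow> nrm A (x - z) \<le> nrm A (x - y) + nrm A (y - z)"
  using nrm_add[of "x - y" "y - z"] by (simp add: mem_simps)

lemma nrm_triangle2: "x \<in> S \<Longrightarrow> y \<in> S \<Longrightarrow> nrm A x \<le> nrm A (x - y) + nrm A y"
  using nrm_add[of "x - y" y] by (simp add: mem_simps)

lemma abs_nrm_diff_le: "x \<in> S \<Longrightarrow> y \<in> S \<Longrightarrow> \<bar>nrm A x - nrm A y\<bar> \<le> nrm A (x - y)"
  using nrm_triangle2[of x y] nrm_triangle2[of y x] nrm_minus[of x y] by simp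

lemma null_right: "x \<in> S \<Longrightarrow> y \<in> S \<Longrightarrow> A y y = 0 \<Longrightarrow> A x y = 0"
  using cauchy_schwarz[of x y] by (simp add: nrm_def)

text \<open>
  The last step of energy estimates: a bound by testing a vector with itself.
\<close>

lemma nrm_le_of_test:
  assumes x: "x \<in> S" and "A x x \<le> M * nrm A x" "0 \<le> M"
  shows "nrm A x \<le> M"
proof (cases "nrm A x = 0")
  case False
  then have "nrm A x > 0" using nrm_nonneg[OF x] by simp
  moreover have "nrm A x * nrm A x \<le> M * nrm A x"
    using assms nrm_sq[OF x] by (simp add: power2_eq_square)
  ultimately show ?thesis by simp
qed (use assms in simp)

lemma psd_form_subspace:
  assumes "subspace S'" "S' \<subseteq> S"
  shows "psd_form S' A"
proof -
  have "x \<in> S" if "x \<in> S'" for x using that assms(2) by blast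
  then show ?thesis by unfold_locales (simp_all add: assms(1) sym add scale nonneg)
qed

end

section \<open>Riesz representation modulo null vectors\<close>

text \<open>
  The span of the \<open>e i\<close> covers \<open>S\<close> only up to vectors in \<open>N\<close>, and a functional is representable
  exactly if it vanishes on the null vectors of the form. The induction adds one vector \<open>s1\<close> outside
  of the subspace that is covered by the previous ones, and makes it orthogonal to this subspace by
  subtracting the representative of \<open>A s1\<close> there. If the result is a null vector, it does not
  contribute.
\<close>

lemma riesz_finite_dim:
  fixes e :: "'i \<Rightarrow> 'a::real_vector"
  assumes "finite I" "psd_form S A" "subspace N"
    and "\<And>x. x \<in> S \<Longrightarrow> \<exists>c. x - (\<Sum>i\<in>I. c i *\<^sub>R e i) \<in> N"
    and "\<And>x. x \<in> S \<Longrightarrow> x \<in> N \<Longrightarrow> A x x = 0"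
    and "\<And>x y. x \<in> S \<Longrightarrow> y \<in> S \<Longrightarrow> l (x + y) = l x + l y"
    and "\<And>c x. x \<in> S \<Longrightarrow> l (c *\<^sub>R x) = c * l x"
    and "\<And>x. x \<in> S \<Longrightarrow> A x x = 0 \<Longrightarrow> l x = (0::real)"
  shows "\<exists>r\<in>S. \<forall>x\<in>S. A r x = l x"
  using assms
proof (induction I arbitrary: S l rule: finite_induct)
  case empty
  interpret psd_form S A by (rule empty.prems(1))
  have "A 0 x = l x" if "x \<in> S" for x
    using that zero empty.prems(3)[OF that] empty.prems(4,7)[OF that] by simp
  then show ?case using mem_simps(1) by blast
next
  case (insert j I)
  interpret psd_form S A by (rule insert.prems(1))
  note N = insert.prems(2)
  define S0 where "S0 = {x\<in>S. \<exists>c. x - (\<Sum>i\<in>I. c i *\<^sub>R e i) \<in> N}"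
  have S0S: "S0 \<subseteq> S" by (auto simp: S0_def)
  have sub0: "subspace S0"
  proof (rule subspaceI)
    show "0 \<in> S0" using subspace_0[OF N] by (auto simp: S0_def mem_simps intro!: exI[of _ "\<lambda>_. 0"])
    fix x y assume "x \<in> S0" "y \<in> S0"
    then obtain c d where cd: "x \<in> S" "y \<in> S" "x - (\<Sum>i\<in>I. c i *\<^sub>R e i) \<in> N" "y - (\<Sum>i\<in>I. d i *\<^sub>R e i) \<in> N"
      by (auto simp: S0_def)
    have "x + y - (\<Sum>i\<in>I. (c i + d i) *\<^sub>R e i) = (x - (\<Sum>i\<in>I. c i *\<^sub>R e i)) + (y - (\<Sum>i\<in>I. d i *\<^sub>R e i))"
      by (simp add: scaleR_add_left sum.distrib)
    then show "x + y \<in> S0"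
      using cd(1,2) subspace_add[OF N cd(3,4)] unfolding S0_def
      by (auto simp only: mem_simps intro!: exI[of _ "\<lambda>i. c i + d i"])
  next
    fix k x assume "x \<in> S0"
    then obtain c where c: "x \<in> S" "x - (\<Sum>i\<in>I. c i *\<^sub>R e i) \<in> N" by (auto simp: S0_def)
    have "k *\<^sub>R x - (\<Sum>i\<in>I. (k * c i) *\<^sub>R e i) = k *\<^sub>R (x - (\<Sum>i\<in>I. c i *\<^sub>R e i))"
      by (simp add: scaleR_right_diff_distrib scaleR_sum_right)
    then show "k *\<^sub>R x \<in> S0"
      using c(1) subspace_scale[OF N c(2)] unfolding S0_def
      by (auto simp only: mem_simps intro!: exI[of _ "\<lambda>i. k * c i"])
  qed
  have psd0: "psd_form S0 A" by (rule psd_form_subspace[OF sub0 S0S])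
  have IH: "\<exists>r\<in>S0. \<forall>x\<in>S0. A r x = l' x"
    if "\<And>x y. x \<in> S0 \<Longrightarrow> y \<in> S0 \<Longrightarrow> l' (x + y) = l' x + l' y"
       "\<And>c x. x \<in> S0 \<Longrightarrow> l' (c *\<^sub>R x) = c * l' x"
       "\<And>x. x \<in> S0 \<Longrightarrow> A x x = 0 \<Longrightarrow> l' x = 0" for l'
  proof (rule insert.IH[OF psd0 N])
    show "\<exists>c. x - (\<Sum>i\<in>I. c i *\<^sub>R e i) \<in> N" if "x \<in> S0" for x using that by (simp add: S0_def)
    show "A x x = 0" if "x \<in> S0" "x \<in> N" for x using that S0S insert.prems(4) by blast
  qed (fact that)+
  show ?case
  proof (cases "S \<subseteq> S0")
    case True
    then have "S = S0" using S0S by auto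
    then show ?thesis using IH[of l] insert.prems(5-7) by blast
  next
    case False
    then obtain s1 where s1: "s1 \<in> S" "s1 \<notin> S0" by auto
    obtain c where c: "s1 - (\<Sum>i\<in>insert j I. c i *\<^sub>R e i) \<in> N" using insert.prems(3)[OF s1(1)] by auto
    have cj: "c j \<noteq> 0"
      using s1 c insert.hyps by (auto simp: S0_def)
    have dec: "\<exists>k. x - k *\<^sub>R s1 \<in> S0" if x: "x \<in> S" for x
    proof -
      obtain d where d: "x - (\<Sum>i\<in>insert j I. d i *\<^sub>R e i) \<in> N" using insert.prems(3)[OF x] by auto
      define k where "k = d j / c j"
      have kc: "k * c j = d j" using cj by (simp add: k_def)
      have "x - k *\<^sub>R s1 - (\<Sum>i\<in>I. (d i - k * c i) *\<^sub>R e i)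
        = (x - (\<Sum>i\<in>insert j I. d i *\<^sub>R e i)) - k *\<^sub>R (s1 - (\<Sum>i\<in>insert j I. c i *\<^sub>R e i))"
        using insert.hyps
        by (simp add: scaleR_right_diff_distrib scaleR_sum_right scaleR_left_diff_distrib sum_subtractf
            scaleR_add_right kc)
      also have "\<dots> \<in> N" by (intro subspace_diff[OF N] subspace_scale[OF N] c d)
      finally show ?thesis using x s1 by (auto simp: S0_def mem_simps intro!: exI[of _ k])
    qed
    obtain r0 where r0: "r0 \<in> S0" "\<And>x. x \<in> S0 \<Longrightarrow> A r0 x = l x"
    proof -
      have "\<exists>r\<in>S0. \<forall>x\<in>S0. A r x = l x"
        by (rule IH) (use S0S insert.prems(5-7) in \<open>simp_all add: subset_iff\<close>)
      then show ?thesis using that by blast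
    qed
    obtain p where p: "p \<in> S0" "\<And>x. x \<in> S0 \<Longrightarrow> A p x = A s1 x"
    proof -
      have "\<exists>r\<in>S0. \<forall>x\<in>S0. A r x = A s1 x"
      proof (rule IH)
        fix x y assume "x \<in> S0" "y \<in> S0"
        then have "x \<in> S" "y \<in> S" using S0S by auto
        then show "A s1 (x + y) = A s1 x + A s1 y" using s1(1) add_right by blast
      next
        fix c x assume "x \<in> S0"
        then show "A s1 (c *\<^sub>R x) = c * A s1 x" using S0S s1(1) scale_right by blast
      next
        fix x assume "x \<in> S0" "A x x = 0"
        then show "A s1 x = 0" using S0S s1(1) null_right by blast
      qed
      then show ?thesis using that by blast
    qed
    define s2 where "s2 = s1 - p"
    have s2: "s2 \<in> S" using s1 p S0S by (auto simp: s2_def mem_simps)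
    have orth: "A s2 x = 0" if "x \<in> S0" for x
    proof -
      have "x \<in> S" "p \<in> S" using that p S0S by auto
      then show ?thesis using p(2)[OF that] s1 by (simp add: s2_def diff)
    qed
    \<comment> \<open>a null vector \<open>s2\<close> satisfies \<open>l s2 = 0\<close>, so that any multiple of it would do\<close>
    define k where "k = (if A s2 s2 = 0 then 0 else l s2 / A s2 s2)"
    have k: "k * A s2 s2 = l s2" using insert.prems(7)[OF s2] by (auto simp: k_def)
    define r where "r = r0 + k *\<^sub>R s2"
    have r: "r \<in> S" using r0 S0S s2 by (auto simp: r_def mem_simps)
    have "A r x = l x" if x: "x \<in> S" for x
    proof -
      obtain t where t: "x - t *\<^sub>R s1 \<in> S0" using dec[OF x] by auto
      define y where "y = x - t *\<^sub>R s2"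
      have "y = (x - t *\<^sub>R s1) + t *\<^sub>R p" by (simp add: y_def s2_def scaleR_right_diff_distrib)
      then have y: "y \<in> S0" using t p by (simp add: subspace_add[OF sub0] subspace_scale[OF sub0])
      then have yS: "y \<in> S" using S0S by auto
      have r0S: "r0 \<in> S" using r0 S0S by auto
      have xe: "x = y + t *\<^sub>R s2" by (simp add: y_def)
      have "A r0 s2 = 0" using orth[OF r0(1)] sym[OF s2 r0S] by simp
      then have "A r x = A r0 y + t * (k * A s2 s2)"
        unfolding xe r_def using yS r0S s2 orth[OF y] by (simp add: form_simps)
      also have "\<dots> = l y + t * l s2" using r0(2)[OF y] k by simp
      also have "\<dots> = l x" unfolding xe using yS s2 insert.prems(5,6) by (simp add: mem_simps)
      finally show ?thesis .
    qed
    then show ?thesis using r by blast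
  qed
qed

section \<open>Differentiation in time with respect to a seminorm\<close>

text \<open>
  The power \<open>3\<close> is what is needed for second order convergence after summation over the steps; the
  constant is not the optimal \<open>1 / 12\<close>, which keeps the proof to repeated mean value bounds.
\<close>

lemma trapezoid_error_real:
  fixes f :: "real \<Rightarrow> real"
  assumes ab: "a \<le> b"
    and f: "\<And>t. t \<in> {a..b} \<Longrightarrow> (f has_real_derivative f1 t) (at t within {a..b})"
    and f1: "\<And>t. t \<in> {a..b} \<Longrightarrow> (f1 has_real_derivative f2 t) (at t within {a..b})"
    and f2: "\<And>t. t \<in> {a..b} \<Longrightarrow> (f2 has_real_derivative f3 t) (at t within {a..b})"
    and M: "\<And>t. t \<in> {a..b} \<Longrightarrow> \<bar>f3 t\<bar> \<le> M"
  shows "\<bar>f b - f a - (b - a) / 2 * (f1 a + f1 b)\<bar> \<le> M * (b - a) ^ 3"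
proof -
  have M0: "0 \<le> M" using M[of a] ab by fastforce
  have b2: "\<bar>f2 t - f2 s\<bar> \<le> M * \<bar>t - s\<bar>" if "s \<in> {a..b}" "t \<in> {a..b}" for s t
    using field_differentiable_bound[of "{a..b}" f2 f3 M t s] f2 M that by auto
  have b1: "\<bar>f1 t - f1 a - (t - a) * f2 t\<bar> \<le> M * (b - a) * (b - a)" if t: "t \<in> {a..b}" for t
  proof -
    have "norm ((f1 t - t * f2 t) - (f1 a - a * f2 t)) \<le> M * (b - a) * norm (t - a)"
    proof (rule field_differentiable_bound[of "{a..b}" _ "\<lambda>s. f2 s - f2 t"])
      fix s assume s: "s \<in> {a..b}"
      show "((\<lambda>s. f1 s - s * f2 t) has_real_derivative f2 s - f2 t) (at s within {a..b})"
        using f1[OF s] by (auto intro!: derivative_eq_intros)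
      have "M * \<bar>s - t\<bar> \<le> M * (b - a)" using s t M0 by (intro mult_left_mono) auto
      then show "norm (f2 s - f2 t) \<le> M * (b - a)" using b2[OF t s] by simp
    qed (use t in auto)
    also have "\<dots> \<le> M * (b - a) * (b - a)" using t M0 ab by (intro mult_left_mono) auto
    finally show ?thesis by (simp add: algebra_simps)
  qed
  have "norm ((f b - (b - a) / 2 * (f1 a + f1 b)) - (f a - (a - a) / 2 * (f1 a + f1 a)))
     \<le> M * (b - a) * (b - a) * norm (b - a)"
  proof (rule field_differentiable_bound[of "{a..b}" "\<lambda>t. f t - (t - a) / 2 * (f1 a + f1 t)"
        "\<lambda>t. (f1 t - f1 a - (t - a) * f2 t) / 2"])
    fix t assume t: "t \<in> {a..b}"
    show "((\<lambda>t. f t - (t - a) / 2 * (f1 a + f1 t)) has_real_derivative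
         (f1 t - f1 a - (t - a) * f2 t) / 2) (at t within {a..b})"
      using f[OF t] f1[OF t] by (auto intro!: derivative_eq_intros simp: field_simps)
    show "norm ((f1 t - f1 a - (t - a) * f2 t) / 2) \<le> M * (b - a) * (b - a)"
      using b1[OF t] by simp
  qed (use ab in auto)
  then show ?thesis using ab by (simp add: power3_eq_cube algebra_simps)
qed

lemma linear_interpolation_error_real:
  fixes f :: "real \<Rightarrow> real"
  assumes s: "s \<in> {a..b}" and ab: "a < b"
    and f: "\<And>t. t \<in> {a..b} \<Longrightarrow> (f has_real_derivative f1 t) (at t within {a..b})"
    and f1: "\<And>t. t \<in> {a..b} \<Longrightarrow> (f1 has_real_derivative f2 t) (at t within {a..b})"
    and M: "\<And>t. t \<in> {a..b} \<Longrightarrow> \<bar>f2 t\<bar> \<le> M"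
  shows "\<bar>f s - ((b - s) / (b - a) * f a + (s - a) / (b - a) * f b)\<bar> \<le> M * (b - a)\<^sup>2"
proof -
  have M0: "0 \<le> M" using M[of a] ab by fastforce
  have b1: "\<bar>f1 t - f1 s\<bar> \<le> M * (b - a)" if "t \<in> {a..b}" for t
  proof -
    have "\<bar>f1 t - f1 s\<bar> \<le> M * \<bar>t - s\<bar>"
      using field_differentiable_bound[of "{a..b}" f1 f2 M t s] f1 M that s by auto
    also have "\<dots> \<le> M * (b - a)" using s that M0 by (intro mult_left_mono) auto
    finally show ?thesis .
  qed
  have g: "\<bar>f t - f s - (t - s) * f1 s\<bar> \<le> M * (b - a) * (b - a)" if t: "t \<in> {a..b}" for t
  proof -
    have "norm ((f t - t * f1 s) - (f s - s * f1 s)) \<le> M * (b - a) * norm (t - s)"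
      by (rule field_differentiable_bound[of "{a..b}" _ "\<lambda>t. f1 t - f1 s"])
         (use t s f b1 in \<open>auto intro!: derivative_eq_intros\<close>)
    also have "\<dots> \<le> M * (b - a) * (b - a)" using s t M0 ab by (intro mult_left_mono) auto
    finally show ?thesis by (simp add: algebra_simps)
  qed
  define l where "l = (b - s) / (b - a)"
  have l: "0 \<le> l" "l \<le> 1" using s ab by (auto simp: l_def)
  have l1: "(s - a) / (b - a) = 1 - l" using ab by (simp add: l_def field_simps)
  have ls: "l * (a - s) + (1 - l) * (b - s) = 0" using ab by (simp add: l_def field_simps)
  define Ra where "Ra = f a - f s - (a - s) * f1 s"
  define Rb where "Rb = f b - f s - (b - s) * f1 s"
  have "f s - (l * f a + (1 - l) * f b) = - (l * Ra + (1 - l) * Rb) - (l * (a - s) + (1 - l) * (b - s)) * f1 s"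
    by (simp add: Ra_def Rb_def algebra_simps)
  then have "\<bar>f s - (l * f a + (1 - l) * f b)\<bar> = \<bar>l * Ra + (1 - l) * Rb\<bar>" by (simp add: ls)
  also have "\<dots> \<le> l * \<bar>Ra\<bar> + (1 - l) * \<bar>Rb\<bar>" using l by (simp add: abs_mult abs_triangle_ineq[THEN order_trans])
  also have "\<dots> \<le> l * (M * (b - a) * (b - a)) + (1 - l) * (M * (b - a) * (b - a))"
    using g[of a] g[of b] ab l by (intro add_mono mult_left_mono) (auto simp: Ra_def Rb_def)
  also have "\<dots> = M * (b - a)\<^sup>2" by (simp add: algebra_simps power2_eq_square)
  finally show ?thesis unfolding l1 l_def[symmetric] .
qed

definition nrm_deriv :: "('a \<Rightarrow> 'a \<Rightarrow> real) \<Rightarrow> real set \<Rightarrow> (real \<Rightarrow> 'a::real_vector) \<Rightarrow> 'a \<Rightarrow> real \<Rightarrow> bool" where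
  "nrm_deriv A J w g t \<longleftrightarrow> ((\<lambda>s. nrm A ((w s - w t) /\<^sub>R (s - t) - g)) \<longlongrightarrow> 0) (at t within J)"

context psd_form
begin

text \<open>
  Testing reduces derivatives with respect to a seminorm to real derivatives. Estimates for real
  functions then carry over to \<open>S\<close> without any integration of vector-valued functions, by testing the
  error with itself.
\<close>

lemma nrm_deriv_test:
  assumes d: "nrm_deriv A J w g t" and w: "\<And>s. s \<in> J \<Longrightarrow> w s \<in> S" and t: "t \<in> J"
    and g: "g \<in> S" and x: "x \<in> S"
  shows "((\<lambda>s. A (w s) x) has_real_derivative A g x) (at t within J)"
  unfolding has_field_derivative_iff
proof (rule Lim_transform2[OF tendsto_const])
  have "((\<lambda>s. nrm A ((w s - w t) /\<^sub>R (s - t) - g) * nrm A x) \<longlongrightarrow> 0) (at t within J)"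
    using d unfolding nrm_deriv_def by (rule tendsto_mult_left_zero)
  then show "((\<lambda>s. A g x - (A (w s) x - A (w t) x) / (s - t)) \<longlongrightarrow> 0) (at t within J)"
  proof (rule Lim_null_comparison[rotated])
    show "\<forall>\<^sub>F s in at t within J. norm (A g x - (A (w s) x - A (w t) x) / (s - t))
         \<le> nrm A ((w s - w t) /\<^sub>R (s - t) - g) * nrm A x"
      unfolding eventually_at_topological
    proof (intro exI[of _ UNIV] conjI ballI impI)
      fix s assume s: "s \<noteq> t" "s \<in> J"
      have m: "w s \<in> S" "w t \<in> S" using w s t by auto
      have "A ((w s - w t) /\<^sub>R (s - t) - g) x = (A (w s) x - A (w t) x) / (s - t) - A g x"
        using m g x by (simp add: form_simps divide_inverse mult.commute)
      then show "norm (A g x - (A (w s) x - A (w t) x) / (s - t))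
         \<le> nrm A ((w s - w t) /\<^sub>R (s - t) - g) * nrm A x"
        using cauchy_schwarz[of "(w s - w t) /\<^sub>R (s - t) - g" x] m g x
        by (simp add: mem_simps abs_minus_commute)
    qed auto
  qed
qed

lemma nrm_deriv_unique:
  assumes "nrm_deriv A J w g t" "nrm_deriv A J w g' t" and w: "\<And>s. s \<in> J \<Longrightarrow> w s \<in> S" and t: "t \<in> J"
    and g: "g \<in> S" "g' \<in> S" and nt: "at t within J \<noteq> bot"
  shows "nrm A (g - g') = 0"
proof -
  have "A g (g - g') = A g' (g - g')"
    using has_field_derivative_unique[OF nrm_deriv_test[OF assms(1) w t g(1)] nrm_deriv_test[OF assms(2) w t g(2)]] nt g
    by (simp add: mem_simps)
  then show ?thesis using g by (simp add: nrm_def form_simps)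
qed

lemma mean_value_bound:
  assumes ab: "a \<le> b" "{a..b} \<subseteq> J"
    and w: "\<And>s. s \<in> J \<Longrightarrow> w s \<in> S" and w1: "\<And>s. s \<in> J \<Longrightarrow> w1 s \<in> S"
    and d: "\<And>t. t \<in> J \<Longrightarrow> nrm_deriv A J w (w1 t) t"
    and M: "\<And>t. t \<in> J \<Longrightarrow> nrm A (w1 t) \<le> M"
  shows "nrm A (w b - w a) \<le> M * (b - a)"
proof -
  have m: "w a \<in> S" "w b \<in> S" using w ab by auto
  define x where "x = w b - w a"
  have x: "x \<in> S" using m by (simp add: x_def mem_simps)
  have M0: "0 \<le> M" using M[of a] nrm_nonneg[OF w1[of a]] ab by fastforce
  have "norm (A (w b) x - A (w a) x) \<le> (M * nrm A x) * norm (b - a)"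
  proof (rule field_differentiable_bound[of "{a..b}" _ "\<lambda>t. A (w1 t) x"])
    fix t assume "t \<in> {a..b}"
    then have t: "t \<in> J" using ab by auto
    show "((\<lambda>t. A (w t) x) has_real_derivative A (w1 t) x) (at t within {a..b})"
      by (rule DERIV_subset[OF nrm_deriv_test[OF d[OF t] w t w1[OF t] x] ab(2)])
    show "norm (A (w1 t) x) \<le> M * nrm A x"
      using cauchy_schwarz[OF w1[OF t] x] mult_right_mono[OF M[OF t] nrm_nonneg[OF x]] by simp
  qed (use ab in auto)
  then have "A x x \<le> (M * (b - a)) * nrm A x"
    using ab m x by (simp add: x_def[symmetric] diff[symmetric] algebra_simps)
  from nrm_le_of_test[OF x this] show ?thesis using M0 ab by (simp add: x_def)
qed

lemma trapezoid_error:
  assumes ab: "a \<le> b" "{a..b} \<subseteq> J"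
    and w: "\<And>s. s \<in> J \<Longrightarrow> w s \<in> S" and w1: "\<And>s. s \<in> J \<Longrightarrow> w1 s \<in> S"
    and w2: "\<And>s. s \<in> J \<Longrightarrow> w2 s \<in> S" and w3: "\<And>s. s \<in> J \<Longrightarrow> w3 s \<in> S"
    and d: "\<And>t. t \<in> J \<Longrightarrow> nrm_deriv A J w (w1 t) t"
    and d1: "\<And>t. t \<in> J \<Longrightarrow> nrm_deriv A J w1 (w2 t) t"
    and d2: "\<And>t. t \<in> J \<Longrightarrow> nrm_deriv A J w2 (w3 t) t"
    and M: "\<And>t. t \<in> J \<Longrightarrow> nrm A (w3 t) \<le> M"
  shows "nrm A (w b - w a - ((b - a) / 2) *\<^sub>R (w1 a + w1 b)) \<le> M * (b - a) ^ 3"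
proof -
  have m: "w a \<in> S" "w b \<in> S" "w1 a \<in> S" "w1 b \<in> S" using w w1 ab by auto
  define x where "x = w b - w a - ((b - a) / 2) *\<^sub>R (w1 a + w1 b)"
  have x: "x \<in> S" using m by (simp add: x_def mem_simps)
  have M0: "0 \<le> M" using M[of a] nrm_nonneg[OF w3[of a]] ab by fastforce
  have "\<bar>A (w b) x - A (w a) x - (b - a) / 2 * (A (w1 a) x + A (w1 b) x)\<bar> \<le> (M * nrm A x) * (b - a) ^ 3"
  proof (rule trapezoid_error_real[where f = "\<lambda>t. A (w t) x" and ?f1.0 = "\<lambda>t. A (w1 t) x" and ?f2.0 = "\<lambda>t. A (w2 t) x"
        and ?f3.0 = "\<lambda>t. A (w3 t) x"])
    fix t assume "t \<in> {a..b}"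
    then have t: "t \<in> J" using ab by auto
    show "((\<lambda>t. A (w t) x) has_real_derivative A (w1 t) x) (at t within {a..b})"
      by (rule DERIV_subset[OF nrm_deriv_test[OF d[OF t] w t w1[OF t] x] ab(2)])
    show "((\<lambda>t. A (w1 t) x) has_real_derivative A (w2 t) x) (at t within {a..b})"
      by (rule DERIV_subset[OF nrm_deriv_test[OF d1[OF t] w1 t w2[OF t] x] ab(2)])
    show "((\<lambda>t. A (w2 t) x) has_real_derivative A (w3 t) x) (at t within {a..b})"
      by (rule DERIV_subset[OF nrm_deriv_test[OF d2[OF t] w2 t w3[OF t] x] ab(2)])
    show "\<bar>A (w3 t) x\<bar> \<le> M * nrm A x"
      using cauchy_schwarz[OF w3[OF t] x] mult_right_mono[OF M[OF t] nrm_nonneg[OF x]] by simp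
  qed (use ab in auto)
  moreover have "A (w b) x - A (w a) x - (b - a) / 2 * (A (w1 a) x + A (w1 b) x) = A x x"
    unfolding x_def[THEN arg_cong[where f = "\<lambda>y. A y x"]]
    using m x by (simp add: form_simps)
  ultimately have "A x x \<le> (M * (b - a) ^ 3) * nrm A x" by (simp add: algebra_simps)
  from nrm_le_of_test[OF x this] show ?thesis using M0 ab by (simp add: x_def)
qed

lemma linear_interpolation_error:
  assumes s: "s \<in> {a..b}" and ab: "a < b" "{a..b} \<subseteq> J"
    and w: "\<And>s. s \<in> J \<Longrightarrow> w s \<in> S" and w1: "\<And>s. s \<in> J \<Longrightarrow> w1 s \<in> S"
    and w2: "\<And>s. s \<in> J \<Longrightarrow> w2 s \<in> S"
    and d: "\<And>t. t \<in> J \<Longrightarrow> nrm_deriv A J w (w1 t) t"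
    and d1: "\<And>t. t \<in> J \<Longrightarrow> nrm_deriv A J w1 (w2 t) t"
    and M: "\<And>t. t \<in> J \<Longrightarrow> nrm A (w2 t) \<le> M"
  shows "nrm A (w s - (((b - s) / (b - a)) *\<^sub>R w a + ((s - a) / (b - a)) *\<^sub>R w b)) \<le> M * (b - a)\<^sup>2"
proof -
  have "a \<in> J" "b \<in> J" "s \<in> J" using ab s by auto
  then have m: "w a \<in> S" "w b \<in> S" "w s \<in> S" using w by auto
  define x where "x = w s - (((b - s) / (b - a)) *\<^sub>R w a + ((s - a) / (b - a)) *\<^sub>R w b)"
  have x: "x \<in> S" using m by (simp add: x_def mem_simps)
  have M0: "0 \<le> M" using M[of a] nrm_nonneg[OF w2[of a]] ab by fastforce
  have "\<bar>A (w s) x - ((b - s) / (b - a) * A (w a) x + (s - a) / (b - a) * A (w b) x)\<bar> \<le> (M * nrm A x) * (b - a)\<^sup>2"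
  proof (rule linear_interpolation_error_real[where f = "\<lambda>t. A (w t) x" and ?f1.0 = "\<lambda>t. A (w1 t) x" and ?f2.0 = "\<lambda>t. A (w2 t) x"])
    fix t assume "t \<in> {a..b}"
    then have t: "t \<in> J" using ab by auto
    show "((\<lambda>t. A (w t) x) has_real_derivative A (w1 t) x) (at t within {a..b})"
      by (rule DERIV_subset[OF nrm_deriv_test[OF d[OF t] w t w1[OF t] x] ab(2)])
    show "((\<lambda>t. A (w1 t) x) has_real_derivative A (w2 t) x) (at t within {a..b})"
      by (rule DERIV_subset[OF nrm_deriv_test[OF d1[OF t] w1 t w2[OF t] x] ab(2)])
    show "\<bar>A (w2 t) x\<bar> \<le> M * nrm A x"
      using cauchy_schwarz[OF w2[OF t] x] mult_right_mono[OF M[OF t] nrm_nonneg[OF x]] by simp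
  qed (use ab s in auto)
  moreover have "A (w s) x - ((b - s) / (b - a) * A (w a) x + (s - a) / (b - a) * A (w b) x) = A x x"
    unfolding x_def[THEN arg_cong[where f = "\<lambda>y. A y x"]]
    using m x by (simp add: form_simps)
  ultimately have "A x x \<le> (M * (b - a)\<^sup>2) * nrm A x" by (simp add: algebra_simps)
  from nrm_le_of_test[OF x this] show ?thesis using M0 ab by (simp add: x_def)
qed

lemma nrm_continuous_bounded:
  assumes w: "\<And>s. s \<in> {a..b} \<Longrightarrow> w s \<in> S"
    and c: "\<And>t. t \<in> {a..b} \<Longrightarrow> ((\<lambda>s. nrm A (w s - w t)) \<longlongrightarrow> 0) (at t within {a..b})"
  shows "\<exists>M\<ge>0. \<forall>t\<in>{a..b::real}. nrm A (w t) \<le> M"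
proof -
  have "continuous_on {a..b} (\<lambda>t. nrm A (w t))"
    unfolding continuous_on_def
  proof (rule ballI)
    fix t assume t: "t \<in> {a..b}"
    have "((\<lambda>s. nrm A (w t) - nrm A (w s)) \<longlongrightarrow> 0) (at t within {a..b})"
      using c[OF t]
    proof (rule Lim_null_comparison[rotated])
      show "\<forall>\<^sub>F s in at t within {a..b}. norm (nrm A (w t) - nrm A (w s)) \<le> nrm A (w s - w t)"
        unfolding eventually_at_topological
        by (intro exI[of _ UNIV]) (use w t abs_nrm_diff_le[of "w _" "w t"] in \<open>auto simp: abs_minus_commute\<close>)
    qed
    then show "((\<lambda>s. nrm A (w s)) \<longlongrightarrow> nrm A (w t)) (at t within {a..b})"
      by (rule Lim_transform2[OF tendsto_const])
  qed
  then have "bounded ((\<lambda>t. nrm A (w t)) ` {a..b})"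
    by (intro compact_imp_bounded compact_continuous_image) auto
  then obtain M where M: "\<forall>x\<in>(\<lambda>t. nrm A (w t)) ` {a..b}. norm x \<le> M" by (auto simp: bounded_iff)
  have "nrm A (w t) \<le> max M 0" if "t \<in> {a..b}" for t
  proof -
    have "norm (nrm A (w t)) \<le> M" using M that by blast
    then show ?thesis unfolding real_norm_def by linarith
  qed
  then show ?thesis by (meson max.cobounded2)
qed

end

section \<open>The scheme for an abstract Stokes problem\<close>

text \<open>
  Finite dimension modulo \<open>N\<close>. The index set is one of natural numbers only in order to avoid a
  further type variable.
\<close>

definition spanned_mod :: "'a::real_vector set \<Rightarrow> 'a set \<Rightarrow> bool" where
  "spanned_mod N S \<longleftrightarrow> (\<exists>(I::nat set) e. finite I \<and> (\<forall>x\<in>S. \<exists>c. x - (\<Sum>i\<in>I. c i *\<^sub>R e i) \<in> N))"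

text \<open>
  The forms stand for \<open>m v w = \<langle>v, w\<rangle>\<close>, \<open>a v w = \<langle>\<nabla>v, \<nabla>w\<rangle>\<close>, \<open>g q s = \<langle>q, s\<rangle>\<close> and \<open>b v q = - \<langle>\<nabla>\<cdot>v, q\<rangle>\<close> on the
  continuous spaces \<open>X\<close> and \<open>P\<close>; the sets \<open>NV\<close> and \<open>NQ\<close> stand for the functions that vanish almost
  everywhere. The inf-sup condition is stated by means of an upper bound of the supremum, which
  avoids quotients by seminorms.
\<close>

locale discrete_stokes =
  m: psd_form X m + a: psd_form X a + g: psd_form P g
  for X :: "'u::real_vector set" and P :: "'q::real_vector set" and m a g +
  fixes b :: "'u \<Rightarrow> 'q \<Rightarrow> real" and Vh :: "'u set" and Qh :: "'q set"
    and NV :: "'u set" and NQ :: "'q set" and Cp Cb \<beta> :: real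
  assumes Vh: "subspace Vh" "Vh \<subseteq> X" and Qh: "subspace Qh" "Qh \<subseteq> P"
    and b_add: "v \<in> X \<Longrightarrow> w \<in> X \<Longrightarrow> q \<in> P \<Longrightarrow> b (v + w) q = b v q + b w q"
    and b_scale: "v \<in> X \<Longrightarrow> q \<in> P \<Longrightarrow> b (c *\<^sub>R v) q = c * b v q"
    and b_add_right: "v \<in> X \<Longrightarrow> q \<in> P \<Longrightarrow> q' \<in> P \<Longrightarrow> b v (q + q') = b v q + b v q'"
    and b_scale_right: "v \<in> X \<Longrightarrow> q \<in> P \<Longrightarrow> b v (c *\<^sub>R q) = c * b v q"
    and b_bound: "v \<in> X \<Longrightarrow> q \<in> P \<Longrightarrow> \<bar>b v q\<bar> \<le> Cb * (nrm a v * nrm g q)"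
    and poincare: "v \<in> X \<Longrightarrow> nrm m v \<le> Cp * nrm a v"
    and inf_sup: "q \<in> Qh \<Longrightarrow> 0 \<le> M \<Longrightarrow> (\<And>v. v \<in> Vh \<Longrightarrow> b v q \<le> M * nrm a v) \<Longrightarrow> \<beta> * nrm g q \<le> M"
    and const_bounds: "0 \<le> Cp" "0 \<le> Cb" "0 < \<beta>"
    and NV: "subspace NV" "spanned_mod NV Vh" "\<And>v. v \<in> Vh \<Longrightarrow> v \<in> NV \<Longrightarrow> a v v = 0"
    and NQ: "subspace NQ" "spanned_mod NQ Qh" "\<And>q. q \<in> Qh \<Longrightarrow> q \<in> NQ \<Longrightarrow> g q q = 0"
begin

definition "Vdiv = {v\<in>Vh. \<forall>q\<in>Qh. b v q = 0}"

lemma VhX: "v \<in> Vh \<Longrightarrow> v \<in> X" and QhP: "q \<in> Qh \<Longrightarrow> q \<in> P"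
  using Vh Qh by auto

lemma b_diff: "v \<in> X \<Longrightarrow> w \<in> X \<Longrightarrow> q \<in> P \<Longrightarrow> b (v - w) q = b v q - b w q"
  using b_add[of "v - w" w q] a.mem_simps by simp

lemma b_diff_right: "v \<in> X \<Longrightarrow> q \<in> P \<Longrightarrow> q' \<in> P \<Longrightarrow> b v (q - q') = b v q - b v q'"
  using b_add_right[of v "q - q'" q'] g.mem_simps by simp

lemma Vdiv_Vh: "v \<in> Vdiv \<Longrightarrow> v \<in> Vh" by (simp add: Vdiv_def)

lemma Vdiv_X: "v \<in> Vdiv \<Longrightarrow> v \<in> X" by (simp add: Vdiv_def VhX)

lemma Vdiv_b: "v \<in> Vdiv \<Longrightarrow> q \<in> Qh \<Longrightarrow> b v q = 0" by (simp add: Vdiv_def)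

lemma subspace_Vdiv: "subspace Vdiv"
proof (rule subspaceI)
  show "0 \<in> Vdiv"
    using b_scale[of 0 _ 0] subspace_0[OF Vh(1)] VhX QhP by (simp add: Vdiv_def)
next
  fix x y assume "x \<in> Vdiv" "y \<in> Vdiv"
  then show "x + y \<in> Vdiv"
    using subspace_add[OF Vh(1)] VhX QhP by (simp add: Vdiv_def b_add)
next
  fix c x assume "x \<in> Vdiv"
  then show "c *\<^sub>R x \<in> Vdiv"
    using subspace_scale[OF Vh(1)] VhX QhP by (simp add: Vdiv_def b_scale)
qed

lemmas Vdiv_mem = subspace_add[OF subspace_Vdiv] subspace_diff[OF subspace_Vdiv] subspace_scale[OF subspace_Vdiv]

lemma g_riesz:
  assumes "psd_form Qh A" "\<And>q. q \<in> Qh \<Longrightarrow> A q q = 0 \<Longrightarrow> l q = 0"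
    and "\<And>q. q \<in> Qh \<Longrightarrow> q \<in> NQ \<Longrightarrow> A q q = 0"
    and "\<And>x y. x \<in> Qh \<Longrightarrow> y \<in> Qh \<Longrightarrow> l (x + y) = l x + l y"
    and "\<And>c x. x \<in> Qh \<Longrightarrow> l (c *\<^sub>R x) = c * l x"
  shows "\<exists>r\<in>Qh. \<forall>q\<in>Qh. A r q = l q"
proof -
  obtain I :: "nat set" and e where "finite I" "\<forall>x\<in>Qh. \<exists>c. x - (\<Sum>i\<in>I. c i *\<^sub>R e i) \<in> NQ"
    using NQ(2) by (auto simp: spanned_mod_def)
  then show ?thesis
    by (intro riesz_finite_dim[OF _ assms(1) NQ(1) _ assms(3-5,2)]) auto
qed

lemma a_riesz:
  assumes "\<And>v. v \<in> Vh \<Longrightarrow> a v v = 0 \<Longrightarrow> l v = 0"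
    and "\<And>x y. x \<in> Vh \<Longrightarrow> y \<in> Vh \<Longrightarrow> l (x + y) = l x + l y"
    and "\<And>c x. x \<in> Vh \<Longrightarrow> l (c *\<^sub>R x) = c * l x"
  shows "\<exists>r\<in>Vh. \<forall>v\<in>Vh. a r v = l v"
proof -
  obtain I :: "nat set" and e where "finite I" "\<forall>x\<in>Vh. \<exists>c. x - (\<Sum>i\<in>I. c i *\<^sub>R e i) \<in> NV"
    using NV(2) by (auto simp: spanned_mod_def)
  then show ?thesis
    by (intro riesz_finite_dim[OF _ a.psd_form_subspace[OF Vh] NV(1) _ NV(3) assms(2,3,1)]) auto
qed

text \<open>
  The minimal energy lift of the discrete divergence of \<open>w\<close>. Let \<open>s q\<close> represent the functional \<open>\<lambda>v. b v q\<close> with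
  respect to the energy form. The Schur complement \<open>A q q' = b (s q) q'\<close> is positive semidefinite, and by the
  inf-sup condition its null vectors are null functions; hence \<open>A r = b w\<close> has a solution \<open>r\<close>, and
  \<open>s r\<close> is the lift. Its energy is \<open>b w r\<close>, which is bounded by the inf-sup condition for \<open>r\<close>.
\<close>

lemma divergence_lift:
  assumes w: "w \<in> X"
  shows "\<exists>e\<in>Vh. (\<forall>q\<in>Qh. b e q = b w q) \<and> nrm a e \<le> Cb / \<beta> * nrm a w"
proof -
  have "\<exists>s\<in>Vh. \<forall>v\<in>Vh. a s v = b v q" if q: "q \<in> Qh" for q
  proof (rule a_riesz)
    fix v assume v: "v \<in> Vh" "a v v = 0"
    then show "b v q = 0" using b_bound[OF VhX[OF v(1)] QhP[OF q]] by (simp add: nrm_def)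
  qed (use q VhX QhP in \<open>simp_all add: b_add b_scale\<close>)
  then obtain s where s: "\<And>q. q \<in> Qh \<Longrightarrow> s q \<in> Vh" "\<And>q v. q \<in> Qh \<Longrightarrow> v \<in> Vh \<Longrightarrow> a (s q) v = b v q"
    by metis
  define A where "A q q' = b (s q) q'" for q q'
  have A_eq: "A q q' = a (s q) (s q')" if "q \<in> Qh" "q' \<in> Qh" for q q'
    using s(2)[OF that(2) s(1)[OF that(1)]] a.sym[OF VhX[OF s(1)[OF that(1)]] VhX[OF s(1)[OF that(2)]]]
    by (simp add: A_def)
  have psd: "psd_form Qh A"
  proof
    fix q q' r c assume q: "q \<in> Qh" and q': "q' \<in> Qh" and r: "r \<in> Qh"
    show sym: "A q q' = A q' q" 
      using A_eq[OF q q'] A_eq[OF q' q] a.sym[OF VhX[OF s(1)[OF q]] VhX[OF s(1)[OF q']]] by simp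
    have qr: "A x r = b (s r) x" if "x \<in> Qh" for x
      using A_eq[OF that r] s(2)[OF that s(1)[OF r]] by simp
    show "A (q + q') r = A q r + A q' r"
      using q q' r s(1) VhX QhP subspace_add[OF Qh(1)] by (simp add: qr b_add_right)
    show "A (c *\<^sub>R q) r = c * A q r"
      using q r s(1) VhX QhP subspace_scale[OF Qh(1)] by (simp add: qr b_scale_right)
    show "0 \<le> A q q" using A_eq[OF q q] s(1)[OF q] VhX a.nonneg by simp
  qed (rule Qh(1))
  have null: "nrm g q = 0" if q: "q \<in> Qh" "A q q = 0" for q
  proof -
    have sq: "a (s q) (s q) = 0" using A_eq q by simp
    have "b v q \<le> 0 * nrm a v" if v: "v \<in> Vh" for v
      using s(2)[OF q(1) v] a.cauchy_schwarz[of "s q" v] s(1)[OF q(1)] v VhX sq by (simp add: nrm_def)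
    then have "\<beta> * nrm g q \<le> 0" using inf_sup[OF q(1), of 0] by simp
    then show ?thesis using const_bounds(3) g.nrm_nonneg[OF QhP[OF q(1)]] by (simp add: mult_le_0_iff)
  qed
  obtain r where r: "r \<in> Qh" "\<And>q. q \<in> Qh \<Longrightarrow> A r q = b w q"
  proof -
    have "\<exists>r\<in>Qh. \<forall>q\<in>Qh. A r q = b w q"
    proof (rule g_riesz[OF psd])
      fix q assume q: "q \<in> Qh" "A q q = 0"
      then show "b w q = 0" using b_bound[OF w QhP[OF q(1)]] null[OF q] by simp
    next
      fix q assume q: "q \<in> Qh" "q \<in> NQ"
      have "\<bar>A q q\<bar> \<le> Cb * (nrm a (s q) * nrm g q)"
        unfolding A_def using q(1) s(1) VhX QhP by (intro b_bound) auto
      then show "A q q = 0" using NQ(3)[OF q] by (simp add: nrm_def)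
    qed (use w QhP in \<open>simp_all add: b_add_right b_scale_right\<close>)
    then show ?thesis using that by blast
  qed
  define e where "e = s r"
  have e: "e \<in> Vh" "\<And>q. q \<in> Qh \<Longrightarrow> b e q = b w q"
    using r s by (auto simp: e_def A_def)
  have eX: "e \<in> X" and rP: "r \<in> P" using e r VhX QhP by auto
  have "b v r \<le> nrm a e * nrm a v" if v: "v \<in> Vh" for v
    using s(2)[OF r(1) v] a.cauchy_schwarz[OF eX VhX[OF v]] by (simp add: e_def)
  then have gr: "\<beta> * nrm g r \<le> nrm a e" using inf_sup[OF r(1)] a.nrm_nonneg[OF eX] by blast
  have "a e e = b w r" using A_eq[OF r(1) r(1)] r(2)[OF r(1)] by (simp add: e_def)
  also have "\<dots> \<le> Cb * (nrm a w * nrm g r)" using b_bound[OF w rP] by simp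
  also have "\<dots> \<le> Cb * (nrm a w * (nrm a e / \<beta>))"
    using gr const_bounds a.nrm_nonneg[OF w] by (intro mult_left_mono) (auto simp: field_simps)
  finally have "a e e \<le> (Cb / \<beta> * nrm a w) * nrm a e" by (simp add: algebra_simps)
  then have "nrm a e \<le> Cb / \<beta> * nrm a w"
    using const_bounds a.nrm_nonneg[OF w] by (intro a.nrm_le_of_test[OF eX]) auto
  then show ?thesis using e by blast
qed

text \<open>
  An arbitrary approximation \<open>v\<close> is made discretely divergence-free by adding a lift of the
  divergence of \<open>w - v\<close>.
\<close>

lemma divfree_approximation:
  assumes w: "w \<in> X" "\<And>q. q \<in> Qh \<Longrightarrow> b w q = 0" and v: "v \<in> Vh"
  shows "\<exists>W\<in>Vdiv. nrm a (w - W) \<le> (1 + Cb / \<beta>) * nrm a (w - v)"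
proof -
  have vX: "v \<in> X" using v VhX by auto
  have wv: "w - v \<in> X" using w vX a.mem_simps by auto
  obtain e where e: "e \<in> Vh" "\<And>q. q \<in> Qh \<Longrightarrow> b e q = b (w - v) q" "nrm a e \<le> Cb / \<beta> * nrm a (w - v)"
    using divergence_lift[OF wv] by blast
  have eX: "e \<in> X" using e VhX by auto
  have "v + e \<in> Vdiv"
    using v e vX eX w QhP subspace_add[OF Vh(1)] by (simp add: Vdiv_def b_add b_diff)
  moreover have "nrm a (w - (v + e)) \<le> nrm a (w - v) + nrm a e"
    using a.nrm_diff_le[OF wv eX] by (simp add: algebra_simps)
  then have "nrm a (w - (v + e)) \<le> (1 + Cb / \<beta>) * nrm a (w - v)"
    using e(3) by (simp add: algebra_simps)
  ultimately show ?thesis by blast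
qed

text \<open>
  Quasi-optimality of the velocity in a stationary problem with residual \<open>R\<close>. The pressure enters
  with its best approximation, since elements of \<open>Vdiv\<close> are orthogonal to the gradients of discrete
  pressures only.
\<close>

lemma stationary_error:
  assumes w: "w \<in> X" and W: "W \<in> Vdiv" and \<sigma>: "\<sigma> \<in> P" and R: "0 \<le> R"
    and eq: "\<And>v. v \<in> Vdiv \<Longrightarrow> \<bar>a (W - w) v - b v \<sigma>\<bar> \<le> R * nrm a v"
    and Y: "Y \<in> Vdiv" and j: "j \<in> Qh"
  shows "nrm a (W - w) \<le> 2 * nrm a (w - Y) + Cb * nrm g (\<sigma> - j) + R"
proof -
  note X = w Vdiv_X[OF W] Vdiv_X[OF Y]
  define v where "v = W - Y"
  have v: "v \<in> Vdiv" "v \<in> X" using W Y Vdiv_mem Vdiv_X by (auto simp: v_def)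
  have jP: "j \<in> P" "\<sigma> - j \<in> P" using j \<sigma> QhP g.mem_simps by auto
  have "a v v = a (W - w) v + a (w - Y) v"
    using X v by (simp add: v_def a.form_simps)
  also have "\<dots> \<le> (b v (\<sigma> - j) + R * nrm a v) + nrm a (w - Y) * nrm a v"
    using eq[OF v(1)] a.cauchy_schwarz[of "w - Y" v] X v Vdiv_b[OF v(1) j]
    by (simp add: b_diff_right v \<sigma> jP a.mem_simps abs_le_iff)
  also have "\<dots> \<le> (Cb * (nrm a v * nrm g (\<sigma> - j)) + R * nrm a v) + nrm a (w - Y) * nrm a v"
    using b_bound[OF v(2) jP(2)] by simp
  finally have "a v v \<le> (nrm a (w - Y) + Cb * nrm g (\<sigma> - j) + R) * nrm a v"
    by (simp add: algebra_simps)
  then have "nrm a v \<le> nrm a (w - Y) + Cb * nrm g (\<sigma> - j) + R"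
    using R const_bounds X jP by (intro a.nrm_le_of_test[OF v(2)]) (auto intro!: add_nonneg_nonneg mult_nonneg_nonneg a.nrm_nonneg g.nrm_nonneg a.mem_simps)
  moreover have "nrm a (W - w) \<le> nrm a v + nrm a (w - Y)"
    using a.nrm_triangle[of W Y w] a.nrm_minus[of Y w] X by (simp add: v_def)
  ultimately show ?thesis by simp
qed

text \<open>
  The inf-sup condition is applied to the difference of \<open>ph\<close> and an approximation \<open>j\<close> of \<open>p\<close>.
\<close>

lemma pressure_error:
  assumes p: "p \<in> P" and ph: "ph \<in> Qh" and j: "j \<in> Qh" and R: "0 \<le> R"
    and eq: "\<And>v. v \<in> Vh \<Longrightarrow> \<bar>b v (ph - p)\<bar> \<le> R * nrm a v"
  shows "nrm g (p - ph) \<le> (1 + Cb / \<beta>) * nrm g (p - j) + R / \<beta>"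
proof -
  note P = p QhP[OF ph] QhP[OF j]
  have pj: "p - j \<in> P" using P g.mem_simps by auto
  have dj: "ph - j \<in> Qh" using ph j subspace_diff[OF Qh(1)] by auto
  have n0: "0 \<le> nrm g (p - j)" using pj g.nrm_nonneg by auto
  have "b v (ph - j) \<le> (R + Cb * nrm g (p - j)) * nrm a v" if v: "v \<in> Vh" for v
  proof -
    have "b v (ph - j) = b v (ph - p) + b v (p - j)"
      using VhX[OF v] P g.mem_simps by (simp add: b_diff_right)
    also have "\<dots> \<le> R * nrm a v + Cb * (nrm a v * nrm g (p - j))"
      using eq[OF v] b_bound[OF VhX[OF v] pj] by simp
    finally show ?thesis by (simp add: algebra_simps)
  qed
  then have "\<beta> * nrm g (ph - j) \<le> R + Cb * nrm g (p - j)"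
    using R const_bounds n0 by (intro inf_sup[OF dj]) auto
  then have "nrm g (ph - j) \<le> (R + Cb * nrm g (p - j)) / \<beta>" using const_bounds by (simp add: field_simps)
  moreover have "nrm g (p - ph) \<le> nrm g (p - j) + nrm g (ph - j)"
    using g.nrm_triangle[of p j ph] g.nrm_minus[of j ph] P by simp
  ultimately show ?thesis by (simp add: field_simps add_divide_distrib)
qed

text \<open>
  Testing a step with \<open>E (Suc n) + E n\<close> turns the time difference into a difference of squares,
  and half of the dissipation absorbs the residual by Young's inequality.
\<close>

lemma crank_nicolson_energy:
  assumes E: "\<And>n. n \<le> N \<Longrightarrow> E n \<in> X" and \<tau>: "\<And>n. n < N \<Longrightarrow> 0 \<le> \<tau> n" 
    and step: "\<And>n. n < N \<Longrightarrow> m (E (Suc n) - E n) (E (Suc n) + E n) + \<tau> n / 2 * a (E (Suc n) + E n) (E (Suc n) + E n)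
        \<le> \<tau> n * (\<epsilon> * nrm a (E (Suc n) + E n))"
    and k: "k \<le> N"
  shows "m (E k) (E k) \<le> m (E 0) (E 0) + (\<Sum>n<k. \<tau> n) * (\<epsilon>\<^sup>2 / 2)"
  using k
proof (induction k)
  case (Suc k)
  then have k: "k < N" by simp
  have X: "E k \<in> X" "E (Suc k) \<in> X" using E k by auto
  define y where "y = nrm a (E (Suc k) + E k)"
  have y2: "a (E (Suc k) + E k) (E (Suc k) + E k) = y\<^sup>2"
    using X a.nrm_sq a.mem_simps by (simp add: y_def)
  have "\<epsilon> * y - y\<^sup>2 / 2 \<le> \<epsilon>\<^sup>2 / 2"
    using zero_le_power2[of "\<epsilon> - y"] by (simp add: power2_eq_square algebra_simps)
  then have young: "\<tau> k * (\<epsilon> * y - y\<^sup>2 / 2) \<le> \<tau> k * (\<epsilon>\<^sup>2 / 2)"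
    using \<tau>[OF k] by (rule mult_left_mono)
  have "m (E (Suc k) - E k) (E (Suc k) + E k) = m (E (Suc k)) (E (Suc k)) - m (E k) (E k)"
    using X by (simp add: m.form_simps m.sym)
  then have "m (E (Suc k)) (E (Suc k)) \<le> m (E k) (E k) + \<tau> k * (\<epsilon>\<^sup>2 / 2)"
    using step[OF k] young unfolding y2 y_def[symmetric] by (simp add: algebra_simps)
  then show ?case using Suc.IH k by (simp add: field_simps)
qed simp

text \<open>
  The values \<open>Y n\<close> start from \<open>Z 0\<close> and follow the increments of the exact time derivative \<open>z\<close> up to an
  error of \<open>\<tau> n * \<delta>\<close>, where \<open>W n\<close> is a discrete approximation of the difference quotient of \<open>z\<close>. Thus
  \<open>z - Y\<close> stays of size \<open>\<delta>\<close> in the energy norm, and \<open>E = Z - Y\<close> has zero initial value and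
  satisfies a Crank-Nicolson scheme. Since \<open>\<tau> / 2 * (z (Suc n) + z n)\<close> replaces the increment
  of \<open>u\<close>, the trapezoidal error enters in the energy norm, and the pressure enters through
  increments, which is why its difference quotients have to be approximated.
\<close>

lemma time_derivative_error:
  assumes \<tau>: "\<And>n. n < N \<Longrightarrow> 0 \<le> \<tau> n" and T: "(\<Sum>n<N. \<tau> n) \<le> T"
    and X: "\<And>n. n \<le> N \<Longrightarrow> u n \<in> X" "\<And>n. n \<le> N \<Longrightarrow> z n \<in> X" "\<And>n. n \<le> N \<Longrightarrow> p n \<in> P"
    and D: "\<And>n. n \<le> N \<Longrightarrow> U n \<in> Vdiv" "\<And>n. n \<le> N \<Longrightarrow> Z n \<in> Vdiv"
    and exact: "\<And>n v. n \<le> N \<Longrightarrow> v \<in> Vdiv \<Longrightarrow> m (z n) v + a (u n) v + b v (p n) = F n v"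
    and disc: "\<And>n v. n \<le> N \<Longrightarrow> v \<in> Vdiv \<Longrightarrow> m (Z n) v + a (U n) v = F n v"
    and incr: "\<And>n v. n < N \<Longrightarrow> v \<in> Vdiv \<Longrightarrow> a (U (Suc n) - U n) v = \<tau> n / 2 * a (Z (Suc n) + Z n) v"
    and W: "\<And>n. n < N \<Longrightarrow> W n \<in> Vdiv" "\<And>n. n < N \<Longrightarrow> nrm a (z (Suc n) - z n - \<tau> n *\<^sub>R W n) \<le> \<tau> n * \<delta>"
    and J: "\<And>n. n < N \<Longrightarrow> J n \<in> Qh" "\<And>n. n < N \<Longrightarrow> nrm g (p (Suc n) - p n - J n) \<le> \<tau> n * \<delta>"
    and trap: "\<And>n. n < N \<Longrightarrow> nrm a (u (Suc n) - u n - (\<tau> n / 2) *\<^sub>R (z (Suc n) + z n)) \<le> \<tau> n * \<kappa>"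
    and init: "nrm a (z 0 - Z 0) \<le> \<delta>" and \<kappa>: "0 \<le> \<kappa>"
    and k: "k \<le> N"
  shows "nrm m (Z k - z k) \<le> (sqrt T + Cp) * ((Cp\<^sup>2 + 1 + T + Cb) * \<delta> + \<kappa>)"
proof -
  define Y where "Y n = Z 0 + (\<Sum>i<n. \<tau> i *\<^sub>R W i)" for n
  have T0: "0 \<le> T" using T \<tau> by (meson lessThan_iff order_trans sum_nonneg)
  have \<delta>: "0 \<le> \<delta>" using init a.nrm_nonneg[of "z 0 - Z 0"] X(2)[of 0] Vdiv_X[OF D(2)[of 0]] a.mem_simps by simp
  have Y_mem: "Y n \<in> Vdiv" if "n \<le> N" for n
    unfolding Y_def using that D(2)[of 0] W(1)
    by (intro Vdiv_mem subspace_sum[OF subspace_Vdiv]) auto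
  have Y_err: "nrm a (z n - Y n) \<le> (1 + (\<Sum>i<n. \<tau> i)) * \<delta>" if "n \<le> N" for n
    using that
  proof (induction n)
    case 0
    then show ?case using init by (simp add: Y_def)
  next
    case (Suc n)
    then have n: "n < N" "n \<le> N" by auto
    have mem: "z n - Y n \<in> X" "z (Suc n) - z n - \<tau> n *\<^sub>R W n \<in> X"
      using X(2) n Suc.prems Vdiv_X Y_mem W(1) a.mem_simps by auto
    have "z (Suc n) - Y (Suc n) = (z n - Y n) + (z (Suc n) - z n - \<tau> n *\<^sub>R W n)"
      by (simp add: Y_def)
    then have "nrm a (z (Suc n) - Y (Suc n)) \<le> nrm a (z n - Y n) + nrm a (z (Suc n) - z n - \<tau> n *\<^sub>R W n)"
      using a.nrm_add[OF mem] by metis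
    also have "\<dots> \<le> (1 + (\<Sum>i<n. \<tau> i)) * \<delta> + \<tau> n * \<delta>"
      using Suc.IH n W(2)[OF n(1)] by auto
    finally show ?case by (simp add: algebra_simps)
  qed
  have sumT: "(\<Sum>i<n. \<tau> i) \<le> T" if "n \<le> N" for n
    using sum_mono2[of "{..<N}" "{..<n}" \<tau>] \<tau> T that by auto
  have Y_err': "nrm a (z n - Y n) \<le> (1 + T) * \<delta>" if "n \<le> N" for n
    using Y_err[OF that] mult_right_mono[OF _ \<delta>, of "1 + (\<Sum>i<n. \<tau> i)" "1 + T"] sumT[OF that] by simp
  define E where "E n = Z n - Y n" for n
  have E: "E n \<in> Vdiv" if "n \<le> N" for n using that D(2) Y_mem Vdiv_mem by (auto simp: E_def)
  define \<epsilon> where "\<epsilon> = (Cp\<^sup>2 + 1 + T + Cb) * \<delta> + \<kappa>"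
  have \<epsilon>0: "0 \<le> \<epsilon>" using \<delta> \<kappa> T0 const_bounds by (simp add: \<epsilon>_def)
  have "m (E k) (E k) \<le> m (E 0) (E 0) + (\<Sum>n<k. \<tau> n) * (\<epsilon>\<^sup>2 / 2)"
  proof (rule crank_nicolson_energy[where N = N])
    fix n assume n: "n < N"
    then have nN: "n \<le> N" "Suc n \<le> N" by auto
    define v where "v = E (Suc n) + E n"
    have v: "v \<in> Vdiv" "v \<in> X" using E nN Vdiv_mem Vdiv_X by (auto simp: v_def)
    note x = X(1)[OF nN(1)] X(1)[OF nN(2)] X(2)[OF nN(1)] X(2)[OF nN(2)]
      Vdiv_X[OF D(1)[OF nN(1)]] Vdiv_X[OF D(1)[OF nN(2)]] Vdiv_X[OF D(2)[OF nN(1)]] Vdiv_X[OF D(2)[OF nN(2)]]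
      Vdiv_X[OF Y_mem[OF nN(1)]] Vdiv_X[OF Y_mem[OF nN(2)]] Vdiv_X[OF W(1)[OF n]]
    note pP = X(3)[OF nN(1)] X(3)[OF nN(2)] QhP[OF J(1)[OF n]]
    have YS: "Y (Suc n) = Y n + \<tau> n *\<^sub>R W n" by (simp add: Y_def)
    have t0: "0 \<le> \<tau> n" using \<tau>[OF n] .
    have D2: "m (Z (Suc n)) v - m (Z n) v + \<tau> n / 2 * (a (Z (Suc n)) v + a (Z n) v) = F (Suc n) v - F n v"
      using disc[OF nN(1) v(1)] disc[OF nN(2) v(1)] incr[OF n v(1)] x v by (simp add: a.form_simps)
    define r1 where "r1 = z (Suc n) - z n - \<tau> n *\<^sub>R W n"
    define r2 where "r2 = u (Suc n) - u n - (\<tau> n / 2) *\<^sub>R (z (Suc n) + z n)"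
    define r3 where "r3 = (\<tau> n / 2) *\<^sub>R ((z (Suc n) - Y (Suc n)) + (z n - Y n))"
    define r4 where "r4 = p (Suc n) - p n - J n"
    have rX: "r1 \<in> X" "r2 \<in> X" "r3 \<in> X" "r4 \<in> P"
      using x pP by (simp_all add: r1_def r2_def r3_def r4_def a.mem_simps g.mem_simps)
    \<comment> \<open>the four residuals: difference quotient of \<open>z\<close>, trapezoidal rule, drift of \<open>Y\<close>, increment of the pressure\<close>
    have "m (E (Suc n) - E n) v + \<tau> n / 2 * a v v
      = (m (Z (Suc n)) v - m (Z n) v + \<tau> n / 2 * (a (Z (Suc n)) v + a (Z n) v))
         - (\<tau> n * m (W n) v + \<tau> n / 2 * (a (Y (Suc n)) v + a (Y n) v))"
    proof -
      have e1: "E (Suc n) - E n = Z (Suc n) - Z n - \<tau> n *\<^sub>R W n"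
        by (simp add: E_def YS)
      have e2: "v = (Z (Suc n) + Z n) - (Y (Suc n) + Y n)" by (simp add: v_def E_def)
      have "a v v = a (Z (Suc n)) v + a (Z n) v - (a (Y (Suc n)) v + a (Y n) v)"
        using x v by (subst e2) (simp add: a.form_simps)
      moreover have "m (E (Suc n) - E n) v = m (Z (Suc n)) v - m (Z n) v - \<tau> n * m (W n) v"
        using x v unfolding e1 by (simp add: m.form_simps)
      ultimately show ?thesis by (simp only:) (simp add: algebra_simps)
    qed
    also have "\<dots> = m r1 v + a r2 v + a r3 v + b v r4"
    proof -
      have "m r1 v = m (z (Suc n)) v - m (z n) v - \<tau> n * m (W n) v"
        using x v by (simp add: r1_def m.form_simps)
      moreover have "a r2 v = a (u (Suc n)) v - a (u n) v - \<tau> n / 2 * (a (z (Suc n)) v + a (z n) v)"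
        using x v by (simp add: r2_def a.form_simps)
      moreover have "a r3 v = \<tau> n / 2 * ((a (z (Suc n)) v - a (Y (Suc n)) v) + (a (z n) v - a (Y n) v))"
        using x v by (simp add: r3_def a.form_simps)
      moreover have "b v r4 = b v (p (Suc n)) - b v (p n)"
        using v pP Vdiv_b[OF v(1) J(1)[OF n]] by (simp add: r4_def b_diff_right g.mem_simps)
      ultimately show ?thesis
        unfolding D2 exact[OF nN(1) v(1), symmetric] exact[OF nN(2) v(1), symmetric]
        by (simp only:) (simp add: algebra_simps)
    qed
    also have "\<dots> \<le> \<tau> n * (\<epsilon> * nrm a v)"
    proof -
      have av: "0 \<le> nrm a v" using v a.nrm_nonneg by auto
      have "m r1 v \<le> nrm m r1 * nrm m v" using m.cauchy_schwarz[OF rX(1) v(2)] by simp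
      also have "\<dots> \<le> (Cp * nrm a r1) * (Cp * nrm a v)"
        using poincare rX v const_bounds m.nrm_nonneg a.nrm_nonneg by (intro mult_mono) auto
      also have "\<dots> \<le> (Cp * (\<tau> n * \<delta>)) * (Cp * nrm a v)"
        using W(2)[OF n] const_bounds av by (intro mult_right_mono mult_left_mono) (auto simp: r1_def)
      finally have 1: "m r1 v \<le> \<tau> n * ((Cp\<^sup>2 * \<delta>) * nrm a v)" by (simp add: power2_eq_square algebra_simps)
      have "a r2 v \<le> nrm a r2 * nrm a v" using a.cauchy_schwarz[OF rX(2) v(2)] by simp
      also have "\<dots> \<le> (\<tau> n * \<kappa>) * nrm a v" using trap[OF n] av by (intro mult_right_mono) (auto simp: r2_def)
      finally have 2: "a r2 v \<le> \<tau> n * (\<kappa> * nrm a v)" by simp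
      have mem: "z (Suc n) - Y (Suc n) \<in> X" "z n - Y n \<in> X" using x a.mem_simps by auto
      have "nrm a r3 = \<tau> n / 2 * nrm a ((z (Suc n) - Y (Suc n)) + (z n - Y n))"
        unfolding r3_def using a.nrm_scale[OF a.mem_simps(2)[OF mem], of "\<tau> n / 2"] t0 by simp
      also have "\<dots> \<le> \<tau> n / 2 * ((1 + T) * \<delta> + (1 + T) * \<delta>)"
        using a.nrm_add[OF mem] Y_err'[OF nN(1)] Y_err'[OF nN(2)] t0 by (intro mult_left_mono; linarith)
      finally have n3: "nrm a r3 \<le> \<tau> n * ((1 + T) * \<delta>)" by (simp add: algebra_simps)
      have "a r3 v \<le> nrm a r3 * nrm a v" using a.cauchy_schwarz[OF rX(3) v(2)] by simp
      also have "\<dots> \<le> (\<tau> n * ((1 + T) * \<delta>)) * nrm a v" using n3 av by (intro mult_right_mono)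
      finally have 3: "a r3 v \<le> \<tau> n * (((1 + T) * \<delta>) * nrm a v)" by simp
      have "b v r4 \<le> Cb * (nrm a v * nrm g r4)" using b_bound[OF v(2) rX(4)] by simp
      also have "\<dots> \<le> Cb * (nrm a v * (\<tau> n * \<delta>))"
        using J(2)[OF n] const_bounds av by (intro mult_left_mono) (auto simp: r4_def)
      finally have 4: "b v r4 \<le> \<tau> n * ((Cb * \<delta>) * nrm a v)" by (simp add: algebra_simps)
      show ?thesis using 1 2 3 4 by (simp add: \<epsilon>_def algebra_simps)
    qed
    finally show "m (E (Suc n) - E n) (E (Suc n) + E n) + \<tau> n / 2 * a (E (Suc n) + E n) (E (Suc n) + E n)
        \<le> \<tau> n * (\<epsilon> * nrm a (E (Suc n) + E n))" unfolding v_def .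
  qed (use E Vdiv_X \<tau> k in auto)
  moreover have "E 0 = 0" by (simp add: E_def Y_def)
  ultimately have "m (E k) (E k) \<le> (\<Sum>n<k. \<tau> n) * (\<epsilon>\<^sup>2 / 2)"
    using m.zero[of 0] m.mem_simps by simp
  also have "\<dots> \<le> T * \<epsilon>\<^sup>2"
    using sumT[OF k] T0 by (intro mult_mono) auto
  finally have "sqrt (m (E k) (E k)) \<le> sqrt (T * \<epsilon>\<^sup>2)" by (rule real_sqrt_le_mono)
  then have 1: "nrm m (E k) \<le> sqrt T * \<epsilon>" using \<epsilon>0 by (simp add: nrm_def real_sqrt_mult)
  note xk = X(2)[OF k] Vdiv_X[OF D(2)[OF k]] Vdiv_X[OF Y_mem[OF k]]
  have "(1 + T) * \<delta> \<le> \<epsilon>" using \<delta> \<kappa> const_bounds unfolding \<epsilon>_def by (simp add: algebra_simps)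
  then have "nrm a (z k - Y k) \<le> \<epsilon>" using Y_err'[OF k] by simp
  then have "nrm m (z k - Y k) \<le> Cp * \<epsilon>"
    using poincare[OF a.mem_simps(3)[OF xk(1,3)]] mult_left_mono[OF _ const_bounds(1)] by force
  moreover have "nrm m (Z k - z k) \<le> nrm m (E k) + nrm m (z k - Y k)"
    using m.nrm_triangle[of "Z k" "Y k" "z k"] m.nrm_minus[of "z k" "Y k"] xk by (simp add: E_def)
  ultimately show ?thesis using 1 by (simp add: \<epsilon>_def algebra_simps)
qed

text \<open>
  Each step has its own left and right nodal values, which are linked by vanishing distances only,
  since \<open>m\<close> is a seminorm. Testing with \<open>Vdiv\<close> at a node eliminates the pressure and shows that
  \<open>ZL\<close> there equals the previous \<open>ZR\<close> up to a null vector. So there are single-valued sequences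
  \<open>U\<close> and \<open>Z\<close> to which the estimate for the time derivative applies. The vectors \<open>Z0\<close> and \<open>z 0\<close> solve
  stationary problems that differ by \<open>\<sigma>\<close> in the place of a pressure, and the same quasi-optimality that bounds
  the velocity bounds the initial error \<open>Z0 - z 0\<close>.
\<close>

lemma nodal_pressure_errors:
  fixes N :: nat
  assumes null: "\<And>v. v \<in> X \<Longrightarrow> m v v = 0 \<Longrightarrow> a v v = 0"
    and \<tau>: "\<And>n. n < N \<Longrightarrow> 0 < \<tau> n" and T: "(\<Sum>n<N. \<tau> n) \<le> T"
    \<comment> \<open>velocity, its time derivative, and pressure of the exact solution at the nodes\<close>
    and ex: "\<And>n. n \<le> N \<Longrightarrow> u n \<in> X" "\<And>n. n \<le> N \<Longrightarrow> z n \<in> X" "\<And>n. n \<le> N \<Longrightarrow> p n \<in> P"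
    and exdiv: "\<And>n q. n \<le> N \<Longrightarrow> q \<in> Qh \<Longrightarrow> b (u n) q = 0" "\<And>n q. n \<le> N \<Longrightarrow> q \<in> Qh \<Longrightarrow> b (z n) q = 0"
    and exact: "\<And>n v. n \<le> N \<Longrightarrow> v \<in> Vh \<Longrightarrow> m (z n) v + a (u n) v + b v (p n) = F n v"
    and trap: "\<And>n. n < N \<Longrightarrow> nrm a (u (Suc n) - u n - (\<tau> n / 2) *\<^sub>R (z (Suc n) + z n)) \<le> \<tau> n * \<kappa>" and \<kappa>: "0 \<le> \<kappa>"
    \<comment> \<open>best approximation errors, also for the difference quotients that drive the scheme for \<open>Z\<close>\<close>
    and Au: "\<And>n. n \<le> N \<Longrightarrow> \<exists>y\<in>Vh. nrm a (u n - y) \<le> \<delta>"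
    and Ap: "\<And>n. n \<le> N \<Longrightarrow> \<exists>j\<in>Qh. nrm g (p n - j) \<le> \<delta>"
    and Az: "\<And>n. n < N \<Longrightarrow> \<exists>y\<in>Vh. nrm a ((1 / \<tau> n) *\<^sub>R (z (Suc n) - z n) - y) \<le> \<delta>"
    and Adp: "\<And>n. n < N \<Longrightarrow> \<exists>j\<in>Qh. nrm g ((1 / \<tau> n) *\<^sub>R (p (Suc n) - p n) - j) \<le> \<delta>"
    and Az0: "\<exists>y\<in>Vh. nrm a (z 0 - y) \<le> \<delta>" and As: "\<exists>j\<in>Qh. nrm g (\<sigma> - j) \<le> \<delta>" and \<sigma>: "\<sigma> \<in> P"
    \<comment> \<open>one-sided nodal values of the discrete solution; \<open>c\<close> is the coefficient of the post-processing\<close>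
    and init: "U0 \<in> Vdiv" "Z0 \<in> Vdiv" "\<And>v. v \<in> Vdiv \<Longrightarrow> m Z0 v + a U0 v = F 0 v"
      "\<And>v. v \<in> Vdiv \<Longrightarrow> a (Z0 - z 0) v = b v \<sigma>"
    and VhUZ: "\<And>n. n < N \<Longrightarrow> UL n \<in> Vh" "\<And>n. n < N \<Longrightarrow> UR n \<in> Vh"
      "\<And>n. n < N \<Longrightarrow> pL n \<in> Qh" "\<And>n. n < N \<Longrightarrow> pR n \<in> Qh"
    and c: "\<And>n. n < N \<Longrightarrow> c n \<in> Vdiv" "\<And>n. n < N \<Longrightarrow> ZL n - ZR n = 2 *\<^sub>R c n"
    and incr: "\<And>n. n < N \<Longrightarrow> UR n - UL n = (\<tau> n / 2) *\<^sub>R (ZL n + ZR n)"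
    and mid: "\<And>n q. n < N \<Longrightarrow> q \<in> Qh \<Longrightarrow> b (UL n + UR n) q = 0"
    and cont: "0 < N \<Longrightarrow> m (UL 0 - U0) (UL 0 - U0) = 0"
      "\<And>n. Suc n < N \<Longrightarrow> m (UL (Suc n) - UR n) (UL (Suc n) - UR n) = 0"
    and eqL: "\<And>n v. n < N \<Longrightarrow> v \<in> Vh \<Longrightarrow> m (ZL n) v + a (UL n) v + b v (pL n) = F n v"
    and eqR: "\<And>n v. n < N \<Longrightarrow> v \<in> Vh \<Longrightarrow> m (ZR n) v + a (UR n) v + b v (pR n) = F (Suc n) v"
    and n: "n < N"
  defines "L \<equiv> 2 * (1 + Cb / \<beta>) + Cb"
  defines "K \<equiv> L * \<delta> * (1 + 1 / \<beta>) + 2 * Cp / \<beta> * ((sqrt T + Cp) * ((Cp\<^sup>2 + 1 + T + Cb) * (L * \<delta>) + \<kappa>))"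
  shows "nrm g (p n - pL n) \<le> K" "nrm g (p (Suc n) - pR n) \<le> K"
proof -
  define G where "G = 1 + Cb / \<beta>"
  have G1: "1 \<le> G" using const_bounds by (simp add: G_def)
  have \<delta>: "0 \<le> \<delta>" using Ap[of 0] g.nrm_nonneg ex(3)[of 0] QhP g.mem_simps(3) by (meson le0 order_trans)
  have LG: "L = 2 * G + Cb" by (simp add: L_def G_def)
  have T0: "0 \<le> T" using T \<tau> by (meson lessThan_iff less_imp_le order_trans sum_nonneg)
  have nullD: "a x y = 0" "m x y = 0" if "x \<in> X" "m x x = 0" "y \<in> X" for x y
    using a.null_right[of y x] m.null_right[of y x] null[OF that(1,2)] a.sym[of x y] m.sym[of x y] that by auto
  have nullb: "b x q = 0" if "x \<in> X" "m x x = 0" "q \<in> P" for x q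
    using b_bound[OF that(1,3)] null[OF that(1,2)] by (simp add: nrm_def)
  define U where "U n = (case n of 0 \<Rightarrow> U0 | Suc k \<Rightarrow> UR k)" for n
  define Z where "Z n = (case n of 0 \<Rightarrow> Z0 | Suc k \<Rightarrow> ZR k)" for n
  have Us: "U 0 = U0" "U (Suc k) = UR k" and Zs: "Z 0 = Z0" "Z (Suc k) = ZR k" for k by (simp_all add: U_def Z_def)
  have contU: "m (UL k - U k) (UL k - U k) = 0" if "k < N" for k using cont that by (cases k) (auto simp: Us)
  have UX: "U k \<in> Vh" if "k \<le> N" for k using that VhUZ(2) init(1) Vdiv_Vh by (cases k) (auto simp: Us)
  have ULdiv: "UL k \<in> Vdiv" if "k < N" "U k \<in> Vdiv" for k
  proof -
    have X: "UL k \<in> X" "U k \<in> X" using that VhUZ(1) VhX Vdiv_X by auto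
    have "b (UL k) q = 0" if q: "q \<in> Qh" for q
      using nullb[of "UL k - U k" q] contU[OF \<open>k < N\<close>] X QhP[OF q] Vdiv_b[OF \<open>U k \<in> Vdiv\<close> q] by (simp add: a.mem_simps b_diff)
    then show ?thesis using VhUZ(1)[OF that(1)] by (simp add: Vdiv_def)
  qed
  have URdiv: "UR k \<in> Vdiv" if "k < N" "U k \<in> Vdiv" for k
  proof -
    have X: "UL k \<in> X" "UR k \<in> X" using that VhUZ VhX by auto
    have "b (UR k) q = 0" if q: "q \<in> Qh" for q
      using mid[OF \<open>k < N\<close> q] Vdiv_b[OF ULdiv[OF \<open>k < N\<close> \<open>U k \<in> Vdiv\<close>] q] X QhP[OF q] by (simp add: b_add)
    then show ?thesis using VhUZ(2)[OF that(1)] by (simp add: Vdiv_def)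
  qed
  have Udiv: "k \<le> N \<Longrightarrow> U k \<in> Vdiv" for k
    by (induction k) (use init(1) URdiv in \<open>auto simp: Us\<close>)
  have ZLR: "ZL k \<in> Vdiv" "ZR k \<in> Vdiv" if k: "k < N" for k
  proof -
    have "UR k - UL k \<in> Vdiv" using ULdiv URdiv Udiv[of k] k by (intro Vdiv_mem(2)) auto
    then have "(1 / \<tau> k) *\<^sub>R (UR k - UL k) \<in> Vdiv" by (rule Vdiv_mem(3))
    moreover have "(1 / \<tau> k) *\<^sub>R (UR k - UL k) = (1 / 2) *\<^sub>R (ZL k + ZR k)" using incr[OF k] \<tau>[OF k] by simp
    ultimately have s: "(1 / 2) *\<^sub>R (ZL k + ZR k) \<in> Vdiv" by simp
    have d: "c k = (1 / 2) *\<^sub>R (ZL k - ZR k)" using c(2)[OF k] by simp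
    \<comment> \<open>both values of the derivative are recovered from their mean, an increment of \<open>U\<close>, and from the coefficient \<open>c\<close> of the post-processing\<close>
    have half: "(1 / 2) *\<^sub>R x + (1 / 2) *\<^sub>R x = x" for x :: 'u by (simp add: scaleR_add_left[symmetric])
    have "(1 / 2) *\<^sub>R (ZL k + ZR k) + c k = (1 / 2) *\<^sub>R ZL k + (1 / 2) *\<^sub>R ZL k" unfolding d by (simp add: scaleR_add_right scaleR_diff_right)
    then have "(1 / 2) *\<^sub>R (ZL k + ZR k) + c k = ZL k" by (simp only: half)
    then show "ZL k \<in> Vdiv" using Vdiv_mem(1)[OF s c(1)[OF k]] by simp
    have "(1 / 2) *\<^sub>R (ZL k + ZR k) - c k = (1 / 2) *\<^sub>R ZR k + (1 / 2) *\<^sub>R ZR k" unfolding d by (simp add: scaleR_add_right scaleR_diff_right)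
    then have "(1 / 2) *\<^sub>R (ZL k + ZR k) - c k = ZR k" by (simp only: half)
    then show "ZR k \<in> Vdiv" using Vdiv_mem(2)[OF s c(1)[OF k]] by simp
  qed
  have Zdiv: "Z k \<in> Vdiv" if "k \<le> N" for k using that ZLR init(2) by (cases k) (auto simp: Zs)
  have disc: "m (Z k) v + a (U k) v = F k v" if "k \<le> N" "v \<in> Vdiv" for k v
  proof (cases k)
    case (Suc l)
    then show ?thesis using eqR[of l v] that Vdiv_Vh Vdiv_b VhUZ(4) by (auto simp: Us Zs)
  qed (use init(3) that in \<open>auto simp: Us Zs\<close>)
  have contZ: "m (ZL k - Z k) (ZL k - Z k) = 0" if k: "k < N" for k
  proof -
    define v where "v = ZL k - Z k"
    have v: "v \<in> Vdiv" using ZLR Zdiv[of k] k by (auto simp: v_def intro: Vdiv_mem)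
    note X = Vdiv_X[OF v] Vdiv_X[OF ZLR(1)[OF k]] Vdiv_X[OF Zdiv[of k]] Vdiv_X[OF Udiv[of k]] VhX[OF VhUZ(1)[OF k]]
    have "m (ZL k) v + a (UL k) v = m (Z k) v + a (U k) v"
      using eqL[OF k Vdiv_Vh[OF v]] disc[of k v] v k Vdiv_b[OF v VhUZ(3)[OF k]] by simp
    moreover have "a (UL k) v = a (U k) v" using nullD(1)[of "UL k - U k" v] contU[OF k] X k by (simp add: a.form_simps)
    ultimately have "m (ZL k) v = m (Z k) v" by simp
    then show ?thesis using X k by (simp add: v_def[symmetric] m.diff[symmetric]) (simp add: v_def m.form_simps)
  qed
  have incrU: "a (U (Suc k) - U k) v = \<tau> k / 2 * a (Z (Suc k) + Z k) v" if k: "k < N" and v: "v \<in> Vdiv" for k v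
  proof -
    note X = Vdiv_X[OF v] Vdiv_X[OF ZLR(1)[OF k]] Vdiv_X[OF ZLR(2)[OF k]] Vdiv_X[OF Zdiv[of k]] Vdiv_X[OF Udiv[of k]] VhX[OF VhUZ(1)[OF k]] VhX[OF VhUZ(2)[OF k]]
    have kN: "k \<le> N" using k by simp
    have 1: "a (UL k) v = a (U k) v" using nullD(1)[of "UL k - U k" v] contU[OF k] X kN by (simp add: a.form_simps)
    have 2: "a (ZL k) v = a (Z k) v" using nullD(1)[of "ZL k - Z k" v] contZ[OF k] X kN by (simp add: a.form_simps)
    have "a (U (Suc k) - U k) v = a (UR k - UL k) v" using 1 X kN by (simp add: Us a.form_simps)
    also have "\<dots> = \<tau> k / 2 * a (ZL k + ZR k) v" unfolding incr[OF k] using X by (simp add: a.form_simps)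
    also have "a (ZL k + ZR k) v = a (Z (Suc k) + Z k) v" using 2 X kN by (simp add: Zs a.form_simps)
    finally show ?thesis .
  qed
  have div_approx: "\<exists>W\<in>Vdiv. nrm a (w - W) \<le> G * \<delta>"
    if w: "w \<in> X" "\<And>q. q \<in> Qh \<Longrightarrow> b w q = 0" "\<exists>y\<in>Vh. nrm a (w - y) \<le> \<delta>" for w
  proof -
    obtain y where y: "y \<in> Vh" "nrm a (w - y) \<le> \<delta>" using w(3) by blast
    obtain W where W: "W \<in> Vdiv" "nrm a (w - W) \<le> G * nrm a (w - y)"
      using divfree_approximation[OF w(1,2) y(1)] unfolding G_def by blast
    have "G * nrm a (w - y) \<le> G * \<delta>" using y(2) G1 by (intro mult_left_mono) auto
    then show ?thesis using W by (intro bexI[of _ W]) auto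
  qed
  have LGd: "G * \<delta> \<le> L * \<delta>" "\<delta> \<le> L * \<delta>"
    using mult_right_mono[OF _ \<delta>, of G L] mult_right_mono[OF _ \<delta>, of 1 L] G1 const_bounds(2) by (simp_all add: LG)
  obtain y0 where y0: "y0 \<in> Vdiv" "nrm a (z 0 - y0) \<le> G * \<delta>" using div_approx[OF ex(2)[of 0] exdiv(2)[of 0] Az0] by auto
  obtain j0 where j0: "j0 \<in> Qh" "nrm g (\<sigma> - j0) \<le> \<delta>" using As by blast
  have "nrm a (Z0 - z 0) \<le> 2 * nrm a (z 0 - y0) + Cb * nrm g (\<sigma> - j0) + 0"
    by (rule stationary_error[OF ex(2)[of 0] init(2) \<sigma> _ _ y0(1) j0(1)]) (simp_all add: init(4))
  also have "\<dots> \<le> 2 * (G * \<delta>) + Cb * \<delta>" using y0(2) j0(2) mult_left_mono[OF j0(2) const_bounds(2)] by linarith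
  finally have init_err: "nrm a (z 0 - Z 0) \<le> L * \<delta>"
    using a.nrm_minus[OF ex(2)[of 0] Vdiv_X[OF init(2)]] by (simp add: LG Zs algebra_simps)
  have "\<exists>W\<in>Vdiv. nrm a (z (Suc k) - z k - \<tau> k *\<^sub>R W) \<le> \<tau> k * (L * \<delta>)" if k: "k < N" for k
  proof -
    note X = ex(2)[of k] ex(2)[of "Suc k"]
    define w where "w = (1 / \<tau> k) *\<^sub>R (z (Suc k) - z k)"
    have w: "w \<in> X" using X k by (simp add: w_def a.mem_simps)
    have "b w q = 0" if "q \<in> Qh" for q
      using X k exdiv(2)[of k q] exdiv(2)[of "Suc k" q] that QhP[OF that] by (simp add: w_def b_scale b_diff a.mem_simps)
    then obtain W where W: "W \<in> Vdiv" "nrm a (w - W) \<le> G * \<delta>"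
      using div_approx[OF w] Az[OF k] unfolding w_def by blast
    have "z (Suc k) - z k - \<tau> k *\<^sub>R W = \<tau> k *\<^sub>R (w - W)" using \<tau>[OF k] by (simp add: w_def scaleR_diff_right)
    then have "nrm a (z (Suc k) - z k - \<tau> k *\<^sub>R W) = \<tau> k * nrm a (w - W)"
      using a.nrm_scale[of "w - W" "\<tau> k"] w Vdiv_X[OF W(1)] \<tau>[OF k] by (simp add: a.mem_simps)
    also have "\<dots> \<le> \<tau> k * (L * \<delta>)" using W(2) LGd(1) \<tau>[OF k] by (intro mult_left_mono) auto
    finally show ?thesis using W(1) by blast
  qed
  then obtain W where W: "\<And>k. k < N \<Longrightarrow> W k \<in> Vdiv" "\<And>k. k < N \<Longrightarrow> nrm a (z (Suc k) - z k - \<tau> k *\<^sub>R W k) \<le> \<tau> k * (L * \<delta>)"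
    by metis
  have "\<exists>j\<in>Qh. nrm g (p (Suc k) - p k - j) \<le> \<tau> k * (L * \<delta>)" if k: "k < N" for k
  proof -
    note X = ex(3)[of k] ex(3)[of "Suc k"]
    define w where "w = (1 / \<tau> k) *\<^sub>R (p (Suc k) - p k)"
    have w: "w \<in> P" using X k by (simp add: w_def g.mem_simps)
    obtain j where j: "j \<in> Qh" "nrm g (w - j) \<le> \<delta>" using Adp[OF k] unfolding w_def by blast
    have "p (Suc k) - p k - \<tau> k *\<^sub>R j = \<tau> k *\<^sub>R (w - j)" using \<tau>[OF k] by (simp add: w_def scaleR_diff_right)
    then have "nrm g (p (Suc k) - p k - \<tau> k *\<^sub>R j) = \<tau> k * nrm g (w - j)"
      using g.nrm_scale[of "w - j" "\<tau> k"] w QhP[OF j(1)] \<tau>[OF k] by (simp add: g.mem_simps)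
    also have "\<dots> \<le> \<tau> k * (L * \<delta>)" using j(2) LGd(2) \<tau>[OF k] by (intro mult_left_mono) auto
    finally show ?thesis using subspace_scale[OF Qh(1) j(1)] by blast
  qed
  then obtain J where J: "\<And>k. k < N \<Longrightarrow> J k \<in> Qh" "\<And>k. k < N \<Longrightarrow> nrm g (p (Suc k) - p k - J k) \<le> \<tau> k * (L * \<delta>)"
    by metis
  define E where "E = (sqrt T + Cp) * ((Cp\<^sup>2 + 1 + T + Cb) * (L * \<delta>) + \<kappa>)"
  have L\<delta>0: "0 \<le> L * \<delta>" using LGd(2) \<delta> by simp
  have E0: "0 \<le> E" unfolding E_def using T0 const_bounds \<kappa> \<delta> G1 LG by (intro mult_nonneg_nonneg add_nonneg_nonneg) auto
  have Zerr: "nrm m (Z k - z k) \<le> E" if "k \<le> N" for k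
    unfolding E_def
    by (rule time_derivative_error[where N = N and \<tau> = \<tau> and u = u and p = p and U = U and F = F and W = W and J = J])
       (use \<tau> T ex Udiv Zdiv exact Vdiv_Vh disc incrU W J trap init_err \<kappa> that in \<open>auto intro: less_imp_le\<close>)
  have final: "nrm g (p k - ph) \<le> K"
    if k: "k \<le> N" and ph: "ph \<in> Qh" and V: "V \<in> Vdiv" "Y \<in> Vdiv" and Y: "nrm m (Y - z k) \<le> E"
      and eq: "\<And>v. v \<in> Vh \<Longrightarrow> m Y v + a V v + b v ph = F k v" for k ph V Y
  proof -
    note x = ex(1)[OF k] ex(2)[OF k] ex(3)[OF k] Vdiv_X[OF V(1)] Vdiv_X[OF V(2)] QhP[OF ph]
    obtain y where y: "y \<in> Vdiv" "nrm a (u k - y) \<le> G * \<delta>" using div_approx[OF x(1) exdiv(1)[OF k] Au[OF k]] by blast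
    obtain j where j: "j \<in> Qh" "nrm g (p k - j) \<le> \<delta>" using Ap[OF k] by blast
    have mb: "\<bar>m (Y - z k) v\<bar> \<le> (Cp * E) * nrm a v" if v: "v \<in> X" for v
    proof -
      have "\<bar>m (Y - z k) v\<bar> \<le> nrm m (Y - z k) * nrm m v" using m.cauchy_schwarz[OF _ v] x m.mem_simps by simp
      also have "\<dots> \<le> E * (Cp * nrm a v)" using Y poincare[OF v] m.nrm_nonneg[OF v] E0 by (intro mult_mono) auto
      finally show ?thesis by (simp add: mult_ac)
    qed
    have res: "a (V - u k) v + b v (ph - p k) = - m (Y - z k) v" if v: "v \<in> Vh" for v
      using eq[OF v] exact[OF k v] x VhX[OF v] by (simp add: a.form_simps m.form_simps b_diff_right)
    have "nrm a (V - u k) \<le> 2 * nrm a (u k - y) + Cb * nrm g (p k - j) + Cp * E"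
    proof (rule stationary_error[OF x(1) V(1) x(3) _ _ y(1) j(1)])
      show "0 \<le> Cp * E" using E0 const_bounds by simp
      fix v assume v: "v \<in> Vdiv"
      have "a (V - u k) v - b v (p k) = - m (Y - z k) v"
        using res[OF Vdiv_Vh[OF v]] Vdiv_b[OF v ph] Vdiv_X[OF v] x by (simp add: b_diff_right)
      then show "\<bar>a (V - u k) v - b v (p k)\<bar> \<le> Cp * E * nrm a v" using mb[OF Vdiv_X[OF v]] by simp
    qed
    also have "\<dots> \<le> L * \<delta> + Cp * E" using y(2) mult_left_mono[OF j(2) const_bounds(2)] by (simp add: LG algebra_simps)
    finally have Uerr: "nrm a (V - u k) \<le> L * \<delta> + Cp * E" .
    have "nrm g (p k - ph) \<le> (1 + Cb / \<beta>) * nrm g (p k - j) + (L * \<delta> + 2 * (Cp * E)) / \<beta>"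
    proof (rule pressure_error[OF x(3) ph j(1)])
      show "0 \<le> L * \<delta> + 2 * (Cp * E)" using L\<delta>0 E0 const_bounds by simp
      fix v assume v: "v \<in> Vh"
      have "\<bar>b v (ph - p k)\<bar> \<le> \<bar>a (V - u k) v\<bar> + \<bar>m (Y - z k) v\<bar>" using res[OF v] by linarith
      also have "\<dots> \<le> (L * \<delta> + Cp * E) * nrm a v + (Cp * E) * nrm a v"
        using a.cauchy_schwarz[of "V - u k" v] x VhX[OF v] mb[OF VhX[OF v]] mult_right_mono[OF Uerr a.nrm_nonneg[OF VhX[OF v]]]
        by (simp add: a.mem_simps)
      finally show "\<bar>b v (ph - p k)\<bar> \<le> (L * \<delta> + 2 * (Cp * E)) * nrm a v" by (simp add: algebra_simps)
    qed
    also have "(1 + Cb / \<beta>) * nrm g (p k - j) \<le> L * \<delta>"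
      using mult_left_mono[OF j(2) order_trans[OF zero_le_one G1]] LGd(1) unfolding G_def by linarith
    finally have "nrm g (p k - ph) \<le> L * \<delta> + (L * \<delta> + 2 * (Cp * E)) / \<beta>" by simp
    also have "\<dots> = K" unfolding K_def E_def[symmetric] using const_bounds(3) by (simp add: field_simps)
    finally show ?thesis .
  qed
  have nN: "n \<le> N" "Suc n \<le> N" using n by auto
  have "nrm m (ZL n - z n) \<le> nrm m (ZL n - Z n) + nrm m (Z n - z n)"
    by (intro m.nrm_triangle Vdiv_X ZLR n Zdiv nN ex)
  then have ZLerr: "nrm m (ZL n - z n) \<le> E" using Zerr[OF nN(1)] contZ[OF n] nrm_def[of m "ZL n - Z n"] by simp
  show "nrm g (p n - pL n) \<le> K"
    by (rule final[OF nN(1) VhUZ(3)[OF n] ULdiv[OF n Udiv[OF nN(1)]] ZLR(1)[OF n] ZLerr eqL[OF n]])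
  show "nrm g (p (Suc n) - pR n) \<le> K"
    by (rule final[OF nN(2) VhUZ(4)[OF n] URdiv[OF n Udiv[OF nN(1)]] ZLR(2)[OF n] Zerr[OF nN(2), unfolded Zs] eqR[OF n]])
qed

end

section \<open>Test functions\<close>

text \<open>
  These functions are closed under differentiation up to linear combinations, which makes
  \<open>exp (- 1 / y)\<close> smooth without a discussion of its higher derivatives.
\<close>

definition flat_exp :: "nat \<Rightarrow> real \<Rightarrow> real" where
  "flat_exp n y = (if y > 0 then (1 / y) ^ n * exp (- (1 / y)) else 0)"

lemma flat_exp_tendsto_0: "(flat_exp n \<longlongrightarrow> 0) (at 0)"
proof -
  have "((\<lambda>y::real. (1 / y) ^ n / exp (1 / y)) \<longlongrightarrow> 0) (at_right 0)"
    using filterlim_compose[OF tendsto_power_div_exp_0[of n] filterlim_inverse_at_top_right]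
    by (simp add: inverse_eq_divide)
  then have "(flat_exp n \<longlongrightarrow> 0) (at_right 0)"
    by (rule Lim_transform_eventually)
       (auto simp: flat_exp_def exp_minus field_simps eventually_at_filter)
  moreover have "(flat_exp n \<longlongrightarrow> 0) (at_left 0)"
    by (rule Lim_transform_eventually[OF tendsto_const])
       (auto simp: flat_exp_def eventually_at_filter)
  ultimately show ?thesis by (simp add: filterlim_at_split)
qed

lemma flat_exp_deriv:
  "(flat_exp n has_real_derivative flat_exp (n + 2) y - real n * flat_exp (n + 1) y) (at y)"
proof -
  consider "y > 0" | "y < 0" | "y = 0" by linarith
  then show ?thesis
  proof cases
    case 1
    have "((\<lambda>y. (1 / y) ^ n * exp (- (1 / y))) has_real_derivative
        flat_exp (n + 2) y - real n * flat_exp (n + 1) y) (at y)"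
    proof (cases "n - 1")
      case 0
      then show ?thesis using 1
        by (cases n) (auto intro!: derivative_eq_intros simp: flat_exp_def field_simps power2_eq_square)
    next
      case (Suc k)
      then have n: "n = Suc (Suc k)" by simp
      have "k = 0 \<or> y ^ k = y * y ^ (k - Suc 0)" by (cases k) auto
      then show ?thesis using 1 unfolding n
        by (auto intro!: derivative_eq_intros simp: flat_exp_def field_simps power2_eq_square)
    qed
    then show ?thesis
      by (rule has_field_derivative_transform_within_open[of _ _ _ "{0<..}"])
         (use 1 in \<open>auto simp: flat_exp_def\<close>)
  next
    case 2
    have "((\<lambda>y. 0) has_real_derivative flat_exp (n + 2) y - real n * flat_exp (n + 1) y) (at y)"
      using 2 by (auto simp: flat_exp_def)
    then show ?thesis
      by (rule has_field_derivative_transform_within_open[of _ _ _ "{..<0}"])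
         (use 2 in \<open>auto simp: flat_exp_def\<close>)
  next
    case 3
    have "((\<lambda>h. (flat_exp n h - flat_exp n 0) / (h - 0)) \<longlongrightarrow> 0) (at 0)"
      by (rule Lim_transform_eventually[OF flat_exp_tendsto_0[of "Suc n"]])
         (auto simp: flat_exp_def eventually_at_filter)
    then show ?thesis using 3 by (simp add: has_field_derivative_iff flat_exp_def)
  qed
qed

text \<open>
  An algebra of functions that contains all its partial derivatives, so that its elements have
  iterated partial derivatives of every order. It is large enough to contain bumps on boxes.
\<close>

inductive_set smooth_fns :: "(real^'d \<Rightarrow> real) set" where
  flat: "(\<lambda>x. flat_exp n (s * x $ i + c)) \<in> smooth_fns"
| add: "f \<in> smooth_fns \<Longrightarrow> h \<in> smooth_fns \<Longrightarrow> (\<lambda>x. f x + h x) \<in> smooth_fns"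
| mult: "f \<in> smooth_fns \<Longrightarrow> h \<in> smooth_fns \<Longrightarrow> (\<lambda>x. f x * h x) \<in> smooth_fns"
| scale: "f \<in> smooth_fns \<Longrightarrow> (\<lambda>x. k * f x) \<in> smooth_fns"

lemma smooth_fns_derivative:
  "f \<in> smooth_fns \<Longrightarrow> \<exists>D. (\<forall>j. D j \<in> smooth_fns) \<and>
     (\<forall>x. (f has_derivative (\<lambda>h. \<Sum>j\<in>UNIV. h $ j * D j x)) (at x))"
proof (induction rule: smooth_fns.induct)
  case (flat n s i c)
  define D :: "'a \<Rightarrow> real^'a \<Rightarrow> real" where
    "D j x = (if j = i then s else 0) * (flat_exp (n + 2) (s * x $ i + c) + (- real n) * flat_exp (n + 1) (s * x $ i + c))" for j x
  have "D j \<in> smooth_fns" for j unfolding D_def by (intro smooth_fns.intros)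
  moreover have "((\<lambda>x. flat_exp n (s * x $ i + c)) has_derivative (\<lambda>h. \<Sum>j\<in>UNIV. h $ j * D j x)) (at x)" for x
  proof -
    have "((\<lambda>x. s * x $ i + c) has_derivative (\<lambda>h. s * h $ i)) (at x)"
      by (auto intro!: derivative_eq_intros bounded_linear.has_derivative[OF bounded_linear_vec_nth])
    from has_derivative_compose[OF this flat_exp_deriv[unfolded has_field_derivative_def]]
    have "((\<lambda>x. flat_exp n (s * x $ i + c)) has_derivative
       (\<lambda>h. (flat_exp (n + 2) (s * x $ i + c) - real n * flat_exp (n + 1) (s * x $ i + c)) * (s * h $ i))) (at x)" .
    moreover have "(\<Sum>j\<in>UNIV. h $ j * D j x) = h $ i * D i x" for h
      by (subst sum.mono_neutral_right[of UNIV "{i}"]) (auto simp: D_def)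
    ultimately show ?thesis
      by (simp only:) (simp add: D_def algebra_simps)
  qed
  ultimately show ?case by blast
next
  case (add f g)
  then obtain D D' where D: "\<And>j. D j \<in> smooth_fns" "\<And>x. (f has_derivative (\<lambda>h. \<Sum>j\<in>UNIV. h $ j * D j x)) (at x)"
    and D': "\<And>j. D' j \<in> smooth_fns" "\<And>x. (g has_derivative (\<lambda>h. \<Sum>j\<in>UNIV. h $ j * D' j x)) (at x)" by blast
  show ?case
  proof (intro exI[of _ "\<lambda>j x. D j x + D' j x"] conjI allI)
    fix x show "((\<lambda>x. f x + g x) has_derivative (\<lambda>h. \<Sum>j\<in>UNIV. h $ j * (D j x + D' j x))) (at x)"
      by (rule has_derivative_eq_rhs[OF has_derivative_add[OF D(2) D'(2)]]) (simp add: algebra_simps sum.distrib)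
  qed (intro smooth_fns.add D D')
next
  case (mult f g)
  then obtain D D' where D: "\<And>j. D j \<in> smooth_fns" "\<And>x. (f has_derivative (\<lambda>h. \<Sum>j\<in>UNIV. h $ j * D j x)) (at x)"
    and D': "\<And>j. D' j \<in> smooth_fns" "\<And>x. (g has_derivative (\<lambda>h. \<Sum>j\<in>UNIV. h $ j * D' j x)) (at x)" by blast
  show ?case
  proof (intro exI[of _ "\<lambda>j x. f x * D' j x + D j x * g x"] conjI allI)
    fix x show "((\<lambda>x. f x * g x) has_derivative (\<lambda>h. \<Sum>j\<in>UNIV. h $ j * (f x * D' j x + D j x * g x))) (at x)"
      by (rule has_derivative_eq_rhs[OF has_derivative_mult[OF D(2) D'(2)]])
         (simp add: algebra_simps sum.distrib sum_distrib_left)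
  qed (intro smooth_fns.intros D D' mult.hyps)
next
  case (scale f k)
  then obtain D where D: "\<And>j. D j \<in> smooth_fns" "\<And>x. (f has_derivative (\<lambda>h. \<Sum>j\<in>UNIV. h $ j * D j x)) (at x)" by blast
  show ?case
  proof (intro exI[of _ "\<lambda>j x. k * D j x"] conjI allI)
    fix x show "((\<lambda>x. k * f x) has_derivative (\<lambda>h. \<Sum>j\<in>UNIV. h $ j * (k * D j x))) (at x)"
      by (rule has_derivative_eq_rhs[OF has_derivative_mult_right[OF D(2)]])
         (simp add: algebra_simps sum_distrib_left)
  qed (intro smooth_fns.intros D)
qed

lemma smooth_fns_partials: "f \<in> smooth_fns \<Longrightarrow> partials is f \<in> smooth_fns"
proof (induction "is")
  case (Cons i "is")
  then obtain D where D: "\<And>j. D j \<in> smooth_fns" "\<And>x. (partials is f has_derivative (\<lambda>h. \<Sum>j\<in>UNIV. h $ j * D j x)) (at x)"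
    using smooth_fns_derivative by blast
  have "partials (i # is) f x = D i x" for x
    using frechet_derivative_at[OF D(2)[of x], symmetric]
    by (simp add: axis_def if_distrib[of "\<lambda>a. a * _"] cong: if_cong)
  then have "partials (i # is) f = D i" by (rule ext)
  then show ?case using D(1) by simp
qed simp

lemma smooth_fns_differentiable: "f \<in> smooth_fns \<Longrightarrow> partials is f differentiable (at x)"
  using smooth_fns_derivative[OF smooth_fns_partials[of f "is"]] by (auto simp: differentiable_def)

definition box_bump :: "nat \<Rightarrow> real^'d \<Rightarrow> real^'d \<Rightarrow> real^'d \<Rightarrow> real" where
  "box_bump k a b x = (\<Prod>i\<in>UNIV. flat_exp 0 (real (Suc k) * (x $ i - a $ i)) * flat_exp 0 (real (Suc k) * (b $ i - x $ i)))"

lemma box_bump_smooth: "box_bump k a b \<in> smooth_fns"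
proof -
  have "(\<lambda>x. \<Prod>i\<in>I. flat_exp 0 (real (Suc k) * (x $ i - a $ i)) * flat_exp 0 (real (Suc k) * (b $ i - x $ i))) \<in> smooth_fns"
    if "finite I" "I \<noteq> {}" for I
  proof -
    have 1: "(\<lambda>x. flat_exp 0 (real (Suc k) * (x $ i - a $ i)) * flat_exp 0 (real (Suc k) * (b $ i - x $ i))) \<in> smooth_fns" for i
      using smooth_fns.mult[OF smooth_fns.flat[of 0 "real (Suc k)" i "- real (Suc k) * a $ i"]
          smooth_fns.flat[of 0 "- real (Suc k)" i "real (Suc k) * b $ i"]]
      by (simp add: algebra_simps)
    show ?thesis using that
      by (induction I rule: finite_ne_induct) (use 1 in \<open>auto intro: smooth_fns.mult\<close>)
  qed
  from this[of UNIV] show ?thesis by (simp add: box_bump_def[abs_def])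
qed

lemma flat_exp_0: "flat_exp 0 y \<noteq> 0 \<longleftrightarrow> 0 < y" "0 \<le> flat_exp 0 y" "flat_exp 0 y \<le> 1"
  by (auto simp: flat_exp_def)

lemma box_bump_eq_0: "box_bump k a b x \<noteq> 0 \<longleftrightarrow> x \<in> box a b"
  using flat_exp_0(1)[unfolded not_def]
  by (auto simp: box_bump_def mem_box_cart flat_exp_def zero_less_mult_iff)

lemma box_bump_bounds: "0 \<le> box_bump k a b x" "box_bump k a b x \<le> 1"
  unfolding box_bump_def
  by (auto intro!: prod_nonneg prod_le_1 mult_nonneg_nonneg mult_le_one simp: flat_exp_0)

text \<open>
  The factor \<open>Suc k\<close> in the arguments steepens the bumps, whose pointwise limit is the indicator
  function of the open box.
\<close>

lemma box_bump_tendsto: "(\<lambda>k. box_bump k a b x) \<longlonglongrightarrow> indicator (box a b) x"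
proof (cases "x \<in> box a b")
  case True
  have 1: "(\<lambda>k. flat_exp 0 (real (Suc k) * y)) \<longlonglongrightarrow> 1" if "y > 0" for y
  proof -
    have "(\<lambda>k. exp (- (inverse (real (Suc k)) * (1 / y)))) \<longlonglongrightarrow> exp (- (0 * (1 / y)))"
      by (intro tendsto_intros LIMSEQ_inverse_real_of_nat)
    moreover have "flat_exp 0 (real (Suc k) * y) = exp (- (inverse (real (Suc k)) * (1 / y)))" for k
      using that by (simp add: flat_exp_def field_simps del: of_nat_Suc)
    ultimately show ?thesis by simp
  qed
  have "(\<lambda>k. box_bump k a b x) \<longlonglongrightarrow> (\<Prod>i\<in>(UNIV::'a set). 1 * 1)"
    unfolding box_bump_def using True by (intro tendsto_prod tendsto_mult 1) (auto simp: mem_box_cart)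
  then show ?thesis using True by simp
next
  case False
  then have "box_bump k a b x = 0" for k using box_bump_eq_0[of k a b x] by blast
  then show ?thesis using False by simp
qed

lemma box_bump_test:
  fixes a b :: "real^'d"
  assumes "cbox a b \<subseteq> \<Omega>"
  shows "box_bump k a b \<in> test_functions \<Omega>"
proof -
  have "{x. box_bump k a b x \<noteq> 0} = box a b" by (auto simp: box_bump_eq_0)
  moreover have "closure (box a b) \<subseteq> cbox a b" by (rule closure_minimal[OF box_subset_cbox closed_cbox])
  moreover have "compact (closure (box a b))" by (simp add: bounded_box)
  ultimately show ?thesis
    using assms smooth_fns_differentiable[OF box_bump_smooth[of k a b]] by (auto simp: test_functions_def)
qed

section \<open>The fundamental lemma\<close>

text \<open>
  Dominated convergence for the bumps on the box. The box has to be compactly contained in \<open>\<Omega>\<close>,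
  since \<open>g\<close> is only locally integrable.
\<close>

lemma box_integral_eq_0:
  fixes g :: "real^'d \<Rightarrow> 'b::euclidean_space"
  assumes \<Omega>: "open \<Omega>" and g: "locally_integrable \<Omega> g"
    and zero: "\<And>\<phi> :: real^'d \<Rightarrow> real. \<phi> \<in> test_functions \<Omega> \<Longrightarrow> (LINT x|lebesgue_on \<Omega>. \<phi> x *\<^sub>R g x) = 0"
    and ab: "cbox a b \<subseteq> \<Omega>"
  shows "(LINT x|lebesgue. indicator (box a b) x *\<^sub>R g x) = 0"
proof -
  have i: "integrable lebesgue (\<lambda>x. indicator (cbox a b) x *\<^sub>R g x)"
    using g ab by (auto simp: locally_integrable_def set_integrable_def)
  have eq: "(LINT x|lebesgue. box_bump k a b x *\<^sub>R (indicator (cbox a b) x *\<^sub>R g x)) = 0" for k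
  proof -
    have "0 = (LINT x|lebesgue_on \<Omega>. box_bump k a b x *\<^sub>R g x)" using zero[OF box_bump_test[OF ab]] by simp
    also have "\<dots> = (LINT x|lebesgue. indicator \<Omega> x *\<^sub>R (box_bump k a b x *\<^sub>R g x))"
      using \<Omega> by (intro integral_restrict_space) auto
    also have "\<dots> = (LINT x|lebesgue. box_bump k a b x *\<^sub>R (indicator (cbox a b) x *\<^sub>R g x))"
    proof (rule Bochner_Integration.integral_cong)
      fix x
      show "indicator \<Omega> x *\<^sub>R (box_bump k a b x *\<^sub>R g x) = box_bump k a b x *\<^sub>R (indicator (cbox a b) x *\<^sub>R g x)"
        using ab box_bump_eq_0[of k a b x] box_subset_cbox[of a b] by (auto simp: indicator_def)
    qed simp
    finally show ?thesis by simp
  qed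
  have bm: "box_bump k a b \<in> borel_measurable lebesgue" for k
  proof -
    have "continuous_on UNIV (box_bump k a b)"
      using smooth_fns_differentiable[OF box_bump_smooth[of k a b], of "[]"]
      by (auto intro!: differentiable_imp_continuous_on simp: differentiable_on_def)
    then show ?thesis by (intro measurable_completion) (simp add: borel_measurable_continuous_onI)
  qed
  have "(\<lambda>k. LINT x|lebesgue. box_bump k a b x *\<^sub>R (indicator (cbox a b) x *\<^sub>R g x)) \<longlonglongrightarrow>
      (LINT x|lebesgue. indicator (box a b) x *\<^sub>R g x)"
  proof (rule integral_dominated_convergence[where w = "\<lambda>x. norm (indicator (cbox a b) x *\<^sub>R g x)"])
    have "(\<lambda>x. indicator (box a b) x *\<^sub>R g x) = (\<lambda>x. indicator (box a b) x *\<^sub>R (indicator (cbox a b) x *\<^sub>R g x) :: 'b)"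
      using box_subset_cbox[of a b] by (intro ext) (auto simp: indicator_def of_bool_def)
    moreover have "(\<lambda>x. indicator (box a b) x *\<^sub>R (indicator (cbox a b) x *\<^sub>R g x)) \<in> borel_measurable lebesgue"
      by (intro borel_measurable_integrable integrable_mult_indicator i) simp
    ultimately show "(\<lambda>x. indicator (box a b) x *\<^sub>R g x) \<in> borel_measurable lebesgue" by (simp only:)
    show "integrable lebesgue (\<lambda>x. norm (indicator (cbox a b) x *\<^sub>R g x))" using i by (rule integrable_norm)
    show "(\<lambda>x. box_bump k a b x *\<^sub>R (indicator (cbox a b) x *\<^sub>R g x)) \<in> borel_measurable lebesgue" for k
      by (rule borel_measurable_scaleR[OF bm borel_measurable_integrable[OF i]])
    show "AE x in lebesgue. (\<lambda>k. box_bump k a b x *\<^sub>R (indicator (cbox a b) x *\<^sub>R g x)) \<longlonglongrightarrow> indicator (box a b) x *\<^sub>R g x"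
    proof (intro AE_I2)
      fix x
      have "(\<lambda>k. box_bump k a b x *\<^sub>R (indicator (cbox a b) x *\<^sub>R g x)) \<longlonglongrightarrow> indicator (box a b) x *\<^sub>R (indicator (cbox a b) x *\<^sub>R g x)"
        by (intro tendsto_intros box_bump_tendsto)
      then show "(\<lambda>k. box_bump k a b x *\<^sub>R (indicator (cbox a b) x *\<^sub>R g x)) \<longlonglongrightarrow> indicator (box a b) x *\<^sub>R g x"
        using box_subset_cbox[of a b] by (auto simp: indicator_def split: if_splits)
    qed
    show "AE x in lebesgue. norm (box_bump k a b x *\<^sub>R (indicator (cbox a b) x *\<^sub>R g x)) \<le> norm (indicator (cbox a b) x *\<^sub>R g x)" for k
    proof (intro AE_I2)
      fix x
      have "\<bar>box_bump k a b x\<bar> * norm (indicator (cbox a b) x *\<^sub>R g x) \<le> 1 * norm (indicator (cbox a b) x *\<^sub>R g x)"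
        using box_bump_bounds[of k a b x] by (intro mult_right_mono) auto
      then show "norm (box_bump k a b x *\<^sub>R (indicator (cbox a b) x *\<^sub>R g x)) \<le> norm (indicator (cbox a b) x *\<^sub>R g x)"
        by (simp only: norm_scaleR[of "box_bump k a b x"] mult_1)
    qed
  qed
  then show ?thesis unfolding eq by (metis LIMSEQ_unique tendsto_const)
qed

lemma sigma_finite_lebesgue: "sigma_finite_measure (lebesgue :: 'a::euclidean_space measure)"
proof
  obtain A :: "'a set set" where A: "countable A" "A \<subseteq> sets lborel" "\<Union>A = space lborel" "\<forall>a\<in>A. emeasure lborel a \<noteq> \<infinity>"
    using lborel.sigma_finite_countable by blast
  then show "\<exists>A. countable A \<and> A \<subseteq> sets lebesgue \<and> \<Union>A = space (lebesgue :: 'a measure) \<and> (\<forall>a\<in>A. emeasure lebesgue a \<noteq> \<infinity>)"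
    by (intro exI[of _ A]) (auto simp: sets_completionI_sets subset_iff)
qed

text \<open>
  Boxes form an intersection-stable generator of the Borel sets, so the integrals over all Borel
  sets vanish. The vanishing integral over the whole space is what makes the complement step of
  the induction work.
\<close>

lemma integral_boxes_zero_imp_AE_zero:
  fixes f :: "real^'d \<Rightarrow> 'b::euclidean_space"
  assumes f: "integrable lebesgue f" and f0: "(LINT x|lebesgue. f x) = 0"
    and box0: "\<And>a b. (LINT x|lebesgue. indicator (box a b) x *\<^sub>R f x) = 0"
  shows "AE x in lebesgue. f x = 0"
proof (rule sigma_finite_measure.density_zero[OF sigma_finite_lebesgue f])
  have borel0: "set_lebesgue_integral lebesgue A f = 0" if "A \<in> sets borel" for A
  proof -
    have A: "A \<in> sigma_sets UNIV (range (\<lambda>(a, b). box a b))"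
      using that by (simp add: borel_eq_box)
    have st: "Int_stable (range (\<lambda>(a, b). box a b :: (real^'d) set))"
      by (auto simp: Int_stable_def box_Int_box)
    show ?thesis
    proof (rule sigma_sets_induct_disjoint[OF st _ A])
      show "range (\<lambda>(a, b). box a b :: (real^'d) set) \<subseteq> Pow UNIV" by simp
      show "set_lebesgue_integral lebesgue B f = 0" if "B \<in> range (\<lambda>(a, b). box a b)" for B
        using that box0 by (auto simp: set_lebesgue_integral_def)
      show "set_lebesgue_integral lebesgue {} f = 0" by (simp add: set_lebesgue_integral_def)
      show "set_lebesgue_integral lebesgue (UNIV - B) f = 0"
        if "B \<in> sigma_sets UNIV (range (\<lambda>(a, b). box a b))" "set_lebesgue_integral lebesgue B f = 0" for B
      proof -
        have "B \<in> sets borel" using that(1) by (simp add: borel_eq_box)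
        then have B: "B \<in> sets lebesgue" by (simp add: sets_completionI_sets)
        have "set_lebesgue_integral lebesgue (UNIV - B) f = (LINT x|lebesgue. f x - indicator B x *\<^sub>R f x)"
          unfolding set_lebesgue_integral_def
          by (intro Bochner_Integration.integral_cong) (auto simp: indicator_def)
        also have "\<dots> = (LINT x|lebesgue. f x) - (LINT x|lebesgue. indicator B x *\<^sub>R f x)"
          using f B by (intro Bochner_Integration.integral_diff integrable_mult_indicator)
        finally show ?thesis using f0 that(2) by (simp add: set_lebesgue_integral_def)
      qed
      show "set_lebesgue_integral lebesgue (\<Union>i. B i) f = 0"
        if "disjoint_family B" "range B \<subseteq> sigma_sets UNIV (range (\<lambda>(a, b). box a b))"
          "\<And>i. set_lebesgue_integral lebesgue (B i) f = 0" for B :: "nat \<Rightarrow> _"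
      proof -
        have "B i \<in> sets borel" for i using that(2) by (auto simp: borel_eq_box)
        then have B: "B i \<in> sets lebesgue" for i by (simp add: sets_completionI_sets)
        have "set_integrable lebesgue (\<Union>i. B i) f"
          unfolding set_integrable_def using f B by (intro integrable_mult_indicator sets.countable_UN) auto
        then have "set_lebesgue_integral lebesgue (\<Union>i. B i) f = (\<Sum>i. set_lebesgue_integral lebesgue (B i) f)"
          using that(1) B by (intro lebesgue_integral_countable_add) (auto simp: disjoint_family_on_def)
        then show ?thesis using that(3) by simp
      qed
    qed
  qed
  fix A :: "(real^'d) set" assume "A \<in> sets lebesgue"
  then obtain S N N' where SN: "A = S \<union> N" "N \<subseteq> N'" "N' \<in> null_sets lborel" "S \<in> sets lborel"
    by (auto elim: sets_completionE)
  have N': "AE x in lebesgue. x \<notin> N'" using SN(3) by (intro AE_not_in) (simp add: null_sets_completionI)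
  have mA: "A \<in> sets lebesgue" by fact
  have "set_lebesgue_integral lebesgue A f = set_lebesgue_integral lebesgue S f"
    unfolding set_lebesgue_integral_def
  proof (rule integral_cong_AE)
    show "AE x in lebesgue. indicat_real A x *\<^sub>R f x = indicat_real S x *\<^sub>R f x"
      using N' SN(1,2) by (elim AE_mp) (auto intro!: AE_I2 simp: indicator_def)
  qed (use f mA SN(4) in \<open>auto intro!: borel_measurable_scaleR borel_measurable_indicator sets_completionI_sets\<close>)
  then show "set_lebesgue_integral lebesgue A f = 0" using borel0 SN(4) by simp
qed

text \<open>
  The open set \<open>\<Omega>\<close> is a countable union of compact boxes, and on each of them all integrals over
  smaller boxes vanish.
\<close>

lemma fundamental_lemma:
  fixes g :: "real^'d \<Rightarrow> 'b::euclidean_space"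
  assumes \<Omega>: "open \<Omega>" and g: "locally_integrable \<Omega> g"
    and zero: "\<And>\<phi> :: real^'d \<Rightarrow> real. \<phi> \<in> test_functions \<Omega> \<Longrightarrow> (LINT x|lebesgue_on \<Omega>. \<phi> x *\<^sub>R g x) = 0"
  shows "AE x in lebesgue_on \<Omega>. g x = 0"
proof -
  obtain \<D> where \<D>: "countable \<D>" "\<D> \<subseteq> Pow \<Omega>" "\<And>X. X \<in> \<D> \<Longrightarrow> \<exists>a b. X = cbox a b" "\<Union>\<D> = \<Omega>"
    using open_countable_Union_open_cbox[OF \<Omega>] by metis
  have 1: "AE x in lebesgue. x \<in> cbox A B \<longrightarrow> g x = 0" if AB: "cbox A B \<subseteq> \<Omega>" for A B
  proof -
    define f where "f x = indicator (box A B) x *\<^sub>R g x" for x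
    have "integrable lebesgue (\<lambda>x. indicator (cbox A B) x *\<^sub>R g x)"
      using g AB by (auto simp: locally_integrable_def set_integrable_def)
    then have "integrable lebesgue (\<lambda>x. indicator (box A B) x *\<^sub>R (indicator (cbox A B) x *\<^sub>R g x))"
      by (rule integrable_mult_indicator[rotated]) simp
    moreover have "(\<lambda>x. indicator (box A B) x *\<^sub>R (indicator (cbox A B) x *\<^sub>R g x)) = f"
      using box_subset_cbox[of A B] by (intro ext) (auto simp: f_def indicator_def of_bool_def)
    ultimately have f: "integrable lebesgue f" by simp
    have "AE x in lebesgue. f x = 0"
    proof (rule integral_boxes_zero_imp_AE_zero[OF f])
      show "(LINT x|lebesgue. f x) = 0" unfolding f_def by (rule box_integral_eq_0[OF \<Omega> g zero AB])
      fix a b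
      obtain c d where cd: "box a b \<inter> box A B = box c d" using box_Int_box by blast
      have "(LINT x|lebesgue. indicator (box a b) x *\<^sub>R f x) = (LINT x|lebesgue. indicator (box c d) x *\<^sub>R g x)"
        by (intro Bochner_Integration.integral_cong) (auto simp: f_def cd[symmetric] indicator_def)
      also have "\<dots> = 0"
      proof (cases "box c d = {}")
        case False
        then have "cbox c d = closure (box c d)" by simp
        also have "\<dots> \<subseteq> closure (box A B)" by (intro closure_mono) (use cd in auto)
        also have "\<dots> \<subseteq> cbox A B" by (rule closure_minimal[OF box_subset_cbox closed_cbox])
        finally show ?thesis using AB by (intro box_integral_eq_0[OF \<Omega> g zero]) auto
      qed simp
      finally show "(LINT x|lebesgue. indicator (box a b) x *\<^sub>R f x) = 0" .
    qed
    moreover have "AE x in lebesgue. x \<notin> cbox A B - box A B"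
      by (intro AE_not_in) (simp add: negligible_frontier_interval negligible_iff_null_sets[symmetric])
    ultimately show ?thesis by eventually_elim (auto simp: f_def)
  qed
  have "AE x in lebesgue. \<forall>X\<in>\<D>. x \<in> X \<longrightarrow> g x = 0"
    using 1 \<D> by (intro AE_ball_countable[THEN iffD2]) (metis Pow_iff subset_eq)+
  then have "AE x in lebesgue. x \<in> \<Omega> \<longrightarrow> g x = 0" by eventually_elim (use \<D>(4) in auto)
  then show ?thesis using \<Omega> by (subst AE_restrict_space_iff) auto
qed

section \<open>Weak derivatives\<close>

lemma partials_append: "partials (is @ js) \<phi> = partials is (partials js \<phi>)"
  by (induction "is") auto

lemma test_fn_differentiable: "\<phi> \<in> test_functions \<Omega> \<Longrightarrow> partials is \<phi> differentiable (at x)"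
  by (simp add: test_functions_def)

lemma test_fn_continuous: "\<phi> \<in> test_functions \<Omega> \<Longrightarrow> continuous_on S (partials is \<phi>)"
  by (meson continuous_at_imp_continuous_on differentiable_imp_continuous_within test_fn_differentiable)

lemma partials_outside_support:
  "x \<notin> closure {x. \<phi> x \<noteq> 0} \<Longrightarrow> partials is \<phi> x = 0"
proof (induction "is" arbitrary: x)
  case Nil
  then show ?case using closure_subset[of "{x. \<phi> x \<noteq> 0}"] by auto
next
  case (Cons i "is")
  have "(partials is \<phi> has_derivative (\<lambda>_. 0)) (at x)"
    by (rule has_derivative_transform_within_open[OF has_derivative_const, of "- closure {x. \<phi> x \<noteq> 0}"])
       (use Cons in auto)
  from frechet_derivative_at[OF this] show ?case by (simp add: fun_eq_iff)
qed

lemma test_fn_partials: 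
  assumes "\<phi> \<in> test_functions \<Omega>"
  shows "partials js \<phi> \<in> test_functions \<Omega>"
proof -
  have "{x. partials js \<phi> x \<noteq> 0} \<subseteq> closure {x. \<phi> x \<noteq> 0}"
    using partials_outside_support by blast
  then have s: "closure {x. partials js \<phi> x \<noteq> 0} \<subseteq> closure {x. \<phi> x \<noteq> 0}" by (simp add: closure_minimal)
  moreover have c: "compact (closure {x. \<phi> x \<noteq> 0})" using assms by (simp add: test_functions_def)
  ultimately have "compact (closure {x. partials js \<phi> x \<noteq> 0})"
    using c by (meson closed_closure bounded_subset compact_eq_bounded_closed)
  then show ?thesis using assms s by (auto simp: test_functions_def partials_append[symmetric])
qed

lemma partials_linear_image:
  assumes "\<phi> \<in> test_functions \<Omega>" and L: "bounded_linear L"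
  shows "partials is (\<lambda>x. L (\<phi> x)) = (\<lambda>x. L (partials is \<phi> x))"
proof (induction "is")
  case (Cons i "is")
  show ?case
  proof
    fix x
    have "(partials is \<phi> has_derivative frechet_derivative (partials is \<phi>) (at x)) (at x)"
      using test_fn_differentiable[OF assms(1)] by (simp add: frechet_derivative_works)
    from frechet_derivative_at[OF bounded_linear.has_derivative[OF L this]]
    show "partials (i # is) (\<lambda>x. L (\<phi> x)) x = L (partials (i # is) \<phi> x)" by (simp add: Cons fun_eq_iff)
  qed
qed simp

text \<open>
  Linear images provide components of vector-valued test functions, and vector-valued test functions from
  scalar ones.
\<close>

lemma test_fn_linear_image:
  assumes "\<phi> \<in> test_functions \<Omega>" and L: "bounded_linear L"
  shows "(\<lambda>x. L (\<phi> x)) \<in> test_functions \<Omega>"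
proof -
  have "{x. L (\<phi> x) \<noteq> 0} \<subseteq> {x. \<phi> x \<noteq> 0}"
    using linear_0[OF bounded_linear.linear[OF L]] by auto
  then have s: "closure {x. L (\<phi> x) \<noteq> 0} \<subseteq> closure {x. \<phi> x \<noteq> 0}" by (rule closure_mono)
  moreover have c: "compact (closure {x. \<phi> x \<noteq> 0})" using assms(1) by (simp add: test_functions_def)
  ultimately have "compact (closure {x. L (\<phi> x) \<noteq> 0})"
    using c by (meson closed_closure bounded_subset compact_eq_bounded_closed)
  moreover have "partials is (\<lambda>x. L (\<phi> x)) differentiable (at x)" for "is" x
    unfolding partials_linear_image[OF assms]
    using bounded_linear.has_derivative[OF L] test_fn_differentiable[OF assms(1)]
    by (fastforce simp: differentiable_def)
  ultimately show ?thesis using assms s by (auto simp: test_functions_def)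
qed

lemma partials_add:
  assumes "\<phi> \<in> test_functions \<Omega>" "\<psi> \<in> test_functions \<Omega>"
  shows "partials is (\<lambda>x. \<phi> x + \<psi> x) = (\<lambda>x. partials is \<phi> x + partials is \<psi> x)"
proof (induction "is")
  case (Cons i "is")
  show ?case
  proof
    fix x
    have "(partials is \<phi> has_derivative frechet_derivative (partials is \<phi>) (at x)) (at x)"
        "(partials is \<psi> has_derivative frechet_derivative (partials is \<psi>) (at x)) (at x)"
      using test_fn_differentiable assms by (simp_all add: frechet_derivative_works[symmetric])
    from frechet_derivative_at[OF has_derivative_add[OF this]]
    show "partials (i # is) (\<lambda>x. \<phi> x + \<psi> x) x = partials (i # is) \<phi> x + partials (i # is) \<psi> x"
      by (simp add: Cons fun_eq_iff)
  qed
qed simp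

lemma test_fn_add:
  assumes "\<phi> \<in> test_functions \<Omega>" "\<psi> \<in> test_functions \<Omega>"
  shows "(\<lambda>x. \<phi> x + \<psi> x) \<in> test_functions \<Omega>"
proof -
  have "{x. \<phi> x + \<psi> x \<noteq> 0} \<subseteq> {x. \<phi> x \<noteq> 0} \<union> {x. \<psi> x \<noteq> 0}" by auto
  from closure_mono[OF this] have s: "closure {x. \<phi> x + \<psi> x \<noteq> 0} \<subseteq> closure {x. \<phi> x \<noteq> 0} \<union> closure {x. \<psi> x \<noteq> 0}"
    by (simp add: closure_Un)
  have c: "compact (closure {x. \<phi> x \<noteq> 0} \<union> closure {x. \<psi> x \<noteq> 0})"
    using assms by (intro compact_Un) (auto simp: test_functions_def)
  then have "compact (closure {x. \<phi> x + \<psi> x \<noteq> 0})"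
    using s by (meson closed_closure bounded_subset compact_eq_bounded_closed)
  moreover have "partials is (\<lambda>x. \<phi> x + \<psi> x) differentiable (at x)" for "is" x
    unfolding partials_add[OF assms]
    using test_fn_differentiable assms by (intro differentiable_add) blast+
  moreover have "closure {x. \<phi> x \<noteq> 0} \<union> closure {x. \<psi> x \<noteq> 0} \<subseteq> \<Omega>"
    using assms by (auto simp: test_functions_def)
  ultimately show ?thesis using s by (auto simp: test_functions_def)
qed

lemma test_fn_bounded:
  assumes "\<phi> \<in> test_functions \<Omega>"
  shows "\<exists>B. \<forall>x. norm (\<phi> x) \<le> B"
proof -
  have "compact (\<phi> ` closure {x. \<phi> x \<noteq> 0})"
    using assms test_fn_continuous[OF assms, of _ "[]"]
    by (intro compact_continuous_image) (auto simp: test_functions_def)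
  then obtain B where B: "\<And>x. x \<in> closure {x. \<phi> x \<noteq> 0} \<Longrightarrow> norm (\<phi> x) \<le> B"
    using compact_imp_bounded by (force simp: bounded_iff)
  have "norm (\<phi> x) \<le> max B 0" for x
    using B[of x] closure_subset[of "{x. \<phi> x \<noteq> 0}"] by (cases "\<phi> x = 0") auto
  then show ?thesis by blast
qed

lemma test_fn_measurable: "\<phi> \<in> test_functions \<Omega> \<Longrightarrow> \<phi> \<in> borel_measurable lebesgue"
  using test_fn_continuous[of \<phi> \<Omega> UNIV "[]"]
  by (intro measurable_completion) (simp add: borel_measurable_continuous_onI)

locale open_domain =
  fixes \<Omega> :: "(real^'d) set"
  assumes open_Omega: "open \<Omega>"
begin

lemma sets_Omega [simp]: "\<Omega> \<in> sets lebesgue"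
  using open_Omega by simp

lemma ae_eq_iff: "ae_eq \<Omega> v w \<longleftrightarrow> (AE x in lebesgue. x \<in> \<Omega> \<longrightarrow> v x = w x)"
  unfolding ae_eq_def by (subst AE_restrict_space_iff) auto

lemma ae_eq_refl [simp]: "ae_eq \<Omega> v v" by (simp add: ae_eq_def)

lemma ae_eq_sym:
  assumes "ae_eq \<Omega> v w"
  shows "ae_eq \<Omega> w v"
  using assms unfolding ae_eq_def by eventually_elim auto

lemma ae_eq_comb:
  assumes "ae_eq \<Omega> v v'" "ae_eq \<Omega> w w'"
  shows "ae_eq \<Omega> (\<lambda>x. h (v x) (w x)) (\<lambda>x. h (v' x) (w' x))"
  using assms unfolding ae_eq_def by eventually_elim auto

lemma ae_eq_apply:
  assumes "ae_eq \<Omega> v v'"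
  shows "ae_eq \<Omega> (\<lambda>x. h (v x)) (\<lambda>x. h (v' x))"
  using assms unfolding ae_eq_def by eventually_elim auto

lemma measurable_on_iff:
  fixes v :: "real^'d \<Rightarrow> 'b::euclidean_space" shows
  "v \<in> borel_measurable (lebesgue_on \<Omega>) \<longleftrightarrow> (\<lambda>x. indicator \<Omega> x *\<^sub>R v x) \<in> borel_measurable lebesgue"
  by (subst borel_measurable_restrict_space_iff) auto

lemma integrable_on_iff:
  fixes v :: "real^'d \<Rightarrow> 'b::euclidean_space" shows
  "integrable (lebesgue_on \<Omega>) v \<longleftrightarrow> integrable lebesgue (\<lambda>x. indicator \<Omega> x *\<^sub>R v x)"
  by (subst integrable_restrict_space) auto

lemma measurable_ae_eq:
  fixes v w :: "real^'d \<Rightarrow> 'b::euclidean_space"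
  assumes "v \<in> borel_measurable (lebesgue_on \<Omega>)" "ae_eq \<Omega> v w"
  shows "w \<in> borel_measurable (lebesgue_on \<Omega>)"
proof -
  have "AE x in lebesgue. indicat_real \<Omega> x *\<^sub>R v x = indicator \<Omega> x *\<^sub>R w x"
    using assms(2) unfolding ae_eq_iff by eventually_elim (auto simp: indicator_def)
  from borel_measurable_AE[OF assms(1)[unfolded measurable_on_iff] this]
  show ?thesis unfolding measurable_on_iff .
qed

lemma locally_integrable_ae_eq:
  fixes v w :: "real^'d \<Rightarrow> 'b::euclidean_space"
  assumes "locally_integrable \<Omega> v" "ae_eq \<Omega> v w"
  shows "locally_integrable \<Omega> w"
  unfolding locally_integrable_def set_integrable_def
proof (intro allI impI, elim conjE)
  fix K assume K: "compact K" "K \<subseteq> \<Omega>"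
  then have i: "integrable lebesgue (\<lambda>x. indicator K x *\<^sub>R v x)"
    using assms by (auto simp: locally_integrable_def set_integrable_def)
  have ae: "AE x in lebesgue. indicator K x *\<^sub>R v x = indicator K x *\<^sub>R w x"
    using assms(2) unfolding ae_eq_iff by eventually_elim (use K in \<open>auto simp: indicator_def\<close>)
  show "integrable lebesgue (\<lambda>x. indicator K x *\<^sub>R w x)"
    by (rule integrable_cong_AE_imp[OF i borel_measurable_AE[OF borel_measurable_integrable[OF i] ae]])
       (use ae in auto)
qed

lemma test_integrable:
  fixes v :: "real^'d \<Rightarrow> 'b::euclidean_space" and \<phi> :: "real^'d \<Rightarrow> real"
  assumes \<phi>: "\<phi> \<in> test_functions \<Omega>" and v: "locally_integrable \<Omega> v"
  shows "integrable (lebesgue_on \<Omega>) (\<lambda>x. \<phi> x *\<^sub>R v x)"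
proof -
  define K where "K = closure {x. \<phi> x \<noteq> 0}"
  have K: "compact K" "K \<subseteq> \<Omega>" using \<phi> by (auto simp: K_def test_functions_def)
  have 0: "\<phi> x = 0" if "x \<notin> K" for x using partials_outside_support[of x \<phi> "[]"] that by (simp add: K_def)
  obtain B where B: "\<And>x. norm (\<phi> x) \<le> B" using test_fn_bounded[OF \<phi>] by blast
  have i: "integrable lebesgue (\<lambda>x. indicator K x *\<^sub>R v x)"
    using v K by (auto simp: locally_integrable_def set_integrable_def)
  have "integrable lebesgue (\<lambda>x. \<phi> x *\<^sub>R (indicator K x *\<^sub>R v x))"
  proof (rule Bochner_Integration.integrable_bound)
    show "integrable lebesgue (\<lambda>x. B *\<^sub>R (indicator K x *\<^sub>R v x))" by (intro integrable_scaleR_right i)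
    show "(\<lambda>x. \<phi> x *\<^sub>R (indicator K x *\<^sub>R v x)) \<in> borel_measurable lebesgue"
      by (rule borel_measurable_scaleR[OF test_fn_measurable[OF \<phi>] borel_measurable_integrable[OF i]])
    have "\<bar>\<phi> x\<bar> \<le> \<bar>B\<bar>" for x using B[of x] by simp
    then show "AE x in lebesgue. norm (\<phi> x *\<^sub>R (indicator K x *\<^sub>R v x)) \<le> norm (B *\<^sub>R (indicator K x *\<^sub>R v x))"
      by (intro AE_I2) (simp only: norm_scaleR[of "\<phi> _"] norm_scaleR[of B], intro mult_right_mono, auto)
  qed
  moreover have "(\<lambda>x. \<phi> x *\<^sub>R (indicator K x *\<^sub>R v x)) = (\<lambda>x. indicator \<Omega> x *\<^sub>R (\<phi> x *\<^sub>R v x))"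
    using 0 K by (intro ext) (auto simp: indicator_def of_bool_def)
  ultimately show ?thesis by (simp only: integrable_on_iff)
qed

lemma locally_integrable_comb:
  fixes v w :: "real^'d \<Rightarrow> 'b::euclidean_space"
  assumes "locally_integrable \<Omega> v" "locally_integrable \<Omega> w"
  shows "locally_integrable \<Omega> (\<lambda>x. a *\<^sub>R v x + b *\<^sub>R w x)"
  using assms unfolding locally_integrable_def
  by (auto intro!: set_integral_add set_integrable_scaleR_right)

lemma has_weak_deriv_comb:
  fixes v w :: "real^'d \<Rightarrow> 'b::euclidean_space"
  assumes "has_weak_deriv \<Omega> is v g" "has_weak_deriv \<Omega> is w h"
  shows "has_weak_deriv \<Omega> is (\<lambda>x. a *\<^sub>R v x + b *\<^sub>R w x) (\<lambda>x. a *\<^sub>R g x + b *\<^sub>R h x)"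
  unfolding has_weak_deriv_def
proof (intro conjI allI impI)
  show "locally_integrable \<Omega> (\<lambda>x. a *\<^sub>R v x + b *\<^sub>R w x)" "locally_integrable \<Omega> (\<lambda>x. a *\<^sub>R g x + b *\<^sub>R h x)"
    using assms by (auto intro!: locally_integrable_comb simp: has_weak_deriv_def)
  fix \<phi> :: "real^'d \<Rightarrow> real" assume \<phi>: "\<phi> \<in> test_functions \<Omega>"
  have lin: "(LINT x|lebesgue_on \<Omega>. \<psi> x *\<^sub>R (a *\<^sub>R v' x + b *\<^sub>R w' x)) =
     a *\<^sub>R (LINT x|lebesgue_on \<Omega>. \<psi> x *\<^sub>R v' x) + b *\<^sub>R (LINT x|lebesgue_on \<Omega>. \<psi> x *\<^sub>R w' x)"
    if "\<psi> \<in> test_functions \<Omega>" "locally_integrable \<Omega> v'" "locally_integrable \<Omega> w'"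
    for \<psi> :: "real^'d \<Rightarrow> real" and v' w' :: "real^'d \<Rightarrow> 'b"
  proof -
    have "(LINT x|lebesgue_on \<Omega>. \<psi> x *\<^sub>R (a *\<^sub>R v' x + b *\<^sub>R w' x)) =
        (LINT x|lebesgue_on \<Omega>. a *\<^sub>R (\<psi> x *\<^sub>R v' x) + b *\<^sub>R (\<psi> x *\<^sub>R w' x))"
      by (simp add: algebra_simps)
    also have "\<dots> = (LINT x|lebesgue_on \<Omega>. a *\<^sub>R (\<psi> x *\<^sub>R v' x)) + (LINT x|lebesgue_on \<Omega>. b *\<^sub>R (\<psi> x *\<^sub>R w' x))"
      using that by (intro Bochner_Integration.integral_add integrable_scaleR_right test_integrable)
    finally show ?thesis by (simp only: integral_scaleR_right)
  qed
  show "(LINT x|lebesgue_on \<Omega>. partials is \<phi> x *\<^sub>R (a *\<^sub>R v x + b *\<^sub>R w x)) =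
        (-1) ^ length is *\<^sub>R (LINT x|lebesgue_on \<Omega>. \<phi> x *\<^sub>R (a *\<^sub>R g x + b *\<^sub>R h x))"
    using assms \<phi> lin[OF test_fn_partials[OF \<phi>], of v w] lin[OF \<phi>, of g h]
    by (simp add: has_weak_deriv_def scaleR_add_right mult.commute)
qed

text \<open>
  The difference of two weak derivatives of \<open>v\<close> is a weak derivative of \<open>0\<close>.
\<close>

lemma has_weak_deriv_unique:
  fixes v :: "real^'d \<Rightarrow> 'b::euclidean_space"
  assumes "has_weak_deriv \<Omega> is v g" "has_weak_deriv \<Omega> is v h"
  shows "ae_eq \<Omega> g h"
proof -
  have l: "locally_integrable \<Omega> (\<lambda>x. 1 *\<^sub>R g x + (-1) *\<^sub>R h x)"
    using assms by (intro locally_integrable_comb) (auto simp: has_weak_deriv_def)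
  have "AE x in lebesgue_on \<Omega>. 1 *\<^sub>R g x + (-1) *\<^sub>R h x = 0"
  proof (rule fundamental_lemma[OF open_Omega l])
    fix \<phi> :: "real^'d \<Rightarrow> real" assume \<phi>: "\<phi> \<in> test_functions \<Omega>"
    have "(-1::real) ^ length is *\<^sub>R (LINT x|lebesgue_on \<Omega>. \<phi> x *\<^sub>R (1 *\<^sub>R g x + (-1) *\<^sub>R h x))
      = (LINT x|lebesgue_on \<Omega>. partials is \<phi> x *\<^sub>R (1 *\<^sub>R v x + (-1) *\<^sub>R v x))"
      using has_weak_deriv_comb[OF assms, of 1 "-1"] \<phi> unfolding has_weak_deriv_def by (auto simp del: scaleR_one)
    then show "(LINT x|lebesgue_on \<Omega>. \<phi> x *\<^sub>R (1 *\<^sub>R g x + (-1) *\<^sub>R h x)) = 0" by simp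
  qed
  then show ?thesis by (simp add: ae_eq_def)
qed

lemma has_weak_deriv_ae_eq:
  fixes v w :: "real^'d \<Rightarrow> 'b::euclidean_space"
  assumes d: "has_weak_deriv \<Omega> is v g" and v: "ae_eq \<Omega> v w" and g: "ae_eq \<Omega> g h"
  shows "has_weak_deriv \<Omega> is w h"
  unfolding has_weak_deriv_def
proof (intro conjI allI impI)
  show l: "locally_integrable \<Omega> w" "locally_integrable \<Omega> h"
    using assms locally_integrable_ae_eq by (auto simp: has_weak_deriv_def)
  fix \<phi> :: "real^'d \<Rightarrow> real" assume \<phi>: "\<phi> \<in> test_functions \<Omega>"
  have cong: "(LINT x|lebesgue_on \<Omega>. \<psi> x *\<^sub>R v' x) = (LINT x|lebesgue_on \<Omega>. \<psi> x *\<^sub>R w' x)"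
    if "\<psi> \<in> test_functions \<Omega>" "locally_integrable \<Omega> v'" "locally_integrable \<Omega> w'" "ae_eq \<Omega> v' w'"
    for \<psi> :: "real^'d \<Rightarrow> real" and v' w' :: "real^'d \<Rightarrow> 'b"
    by (rule integral_cong_AE[OF borel_measurable_integrable[OF test_integrable[OF that(1,2)]]
          borel_measurable_integrable[OF test_integrable[OF that(1,3)]]])
       (use that(4) in \<open>auto simp: ae_eq_def elim: AE_mp\<close>)
  show "(LINT x|lebesgue_on \<Omega>. partials is \<phi> x *\<^sub>R w x) = (-1) ^ length is *\<^sub>R (LINT x|lebesgue_on \<Omega>. \<phi> x *\<^sub>R h x)"
    using cong[OF test_fn_partials[OF \<phi>] _ l(1) v] cong[OF \<phi> _ l(2) g] d \<phi> by (auto simp: has_weak_deriv_def)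
qed

text \<open>
  Equality, and not only almost everywhere: the representative of a weak derivative is chosen by
  means of a predicate that does not distinguish \<open>v\<close> and \<open>w\<close>.
\<close>

lemma weak_deriv_ae_eq:
  fixes v w :: "real^'d \<Rightarrow> 'b::euclidean_space"
  assumes "ae_eq \<Omega> v w"
  shows "weak_deriv \<Omega> is v = weak_deriv \<Omega> is w"
proof -
  have "has_weak_deriv \<Omega> is v = has_weak_deriv \<Omega> is w"
    using has_weak_deriv_ae_eq[OF _ assms ae_eq_refl] has_weak_deriv_ae_eq[OF _ ae_eq_sym[OF assms] ae_eq_refl]
    by (intro ext iffI)
  then show ?thesis by (simp add: weak_deriv_def)
qed

end

section \<open>Square integrable functions and Sobolev spaces\<close>

context open_domain
begin

lemma weak_deriv_eqI:
  fixes v :: "real^'d \<Rightarrow> 'b::euclidean_space"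
  assumes "has_weak_deriv \<Omega> is v g" shows "ae_eq \<Omega> (weak_deriv \<Omega> is v) g"
proof -
  have "has_weak_deriv \<Omega> is v (weak_deriv \<Omega> is v)" unfolding weak_deriv_def by (rule someI[of "has_weak_deriv \<Omega> is v", OF assms])
  from has_weak_deriv_unique[OF this assms] show ?thesis .
qed

text \<open>
  Membership and norm bounds for most derived functions, such as components and multiples, follow
  from a pointwise bound.
\<close>

lemma l2_dominated:
  fixes v :: "real^'d \<Rightarrow> 'b::euclidean_space" and w :: "real^'d \<Rightarrow> 'c::euclidean_space"
  assumes v: "v \<in> l2_space \<Omega>" and w: "w \<in> borel_measurable (lebesgue_on \<Omega>)" and le: "\<And>x. norm (w x) \<le> norm (v x)"
  shows "w \<in> l2_space \<Omega>" "l2_norm \<Omega> w \<le> l2_norm \<Omega> v"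
proof -
  have v2: "integrable (lebesgue_on \<Omega>) (\<lambda>x. (norm (v x))\<^sup>2)" using v by (simp add: l2_space_def)
  have m: "(\<lambda>x. (norm (w x))\<^sup>2) \<in> borel_measurable (lebesgue_on \<Omega>)" using w by measurable
  have w2: "integrable (lebesgue_on \<Omega>) (\<lambda>x. (norm (w x))\<^sup>2)"
    by (rule Bochner_Integration.integrable_bound[OF v2 m]) (use le in \<open>auto intro!: power_mono\<close>)
  then show "w \<in> l2_space \<Omega>" using w by (simp add: l2_space_def)
  have "(LINT x|lebesgue_on \<Omega>. (norm (w x))\<^sup>2) \<le> (LINT x|lebesgue_on \<Omega>. (norm (v x))\<^sup>2)"
    by (rule integral_mono[OF w2 v2]) (use le in \<open>auto intro!: power_mono\<close>)
  then show "l2_norm \<Omega> w \<le> l2_norm \<Omega> v" by (simp add: l2_norm_def l2_inner_def power2_norm_eq_inner)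
qed

lemma l2_inner_integrable:
  fixes v w :: "real^'d \<Rightarrow> 'b::euclidean_space"
  assumes v: "v \<in> l2_space \<Omega>" and w: "w \<in> l2_space \<Omega>"
  shows "integrable (lebesgue_on \<Omega>) (\<lambda>x. v x \<bullet> w x)"
proof (rule Bochner_Integration.integrable_bound)
  show "integrable (lebesgue_on \<Omega>) (\<lambda>x. (norm (v x))\<^sup>2 + (norm (w x))\<^sup>2)"
    using v w by (auto simp: l2_space_def)
  show "(\<lambda>x. v x \<bullet> w x) \<in> borel_measurable (lebesgue_on \<Omega>)"
    using v w by (auto simp: l2_space_def)
  have "norm (v x \<bullet> w x) \<le> norm ((norm (v x))\<^sup>2 + (norm (w x))\<^sup>2)" for x
  proof -
    have "2 * (norm (v x) * norm (w x)) \<le> (norm (v x))\<^sup>2 + (norm (w x))\<^sup>2"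
      using zero_le_power2[of "norm (v x) - norm (w x)"] by (simp add: power2_eq_square algebra_simps)
    moreover have "0 \<le> norm (v x) * norm (w x)" by simp
    ultimately show ?thesis using Cauchy_Schwarz_ineq2[of "v x" "w x"] by simp
  qed
  then show "AE x in lebesgue_on \<Omega>. norm (v x \<bullet> w x) \<le> norm ((norm (v x))\<^sup>2 + (norm (w x))\<^sup>2)" by simp
qed

lemma l2_inner_add:
  assumes "u \<in> l2_space \<Omega>" "v \<in> l2_space \<Omega>" "w \<in> l2_space \<Omega>"
  shows "l2_inner \<Omega> (u + v) w = l2_inner \<Omega> u w + l2_inner \<Omega> v w"
  unfolding l2_inner_def plus_fun_apply inner_add_left
  using assms by (intro Bochner_Integration.integral_add l2_inner_integrable)

lemma l2_inner_scale: "l2_inner \<Omega> (c *\<^sub>R v) w = c * l2_inner \<Omega> v w"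
  by (simp add: l2_inner_def)

lemma l2_psd: "psd_form (l2_space \<Omega>) (l2_inner \<Omega> :: (real^'d \<Rightarrow> 'b::euclidean_space) \<Rightarrow> _)"
proof
  show "subspace (l2_space \<Omega> :: (real^'d \<Rightarrow> 'b) set)"
  proof (rule subspaceI)
    show "0 \<in> (l2_space \<Omega> :: (real^'d \<Rightarrow> 'b) set)" by (simp add: l2_space_def zero_fun_def)
    fix v w :: "real^'d \<Rightarrow> 'b" assume v: "v \<in> l2_space \<Omega>" and w: "w \<in> l2_space \<Omega>"
    have m: "(\<lambda>x. v x + w x) \<in> borel_measurable (lebesgue_on \<Omega>)" using v w by (auto simp: l2_space_def)
    have "integrable (lebesgue_on \<Omega>) (\<lambda>x. (norm (v x))\<^sup>2 + 2 * (v x \<bullet> w x) + (norm (w x))\<^sup>2)"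
      using v w l2_inner_integrable[OF v w] by (auto simp: l2_space_def)
    then show "v + w \<in> l2_space \<Omega>" using m
      by (simp add: l2_space_def plus_fun_def power2_norm_eq_inner inner_add_left inner_add_right inner_commute algebra_simps)
  next
    fix c and v :: "real^'d \<Rightarrow> 'b" assume v: "v \<in> l2_space \<Omega>"
    then show "c *\<^sub>R v \<in> l2_space \<Omega>" by (auto simp: l2_space_def scaleR_fun_def power_mult_distrib)
  qed
  show "l2_inner \<Omega> v w = l2_inner \<Omega> w v" for v w :: "real^'d \<Rightarrow> 'b" by (simp add: l2_inner_def inner_commute)
  show "0 \<le> l2_inner \<Omega> v v" for v :: "real^'d \<Rightarrow> 'b" unfolding l2_inner_def by (intro integral_nonneg_AE) auto
qed (simp_all add: l2_inner_add l2_inner_scale)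

sublocale l2: psd_form "l2_space \<Omega> :: (real^'d \<Rightarrow> 'b::euclidean_space) set" "l2_inner \<Omega>"
  by (rule l2_psd)

lemma l2_norm_eq: "l2_norm \<Omega> = nrm (l2_inner \<Omega>)"
  by (simp add: fun_eq_iff l2_norm_def nrm_def)

lemma l2_ae_eq:
  fixes v w :: "real^'d \<Rightarrow> 'b::euclidean_space"
  assumes v: "v \<in> l2_space \<Omega>" and e: "ae_eq \<Omega> v w"
  shows "w \<in> l2_space \<Omega>"
proof -
  have m: "w \<in> borel_measurable (lebesgue_on \<Omega>)" using v e measurable_ae_eq by (auto simp: l2_space_def)
  have "integrable (lebesgue_on \<Omega>) (\<lambda>x. (norm (w x))\<^sup>2)"
    by (rule integrable_cong_AE_imp[of _ "\<lambda>x. (norm (v x))\<^sup>2"])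
       (use v m ae_eq_apply[OF e] in \<open>auto simp: l2_space_def ae_eq_def\<close>)
  then show ?thesis using m by (simp add: l2_space_def)
qed

lemma l2_inner_ae_eq:
  fixes v w :: "real^'d \<Rightarrow> 'b::euclidean_space"
  assumes v: "v \<in> l2_space \<Omega>" "ae_eq \<Omega> v v'" and w: "w \<in> l2_space \<Omega>" "ae_eq \<Omega> w w'"
  shows "l2_inner \<Omega> v w = l2_inner \<Omega> v' w'"
  unfolding l2_inner_def
  by (rule integral_cong_AE[OF borel_measurable_integrable[OF l2_inner_integrable[OF v(1) w(1)]]
        borel_measurable_integrable[OF l2_inner_integrable[OF l2_ae_eq[OF v] l2_ae_eq[OF w]]]])
     (use ae_eq_comb[OF v(2) w(2), of "(\<bullet>)"] in \<open>simp add: ae_eq_def\<close>)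

lemma l2_norm_ae_eq: 
  fixes v :: "real^'d \<Rightarrow> 'b::euclidean_space"
  shows "v \<in> l2_space \<Omega> \<Longrightarrow> ae_eq \<Omega> v v' \<Longrightarrow> l2_norm \<Omega> v = l2_norm \<Omega> v'"
  by (simp add: l2_norm_def l2_inner_ae_eq[of v v' v v'])

lemma l2_null_iff:
  fixes v :: "real^'d \<Rightarrow> 'b::euclidean_space"
  assumes "v \<in> l2_space \<Omega>"
  shows "l2_inner \<Omega> v v = 0 \<longleftrightarrow> ae_eq \<Omega> v (\<lambda>x. 0)"
  unfolding l2_inner_def ae_eq_def
  using integral_nonneg_eq_0_iff_AE[OF l2_inner_integrable[OF assms assms]] by simp

lemma l2_locally_integrable:
  fixes v :: "real^'d \<Rightarrow> 'b::euclidean_space"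
  assumes v: "v \<in> l2_space \<Omega>"
  shows "locally_integrable \<Omega> v"
  unfolding locally_integrable_def set_integrable_def
proof (intro allI impI, elim conjE)
  fix K assume K: "compact K" "K \<subseteq> \<Omega>"
  have mK: "K \<in> lmeasurable" using K by (simp add: lmeasurable_compact)
  have v2: "integrable lebesgue (\<lambda>x. indicator \<Omega> x *\<^sub>R (norm (v x))\<^sup>2)"
    using v by (simp add: l2_space_def integrable_on_iff)
  have m: "(\<lambda>x. indicator \<Omega> x *\<^sub>R v x) \<in> borel_measurable lebesgue"
    using v by (simp only: measurable_on_iff[symmetric]) (simp add: l2_space_def)
  have eq: "(\<lambda>x. indicator K x *\<^sub>R v x) = (\<lambda>x. indicator K x *\<^sub>R (indicator \<Omega> x *\<^sub>R v x))"
    using K by (intro ext) (auto simp: indicator_def of_bool_def)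
  show "integrable lebesgue (\<lambda>x. indicator K x *\<^sub>R v x)"
  proof (rule Bochner_Integration.integrable_bound)
    show "integrable lebesgue (\<lambda>x. indicat_real K x + indicator \<Omega> x *\<^sub>R (norm (v x))\<^sup>2)"
      using mK v2 by (intro Bochner_Integration.integrable_add) (auto simp: fmeasurable_def integrable_indicator_iff)
    show "(\<lambda>x. indicator K x *\<^sub>R v x) \<in> borel_measurable lebesgue"
      unfolding eq using mK by (intro borel_measurable_scaleR[OF _ m] borel_measurable_indicator) auto
    have "norm (v x) \<le> 1 + (norm (v x))\<^sup>2" for x
      using zero_le_power2[of "norm (v x) - 1 / 2"] by (simp add: power2_eq_square algebra_simps)
    then show "AE x in lebesgue. norm (indicator K x *\<^sub>R v x) \<le> norm (indicat_real K x + indicator \<Omega> x *\<^sub>R (norm (v x))\<^sup>2)"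
      using K by (intro AE_I2) (auto simp: indicator_def of_bool_def)
  qed
qed

lemma has_weak_deriv_Nil:
  "locally_integrable \<Omega> v \<Longrightarrow> has_weak_deriv \<Omega> [] v v"
  by (simp add: has_weak_deriv_def)

lemma sobolev_weak_deriv:
  fixes v :: "real^'d \<Rightarrow> 'b::euclidean_space"
  assumes v: "v \<in> sobolev \<Omega> m" and "length is \<le> m"
  shows "has_weak_deriv \<Omega> is v (weak_deriv \<Omega> is v)" "weak_deriv \<Omega> is v \<in> l2_space \<Omega>"
proof -
  obtain g where g: "g \<in> l2_space \<Omega>" "has_weak_deriv \<Omega> is v g" using assms by (auto simp: sobolev_def)
  have e: "ae_eq \<Omega> g (weak_deriv \<Omega> is v)" by (rule ae_eq_sym[OF weak_deriv_eqI[OF g(2)]])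
  show "has_weak_deriv \<Omega> is v (weak_deriv \<Omega> is v)" by (rule has_weak_deriv_ae_eq[OF g(2) ae_eq_refl e])
  show "weak_deriv \<Omega> is v \<in> l2_space \<Omega>" by (rule l2_ae_eq[OF g(1) e])
qed

lemma sobolev_l2: "v \<in> sobolev \<Omega> m \<Longrightarrow> v \<in> l2_space \<Omega>"
  by (simp add: sobolev_def)

lemma weak_deriv_Nil:
  fixes v :: "real^'d \<Rightarrow> 'b::euclidean_space"
  shows "v \<in> l2_space \<Omega> \<Longrightarrow> ae_eq \<Omega> (weak_deriv \<Omega> [] v) v"
  by (intro weak_deriv_eqI has_weak_deriv_Nil l2_locally_integrable)

lemma l2_comb:
  fixes v w :: "real^'d \<Rightarrow> 'b::euclidean_space"
  shows "v \<in> l2_space \<Omega> \<Longrightarrow> w \<in> l2_space \<Omega> \<Longrightarrow> (\<lambda>x. a *\<^sub>R v x + b *\<^sub>R w x) \<in> l2_space \<Omega>"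
  using l2.mem_simps(2)[OF l2.mem_simps(4)[of v a] l2.mem_simps(4)[of w b]]
  by (simp add: plus_fun_def)

lemma sobolev_comb:
  fixes v w :: "real^'d \<Rightarrow> 'b::euclidean_space"
  assumes "v \<in> sobolev \<Omega> m" "w \<in> sobolev \<Omega> m"
  shows "(\<lambda>x. a *\<^sub>R v x + b *\<^sub>R w x) \<in> sobolev \<Omega> m"
  unfolding sobolev_def
proof (intro CollectI conjI allI impI)
  show "(\<lambda>x. a *\<^sub>R v x + b *\<^sub>R w x) \<in> l2_space \<Omega>" using assms by (intro l2_comb sobolev_l2)
  fix "is" :: "'d list" assume "length is \<le> m"
  then show "\<exists>g\<in>l2_space \<Omega>. has_weak_deriv \<Omega> is (\<lambda>x. a *\<^sub>R v x + b *\<^sub>R w x) g"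
    using has_weak_deriv_comb[OF sobolev_weak_deriv(1)[OF assms(1)] sobolev_weak_deriv(1)[OF assms(2)]]
      l2_comb[OF sobolev_weak_deriv(2)[OF assms(1)] sobolev_weak_deriv(2)[OF assms(2)]] by blast
qed

lemma weak_deriv_comb:
  fixes v w :: "real^'d \<Rightarrow> 'b::euclidean_space"
  assumes "v \<in> sobolev \<Omega> m" "w \<in> sobolev \<Omega> m" "length is \<le> m"
  shows "ae_eq \<Omega> (weak_deriv \<Omega> is (\<lambda>x. a *\<^sub>R v x + b *\<^sub>R w x))
           (\<lambda>x. a *\<^sub>R weak_deriv \<Omega> is v x + b *\<^sub>R weak_deriv \<Omega> is w x)"
  using assms by (intro weak_deriv_eqI has_weak_deriv_comb sobolev_weak_deriv)

lemma subspace_sobolev: "subspace (sobolev \<Omega> m :: (real^'d \<Rightarrow> 'b::euclidean_space) set)"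
proof (rule subspaceI)
  have "has_weak_deriv \<Omega> is (\<lambda>x. 0) (\<lambda>x. 0::'b)" for "is"
    by (simp add: has_weak_deriv_def locally_integrable_def set_integrable_def)
  moreover have "(\<lambda>x. 0::'b) \<in> l2_space \<Omega>" by (simp add: l2_space_def)
  ultimately show "0 \<in> (sobolev \<Omega> m :: (real^'d \<Rightarrow> 'b) set)" by (auto simp: sobolev_def zero_fun_def)
next
  fix v w :: "real^'d \<Rightarrow> 'b" assume "v \<in> sobolev \<Omega> m" "w \<in> sobolev \<Omega> m"
  from sobolev_comb[OF this, of 1 1] show "v + w \<in> sobolev \<Omega> m" by (simp add: plus_fun_def)
next
  fix c and v :: "real^'d \<Rightarrow> 'b" assume "v \<in> sobolev \<Omega> m"
  from sobolev_comb[OF this this, of c 0] show "c *\<^sub>R v \<in> sobolev \<Omega> m" by (simp add: scaleR_fun_def)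
qed

lemma weak_deriv_add:
  fixes v w :: "real^'d \<Rightarrow> 'b::euclidean_space"
  assumes "v \<in> sobolev \<Omega> m" "w \<in> sobolev \<Omega> m" "length is \<le> m"
  shows "ae_eq \<Omega> (weak_deriv \<Omega> is (v + w)) (weak_deriv \<Omega> is v + weak_deriv \<Omega> is w)"
  using weak_deriv_comb[OF assms, of 1 1] by (simp add: plus_fun_def)

lemma weak_deriv_scale:
  fixes v :: "real^'d \<Rightarrow> 'b::euclidean_space"
  assumes "v \<in> sobolev \<Omega> m" "length is \<le> m"
  shows "ae_eq \<Omega> (weak_deriv \<Omega> is (c *\<^sub>R v)) (c *\<^sub>R weak_deriv \<Omega> is v)"
  using weak_deriv_comb[OF assms(1,1,2), of c 0] by (simp add: scaleR_fun_def)

text \<open>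
  Both the Sobolev inner products and the Dirichlet form are sums of this kind, for different sets of
  derivatives.
\<close>

lemma derivative_form_psd:
  fixes m :: nat and I :: "'d list set"
  assumes I: "finite I" "\<And>is. is \<in> I \<Longrightarrow> length is \<le> m"
  shows "psd_form (sobolev \<Omega> m :: (real^'d \<Rightarrow> 'b::euclidean_space) set)
     (\<lambda>v w. \<Sum>is\<in>I. l2_inner \<Omega> (weak_deriv \<Omega> is v) (weak_deriv \<Omega> is w))"
proof
  fix x y z :: "real^'d \<Rightarrow> 'b" and c
  assume x: "x \<in> sobolev \<Omega> m"
  note W = sobolev_weak_deriv(2)
  show "(\<Sum>is\<in>I. l2_inner \<Omega> (weak_deriv \<Omega> is x) (weak_deriv \<Omega> is x)) \<ge> 0"
    by (intro sum_nonneg l2.nonneg W[OF x] I)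
  assume z: "z \<in> sobolev \<Omega> m"
  show "(\<Sum>is\<in>I. l2_inner \<Omega> (weak_deriv \<Omega> is (c *\<^sub>R x)) (weak_deriv \<Omega> is z))
     = c * (\<Sum>is\<in>I. l2_inner \<Omega> (weak_deriv \<Omega> is x) (weak_deriv \<Omega> is z))"
    unfolding sum_distrib_left
  proof (rule sum.cong[OF refl])
    fix "is" assume i: "is \<in> I"
    show "l2_inner \<Omega> (weak_deriv \<Omega> is (c *\<^sub>R x)) (weak_deriv \<Omega> is z) = c * l2_inner \<Omega> (weak_deriv \<Omega> is x) (weak_deriv \<Omega> is z)"
      using l2_inner_ae_eq[OF l2.mem_simps(4)[OF W[OF x I(2)[OF i]]] ae_eq_sym[OF weak_deriv_scale[OF x I(2)[OF i]]] W[OF z I(2)[OF i]] ae_eq_refl]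
      by (simp add: l2_inner_scale)
  qed
  assume y: "y \<in> sobolev \<Omega> m"
  show "(\<Sum>is\<in>I. l2_inner \<Omega> (weak_deriv \<Omega> is (x + y)) (weak_deriv \<Omega> is z))
     = (\<Sum>is\<in>I. l2_inner \<Omega> (weak_deriv \<Omega> is x) (weak_deriv \<Omega> is z)) + (\<Sum>is\<in>I. l2_inner \<Omega> (weak_deriv \<Omega> is y) (weak_deriv \<Omega> is z))"
    unfolding sum.distrib[symmetric]
  proof (rule sum.cong[OF refl])
    fix "is" assume i: "is \<in> I"
    note d = W[OF x I(2)[OF i]] W[OF y I(2)[OF i]] W[OF z I(2)[OF i]]
    show "l2_inner \<Omega> (weak_deriv \<Omega> is (x + y)) (weak_deriv \<Omega> is z) =
        l2_inner \<Omega> (weak_deriv \<Omega> is x) (weak_deriv \<Omega> is z) + l2_inner \<Omega> (weak_deriv \<Omega> is y) (weak_deriv \<Omega> is z)"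
      using l2_inner_ae_eq[OF l2.mem_simps(2)[OF d(1,2)] ae_eq_sym[OF weak_deriv_add[OF x y I(2)[OF i]]] d(3) ae_eq_refl] l2_inner_add[OF d]
      by simp
  qed
qed (simp_all add: subspace_sobolev l2_inner_def inner_commute)

definition sob_inner :: "nat \<Rightarrow> (real^'d \<Rightarrow> 'b::euclidean_space) \<Rightarrow> (real^'d \<Rightarrow> 'b) \<Rightarrow> real" where
  "sob_inner m v w = (\<Sum>is | length is \<le> m. l2_inner \<Omega> (weak_deriv \<Omega> is v) (weak_deriv \<Omega> is w))"

lemma finite_multiindices: "finite {is :: 'd list. length is \<le> m}"
  using finite_lists_length_le[of "UNIV :: 'd set" m] by simp

lemma sob_psd: "psd_form (sobolev \<Omega> m :: (real^'d \<Rightarrow> 'b::euclidean_space) set) (sob_inner m)"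
  unfolding sob_inner_def[abs_def] by (rule derivative_form_psd) (auto simp: finite_multiindices)

sublocale sob: psd_form "sobolev \<Omega> m :: (real^'d \<Rightarrow> 'b::euclidean_space) set" "sob_inner m" for m
  by (rule sob_psd)

lemma sobolev_norm_eq:
  fixes v :: "real^'d \<Rightarrow> 'b::euclidean_space"
  assumes v: "v \<in> sobolev \<Omega> m"
  shows "sobolev_norm \<Omega> m v = nrm (sob_inner m) v"
  using sobolev_weak_deriv(2)[OF v]
  by (simp add: sobolev_norm_def nrm_def sob_inner_def l2_norm_eq l2.nrm_sq[unfolded nrm_def])

lemma sobolev_mono: "m \<le> k \<Longrightarrow> v \<in> sobolev \<Omega> k \<Longrightarrow> v \<in> sobolev \<Omega> m"
  by (auto simp: sobolev_def)

lemma nrm_derivative_form_mono: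
  fixes v :: "real^'d \<Rightarrow> 'b::euclidean_space"
  assumes v: "v \<in> sobolev \<Omega> m" and I: "I \<subseteq> {is. length is \<le> m}"
  shows "nrm (\<lambda>v w. \<Sum>is\<in>I. l2_inner \<Omega> (weak_deriv \<Omega> is v) (weak_deriv \<Omega> is w)) v \<le> nrm (sob_inner m) v"
  unfolding nrm_def sob_inner_def
  by (intro real_sqrt_le_mono sum_mono2 finite_multiindices I l2.nonneg sobolev_weak_deriv(2)[OF v]) auto

lemma sob_nrm_mono:
  fixes v :: "real^'d \<Rightarrow> 'b::euclidean_space"
  assumes "m \<le> k" "v \<in> sobolev \<Omega> k"
  shows "nrm (sob_inner m) v \<le> nrm (sob_inner k) v"
proof -
  have "{is :: 'd list. length is \<le> m} \<subseteq> {is. length is \<le> k}" using assms(1) by auto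
  from nrm_derivative_form_mono[OF assms(2) this] show ?thesis by (simp add: sob_inner_def[abs_def])
qed

lemma l2_norm_weak_deriv_le:
  fixes v :: "real^'d \<Rightarrow> 'b::euclidean_space"
  assumes "v \<in> sobolev \<Omega> m" "length is \<le> m"
  shows "nrm (l2_inner \<Omega>) (weak_deriv \<Omega> is v) \<le> nrm (sob_inner m) v"
  using nrm_derivative_form_mono[OF assms(1), of "{is}"] assms(2) by (simp add: nrm_def)

lemma l2_norm_le_sob:
  fixes v :: "real^'d \<Rightarrow> 'b::euclidean_space"
  assumes "v \<in> sobolev \<Omega> m"
  shows "nrm (l2_inner \<Omega>) v \<le> nrm (sob_inner m) v"
  using l2_norm_weak_deriv_le[OF assms, of "[]"] 
    l2_norm_ae_eq[OF sobolev_weak_deriv(2)[OF assms, of "[]"] weak_deriv_Nil[OF sobolev_l2[OF assms]]]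
  by (simp add: l2_norm_eq)

text \<open>
  The list notation appends the outer derivative: partial derivatives of \<open>\<phi>\<close> are applied from
  right to left, and moving them to \<open>v\<close> reverses their order.
\<close>

lemma weak_deriv_weak_deriv:
  fixes v :: "real^'d \<Rightarrow> 'b::euclidean_space"
  assumes v: "v \<in> sobolev \<Omega> m" and l: "length js + length is \<le> m"
  shows "has_weak_deriv \<Omega> is (weak_deriv \<Omega> js v) (weak_deriv \<Omega> (js @ is) v)"
proof -
  have 1: "has_weak_deriv \<Omega> js v (weak_deriv \<Omega> js v)" and 2: "has_weak_deriv \<Omega> (js @ is) v (weak_deriv \<Omega> (js @ is) v)"
    using sobolev_weak_deriv(1)[OF v] l by auto
  show ?thesis unfolding has_weak_deriv_def
  proof (intro conjI allI impI)
    fix \<phi> :: "real^'d \<Rightarrow> real" assume \<phi>: "\<phi> \<in> test_functions \<Omega>"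
    have "(LINT x|lebesgue_on \<Omega>. partials (js @ is) \<phi> x *\<^sub>R v x) =
       (-1) ^ length js *\<^sub>R (LINT x|lebesgue_on \<Omega>. partials is \<phi> x *\<^sub>R weak_deriv \<Omega> js v x)"
      using 1 test_fn_partials[OF \<phi>, of "is"] by (simp add: has_weak_deriv_def partials_append)
    moreover have "(LINT x|lebesgue_on \<Omega>. partials (js @ is) \<phi> x *\<^sub>R v x) =
       (-1) ^ length js *\<^sub>R ((-1) ^ length is *\<^sub>R (LINT x|lebesgue_on \<Omega>. \<phi> x *\<^sub>R weak_deriv \<Omega> (js @ is) v x))"
      using 2 \<phi> by (simp add: has_weak_deriv_def power_add)
    ultimately have "(-1::real) ^ length js *\<^sub>R (LINT x|lebesgue_on \<Omega>. partials is \<phi> x *\<^sub>R weak_deriv \<Omega> js v x) =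
       (-1) ^ length js *\<^sub>R ((-1) ^ length is *\<^sub>R (LINT x|lebesgue_on \<Omega>. \<phi> x *\<^sub>R weak_deriv \<Omega> (js @ is) v x))"
      by (simp only:)
    then show "(LINT x|lebesgue_on \<Omega>. partials is \<phi> x *\<^sub>R weak_deriv \<Omega> js v x) =
         (-1) ^ length is *\<^sub>R (LINT x|lebesgue_on \<Omega>. \<phi> x *\<^sub>R weak_deriv \<Omega> (js @ is) v x)"
      by (simp only: scaleR_cancel_left) simp
  qed (use 1 2 in \<open>auto simp: has_weak_deriv_def\<close>)
qed

lemma weak_deriv_sobolev:
  fixes v :: "real^'d \<Rightarrow> 'b::euclidean_space"
  assumes v: "v \<in> sobolev \<Omega> m" and l: "length js + k \<le> m"
  shows "weak_deriv \<Omega> js v \<in> sobolev \<Omega> k"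
  unfolding sobolev_def
proof (intro CollectI conjI allI impI)
  show "weak_deriv \<Omega> js v \<in> l2_space \<Omega>" using sobolev_weak_deriv(2)[OF v, of js] l by simp
  fix "is" :: "'d list" assume i: "length is \<le> k"
  show "\<exists>g\<in>l2_space \<Omega>. has_weak_deriv \<Omega> is (weak_deriv \<Omega> js v) g"
    using weak_deriv_weak_deriv[OF v, of js "is"] sobolev_weak_deriv(2)[OF v, of "js @ is"] l i by auto
qed

section \<open>The Stokes forms\<close>

lemma form_a_eq:
  assumes "u \<in> sobolev \<Omega> 1" "v \<in> sobolev \<Omega> 1"
  shows "form_a \<Omega> u v = (\<Sum>is\<in>range (\<lambda>j. [j]). l2_inner \<Omega> (weak_deriv \<Omega> is u) (weak_deriv \<Omega> is v))"
proof -
  have "grad_v \<Omega> u x \<bullet> grad_v \<Omega> v x = (\<Sum>j\<in>UNIV. weak_deriv \<Omega> [j] u x \<bullet> weak_deriv \<Omega> [j] v x)" for x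
    by (simp add: grad_v_def inner_vec_def) (rule sum.swap)
  then have "form_a \<Omega> u v = (\<Sum>j\<in>UNIV. l2_inner \<Omega> (weak_deriv \<Omega> [j] u) (weak_deriv \<Omega> [j] v))"
    unfolding form_a_def l2_inner_def
    by (simp add: Bochner_Integration.integral_sum l2_inner_integrable sobolev_weak_deriv(2)[OF assms(1)] sobolev_weak_deriv(2)[OF assms(2)])
  then show ?thesis by (simp add: sum.reindex inj_on_def)
qed

text \<open>
  This form agrees with \<open>form_a\<close> on \<open>H\<^sup>1\<close>, and as a sum over lists of length one it is an
  instance of the forms above.
\<close>

definition grad_form :: "(real^'d \<Rightarrow> real^'d) \<Rightarrow> (real^'d \<Rightarrow> real^'d) \<Rightarrow> real" where
  "grad_form u v = (\<Sum>is\<in>range (\<lambda>j. [j]). l2_inner \<Omega> (weak_deriv \<Omega> is u) (weak_deriv \<Omega> is v))"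

lemma a_psd: "psd_form (sobolev \<Omega> 1) grad_form"
  unfolding grad_form_def[abs_def] by (rule derivative_form_psd) auto

sublocale a: psd_form "sobolev \<Omega> 1 :: (real^'d \<Rightarrow> real^'d) set" grad_form
  by (rule a_psd)

lemma a_le_sob: "v \<in> sobolev \<Omega> 1 \<Longrightarrow> nrm grad_form v \<le> nrm (sob_inner 1) v"
  unfolding grad_form_def[abs_def] by (rule nrm_derivative_form_mono) auto

end

section \<open>Integration by parts\<close>

lemma test_fn_has_derivative:
  assumes "\<phi> \<in> test_functions \<Omega>"
  shows "(partials is \<phi> has_derivative frechet_derivative (partials is \<phi>) (at x)) (at x)"
  using test_fn_differentiable[OF assms] by (simp add: frechet_derivative_works)

lemma continuous_compact_support_integrable:
  fixes f :: "real^'d \<Rightarrow> 'b::euclidean_space"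
  assumes f: "continuous_on UNIV f" and K: "compact K" and 0: "\<And>x. x \<notin> K \<Longrightarrow> f x = 0"
  shows "integrable lborel f"
proof -
  have "set_integrable lborel K f" using borel_integrable_compact[OF K continuous_on_subset[OF f]] by (simp add: set_integrable_def)
  moreover have "(\<lambda>x. indicator K x *\<^sub>R f x) = f" using 0 by (intro ext) (auto simp: indicator_def of_bool_def)
  ultimately show ?thesis by (simp add: set_integrable_def)
qed

lemma integral_lebesgue_lborel:
  fixes f :: "real^'d \<Rightarrow> 'b::euclidean_space"
  shows "continuous_on UNIV f \<Longrightarrow> (LINT x|lebesgue. f x) = (LINT x|lborel. f x)"
  by (intro integral_completion) (simp add: borel_measurable_continuous_onI)

lemma integral_translation:
  fixes f :: "real^'d \<Rightarrow> real"
  assumes "continuous_on UNIV f"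
  shows "(LINT x|lborel. f (a + x)) = (LINT x|lborel. f x)"
proof -
  have m: "f \<in> borel_measurable borel" using assms by (rule borel_measurable_continuous_onI)
  have "(LINT x|lborel. f x) = (LINT x|distr lborel borel ((+) a). f x)" by (simp add: lborel_distr_plus)
  also have "\<dots> = (LINT x|lborel. f (a + x))" using m by (intro integral_distr) auto
  finally show ?thesis by simp
qed

text \<open>
  By translation invariance the difference quotients of \<open>G\<close> have vanishing integrals. They
  converge to the directional derivative \<open>G' x e\<close>, boundedly and with supports in a common compact
  set. This replaces Fubini's theorem.
\<close>

lemma integral_partial_derivative_eq_0:
  fixes G :: "real^'d \<Rightarrow> real"
  assumes G: "\<And>x. (G has_derivative G' x) (at x)" and c: "continuous_on UNIV (\<lambda>x. G' x e)"
    and K: "compact K" and 0: "\<And>x. x \<notin> K \<Longrightarrow> G x = 0" and e: "norm e = 1"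
  shows "(LINT x|lborel. G' x e) = 0"
proof -
  have Gc: "continuous_on UNIV G"
    using G by (auto simp: continuous_on_eq_continuous_at intro: has_derivative_continuous)
  have D0: "G' x e = 0" if "x \<notin> K" for x
  proof -
    have "(G has_derivative (\<lambda>_. 0)) (at x)"
      by (rule has_derivative_transform_within_open[OF has_derivative_const, of "- K"])
         (use that K 0 compact_imp_closed in auto)
    from has_derivative_unique[OF this G[of x]] show ?thesis by (metis)
  qed
  have "compact ((\<lambda>x. G' x e) ` K)" using c K continuous_on_subset by (intro compact_continuous_image) auto
  then obtain B0 where B0: "\<And>x. x \<in> K \<Longrightarrow> \<bar>G' x e\<bar> \<le> B0" by (force dest: compact_imp_bounded simp: bounded_iff)
  define B where "B = max B0 0"
  have B: "\<bar>G' x e\<bar> \<le> B" for x using B0[of x] D0[of x] by (cases "x \<in> K") (auto simp: B_def)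
  define K' where "K' = (\<lambda>(x, y). x + y) ` (K \<times> cball 0 1)"
  have K': "compact K'" unfolding K'_def
    by (intro compact_continuous_image compact_Times K compact_cball) (auto intro!: continuous_intros simp: split_beta)
  define h where "h n = inverse (real (Suc n))" for n
  have h: "0 < h n" "h n \<le> 1" for n by (auto simp: h_def inverse_le_1_iff)
  have h0: "h \<longlonglongrightarrow> 0" unfolding h_def by (rule LIMSEQ_inverse_real_of_nat)
  define F where "F n x = (G (h n *\<^sub>R e + x) - G x) / h n" for n x
  have line: "((\<lambda>s. G (s *\<^sub>R e + x)) has_real_derivative G' (s *\<^sub>R e + x) e) (at s within S)" for s x S
  proof -
    have "((\<lambda>s. s *\<^sub>R e + x) has_derivative (\<lambda>t. t *\<^sub>R e)) (at s within S)"
      by (auto intro!: derivative_eq_intros)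
    from has_derivative_compose[OF this G]
    have "((\<lambda>s. G (s *\<^sub>R e + x)) has_derivative (\<lambda>t. G' (s *\<^sub>R e + x) (t *\<^sub>R e))) (at s within S)" .
    moreover have "G' y (t *\<^sub>R e) = t * G' y e" for y t
      using linear_scale[OF has_derivative_linear[OF G[of y]], of t e] by simp
    ultimately show ?thesis by (simp add: has_field_derivative_def mult_commute_abs)
  qed
  have "(\<lambda>n. LINT x|lborel. F n x) \<longlonglongrightarrow> (LINT x|lborel. G' x e)"
  proof (rule integral_dominated_convergence[where w = "\<lambda>x. B * indicator K' x"])
    show "(\<lambda>x. G' x e) \<in> borel_measurable lborel" using c by (simp add: borel_measurable_continuous_onI)
    show "F n \<in> borel_measurable lborel" for n
    proof -
      have "continuous_on UNIV (F n)" unfolding F_def using h[of n]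
        by (intro continuous_intros continuous_on_compose2[OF Gc]) (auto intro!: continuous_intros Gc)
      then show ?thesis by (simp add: borel_measurable_continuous_onI)
    qed
    show "integrable lborel (\<lambda>x. B * indicat_real K' x)"
      using K' by (intro integrable_mult_right integrable_real_indicator) (use emeasure_compact_finite[OF K'] in \<open>auto simp: borel_compact\<close>)
    show "AE x in lborel. (\<lambda>n. F n x) \<longlonglongrightarrow> G' x e"
    proof (intro AE_I2)
      fix x
      have "((\<lambda>y. (G (y *\<^sub>R e + x) - G x) / y) \<longlongrightarrow> G' x e) (at 0)"
        using line[of x 0 UNIV] by (simp add: has_field_derivative_iff)
      moreover have "filterlim h (at 0) sequentially"
        using h0 h by (auto simp: filterlim_at intro!: always_eventually less_imp_neq[THEN not_sym])
      ultimately show "(\<lambda>n. F n x) \<longlonglongrightarrow> G' x e" unfolding F_def by (rule filterlim_compose)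
    qed
    show "AE x in lborel. norm (F n x) \<le> B * indicator K' x" for n
    proof (intro AE_I2)
      fix x
      show "norm (F n x) \<le> B * indicator K' x"
      proof (cases "x \<in> K'")
        case True
        have "norm (G (h n *\<^sub>R e + x) - G (0 *\<^sub>R e + x)) \<le> B * norm (h n - 0)"
          by (rule field_differentiable_bound[of UNIV "\<lambda>s. G (s *\<^sub>R e + x)" "\<lambda>s. G' (s *\<^sub>R e + x) e"])
             (use line B in auto)
        then show ?thesis using True h[of n] by (simp add: F_def field_simps)
      next
        case False
        have K'I: "y + z \<in> K'" if "y \<in> K" "norm z \<le> 1" for y z
          unfolding K'_def by (rule image_eqI[of _ _ "(y, z)"]) (use that in auto)
        have "x \<notin> K" using K'I[of x 0] False by auto
        moreover have "h n *\<^sub>R e + x \<notin> K"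
        proof
          assume "h n *\<^sub>R e + x \<in> K"
          then have "x \<in> K'" using K'I[of "h n *\<^sub>R e + x" "- (h n *\<^sub>R e)"] h[of n] e by simp
          then show False using False by simp
        qed
        ultimately show ?thesis using 0 False by (simp add: F_def)
      qed
    qed
  qed
  moreover have "(LINT x|lborel. F n x) = 0" for n
  proof -
    have iG: "integrable lborel G" by (rule continuous_compact_support_integrable[OF Gc K 0])
    have "integrable lborel (\<lambda>x. G (h n *\<^sub>R e + x))"
    proof (rule continuous_compact_support_integrable)
      show "continuous_on UNIV (\<lambda>x. G (h n *\<^sub>R e + x))"
        by (intro continuous_on_compose2[OF Gc] continuous_intros) auto
      show "compact ((+) (- h n *\<^sub>R e) ` K)" by (intro compact_translation K)
      show "G (h n *\<^sub>R e + x) = 0" if "x \<notin> (+) (- h n *\<^sub>R e) ` K" for x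
        using that by (intro 0) (auto simp: image_iff algebra_simps)
    qed
    then have "(LINT x|lborel. F n x) = ((LINT x|lborel. G (h n *\<^sub>R e + x)) - (LINT x|lborel. G x)) / h n"
      using iG by (simp add: F_def)
    then show ?thesis using integral_translation[OF Gc] by simp
  qed
  ultimately show ?thesis by (simp add: LIMSEQ_const_iff)
qed

lemma test_fn_ibp:
  fixes \<phi> \<psi> :: "real^'d \<Rightarrow> real"
  assumes \<phi>: "\<phi> \<in> test_functions \<Omega>" and \<psi>: "\<psi> \<in> test_functions \<Omega>"
  shows "(LINT x|lborel. partials [i] \<psi> x * \<phi> x) = - (LINT x|lborel. \<psi> x * partials [i] \<phi> x)"
proof -
  note d = test_fn_has_derivative[OF \<phi>, of "[]", simplified] test_fn_has_derivative[OF \<psi>, of "[]", simplified]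
  define S where "S = closure {x. \<phi> x \<noteq> 0}"
  have K: "compact S" using \<phi> by (simp add: S_def test_functions_def)
  have 0: "\<phi> x = 0" "partials [i] \<phi> x = 0" if "x \<notin> S" for x
    using partials_outside_support[OF that[unfolded S_def], of "[]"]
      partials_outside_support[OF that[unfolded S_def], of "[i]"] by simp_all
  have c: "continuous_on UNIV (\<lambda>x. \<psi> x * partials [i] \<phi> x)" "continuous_on UNIV (\<lambda>x. partials [i] \<psi> x * \<phi> x)"
    using test_fn_continuous[OF \<phi>, of UNIV "[]"] test_fn_continuous[OF \<phi>, of UNIV "[i]"]
      test_fn_continuous[OF \<psi>, of UNIV "[]"] test_fn_continuous[OF \<psi>, of UNIV "[i]"]
    by (simp_all add: continuous_on_mult)
  have "(LINT x|lborel. \<psi> x * frechet_derivative \<phi> (at x) (axis i 1) + frechet_derivative \<psi> (at x) (axis i 1) * \<phi> x) = 0"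
  proof (rule integral_partial_derivative_eq_0[where G = "\<lambda>x. \<psi> x * \<phi> x" and e = "axis i 1" and K = S
        and G' = "\<lambda>x h. \<psi> x * frechet_derivative \<phi> (at x) h + frechet_derivative \<psi> (at x) h * \<phi> x"])
    show "((\<lambda>x. \<psi> x * \<phi> x) has_derivative (\<lambda>h. \<psi> x * frechet_derivative \<phi> (at x) h + frechet_derivative \<psi> (at x) h * \<phi> x)) (at x)" for x
      by (rule has_derivative_mult[OF d(2) d(1)])
    show "continuous_on UNIV (\<lambda>x. \<psi> x * frechet_derivative \<phi> (at x) (axis i 1) + frechet_derivative \<psi> (at x) (axis i 1) * \<phi> x)"
      using continuous_on_add[OF c] by simp
  qed (simp_all add: K 0(1))
  moreover have "integrable lborel (\<lambda>x. \<psi> x * partials [i] \<phi> x)"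
    by (rule continuous_compact_support_integrable[OF c(1) K]) (use 0(2) in simp)
  moreover have "integrable lborel (\<lambda>x. partials [i] \<psi> x * \<phi> x)"
    by (rule continuous_compact_support_integrable[OF c(2) K]) (use 0(1) in simp)
  ultimately show ?thesis by simp
qed

section \<open>Symmetry of second derivatives\<close>

lemma test_fn_line_derivative:
  fixes \<phi> :: "real^'d \<Rightarrow> real"
  assumes "\<phi> \<in> test_functions \<Omega>"
  shows "((\<lambda>s. partials is \<phi> (y + s *\<^sub>R axis i 1)) has_real_derivative partials (i # is) \<phi> (y + s *\<^sub>R axis i 1)) (at s)"
proof -
  have "((\<lambda>s. y + s *\<^sub>R axis i 1) has_derivative (\<lambda>t. t *\<^sub>R axis i 1 :: real^'d)) (at s)"
    by (auto intro!: derivative_eq_intros)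
  from has_derivative_compose[OF this test_fn_has_derivative[OF assms]]
  have "((\<lambda>s. partials is \<phi> (y + s *\<^sub>R axis i 1)) has_derivative
     (\<lambda>t. frechet_derivative (partials is \<phi>) (at (y + s *\<^sub>R axis i 1)) (t *\<^sub>R axis i 1))) (at s)" .
  moreover have "frechet_derivative (partials is \<phi>) (at x) (t *\<^sub>R axis i 1) = partials (i # is) \<phi> x * t" for x t
    using linear_scale[OF has_derivative_linear[OF test_fn_has_derivative[OF assms, of "is" x]], of t "axis i 1"] by simp
  ultimately show ?thesis by (simp add: has_field_derivative_def mult.commute[of "partials _ _ _"])
qed

text \<open>
  Two applications of the mean value theorem, first to the difference in one direction and then to
  its derivative in the other one.
\<close>

lemma second_difference_mean_value:
  fixes \<phi> :: "real^'d \<Rightarrow> real"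
  assumes \<phi>: "\<phi> \<in> test_functions \<Omega>" and h: "0 < h"
  shows "\<exists>z. norm (z - x) \<le> 2 * h \<and>
    \<phi> (x + h *\<^sub>R axis i 1 + h *\<^sub>R axis j 1) - \<phi> (x + h *\<^sub>R axis i 1) - \<phi> (x + h *\<^sub>R axis j 1) + \<phi> x
      = h\<^sup>2 * partials [j, i] \<phi> z"
proof -
  define p where "p s = \<phi> ((x + h *\<^sub>R axis j 1) + s *\<^sub>R axis i 1) - \<phi> (x + s *\<^sub>R axis i 1)" for s
  have "\<exists>z>0. z < h \<and> p h - p 0 = (h - 0) * (partials [i] \<phi> ((x + h *\<^sub>R axis j 1) + z *\<^sub>R axis i 1) - partials [i] \<phi> (x + z *\<^sub>R axis i 1))"
    unfolding p_def
    by (intro MVT2[OF h]) (intro DERIV_diff test_fn_line_derivative[OF \<phi>, of "[]", unfolded partials.simps(1)])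
  then obtain s where s: "0 < s" "s < h"
    "p h - p 0 = h * (partials [i] \<phi> ((x + s *\<^sub>R axis i 1) + h *\<^sub>R axis j 1) - partials [i] \<phi> ((x + s *\<^sub>R axis i 1) + 0 *\<^sub>R axis j 1))"
    by (auto simp: algebra_simps)
  obtain t where t: "0 < t" "t < h" "partials [i] \<phi> ((x + s *\<^sub>R axis i 1) + h *\<^sub>R axis j 1) - partials [i] \<phi> ((x + s *\<^sub>R axis i 1) + 0 *\<^sub>R axis j 1)
      = (h - 0) * partials [j, i] \<phi> ((x + s *\<^sub>R axis i 1) + t *\<^sub>R axis j 1)"
    using MVT2[OF h, of "\<lambda>t. partials [i] \<phi> ((x + s *\<^sub>R axis i 1) + t *\<^sub>R axis j 1)"
        "\<lambda>t. partials [j, i] \<phi> ((x + s *\<^sub>R axis i 1) + t *\<^sub>R axis j 1)"] test_fn_line_derivative[OF \<phi>, of "[i]"]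
    by blast
  have e1: "p h - p 0 = \<phi> (x + h *\<^sub>R axis i 1 + h *\<^sub>R axis j 1) - \<phi> (x + h *\<^sub>R axis i 1) - \<phi> (x + h *\<^sub>R axis j 1) + \<phi> x"
    by (simp add: p_def add_ac)
  have e2: "p h - p 0 = h\<^sup>2 * partials [j, i] \<phi> (x + s *\<^sub>R axis i 1 + t *\<^sub>R axis j 1)"
    unfolding s(3) t(3) by (simp add: power2_eq_square)
  have "norm (s *\<^sub>R axis i 1 + t *\<^sub>R axis j 1 :: real^'d) \<le> 2 * h"
    using norm_triangle_ineq[of "s *\<^sub>R axis i 1 :: real^'d" "t *\<^sub>R axis j 1"] s(1,2) t(1,2) by simp
  then have "norm ((x + s *\<^sub>R axis i 1 + t *\<^sub>R axis j 1) - x) \<le> 2 * h" by (simp add: algebra_simps)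
  then show ?thesis using e2[unfolded e1] by blast
qed

text \<open>
  The second difference quotient is symmetric in the two directions, and it converges to
  either mixed derivative.
\<close>

lemma partials_commute:
  fixes \<phi> :: "real^'d \<Rightarrow> real"
  assumes \<phi>: "\<phi> \<in> test_functions \<Omega>"
  shows "partials [i, j] \<phi> = partials [j, i] \<phi>"
proof
  fix x
  define h where "h n = inverse (real (Suc n))" for n
  have h: "0 < h n" for n by (simp add: h_def)
  have h0: "h \<longlonglongrightarrow> 0" unfolding h_def by (rule LIMSEQ_inverse_real_of_nat)
  have lim: "\<exists>z. z \<longlonglongrightarrow> x \<and> (\<forall>n. \<phi> (x + h n *\<^sub>R axis i 1 + h n *\<^sub>R axis j 1) - \<phi> (x + h n *\<^sub>R axis i 1) - \<phi> (x + h n *\<^sub>R axis j 1) + \<phi> x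
      = (h n)\<^sup>2 * partials [j, i] \<phi> (z n))" for i j
  proof -
    have "\<forall>n. \<exists>z. norm (z - x) \<le> 2 * h n \<and>
      \<phi> (x + h n *\<^sub>R axis i 1 + h n *\<^sub>R axis j 1) - \<phi> (x + h n *\<^sub>R axis i 1) - \<phi> (x + h n *\<^sub>R axis j 1) + \<phi> x
      = (h n)\<^sup>2 * partials [j, i] \<phi> z"
      by (intro allI second_difference_mean_value[OF \<phi> h])
    from choice[OF this] obtain z where z: "\<And>n. norm (z n - x) \<le> 2 * h n \<and>
      \<phi> (x + h n *\<^sub>R axis i 1 + h n *\<^sub>R axis j 1) - \<phi> (x + h n *\<^sub>R axis i 1) - \<phi> (x + h n *\<^sub>R axis j 1) + \<phi> x
      = (h n)\<^sup>2 * partials [j, i] \<phi> (z n)"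
      by blast
    have "(\<lambda>n. z n - x) \<longlonglongrightarrow> 0"
    proof (rule Lim_null_comparison)
      show "(\<lambda>n. 2 * h n) \<longlonglongrightarrow> 0" using tendsto_mult_right_zero[OF h0] .
    qed (use z in auto)
    then have "z \<longlonglongrightarrow> x" by (rule LIM_zero_cancel)
    then show ?thesis using z by blast
  qed
  obtain z z' where z: "z \<longlonglongrightarrow> x" "\<And>n. \<phi> (x + h n *\<^sub>R axis i 1 + h n *\<^sub>R axis j 1) - \<phi> (x + h n *\<^sub>R axis i 1) - \<phi> (x + h n *\<^sub>R axis j 1) + \<phi> x
      = (h n)\<^sup>2 * partials [j, i] \<phi> (z n)"
    and z': "z' \<longlonglongrightarrow> x" "\<And>n. \<phi> (x + h n *\<^sub>R axis j 1 + h n *\<^sub>R axis i 1) - \<phi> (x + h n *\<^sub>R axis j 1) - \<phi> (x + h n *\<^sub>R axis i 1) + \<phi> x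
      = (h n)\<^sup>2 * partials [i, j] \<phi> (z' n)"
    using lim[of i j] lim[of j i] by blast
  have eq: "partials [j, i] \<phi> (z n) = partials [i, j] \<phi> (z' n)" for n
  proof -
    have "x + h n *\<^sub>R axis j 1 + h n *\<^sub>R axis i 1 = x + h n *\<^sub>R axis i 1 + h n *\<^sub>R axis j 1" by (simp add: add_ac)
    note comm = this
    have "(h n)\<^sup>2 * partials [j, i] \<phi> (z n) = \<phi> (x + h n *\<^sub>R axis i 1 + h n *\<^sub>R axis j 1) - \<phi> (x + h n *\<^sub>R axis i 1) - \<phi> (x + h n *\<^sub>R axis j 1) + \<phi> x"
      using z(2)[of n] by (rule sym)
    also have "\<dots> = \<phi> (x + h n *\<^sub>R axis i 1 + h n *\<^sub>R axis j 1) - \<phi> (x + h n *\<^sub>R axis j 1) - \<phi> (x + h n *\<^sub>R axis i 1) + \<phi> x"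
      by simp
    also have "\<dots> = (h n)\<^sup>2 * partials [i, j] \<phi> (z' n)" using z'(2)[of n] unfolding comm .
    finally have "(h n)\<^sup>2 * partials [j, i] \<phi> (z n) = (h n)\<^sup>2 * partials [i, j] \<phi> (z' n)" .
    then show ?thesis using h[of n] by simp
  qed
  have c: "isCont (partials is \<phi>) x" for "is"
    using test_fn_differentiable[OF \<phi>] differentiable_imp_continuous_within by blast
  have "(\<lambda>n. partials [j, i] \<phi> (z n)) \<longlonglongrightarrow> partials [j, i] \<phi> x" by (rule isCont_tendsto_compose[OF c z(1)])
  moreover have "(\<lambda>n. partials [i, j] \<phi> (z' n)) \<longlonglongrightarrow> partials [i, j] \<phi> x" by (rule isCont_tendsto_compose[OF c z'(1)])
  ultimately show "partials [i, j] \<phi> x = partials [j, i] \<phi> x" unfolding eq by (rule LIMSEQ_unique[rotated])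
qed

section \<open>Functions vanishing on the boundary\<close>

context open_domain
begin

lemma integral_Omega_eq:
  fixes f :: "real^'d \<Rightarrow> 'b::euclidean_space"
  assumes f: "continuous_on UNIV f" and 0: "\<And>x. x \<notin> \<Omega> \<Longrightarrow> f x = 0"
  shows "(LINT x|lebesgue_on \<Omega>. f x) = (LINT x|lborel. f x)"
proof -
  have "(LINT x|lebesgue_on \<Omega>. f x) = (LINT x|lebesgue. indicator \<Omega> x *\<^sub>R f x)"
    by (intro integral_restrict_space) auto
  also have "(\<lambda>x. indicator \<Omega> x *\<^sub>R f x) = f" using 0 by (intro ext) (auto simp: indicator_def of_bool_def)
  finally show ?thesis using integral_lebesgue_lborel[OF f] by simp
qed

lemma test_fn_outside: "\<phi> \<in> test_functions \<Omega> \<Longrightarrow> x \<notin> \<Omega> \<Longrightarrow> partials is \<phi> x = 0"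
  by (rule partials_outside_support) (auto simp: test_functions_def)

lemma test_fn_l2:
  fixes \<phi> :: "real^'d \<Rightarrow> 'b::euclidean_space"
  assumes \<phi>: "\<phi> \<in> test_functions \<Omega>"
  shows "\<phi> \<in> l2_space \<Omega>"
proof -
  define S where "S = closure {x. \<phi> x \<noteq> 0}"
  have K: "compact S" "S \<subseteq> \<Omega>" using \<phi> by (auto simp: S_def test_functions_def)
  have 0: "\<phi> x = 0" if "x \<notin> S" for x
    using partials_outside_support[OF that[unfolded S_def], of "[]"] by simp
  have c: "continuous_on UNIV \<phi>" using test_fn_continuous[OF \<phi>, of UNIV "[]"] by simp
  have m: "\<phi> \<in> borel_measurable (lebesgue_on \<Omega>)"
    using test_fn_measurable[OF \<phi>] by (rule measurable_restrict_space1)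
  have "integrable lborel (\<lambda>x. (norm (\<phi> x))\<^sup>2)"
    by (rule continuous_compact_support_integrable[OF _ K(1)]) (use c 0 in \<open>auto intro!: continuous_intros\<close>)
  then have "integrable lebesgue (\<lambda>x. (norm (\<phi> x))\<^sup>2)" using integrable_completion[of "\<lambda>x. (norm (\<phi> x))\<^sup>2" lborel] c
    by (simp add: borel_measurable_continuous_onI continuous_intros)
  then have "integrable lebesgue (\<lambda>x. indicator \<Omega> x *\<^sub>R (norm (\<phi> x))\<^sup>2)"
    by (intro integrable_mult_indicator) auto
  then show ?thesis using m by (simp add: l2_space_def integrable_on_iff)
qed

lemma test_fn_ibp_Omega:
  fixes \<phi> :: "real^'d \<Rightarrow> 'b::euclidean_space" and \<psi> :: "real^'d \<Rightarrow> real"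
  assumes \<phi>: "\<phi> \<in> test_functions \<Omega>" and \<psi>: "\<psi> \<in> test_functions \<Omega>"
  shows "(LINT x|lebesgue_on \<Omega>. partials [i] \<psi> x *\<^sub>R \<phi> x) = - (LINT x|lebesgue_on \<Omega>. \<psi> x *\<^sub>R partials [i] \<phi> x)"
proof (rule euclidean_eqI)
  fix b :: 'b assume "b \<in> Basis"
  have L: "bounded_linear (\<lambda>y::'b. y \<bullet> b)" by (rule bounded_linear_inner_left)
  define \<phi>b where "\<phi>b x = \<phi> x \<bullet> b" for x
  have \<phi>b: "\<phi>b \<in> test_functions \<Omega>" unfolding \<phi>b_def by (rule test_fn_linear_image[OF \<phi> L])
  have pb: "partials is \<phi>b = (\<lambda>x. partials is \<phi> x \<bullet> b)" for "is" unfolding \<phi>b_def by (rule partials_linear_image[OF \<phi> L])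
  have li: "locally_integrable \<Omega> (partials is \<phi>)" for "is"
    by (intro l2_locally_integrable test_fn_l2 test_fn_partials \<phi>)
  have c: "continuous_on UNIV (\<lambda>x. partials is \<psi> x * partials js \<phi>b x)" for "is" js
    by (intro continuous_on_mult test_fn_continuous[OF \<phi>b] test_fn_continuous[OF \<psi>])
  have e: "(LINT x|lebesgue_on \<Omega>. partials is \<psi> x *\<^sub>R partials js \<phi> x) \<bullet> b = (LINT x|lborel. partials is \<psi> x * partials js \<phi>b x)" for "is" js
  proof -
    have "(LINT x|lebesgue_on \<Omega>. partials is \<psi> x *\<^sub>R partials js \<phi> x) \<bullet> b = (LINT x|lebesgue_on \<Omega>. (partials is \<psi> x *\<^sub>R partials js \<phi> x) \<bullet> b)"
      by (rule integral_inner_left[symmetric]) (intro test_integrable test_fn_partials \<psi> li)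
    also have "\<dots> = (LINT x|lebesgue_on \<Omega>. partials is \<psi> x * partials js \<phi>b x)" by (simp add: pb)
    also have "\<dots> = (LINT x|lborel. partials is \<psi> x * partials js \<phi>b x)"
      by (rule integral_Omega_eq[OF c]) (simp add: test_fn_outside[OF \<psi>])
    finally show ?thesis .
  qed
  show "(LINT x|lebesgue_on \<Omega>. partials [i] \<psi> x *\<^sub>R \<phi> x) \<bullet> b = (- (LINT x|lebesgue_on \<Omega>. \<psi> x *\<^sub>R partials [i] \<phi> x)) \<bullet> b"
    using e[of "[i]" "[]"] e[of "[]" "[i]"] test_fn_ibp[OF \<phi>b \<psi>, of i] by (simp only: partials.simps(1) inner_minus_left)
qed

lemma test_fn_weak_deriv:
  fixes \<phi> :: "real^'d \<Rightarrow> 'b::euclidean_space"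
  assumes \<phi>: "\<phi> \<in> test_functions \<Omega>"
  shows "has_weak_deriv \<Omega> [i] \<phi> (partials [i] \<phi>)"
  unfolding has_weak_deriv_def
  using test_fn_ibp_Omega[OF \<phi>, of _ i] l2_locally_integrable[OF test_fn_l2[OF \<phi>]]
    l2_locally_integrable[OF test_fn_l2[OF test_fn_partials[OF \<phi>, of "[i]"]]]
  by (simp del: partials.simps(2))

lemma test_fn_sobolev:
  fixes \<phi> :: "real^'d \<Rightarrow> 'b::euclidean_space"
  assumes \<phi>: "\<phi> \<in> test_functions \<Omega>"
  shows "\<phi> \<in> sobolev \<Omega> 1"
  unfolding sobolev_def
proof (intro CollectI conjI allI impI)
  show "\<phi> \<in> l2_space \<Omega>" by (rule test_fn_l2[OF \<phi>])
  fix "is" :: "'d list" assume "length is \<le> 1"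
  then consider "is = []" | i where "is = [i]" by (cases "is") auto
  then show "\<exists>g\<in>l2_space \<Omega>. has_weak_deriv \<Omega> is \<phi> g"
  proof cases
    case 1
    then show ?thesis using has_weak_deriv_Nil[OF l2_locally_integrable] test_fn_l2[OF \<phi>] by blast
  next
    case 2
    then show ?thesis using test_fn_weak_deriv[OF \<phi>] test_fn_l2[OF test_fn_partials[OF \<phi>]] by blast
  qed
qed

lemma test_fn_weak_deriv_eq:
  fixes \<phi> :: "real^'d \<Rightarrow> 'b::euclidean_space"
  shows "\<phi> \<in> test_functions \<Omega> \<Longrightarrow> ae_eq \<Omega> (weak_deriv \<Omega> [i] \<phi>) (partials [i] \<phi>)"
  by (rule weak_deriv_eqI[OF test_fn_weak_deriv])

lemma sobolev10_iff:
  fixes v :: "real^'d \<Rightarrow> 'b::euclidean_space"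
  shows "v \<in> sobolev10 \<Omega> \<longleftrightarrow> v \<in> sobolev \<Omega> 1 \<and> (\<forall>\<epsilon>>0. \<exists>\<phi>\<in>test_functions \<Omega>. nrm (sob_inner 1) (v - \<phi>) < \<epsilon>)"
proof -
  have "sobolev_norm \<Omega> 1 (\<lambda>x. v x - \<phi> x) = nrm (sob_inner 1) (v - \<phi>)" if "v \<in> sobolev \<Omega> 1" "\<phi> \<in> test_functions \<Omega>" for \<phi>
    using sobolev_norm_eq[OF sob.mem_simps(3)[OF that(1) test_fn_sobolev[OF that(2)]]] by (simp add: fun_diff_def)
  then show ?thesis unfolding sobolev10_def by auto
qed

lemma sobolev10_sobolev: "v \<in> sobolev10 \<Omega> \<Longrightarrow> v \<in> sobolev \<Omega> 1"
  by (simp add: sobolev10_def)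

lemma test_fn_sobolev10:
  fixes \<phi> :: "real^'d \<Rightarrow> 'b::euclidean_space"
  shows "\<phi> \<in> test_functions \<Omega> \<Longrightarrow> \<phi> \<in> sobolev10 \<Omega>"
  unfolding sobolev10_iff using test_fn_sobolev[of \<phi>] by (auto intro!: bexI[of _ \<phi>])

lemma subspace_sobolev10: "subspace (sobolev10 \<Omega> :: (real^'d \<Rightarrow> 'b::euclidean_space) set)"
proof (rule subspaceI)
  have "(\<lambda>x. 0::'b) \<in> test_functions \<Omega>"
  proof -
    have "partials is (\<lambda>x::real^'d. 0::'b) = (\<lambda>x. 0)" for "is" by (induction "is") auto
    then show ?thesis by (simp add: test_functions_def)
  qed
  from test_fn_sobolev10[OF this] show "0 \<in> (sobolev10 \<Omega> :: (real^'d \<Rightarrow> 'b) set)" by (simp add: zero_fun_def)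
next
  fix v w :: "real^'d \<Rightarrow> 'b" assume vw: "v \<in> sobolev10 \<Omega>" "w \<in> sobolev10 \<Omega>"
  note s = vw[THEN sobolev10_sobolev]
  show "v + w \<in> sobolev10 \<Omega>" unfolding sobolev10_iff
  proof (intro conjI allI impI)
    show "v + w \<in> sobolev \<Omega> 1" using s by (rule sob.mem_simps(2))
    fix \<epsilon> :: real assume "\<epsilon> > 0"
    then have e2: "\<epsilon> / 2 > 0" by simp
    obtain \<phi> \<psi> where t: "\<phi> \<in> test_functions \<Omega>" "nrm (sob_inner 1) (v - \<phi>) < \<epsilon> / 2"
        "\<psi> \<in> test_functions \<Omega>" "nrm (sob_inner 1) (w - \<psi>) < \<epsilon> / 2"
      using vw e2 unfolding sobolev10_iff by metis
    have "nrm (sob_inner 1) ((v - \<phi>) + (w - \<psi>)) \<le> nrm (sob_inner 1) (v - \<phi>) + nrm (sob_inner 1) (w - \<psi>)"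
      by (intro sob.nrm_add sob.mem_simps(3) s test_fn_sobolev t)
    moreover have "(v - \<phi>) + (w - \<psi>) = (v + w) - (\<lambda>x. \<phi> x + \<psi> x)" by (simp add: fun_eq_iff algebra_simps)
    ultimately show "\<exists>\<phi>\<in>test_functions \<Omega>. nrm (sob_inner 1) (v + w - \<phi>) < \<epsilon>"
      using t test_fn_add[OF t(1,3)] by (intro bexI[of _ "\<lambda>x. \<phi> x + \<psi> x"]) auto
  qed
next
  fix c and v :: "real^'d \<Rightarrow> 'b" assume v: "v \<in> sobolev10 \<Omega>"
  note s = v[THEN sobolev10_sobolev]
  show "c *\<^sub>R v \<in> sobolev10 \<Omega>" unfolding sobolev10_iff
  proof (intro conjI allI impI)
    show "c *\<^sub>R v \<in> sobolev \<Omega> 1" using s by (rule sob.mem_simps(4))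
    fix \<epsilon> :: real assume e: "\<epsilon> > 0"
    then have "\<epsilon> / (\<bar>c\<bar> + 1) > 0" by simp
    then obtain \<phi> where t: "\<phi> \<in> test_functions \<Omega>" "nrm (sob_inner 1) (v - \<phi>) < \<epsilon> / (\<bar>c\<bar> + 1)"
      using v unfolding sobolev10_iff by blast
    have m: "v - \<phi> \<in> sobolev \<Omega> 1" by (intro sob.mem_simps(3) s test_fn_sobolev t)
    have "nrm (sob_inner 1) (c *\<^sub>R (v - \<phi>)) \<le> (\<bar>c\<bar> + 1) * nrm (sob_inner 1) (v - \<phi>)"
      using sob.nrm_scale[OF m] sob.nrm_nonneg[OF m] by (simp add: mult_right_mono)
    also have "\<dots> < \<epsilon>" using t(2) by (simp add: field_simps)
    also have "c *\<^sub>R (v - \<phi>) = c *\<^sub>R v - (\<lambda>x. c *\<^sub>R \<phi> x)" by (simp add: fun_eq_iff algebra_simps)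
    finally show "\<exists>\<phi>\<in>test_functions \<Omega>. nrm (sob_inner 1) (c *\<^sub>R v - \<phi>) < \<epsilon>"
      using test_fn_linear_image[OF t(1) bounded_linear_scaleR_right] by blast
  qed
qed

lemma sobolev10_closed:
  fixes v :: "real^'d \<Rightarrow> 'b::euclidean_space"
  assumes v: "v \<in> sobolev \<Omega> 1" and lim: "\<And>\<epsilon>. \<epsilon> > 0 \<Longrightarrow> \<exists>w\<in>sobolev10 \<Omega>. nrm (sob_inner 1) (v - w) < \<epsilon>"
  shows "v \<in> sobolev10 \<Omega>"
  unfolding sobolev10_iff
proof (intro conjI allI impI v)
  fix \<epsilon> :: real assume "\<epsilon> > 0"
  then have e2: "\<epsilon> / 2 > 0" by simp
  obtain w where w: "w \<in> sobolev10 \<Omega>" "nrm (sob_inner 1) (v - w) < \<epsilon> / 2" using lim[OF e2] by blast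
  obtain \<phi> where \<phi>: "\<phi> \<in> test_functions \<Omega>" "nrm (sob_inner 1) (w - \<phi>) < \<epsilon> / 2"
    using w(1) e2 unfolding sobolev10_iff by blast
  have "nrm (sob_inner 1) (v - \<phi>) < \<epsilon>"
    using sob.nrm_triangle[OF v sobolev10_sobolev[OF w(1)] test_fn_sobolev[OF \<phi>(1)]] w(2) \<phi>(2) by simp
  then show "\<exists>\<phi>\<in>test_functions \<Omega>. nrm (sob_inner 1) (v - \<phi>) < \<epsilon>" using \<phi>(1) by blast
qed

text \<open>
  Identities that are linear and bounded in a function with zero boundary values need to be verified
  for test functions only. All formulas of Green's type below follow this pattern.
\<close>

lemma vanishing_by_density:
  fixes L :: "(real^'d \<Rightarrow> 'b::euclidean_space) \<Rightarrow> real"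
  assumes diff: "\<And>v w. v \<in> sobolev \<Omega> 1 \<Longrightarrow> w \<in> sobolev \<Omega> 1 \<Longrightarrow> L (v - w) = L v - L w"
    and bound: "\<And>v. v \<in> sobolev \<Omega> 1 \<Longrightarrow> \<bar>L v\<bar> \<le> C * nrm (sob_inner 1) v"
    and zero: "\<And>\<phi>. \<phi> \<in> test_functions \<Omega> \<Longrightarrow> L \<phi> = 0" and v: "v \<in> sobolev10 \<Omega>"
  shows "L v = 0"
proof -
  have "\<bar>L v\<bar> \<le> e" if e: "e > 0" for e
  proof -
    have "e / (\<bar>C\<bar> + 1) > 0" using e by simp
    then obtain \<phi> where \<phi>: "\<phi> \<in> test_functions \<Omega>" "nrm (sob_inner 1) (v - \<phi>) < e / (\<bar>C\<bar> + 1)"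
      using v unfolding sobolev10_iff by blast
    note s = sobolev10_sobolev[OF v] test_fn_sobolev[OF \<phi>(1)]
    have "\<bar>L v\<bar> = \<bar>L (v - \<phi>)\<bar>" using diff[OF s] zero[OF \<phi>(1)] by simp
    also have "\<dots> \<le> C * nrm (sob_inner 1) (v - \<phi>)" using bound sob.mem_simps(3)[OF s] by blast
    also have "\<dots> \<le> (\<bar>C\<bar> + 1) * nrm (sob_inner 1) (v - \<phi>)"
      using sob.nrm_nonneg[OF sob.mem_simps(3)[OF s]] by (intro mult_right_mono) auto
    also have "\<dots> \<le> e" using \<phi>(2) by (simp add: field_simps)
    finally show ?thesis .
  qed
  then have "\<bar>L v\<bar> \<le> 0" by (rule field_le_epsilon[of _ 0, simplified])
  then show ?thesis by simp
qed

text \<open>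
  Weak derivatives are defined by testing with scalar functions; here the test function takes values in the same
  space, and the identity is applied to each of its components.
\<close>

lemma weak_deriv_pairing:
  fixes v :: "real^'d \<Rightarrow> 'b::euclidean_space"
  assumes d: "has_weak_deriv \<Omega> is v g" and v: "v \<in> l2_space \<Omega>" and g: "g \<in> l2_space \<Omega>" and \<phi>: "\<phi> \<in> test_functions \<Omega>"
  shows "l2_inner \<Omega> v (partials is \<phi>) = (-1) ^ length is * l2_inner \<Omega> g \<phi>"
proof -
  have expand: "l2_inner \<Omega> w (partials js \<phi>) = (\<Sum>b\<in>Basis. (LINT x|lebesgue_on \<Omega>. partials js (\<lambda>x. \<phi> x \<bullet> b) x *\<^sub>R w x) \<bullet> b)"
    if w: "w \<in> l2_space \<Omega>" for w js
  proof -
    have t: "(\<lambda>x. \<phi> x \<bullet> b) \<in> test_functions \<Omega>" for b by (rule test_fn_linear_image[OF \<phi> bounded_linear_inner_left])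
    have p: "partials js (\<lambda>x. \<phi> x \<bullet> b) = (\<lambda>x. partials js \<phi> x \<bullet> b)" for b
      by (rule partials_linear_image[OF \<phi> bounded_linear_inner_left])
    have i: "integrable (lebesgue_on \<Omega>) (\<lambda>x. partials js (\<lambda>x. \<phi> x \<bullet> b) x *\<^sub>R w x)" for b
      by (intro test_integrable test_fn_partials t l2_locally_integrable w)
    have "(\<Sum>b\<in>Basis. (LINT x|lebesgue_on \<Omega>. partials js (\<lambda>x. \<phi> x \<bullet> b) x *\<^sub>R w x) \<bullet> b)
      = (\<Sum>b\<in>Basis. (LINT x|lebesgue_on \<Omega>. (partials js (\<lambda>x. \<phi> x \<bullet> b) x *\<^sub>R w x) \<bullet> b))"
      by (intro sum.cong refl integral_inner_left[symmetric] i)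
    also have "\<dots> = (LINT x|lebesgue_on \<Omega>. (\<Sum>b\<in>Basis. (partials js (\<lambda>x. \<phi> x \<bullet> b) x *\<^sub>R w x) \<bullet> b))"
      by (intro Bochner_Integration.integral_sum[symmetric] integrable_inner_left i)
    also have "\<dots> = l2_inner \<Omega> w (partials js \<phi>)"
      unfolding l2_inner_def p by (subst euclidean_inner) (simp add: mult.commute)
    finally show ?thesis by simp
  qed
  have "l2_inner \<Omega> v (partials is \<phi>) = (\<Sum>b\<in>Basis. ((-1) ^ length is *\<^sub>R (LINT x|lebesgue_on \<Omega>. (\<phi> x \<bullet> b) *\<^sub>R g x)) \<bullet> b)"
    unfolding expand[OF v]
  proof (intro sum.cong refl)
    fix b :: 'b
    have "(\<lambda>x. \<phi> x \<bullet> b) \<in> test_functions \<Omega>" by (rule test_fn_linear_image[OF \<phi> bounded_linear_inner_left])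
    then show "(LINT x|lebesgue_on \<Omega>. partials is (\<lambda>x. \<phi> x \<bullet> b) x *\<^sub>R v x) \<bullet> b = ((-1) ^ length is *\<^sub>R (LINT x|lebesgue_on \<Omega>. (\<phi> x \<bullet> b) *\<^sub>R g x)) \<bullet> b"
      using d unfolding has_weak_deriv_def by auto
  qed
  also have "\<dots> = (-1) ^ length is * l2_inner \<Omega> g \<phi>"
    using expand[OF g, of "[]"] by (simp add: sum_distrib_left)
  finally show ?thesis .
qed

section \<open>The Poincare inequality\<close>

text \<open>
  Integration of \<open>\<partial>\<^sub>i (x\<^sub>i |\<phi>|\<^sup>2)\<close>, which has a vanishing integral, bounds \<open>\<parallel>\<phi>\<parallel>\<^sup>2\<close> by
  \<open>2 |\<langle>x\<^sub>i \<partial>\<^sub>i \<phi>, \<phi>\<rangle>|\<close>.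
\<close>

lemma poincare_test_fn:
  fixes \<phi> :: "real^'d \<Rightarrow> 'b::euclidean_space"
  assumes \<phi>: "\<phi> \<in> test_functions \<Omega>" and R: "\<And>x. x \<in> \<Omega> \<Longrightarrow> \<bar>x $ i\<bar> \<le> R" "0 \<le> R"
  shows "nrm (l2_inner \<Omega>) \<phi> \<le> 2 * R * nrm (l2_inner \<Omega>) (partials [i] \<phi>)"
proof -
  define S where "S = closure {x. \<phi> x \<noteq> 0}"
  have K: "compact S" "S \<subseteq> \<Omega>" using \<phi> by (auto simp: S_def test_functions_def)
  have 0: "\<phi> x = 0" if "x \<notin> S" for x
    using partials_outside_support[OF that[unfolded S_def], of "[]"] by simp
  have c: "continuous_on UNIV (partials is \<phi>)" for "is" by (rule test_fn_continuous[OF \<phi>])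
  define d where "d = frechet_derivative \<phi>"
  have d: "(\<phi> has_derivative d (at x)) (at x)" for x
    using test_fn_has_derivative[OF \<phi>, of "[]"] by (simp add: d_def)
  have di: "d (at x) (axis i 1) = partials [i] \<phi> x" for x by (simp add: d_def)
  have dx: "((\<lambda>x::real^'d. x $ i) has_derivative (\<lambda>h. h $ i)) (at x)" for x
    by (rule bounded_linear_imp_has_derivative[OF bounded_linear_vec_nth])
  define w where "w x = (x $ i) *\<^sub>R partials [i] \<phi> x" for x
  have w_le: "norm (w x) \<le> norm (R *\<^sub>R partials [i] \<phi> x)" for x
    using R(1)[of x] R(2) test_fn_outside[OF \<phi>, of x "[i]"] 
    by (cases "x \<in> \<Omega>") (simp_all add: w_def mult_right_mono del: partials.simps(2))
  have wc: "continuous_on UNIV w" unfolding w_def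
    using c[of "[i]"] by (auto intro!: continuous_intros simp del: partials.simps(2))
  have wm: "w \<in> borel_measurable (lebesgue_on \<Omega>)"
    by (intro measurable_restrict_space1 measurable_completion) (use wc in \<open>simp add: borel_measurable_continuous_onI\<close>)
  have pl2: "partials [i] \<phi> \<in> l2_space \<Omega>" by (intro test_fn_l2 test_fn_partials \<phi>)
  have Rl2: "R *\<^sub>R partials [i] \<phi> \<in> l2_space \<Omega>" using pl2 by (rule l2.mem_simps(4))
  have wl2: "w \<in> l2_space \<Omega>" "l2_norm \<Omega> w \<le> l2_norm \<Omega> (R *\<^sub>R partials [i] \<phi>)"
    using l2_dominated[OF Rl2 wm] w_le by (auto simp del: partials.simps(2))
  have \<phi>l2: "\<phi> \<in> l2_space \<Omega>" by (rule test_fn_l2[OF \<phi>])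
  have "(LINT x|lborel. x $ i * (\<phi> x \<bullet> d (at x) (axis i 1) + d (at x) (axis i 1) \<bullet> \<phi> x) + axis i 1 $ i * (\<phi> x \<bullet> \<phi> x)) = 0"
  proof (rule integral_partial_derivative_eq_0[where G = "\<lambda>x. x $ i * (\<phi> x \<bullet> \<phi> x)" and e = "axis i 1" and K = S
        and G' = "\<lambda>x h. x $ i * (\<phi> x \<bullet> d (at x) h + d (at x) h \<bullet> \<phi> x) + h $ i * (\<phi> x \<bullet> \<phi> x)"])
    show "((\<lambda>x. x $ i * (\<phi> x \<bullet> \<phi> x)) has_derivative (\<lambda>h. x $ i * (\<phi> x \<bullet> d (at x) h + d (at x) h \<bullet> \<phi> x) + h $ i * (\<phi> x \<bullet> \<phi> x))) (at x)" for x
      by (intro has_derivative_mult has_derivative_inner d dx)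
    show "continuous_on UNIV (\<lambda>x. x $ i * (\<phi> x \<bullet> d (at x) (axis i 1) + d (at x) (axis i 1) \<bullet> \<phi> x) + axis i 1 $ i * (\<phi> x \<bullet> \<phi> x))"
      unfolding di using c[of "[i]"] c[of "[]"] by (auto intro!: continuous_intros simp del: partials.simps(2))
  qed (simp_all add: K 0)
  also have "(\<lambda>x. x $ i * (\<phi> x \<bullet> d (at x) (axis i 1) + d (at x) (axis i 1) \<bullet> \<phi> x) + axis i 1 $ i * (\<phi> x \<bullet> \<phi> x))
      = (\<lambda>x. 2 * (w x \<bullet> \<phi> x) + \<phi> x \<bullet> \<phi> x)"
    by (simp add: fun_eq_iff di w_def inner_commute algebra_simps del: partials.simps(2))
  also have "(LINT x|lborel. 2 * (w x \<bullet> \<phi> x) + \<phi> x \<bullet> \<phi> x) = (LINT x|lebesgue_on \<Omega>. 2 * (w x \<bullet> \<phi> x) + \<phi> x \<bullet> \<phi> x)"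
  proof (rule integral_Omega_eq[symmetric])
    show "continuous_on UNIV (\<lambda>x. 2 * (w x \<bullet> \<phi> x) + \<phi> x \<bullet> \<phi> x)"
      using wc c[of "[]"] by (auto intro!: continuous_intros)
    fix x assume "x \<notin> \<Omega>"
    then have "\<phi> x = 0" using 0 K(2) by blast
    then show "2 * (w x \<bullet> \<phi> x) + \<phi> x \<bullet> \<phi> x = 0" by simp
  qed
  also have "\<dots> = 2 * l2_inner \<Omega> w \<phi> + l2_inner \<Omega> \<phi> \<phi>"
    using l2_inner_integrable[OF wl2(1) \<phi>l2] l2_inner_integrable[OF \<phi>l2 \<phi>l2] by (simp add: l2_inner_def)
  finally have "l2_inner \<Omega> \<phi> \<phi> = - 2 * l2_inner \<Omega> w \<phi>" by simp
  also have "\<dots> \<le> 2 * (nrm (l2_inner \<Omega>) w * nrm (l2_inner \<Omega>) \<phi>)" using l2.cauchy_schwarz[OF wl2(1) \<phi>l2] by (simp add: mult.commute)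
  also have "\<dots> \<le> 2 * ((R * nrm (l2_inner \<Omega>) (partials [i] \<phi>)) * nrm (l2_inner \<Omega>) \<phi>)"
  proof (intro mult_left_mono mult_right_mono l2.nrm_nonneg[OF \<phi>l2])
    show "nrm (l2_inner \<Omega>) w \<le> R * nrm (l2_inner \<Omega>) (partials [i] \<phi>)"
      using wl2(2) R(2) l2.nrm_scale[OF pl2, of R] by (simp add: l2_norm_eq del: partials.simps(2))
  qed simp
  finally have "l2_inner \<Omega> \<phi> \<phi> \<le> (2 * R * nrm (l2_inner \<Omega>) (partials [i] \<phi>)) * nrm (l2_inner \<Omega>) \<phi>" by simp
  then show ?thesis using R(2) l2.nrm_nonneg[OF pl2] by (intro l2.nrm_le_of_test[OF \<phi>l2]) auto
qed

lemma poincare: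
  fixes v :: "real^'d \<Rightarrow> real^'d"
  assumes v: "v \<in> sobolev10 \<Omega>" and R: "\<And>x i. x \<in> \<Omega> \<Longrightarrow> \<bar>x $ i\<bar> \<le> R" "0 \<le> R"
  shows "nrm (l2_inner \<Omega>) v \<le> 2 * R * nrm grad_form v"
proof (rule field_le_epsilon)
  fix e :: real assume e: "e > 0"
  define \<delta> where "\<delta> = e / (1 + 2 * R)"
  have \<delta>: "\<delta> > 0" using e R(2) by (simp add: \<delta>_def)
  obtain \<phi> where \<phi>: "\<phi> \<in> test_functions \<Omega>" "nrm (sob_inner 1) (v - \<phi>) < \<delta>"
    using v \<delta> unfolding sobolev10_iff by blast
  note s = sobolev10_sobolev[OF v] test_fn_sobolev[OF \<phi>(1)]
  have m: "v - \<phi> \<in> sobolev \<Omega> 1" "\<phi> - v \<in> sobolev \<Omega> 1" using s by (auto intro: sob.mem_simps)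
  fix i :: 'd
  have i: "[i] \<in> range (\<lambda>j. [j])" by simp
  have "nrm (l2_inner \<Omega>) (partials [i] \<phi>) = nrm (l2_inner \<Omega>) (weak_deriv \<Omega> [i] \<phi>)"
    using l2_norm_ae_eq[OF sobolev_weak_deriv(2)[OF s(2), of "[i]"] test_fn_weak_deriv_eq[OF \<phi>(1)]] by (simp add: l2_norm_eq)
  also have "\<dots> \<le> nrm grad_form \<phi>"
    unfolding nrm_def grad_form_def
  proof (intro real_sqrt_le_mono member_le_sum[where f = "\<lambda>is. l2_inner \<Omega> (weak_deriv \<Omega> is \<phi>) (weak_deriv \<Omega> is \<phi>)"])
    fix "is" assume "is \<in> range (\<lambda>j. [j]) - {[i]}"
    then show "0 \<le> l2_inner \<Omega> (weak_deriv \<Omega> is \<phi>) (weak_deriv \<Omega> is \<phi>)"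
      by (intro l2.nonneg sobolev_weak_deriv(2)[OF s(2)]) auto
  qed auto
  also have "\<dots> \<le> nrm grad_form v + nrm grad_form (\<phi> - v)" using a.nrm_add[OF s(1) m(2)] by simp
  also have "nrm grad_form (\<phi> - v) \<le> \<delta>" using a_le_sob[OF m(2)] \<phi>(2) sob.nrm_minus[OF s] by simp
  finally have 1: "nrm (l2_inner \<Omega>) (partials [i] \<phi>) \<le> nrm grad_form v + \<delta>" by simp
  have "nrm (l2_inner \<Omega>) v \<le> nrm (l2_inner \<Omega>) (v - \<phi>) + nrm (l2_inner \<Omega>) \<phi>"
    by (intro l2.nrm_triangle2 sobolev_l2[OF s(1)] sobolev_l2[OF s(2)])
  also have "nrm (l2_inner \<Omega>) (v - \<phi>) \<le> \<delta>" using l2_norm_le_sob[OF m(1)] \<phi>(2) by simp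
  also have "nrm (l2_inner \<Omega>) \<phi> \<le> 2 * R * nrm (l2_inner \<Omega>) (partials [i] \<phi>)"
    by (rule poincare_test_fn[OF \<phi>(1) R])
  also have "\<dots> \<le> 2 * R * (nrm grad_form v + \<delta>)" using 1 R(2) by (intro mult_left_mono) auto
  finally have "nrm (l2_inner \<Omega>) v \<le> 2 * R * nrm grad_form v + (1 + 2 * R) * \<delta>" by (simp add: algebra_simps)
  also have "(1 + 2 * R) * \<delta> = e" using R(2) by (simp add: \<delta>_def)
  finally show "nrm (l2_inner \<Omega>) v \<le> 2 * R * nrm grad_form v + e" .
qed

end

section \<open>Green's formulas\<close>

context psd_form
begin

lemma sum_left: "finite I \<Longrightarrow> (\<And>i. i \<in> I \<Longrightarrow> f i \<in> S) \<Longrightarrow> y \<in> S \<Longrightarrow> A (\<Sum>i\<in>I. f i) y = (\<Sum>i\<in>I. A (f i) y)"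
  by (induction I rule: finite_induct) (simp_all add: zero add subspace_sum[OF subspace])

lemma sum_right: "finite I \<Longrightarrow> (\<And>i. i \<in> I \<Longrightarrow> f i \<in> S) \<Longrightarrow> y \<in> S \<Longrightarrow> A y (\<Sum>i\<in>I. f i) = (\<Sum>i\<in>I. A y (f i))"
  using sum_left[of I f y] sym[of y] subspace_sum[OF subspace, of I f] by simp

lemma nrm_sum: "finite I \<Longrightarrow> (\<And>i. i \<in> I \<Longrightarrow> f i \<in> S) \<Longrightarrow> nrm A (\<Sum>i\<in>I. f i) \<le> (\<Sum>i\<in>I. nrm A (f i))"
proof (induction I rule: finite_induct)
  case (insert i I)
  then have "f i \<in> S" "(\<Sum>i\<in>I. f i) \<in> S" by (auto intro!: subspace_sum[OF subspace])
  from nrm_add[OF this] insert show ?case by force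
qed simp

end

context open_domain
begin

lemma grad_form_sum: "grad_form u v = (\<Sum>j\<in>UNIV. l2_inner \<Omega> (weak_deriv \<Omega> [j] u) (weak_deriv \<Omega> [j] v))"
  by (simp add: grad_form_def sum.reindex inj_on_def)

lemma weak_deriv1_l2:
  fixes v :: "real^'d \<Rightarrow> 'b::euclidean_space"
  shows "v \<in> sobolev \<Omega> 1 \<Longrightarrow> weak_deriv \<Omega> [i] v \<in> l2_space \<Omega>"
  by (rule sobolev_weak_deriv(2)) auto

lemma nrm_weak_deriv_le_grad:
  assumes v: "v \<in> sobolev \<Omega> 1"
  shows "nrm (l2_inner \<Omega>) (weak_deriv \<Omega> [i] v) \<le> nrm grad_form v"
  unfolding nrm_def grad_form_sum
  by (intro real_sqrt_le_mono member_le_sum[where f = "\<lambda>j. l2_inner \<Omega> (weak_deriv \<Omega> [j] v) (weak_deriv \<Omega> [j] v)"]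
      l2.nonneg weak_deriv1_l2[OF v]) auto

text \<open>
  Components and multiples of unit vectors translate between \<open>grad_s\<close> and \<open>divg\<close>, which are
  defined componentwise, and the forms on vector-valued functions.
\<close>

lemma component_l2:
  fixes v :: "real^'d \<Rightarrow> real^'d"
  assumes v: "v \<in> l2_space \<Omega>"
  shows "(\<lambda>x. v x $ i) \<in> l2_space \<Omega>" "nrm (l2_inner \<Omega>) (\<lambda>x. v x $ i) \<le> nrm (l2_inner \<Omega>) v"
proof -
  have "(\<lambda>x. v x \<bullet> axis i 1) \<in> borel_measurable (lebesgue_on \<Omega>)" using v by (auto simp: l2_space_def)
  then have m: "(\<lambda>x. v x $ i) \<in> borel_measurable (lebesgue_on \<Omega>)" by (simp add: inner_axis)
  show "(\<lambda>x. v x $ i) \<in> l2_space \<Omega>" "nrm (l2_inner \<Omega>) (\<lambda>x. v x $ i) \<le> nrm (l2_inner \<Omega>) v"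
    using l2_dominated[OF v m] component_le_norm_cart by (auto simp: l2_norm_eq)
qed

lemma scaled_axis_l2:
  fixes q :: "real^'d \<Rightarrow> real"
  assumes q: "q \<in> l2_space \<Omega>"
  shows "(\<lambda>x. q x *\<^sub>R axis i 1 :: real^'d) \<in> l2_space \<Omega>"
proof (rule l2_dominated(1)[OF q])
  show "(\<lambda>x. q x *\<^sub>R axis i 1 :: real^'d) \<in> borel_measurable (lebesgue_on \<Omega>)"
    using q by (auto simp: l2_space_def)
qed simp

lemma divg_eq: "divg \<Omega> v = (\<Sum>i\<in>UNIV. (\<lambda>x. weak_deriv \<Omega> [i] v x $ i))"
  by (simp add: fun_eq_iff divg_def sum_fun_apply)

lemma divg_l2:
  assumes v: "v \<in> sobolev \<Omega> 1"
  shows "divg \<Omega> v \<in> l2_space \<Omega>" "nrm (l2_inner \<Omega>) (divg \<Omega> v) \<le> real CARD('d) * nrm grad_form v"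
proof -
  note c = component_l2[OF weak_deriv1_l2[OF v]]
  show "divg \<Omega> v \<in> l2_space \<Omega>" unfolding divg_eq by (intro subspace_sum[OF l2.subspace] c)
  have "nrm (l2_inner \<Omega>) (divg \<Omega> v) \<le> (\<Sum>i\<in>(UNIV::'d set). nrm (l2_inner \<Omega>) (\<lambda>x. weak_deriv \<Omega> [i] v x $ i))"
    unfolding divg_eq by (intro l2.nrm_sum c) auto
  also have "\<dots> \<le> (\<Sum>i\<in>(UNIV::'d set). nrm grad_form v)"
    by (intro sum_mono order_trans[OF c(2) nrm_weak_deriv_le_grad[OF v]])
  finally show "nrm (l2_inner \<Omega>) (divg \<Omega> v) \<le> real CARD('d) * nrm grad_form v" by simp
qed

lemma ae_eq_sum:
  fixes f g :: "'i \<Rightarrow> real^'d \<Rightarrow> 'b::comm_monoid_add"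
  assumes "finite I" "\<And>i. i \<in> I \<Longrightarrow> ae_eq \<Omega> (f i) (g i)"
  shows "ae_eq \<Omega> (\<Sum>i\<in>I. f i) (\<Sum>i\<in>I. g i)"
  using assms
proof (induction I rule: finite_induct)
  case (insert i I)
  then have "ae_eq \<Omega> (f i) (g i)" "ae_eq \<Omega> (\<Sum>i\<in>I. f i) (\<Sum>i\<in>I. g i)" by auto
  from ae_eq_comb[OF this, of "(+)"] show ?case using insert by (simp add: plus_fun_def)
qed simp

lemma divg_comb:
  assumes v: "v \<in> sobolev \<Omega> 1" and w: "w \<in> sobolev \<Omega> 1"
  shows "ae_eq \<Omega> (divg \<Omega> (\<lambda>x. a *\<^sub>R v x + b *\<^sub>R w x)) (a *\<^sub>R divg \<Omega> v + b *\<^sub>R divg \<Omega> w)"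
proof -
  have "ae_eq \<Omega> (divg \<Omega> (\<lambda>x. a *\<^sub>R v x + b *\<^sub>R w x))
     (\<Sum>i\<in>UNIV. (\<lambda>x. (a *\<^sub>R weak_deriv \<Omega> [i] v x + b *\<^sub>R weak_deriv \<Omega> [i] w x) $ i))"
    unfolding divg_eq
  proof (rule ae_eq_sum)
    fix i :: 'd
    show "ae_eq \<Omega> (\<lambda>x. weak_deriv \<Omega> [i] (\<lambda>x. a *\<^sub>R v x + b *\<^sub>R w x) x $ i) (\<lambda>x. (a *\<^sub>R weak_deriv \<Omega> [i] v x + b *\<^sub>R weak_deriv \<Omega> [i] w x) $ i)"
      using ae_eq_apply[OF weak_deriv_comb[OF v w, of "[i]" a b], of "\<lambda>y. y $ i"] by simp
  qed simp
  also have "(\<Sum>i\<in>UNIV. (\<lambda>x. (a *\<^sub>R weak_deriv \<Omega> [i] v x + b *\<^sub>R weak_deriv \<Omega> [i] w x) $ i)) = a *\<^sub>R divg \<Omega> v + b *\<^sub>R divg \<Omega> w"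
    by (simp add: fun_eq_iff divg_def sum_fun_apply sum.distrib sum_distrib_left)
  finally show ?thesis .
qed

lemma form_b_comb:
  assumes v: "v \<in> sobolev \<Omega> 1" and w: "w \<in> sobolev \<Omega> 1" and q: "q \<in> l2_space \<Omega>"
  shows "form_b \<Omega> (\<lambda>x. a *\<^sub>R v x + b *\<^sub>R w x) q = a * form_b \<Omega> v q + b * form_b \<Omega> w q"
proof -
  note d = divg_l2(1)[OF v] divg_l2(1)[OF w]
  have "l2_inner \<Omega> (divg \<Omega> (\<lambda>x. a *\<^sub>R v x + b *\<^sub>R w x)) q = l2_inner \<Omega> (a *\<^sub>R divg \<Omega> v + b *\<^sub>R divg \<Omega> w) q"
    using l2_inner_ae_eq[OF divg_l2(1)[OF sobolev_comb[OF v w]] divg_comb[OF v w] q ae_eq_refl] .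
  then show ?thesis using d q by (simp add: form_b_def l2.form_simps)
qed

lemma form_b_add: "v \<in> sobolev \<Omega> 1 \<Longrightarrow> w \<in> sobolev \<Omega> 1 \<Longrightarrow> q \<in> l2_space \<Omega> \<Longrightarrow> form_b \<Omega> (v + w) q = form_b \<Omega> v q + form_b \<Omega> w q"
  using form_b_comb[of v w q 1 1] by (simp add: plus_fun_def)

lemma form_b_scale: "v \<in> sobolev \<Omega> 1 \<Longrightarrow> q \<in> l2_space \<Omega> \<Longrightarrow> form_b \<Omega> (c *\<^sub>R v) q = c * form_b \<Omega> v q"
  using form_b_comb[of v v q c 0] by (simp add: scaleR_fun_def)

lemma form_b_diff: "v \<in> sobolev \<Omega> 1 \<Longrightarrow> w \<in> sobolev \<Omega> 1 \<Longrightarrow> q \<in> l2_space \<Omega> \<Longrightarrow> form_b \<Omega> (v - w) q = form_b \<Omega> v q - form_b \<Omega> w q"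
  using form_b_comb[of v w q 1 "-1"] by (simp add: fun_diff_def)

lemma form_b_add_right: "v \<in> sobolev \<Omega> 1 \<Longrightarrow> q \<in> l2_space \<Omega> \<Longrightarrow> q' \<in> l2_space \<Omega> \<Longrightarrow> form_b \<Omega> v (q + q') = form_b \<Omega> v q + form_b \<Omega> v q'"
  using divg_l2(1)[of v] by (simp add: form_b_def l2.add_right)

lemma form_b_scale_right: "v \<in> sobolev \<Omega> 1 \<Longrightarrow> q \<in> l2_space \<Omega> \<Longrightarrow> form_b \<Omega> v (c *\<^sub>R q) = c * form_b \<Omega> v q"
  using divg_l2(1)[of v] by (simp add: form_b_def l2.scale_right)

lemma form_b_bound:
  assumes v: "v \<in> sobolev \<Omega> 1" and q: "q \<in> l2_space \<Omega>"
  shows "\<bar>form_b \<Omega> v q\<bar> \<le> real CARD('d) * (nrm grad_form v * nrm (l2_inner \<Omega>) q)"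
proof -
  have "\<bar>form_b \<Omega> v q\<bar> \<le> nrm (l2_inner \<Omega>) (divg \<Omega> v) * nrm (l2_inner \<Omega>) q"
    using l2.cauchy_schwarz[OF divg_l2(1)[OF v] q] by (simp add: form_b_def)
  also have "\<dots> \<le> (real CARD('d) * nrm grad_form v) * nrm (l2_inner \<Omega>) q"
    by (intro mult_right_mono divg_l2(2)[OF v] l2.nrm_nonneg q)
  finally show ?thesis by (simp add: mult.assoc)
qed

lemma form_b_bound_sob:
  assumes v: "v \<in> sobolev \<Omega> 1" and q: "q \<in> l2_space \<Omega>"
  shows "\<bar>form_b \<Omega> v q\<bar> \<le> (real CARD('d) * nrm (l2_inner \<Omega>) q) * nrm (sob_inner 1) v"
proof -
  note form_b_bound[OF v q]
  also have "real CARD('d) * (nrm grad_form v * nrm (l2_inner \<Omega>) q) \<le> real CARD('d) * (nrm (sob_inner 1) v * nrm (l2_inner \<Omega>) q)"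
    by (intro mult_left_mono mult_right_mono a_le_sob v l2.nrm_nonneg q) auto
  finally show ?thesis by (simp only: mult_ac)
qed

lemma laplacian_eq: "laplacian \<Omega> u = (\<Sum>i\<in>UNIV. weak_deriv \<Omega> [i, i] u)"
  by (simp add: fun_eq_iff laplacian_def sum_fun_apply)

lemma weak_deriv2_l2:
  fixes v :: "real^'d \<Rightarrow> 'b::euclidean_space"
  shows "v \<in> sobolev \<Omega> 2 \<Longrightarrow> weak_deriv \<Omega> [i, j] v \<in> l2_space \<Omega>"
  by (rule sobolev_weak_deriv(2)) auto

lemma laplacian_l2: "u \<in> sobolev \<Omega> 2 \<Longrightarrow> laplacian \<Omega> u \<in> l2_space \<Omega>"
  unfolding laplacian_eq by (intro subspace_sum[OF l2.subspace] weak_deriv2_l2)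

lemma second_weak_deriv:
  fixes v :: "real^'d \<Rightarrow> 'b::euclidean_space"
  assumes "v \<in> sobolev \<Omega> 2"
  shows "has_weak_deriv \<Omega> [j] (weak_deriv \<Omega> [i] v) (weak_deriv \<Omega> [i, j] v)"
  using weak_deriv_weak_deriv[OF assms, of "[i]" "[j]"] by simp

lemma laplacian_green:
  assumes u: "u \<in> sobolev \<Omega> 2" and v: "v \<in> sobolev10 \<Omega>"
  shows "l2_inner \<Omega> (laplacian \<Omega> u) v = - grad_form u v"
proof -
  have u1: "u \<in> sobolev \<Omega> 1" by (rule sobolev_mono[OF _ u]) simp
  have "l2_inner \<Omega> (laplacian \<Omega> u) v + grad_form u v = 0"
  proof (rule vanishing_by_density[where L = "\<lambda>v. l2_inner \<Omega> (laplacian \<Omega> u) v + grad_form u v", OF _ _ _ v])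
    fix v w :: "real^'d \<Rightarrow> real^'d" assume s: "v \<in> sobolev \<Omega> 1" "w \<in> sobolev \<Omega> 1"
    show "l2_inner \<Omega> (laplacian \<Omega> u) (v - w) + grad_form u (v - w) =
      l2_inner \<Omega> (laplacian \<Omega> u) v + grad_form u v - (l2_inner \<Omega> (laplacian \<Omega> u) w + grad_form u w)"
      by (simp add: l2.diff_right[OF sobolev_l2[OF s(1)] sobolev_l2[OF s(2)] laplacian_l2[OF u]] a.diff_right[OF s u1])
  next
    fix v :: "real^'d \<Rightarrow> real^'d" assume s: "v \<in> sobolev \<Omega> 1"
    have "\<bar>l2_inner \<Omega> (laplacian \<Omega> u) v + grad_form u v\<bar> \<le> nrm (l2_inner \<Omega>) (laplacian \<Omega> u) * nrm (l2_inner \<Omega>) v + nrm grad_form u * nrm grad_form v"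
      using l2.cauchy_schwarz[OF laplacian_l2[OF u] sobolev_l2[OF s]] a.cauchy_schwarz[OF u1 s] by linarith
    also have "\<dots> \<le> nrm (l2_inner \<Omega>) (laplacian \<Omega> u) * nrm (sob_inner 1) v + nrm grad_form u * nrm (sob_inner 1) v"
      by (intro add_mono mult_left_mono l2_norm_le_sob a_le_sob s l2.nrm_nonneg laplacian_l2 u a.nrm_nonneg u1)
    finally show "\<bar>l2_inner \<Omega> (laplacian \<Omega> u) v + grad_form u v\<bar> \<le> (nrm (l2_inner \<Omega>) (laplacian \<Omega> u) + nrm grad_form u) * nrm (sob_inner 1) v"
      by (simp add: algebra_simps)
  next
    fix \<phi> :: "real^'d \<Rightarrow> real^'d" assume \<phi>: "\<phi> \<in> test_functions \<Omega>"
    have "l2_inner \<Omega> (laplacian \<Omega> u) \<phi> = (\<Sum>i\<in>UNIV. l2_inner \<Omega> (weak_deriv \<Omega> [i, i] u) \<phi>)"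
      unfolding laplacian_eq by (intro l2.sum_left weak_deriv2_l2 u test_fn_l2 \<phi>) simp
    also have "\<dots> = (\<Sum>i\<in>UNIV. - l2_inner \<Omega> (weak_deriv \<Omega> [i] u) (weak_deriv \<Omega> [i] \<phi>))"
    proof (rule sum.cong[OF refl])
      fix i :: 'd
      have "l2_inner \<Omega> (weak_deriv \<Omega> [i] u) (weak_deriv \<Omega> [i] \<phi>) = l2_inner \<Omega> (weak_deriv \<Omega> [i] u) (partials [i] \<phi>)"
        by (rule l2_inner_ae_eq[OF weak_deriv1_l2[OF u1] ae_eq_refl weak_deriv1_l2[OF test_fn_sobolev[OF \<phi>]] test_fn_weak_deriv_eq[OF \<phi>]])
      then show "l2_inner \<Omega> (weak_deriv \<Omega> [i, i] u) \<phi> = - l2_inner \<Omega> (weak_deriv \<Omega> [i] u) (weak_deriv \<Omega> [i] \<phi>)"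
        using weak_deriv_pairing[OF second_weak_deriv[OF u, of i i] weak_deriv1_l2[OF u1] weak_deriv2_l2[OF u] \<phi>] by simp
    qed
    finally show "l2_inner \<Omega> (laplacian \<Omega> u) \<phi> + grad_form u \<phi> = 0" by (simp add: grad_form_sum sum_negf)
  qed
  then show ?thesis by simp
qed

lemma grad_s_eq: "grad_s \<Omega> q = (\<Sum>i\<in>UNIV. (\<lambda>x. weak_deriv \<Omega> [i] q x *\<^sub>R axis i 1))"
  by (simp add: fun_eq_iff grad_s_def sum_fun_apply vec_eq_iff axis_def if_distrib cong: if_cong)

lemma grad_s_l2: "q \<in> sobolev \<Omega> 1 \<Longrightarrow> grad_s \<Omega> q \<in> l2_space \<Omega>"
  unfolding grad_s_eq by (intro subspace_sum[OF l2.subspace] scaled_axis_l2 weak_deriv1_l2)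

lemma component_test_fn:
  fixes \<phi> :: "real^'d \<Rightarrow> real^'d"
  assumes \<phi>: "\<phi> \<in> test_functions \<Omega>"
  shows "(\<lambda>x. \<phi> x $ i) \<in> test_functions \<Omega>" "partials is (\<lambda>x. \<phi> x $ i) = (\<lambda>x. partials is \<phi> x $ i)"
  by (rule test_fn_linear_image[OF \<phi> bounded_linear_vec_nth] partials_linear_image[OF \<phi> bounded_linear_vec_nth])+

lemma divg_test_fn:
  assumes \<phi>: "\<phi> \<in> test_functions \<Omega>"
  shows "ae_eq \<Omega> (divg \<Omega> \<phi>) (\<Sum>i\<in>UNIV. partials [i] (\<lambda>x. \<phi> x $ i))"
  unfolding divg_eq component_test_fn(2)[OF \<phi>]
  by (rule ae_eq_sum[OF finite]) (rule ae_eq_apply[OF test_fn_weak_deriv_eq[OF \<phi>]])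

lemma l2_inner_divg_test_fn:
  assumes \<phi>: "\<phi> \<in> test_functions \<Omega>" and q: "q \<in> l2_space \<Omega>"
  shows "l2_inner \<Omega> q (divg \<Omega> \<phi>) = (\<Sum>i\<in>UNIV. l2_inner \<Omega> q (partials [i] (\<lambda>x. \<phi> x $ i)))"
proof -
  have p: "partials [i] (\<lambda>x. \<phi> x $ i) \<in> l2_space \<Omega>" for i by (intro test_fn_l2 test_fn_partials component_test_fn \<phi>)
  have "l2_inner \<Omega> q (divg \<Omega> \<phi>) = l2_inner \<Omega> q (\<Sum>i\<in>UNIV. partials [i] (\<lambda>x. \<phi> x $ i))"
    by (rule l2_inner_ae_eq[OF q ae_eq_refl divg_l2(1)[OF test_fn_sobolev[OF \<phi>]] divg_test_fn[OF \<phi>]])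
  also have "\<dots> = (\<Sum>i\<in>UNIV. l2_inner \<Omega> q (partials [i] (\<lambda>x. \<phi> x $ i)))"
    by (intro l2.sum_right p q) simp
  finally show ?thesis .
qed

lemma gradient_green:
  assumes q: "q \<in> sobolev \<Omega> 1" and v: "v \<in> sobolev10 \<Omega>"
  shows "l2_inner \<Omega> (grad_s \<Omega> q) v = form_b \<Omega> v q"
proof -
  note ql = sobolev_l2[OF q]
  have "l2_inner \<Omega> (grad_s \<Omega> q) v - form_b \<Omega> v q = 0"
  proof (rule vanishing_by_density[where L = "\<lambda>v. l2_inner \<Omega> (grad_s \<Omega> q) v - form_b \<Omega> v q", OF _ _ _ v])
    fix v w :: "real^'d \<Rightarrow> real^'d" assume s: "v \<in> sobolev \<Omega> 1" "w \<in> sobolev \<Omega> 1"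
    show "l2_inner \<Omega> (grad_s \<Omega> q) (v - w) - form_b \<Omega> (v - w) q =
      l2_inner \<Omega> (grad_s \<Omega> q) v - form_b \<Omega> v q - (l2_inner \<Omega> (grad_s \<Omega> q) w - form_b \<Omega> w q)"
      by (simp add: l2.diff_right[OF sobolev_l2[OF s(1)] sobolev_l2[OF s(2)] grad_s_l2[OF q]] form_b_diff[OF s ql])
  next
    fix v :: "real^'d \<Rightarrow> real^'d" assume s: "v \<in> sobolev \<Omega> 1"
    have "\<bar>l2_inner \<Omega> (grad_s \<Omega> q) v - form_b \<Omega> v q\<bar> \<le> nrm (l2_inner \<Omega>) (grad_s \<Omega> q) * nrm (l2_inner \<Omega>) v + (real CARD('d) * nrm (l2_inner \<Omega>) q) * nrm (sob_inner 1) v"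
      using l2.cauchy_schwarz[OF grad_s_l2[OF q] sobolev_l2[OF s]] form_b_bound_sob[OF s ql] by linarith
    also have "\<dots> \<le> nrm (l2_inner \<Omega>) (grad_s \<Omega> q) * nrm (sob_inner 1) v + (real CARD('d) * nrm (l2_inner \<Omega>) q) * nrm (sob_inner 1) v"
      by (intro add_right_mono mult_left_mono l2_norm_le_sob s l2.nrm_nonneg grad_s_l2 q)
    finally show "\<bar>l2_inner \<Omega> (grad_s \<Omega> q) v - form_b \<Omega> v q\<bar> \<le> (nrm (l2_inner \<Omega>) (grad_s \<Omega> q) + real CARD('d) * nrm (l2_inner \<Omega>) q) * nrm (sob_inner 1) v"
      by (simp add: algebra_simps)
  next
    fix \<phi> :: "real^'d \<Rightarrow> real^'d" assume \<phi>: "\<phi> \<in> test_functions \<Omega>"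
    have "l2_inner \<Omega> (grad_s \<Omega> q) \<phi> = (\<Sum>i\<in>UNIV. l2_inner \<Omega> (\<lambda>x. weak_deriv \<Omega> [i] q x *\<^sub>R axis i 1) \<phi>)"
      unfolding grad_s_eq by (intro l2.sum_left scaled_axis_l2 weak_deriv1_l2 q test_fn_l2 \<phi>) simp
    also have "\<dots> = (\<Sum>i\<in>UNIV. - l2_inner \<Omega> q (partials [i] (\<lambda>x. \<phi> x $ i)))"
    proof (rule sum.cong[OF refl])
      fix i :: 'd
      have "l2_inner \<Omega> (\<lambda>x. weak_deriv \<Omega> [i] q x *\<^sub>R axis i 1) \<phi> = l2_inner \<Omega> (weak_deriv \<Omega> [i] q) (\<lambda>x. \<phi> x $ i)"
        by (simp add: l2_inner_def inner_axis')
      moreover have "l2_inner \<Omega> q (partials [i] (\<lambda>x. \<phi> x $ i)) = (-1) ^ length [i] * l2_inner \<Omega> (weak_deriv \<Omega> [i] q) (\<lambda>x. \<phi> x $ i)"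
        by (rule weak_deriv_pairing[OF sobolev_weak_deriv(1)[OF q] ql weak_deriv1_l2[OF q] component_test_fn(1)[OF \<phi>]]) simp
      ultimately show "l2_inner \<Omega> (\<lambda>x. weak_deriv \<Omega> [i] q x *\<^sub>R axis i 1) \<phi> = - l2_inner \<Omega> q (partials [i] (\<lambda>x. \<phi> x $ i))" by simp
    qed
    also have "\<dots> = - l2_inner \<Omega> q (divg \<Omega> \<phi>)" by (simp only: l2_inner_divg_test_fn[OF \<phi> ql] sum_negf)
    finally show "l2_inner \<Omega> (grad_s \<Omega> q) \<phi> - form_b \<Omega> \<phi> q = 0"
      using l2.sym[OF ql divg_l2(1)[OF test_fn_sobolev[OF \<phi>]]] by (simp add: form_b_def)
  qed
  then show ?thesis by simp
qed

lemma has_weak_deriv_zero: "has_weak_deriv \<Omega> is (\<lambda>x. 0::'b::euclidean_space) (\<lambda>x. 0)"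
  by (simp add: has_weak_deriv_def locally_integrable_def set_integrable_def)

lemma has_weak_deriv_sum:
  fixes w g :: "'i \<Rightarrow> real^'d \<Rightarrow> 'b::euclidean_space"
  assumes "finite I" "\<And>i. i \<in> I \<Longrightarrow> has_weak_deriv \<Omega> is (w i) (g i)"
  shows "has_weak_deriv \<Omega> is (\<Sum>i\<in>I. w i) (\<Sum>i\<in>I. g i)"
  using assms
proof (induction I rule: finite_induct)
  case empty
  show ?case using has_weak_deriv_zero by (simp add: zero_fun_def)
next
  case (insert i I)
  then have "has_weak_deriv \<Omega> is (w i) (g i)" "has_weak_deriv \<Omega> is (\<Sum>i\<in>I. w i) (\<Sum>i\<in>I. g i)" by auto
  from has_weak_deriv_comb[OF this, of 1 1] show ?case using insert by (simp add: plus_fun_def)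
qed

lemma has_weak_deriv_scaled_axis:
  fixes w :: "real^'d \<Rightarrow> real"
  assumes d: "has_weak_deriv \<Omega> is w g" and l: "w \<in> l2_space \<Omega>" "g \<in> l2_space \<Omega>"
  shows "has_weak_deriv \<Omega> is (\<lambda>x. w x *\<^sub>R axis i 1 :: real^'d) (\<lambda>x. g x *\<^sub>R axis i 1)"
  unfolding has_weak_deriv_def
proof (intro conjI allI impI)
  show "locally_integrable \<Omega> (\<lambda>x. w x *\<^sub>R axis i 1 :: real^'d)" "locally_integrable \<Omega> (\<lambda>x. g x *\<^sub>R axis i 1 :: real^'d)"
    by (intro l2_locally_integrable scaled_axis_l2 l)+
  fix \<phi> :: "real^'d \<Rightarrow> real" assume \<phi>: "\<phi> \<in> test_functions \<Omega>"
  have e: "(LINT x|lebesgue_on \<Omega>. \<psi> x *\<^sub>R (w' x *\<^sub>R axis i 1 :: real^'d)) = (LINT x|lebesgue_on \<Omega>. \<psi> x *\<^sub>R w' x) *\<^sub>R axis i 1"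
    if "\<psi> \<in> test_functions \<Omega>" "w' \<in> l2_space \<Omega>" for \<psi> w' :: "real^'d \<Rightarrow> real"
    using integral_scaleR_left[OF test_integrable[OF that(1) l2_locally_integrable[OF that(2)]], of "axis i 1 :: real^'d"] by simp
  show "(LINT x|lebesgue_on \<Omega>. partials is \<phi> x *\<^sub>R (w x *\<^sub>R axis i 1 :: real^'d)) =
      (-1) ^ length is *\<^sub>R (LINT x|lebesgue_on \<Omega>. \<phi> x *\<^sub>R (g x *\<^sub>R axis i 1))"
    unfolding e[OF test_fn_partials[OF \<phi>] l(1)] e[OF \<phi> l(2)] using d \<phi> by (simp add: has_weak_deriv_def)
qed

lemma grad_s_weak_deriv:
  assumes p: "p \<in> sobolev \<Omega> m" and l: "length is < m"
  shows "has_weak_deriv \<Omega> is (grad_s \<Omega> p) (\<Sum>i\<in>UNIV. (\<lambda>x. weak_deriv \<Omega> (i # is) p x *\<^sub>R axis i 1))"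
  unfolding grad_s_eq
proof (rule has_weak_deriv_sum)
  fix i :: 'd
  show "has_weak_deriv \<Omega> is (\<lambda>x. weak_deriv \<Omega> [i] p x *\<^sub>R axis i 1 :: real^'d) (\<lambda>x. weak_deriv \<Omega> (i # is) p x *\<^sub>R axis i 1)"
    using weak_deriv_weak_deriv[OF p, of "[i]" "is"] l sobolev_weak_deriv(2)[OF p, of "[i]"] sobolev_weak_deriv(2)[OF p, of "i # is"]
    by (intro has_weak_deriv_scaled_axis) auto
qed simp

lemma grad_s_sobolev:
  assumes p: "p \<in> sobolev \<Omega> (Suc m)"
  shows "grad_s \<Omega> p \<in> sobolev \<Omega> m"
  unfolding sobolev_def
proof (intro CollectI conjI allI impI)
  show "grad_s \<Omega> p \<in> l2_space \<Omega>" by (rule grad_s_l2[OF sobolev_mono[OF _ p]]) simp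
  fix "is" :: "'d list" assume l: "length is \<le> m"
  then show "\<exists>g\<in>l2_space \<Omega>. has_weak_deriv \<Omega> is (grad_s \<Omega> p) g"
    using grad_s_weak_deriv[OF p, of "is"] sobolev_weak_deriv(2)[OF p]
    by (intro bexI[of _ "\<Sum>i\<in>UNIV. (\<lambda>x. weak_deriv \<Omega> (i # is) p x *\<^sub>R axis i 1)"] subspace_sum[OF l2.subspace] scaled_axis_l2) auto
qed

lemma weak_deriv_commute:
  fixes v :: "real^'d \<Rightarrow> 'b::euclidean_space"
  shows "weak_deriv \<Omega> [i, j] v = weak_deriv \<Omega> [j, i] v"
proof -
  have "has_weak_deriv \<Omega> [i, j] v = has_weak_deriv \<Omega> [j, i] v"
    unfolding has_weak_deriv_def fun_eq_iff using partials_commute[of _ \<Omega> i j] by (simp del: partials.simps)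
  then show ?thesis by (simp add: weak_deriv_def)
qed

definition laplacian_s :: "(real^'d \<Rightarrow> real) \<Rightarrow> real^'d \<Rightarrow> real" where
  "laplacian_s p = (\<Sum>j\<in>UNIV. weak_deriv \<Omega> [j, j] p)"

lemma laplacian_s_sobolev: "p \<in> sobolev \<Omega> (m + 2) \<Longrightarrow> laplacian_s p \<in> sobolev \<Omega> m"
  unfolding laplacian_s_def
  by (intro subspace_sum[OF subspace_sobolev] weak_deriv_sobolev[of _ "m + 2"]) auto

text \<open>
  For a test function both sides equal \<open>\<Sum>\<^sub>i\<^sub>j \<langle>\<partial>\<^sub>j\<partial>\<^sub>i p, \<partial>\<^sub>j \<phi>\<^sub>i\<rangle>\<close> after one index is moved by the symmetry of
  second derivatives. The point is that no boundary term appears although \<open>\<nabla>p\<close> does not vanish on the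
  boundary: the vanishing trace of \<open>v\<close> is used twice.
\<close>

lemma hessian_green:
  assumes p: "p \<in> sobolev \<Omega> 2" and v: "v \<in> sobolev10 \<Omega>"
  shows "grad_form (grad_s \<Omega> p) v = l2_inner \<Omega> (laplacian_s p) (divg \<Omega> v)"
proof -
  have G: "grad_s \<Omega> p \<in> sobolev \<Omega> 1" using grad_s_sobolev[of p 1] p by (simp add: numeral_2_eq_2)
  have p1: "p \<in> sobolev \<Omega> 1" by (rule sobolev_mono[OF _ p]) simp
  have lap: "laplacian_s p \<in> l2_space \<Omega>" unfolding laplacian_s_def by (intro subspace_sum[OF l2.subspace] weak_deriv2_l2 p)
  have "grad_form (grad_s \<Omega> p) v - l2_inner \<Omega> (laplacian_s p) (divg \<Omega> v) = 0"
  proof (rule vanishing_by_density[where L = "\<lambda>v. grad_form (grad_s \<Omega> p) v - l2_inner \<Omega> (laplacian_s p) (divg \<Omega> v)", OF _ _ _ v])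
    have b: "l2_inner \<Omega> (laplacian_s p) (divg \<Omega> v) = - form_b \<Omega> v (laplacian_s p)" if "v \<in> sobolev \<Omega> 1" for v
      using l2.sym[OF lap divg_l2(1)[OF that]] by (simp add: form_b_def)
    {
      fix v w :: "real^'d \<Rightarrow> real^'d" assume s: "v \<in> sobolev \<Omega> 1" "w \<in> sobolev \<Omega> 1"
      show "grad_form (grad_s \<Omega> p) (v - w) - l2_inner \<Omega> (laplacian_s p) (divg \<Omega> (v - w)) =
        grad_form (grad_s \<Omega> p) v - l2_inner \<Omega> (laplacian_s p) (divg \<Omega> v) - (grad_form (grad_s \<Omega> p) w - l2_inner \<Omega> (laplacian_s p) (divg \<Omega> w))"
        using s by (simp add: b sob.mem_simps(3) a.diff_right[OF s G] form_b_diff[OF s lap])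
    next
      fix v :: "real^'d \<Rightarrow> real^'d" assume s: "v \<in> sobolev \<Omega> 1"
      have "\<bar>grad_form (grad_s \<Omega> p) v - l2_inner \<Omega> (laplacian_s p) (divg \<Omega> v)\<bar> \<le> nrm grad_form (grad_s \<Omega> p) * nrm grad_form v + (real CARD('d) * nrm (l2_inner \<Omega>) (laplacian_s p)) * nrm (sob_inner 1) v"
        using a.cauchy_schwarz[OF G s] form_b_bound_sob[OF s lap] b[OF s] by linarith
      also have "\<dots> \<le> nrm grad_form (grad_s \<Omega> p) * nrm (sob_inner 1) v + (real CARD('d) * nrm (l2_inner \<Omega>) (laplacian_s p)) * nrm (sob_inner 1) v"
        by (intro add_right_mono mult_left_mono a_le_sob s a.nrm_nonneg G)
      finally show "\<bar>grad_form (grad_s \<Omega> p) v - l2_inner \<Omega> (laplacian_s p) (divg \<Omega> v)\<bar> \<le> (nrm grad_form (grad_s \<Omega> p) + real CARD('d) * nrm (l2_inner \<Omega>) (laplacian_s p)) * nrm (sob_inner 1) v"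
        by (simp add: algebra_simps)
    }
    fix \<phi> :: "real^'d \<Rightarrow> real^'d" assume \<phi>: "\<phi> \<in> test_functions \<Omega>"
    note comp = component_test_fn(1)[OF \<phi>]
    have t: "partials is (\<lambda>x. \<phi> x $ i) \<in> l2_space \<Omega>" for i "is" by (intro test_fn_l2 test_fn_partials comp)
    have swap: "l2_inner \<Omega> (weak_deriv \<Omega> [i, j] p) (partials [j] (\<lambda>x. \<phi> x $ i)) = l2_inner \<Omega> (weak_deriv \<Omega> [j, j] p) (partials [i] (\<lambda>x. \<phi> x $ i))" for i j
    proof -
      have "l2_inner \<Omega> (weak_deriv \<Omega> [j] p) (partials [i] (partials [j] (\<lambda>x. \<phi> x $ i))) = (-1) ^ length [i] * l2_inner \<Omega> (weak_deriv \<Omega> [j, i] p) (partials [j] (\<lambda>x. \<phi> x $ i))"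
        by (rule weak_deriv_pairing[OF second_weak_deriv[OF p] weak_deriv1_l2[OF p1] weak_deriv2_l2[OF p] test_fn_partials[OF comp]])
      moreover have "l2_inner \<Omega> (weak_deriv \<Omega> [j] p) (partials [j] (partials [i] (\<lambda>x. \<phi> x $ i))) = (-1) ^ length [j] * l2_inner \<Omega> (weak_deriv \<Omega> [j, j] p) (partials [i] (\<lambda>x. \<phi> x $ i))"
        by (rule weak_deriv_pairing[OF second_weak_deriv[OF p] weak_deriv1_l2[OF p1] weak_deriv2_l2[OF p] test_fn_partials[OF comp]])
      moreover have "partials [i] (partials [j] (\<lambda>x. \<phi> x $ i)) = partials [j] (partials [i] (\<lambda>x. \<phi> x $ i))"
        using partials_commute[OF comp, of i j i] by (simp only: partials_append[symmetric] append.simps)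
      ultimately show ?thesis unfolding weak_deriv_commute[of i j p] by simp
    qed
    have "l2_inner \<Omega> (weak_deriv \<Omega> [j] (grad_s \<Omega> p)) (weak_deriv \<Omega> [j] \<phi>) = (\<Sum>i\<in>UNIV. l2_inner \<Omega> (weak_deriv \<Omega> [j, j] p) (partials [i] (\<lambda>x. \<phi> x $ i)))" for j
    proof -
      have "l2_inner \<Omega> (weak_deriv \<Omega> [j] (grad_s \<Omega> p)) (weak_deriv \<Omega> [j] \<phi>) =
          l2_inner \<Omega> (\<Sum>i\<in>UNIV. (\<lambda>x. weak_deriv \<Omega> [i, j] p x *\<^sub>R axis i 1)) (partials [j] \<phi>)"
        by (rule l2_inner_ae_eq[OF weak_deriv1_l2[OF G] weak_deriv_eqI[OF grad_s_weak_deriv[OF p]] weak_deriv1_l2[OF test_fn_sobolev[OF \<phi>]] test_fn_weak_deriv_eq[OF \<phi>]])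
           simp
      also have "\<dots> = (\<Sum>i\<in>UNIV. l2_inner \<Omega> (\<lambda>x. weak_deriv \<Omega> [i, j] p x *\<^sub>R axis i 1) (partials [j] \<phi>))"
        by (intro l2.sum_left scaled_axis_l2 weak_deriv2_l2 p test_fn_l2 test_fn_partials \<phi>) simp
      also have "\<dots> = (\<Sum>i\<in>UNIV. l2_inner \<Omega> (weak_deriv \<Omega> [i, j] p) (partials [j] (\<lambda>x. \<phi> x $ i)))"
        unfolding component_test_fn(2)[OF \<phi>] by (simp add: l2_inner_def inner_axis' del: partials.simps)
      also have "\<dots> = (\<Sum>i\<in>UNIV. l2_inner \<Omega> (weak_deriv \<Omega> [j, j] p) (partials [i] (\<lambda>x. \<phi> x $ i)))"
        by (intro sum.cong refl swap)
      finally show ?thesis .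
    qed
    then have "grad_form (grad_s \<Omega> p) \<phi> = (\<Sum>j\<in>UNIV. \<Sum>i\<in>UNIV. l2_inner \<Omega> (weak_deriv \<Omega> [j, j] p) (partials [i] (\<lambda>x. \<phi> x $ i)))"
      by (simp only: grad_form_sum)
    also have "\<dots> = (\<Sum>i\<in>UNIV. l2_inner \<Omega> (laplacian_s p) (partials [i] (\<lambda>x. \<phi> x $ i)))"
      unfolding laplacian_s_def by (subst sum.swap) (intro sum.cong refl l2.sum_left[symmetric] weak_deriv2_l2 p t, simp)
    also have "\<dots> = l2_inner \<Omega> (laplacian_s p) (divg \<Omega> \<phi>)" by (simp only: l2_inner_divg_test_fn[OF \<phi> lap])
    finally show "grad_form (grad_s \<Omega> p) \<phi> - l2_inner \<Omega> (laplacian_s p) (divg \<Omega> \<phi>) = 0" by simp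
  qed
  then show ?thesis by simp
qed

end

section \<open>Finite element spaces\<close>

lemma spanned_modI:
  fixes e :: "'j \<Rightarrow> 'a::real_vector"
  assumes J: "finite J" and span: "\<And>x. x \<in> S \<Longrightarrow> \<exists>c. x - (\<Sum>j\<in>J. c j *\<^sub>R e j) \<in> N"
  shows "spanned_mod N S"
proof -
  obtain h where h: "bij_betw h {0..<card J} J" using ex_bij_betw_nat_finite[OF J] by blast
  have "\<exists>c. x - (\<Sum>n\<in>{0..<card J}. c n *\<^sub>R e (h n)) \<in> N" if x: "x \<in> S" for x
  proof -
    obtain c where "x - (\<Sum>j\<in>J. c j *\<^sub>R e j) \<in> N" using span[OF x] by blast
    moreover have "(\<Sum>n\<in>{0..<card J}. c (h n) *\<^sub>R e (h n)) = (\<Sum>j\<in>J. c j *\<^sub>R e j)"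
      by (rule sum.reindex_bij_betw[OF h])
    ultimately show ?thesis by (intro exI[of _ "\<lambda>n. c (h n)"]) simp
  qed
  then show ?thesis unfolding spanned_mod_def
    by (intro exI[of _ "{0..<card J}"] exI[of _ "\<lambda>n. e (h n)"]) auto
qed

lemma finite_exponents: "finite {\<alpha> :: 'd::finite \<Rightarrow> nat. (\<Sum>i\<in>UNIV. \<alpha> i) \<le> m}"
proof (rule finite_subset)
  show "{\<alpha> :: 'd \<Rightarrow> nat. (\<Sum>i\<in>UNIV. \<alpha> i) \<le> m} \<subseteq> PiE UNIV (\<lambda>_. {..m})"
  proof
    fix \<alpha> :: "'d \<Rightarrow> nat" assume "\<alpha> \<in> {\<alpha>. (\<Sum>i\<in>UNIV. \<alpha> i) \<le> m}"
    then have "\<alpha> i \<le> m" for i using member_le_sum[of i UNIV \<alpha>] by simp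
    then show "\<alpha> \<in> PiE UNIV (\<lambda>_. {..m})" by auto
  qed
qed (auto intro: finite_PiE)

context open_domain
begin

definition null_functions :: "(real^'d \<Rightarrow> 'b::euclidean_space) set" where
  "null_functions = {v. ae_eq \<Omega> v (\<lambda>x. 0)}"

lemma subspace_null_functions: "subspace (null_functions :: (real^'d \<Rightarrow> 'b::euclidean_space) set)"
proof (rule subspaceI)
  show "0 \<in> (null_functions :: (real^'d \<Rightarrow> 'b) set)" by (simp add: null_functions_def zero_fun_def)
  fix v w :: "real^'d \<Rightarrow> 'b" assume "v \<in> null_functions" "w \<in> null_functions"
  then show "v + w \<in> null_functions" using ae_eq_comb[of v "\<lambda>x. 0" w "\<lambda>x. 0" "(+)"] by (simp add: null_functions_def plus_fun_def)
next
  fix c and v :: "real^'d \<Rightarrow> 'b" assume "v \<in> null_functions"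
  then show "c *\<^sub>R v \<in> null_functions" using ae_eq_apply[of v "\<lambda>x. 0" "\<lambda>y. c *\<^sub>R y"] by (simp add: null_functions_def scaleR_fun_def)
qed

text \<open>
  The span consists of the mapped monomials of each cell, times basis vectors of the range,
  extended by zero. Almost everywhere on a cell the coefficients of the reference polynomial give
  the value of \<open>v\<close>.
\<close>

lemma piecewise_mapped_poly_spanned:
  fixes L :: "(real^'d) set \<Rightarrow> (real^'d \<Rightarrow> 'b::euclidean_space) set"
  assumes T: "finite T" "\<Omega> \<subseteq> \<Union>T" "\<And>K. K \<in> T \<Longrightarrow> K \<in> sets lebesgue"
    and F: "\<And>K. K \<in> T \<Longrightarrow> F K ` Pr K = K"
    and L: "\<And>K. K \<in> T \<Longrightarrow> mapped_poly_space m (Pr K) (F K) (L K)"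
    and S: "\<And>v K. v \<in> S \<Longrightarrow> K \<in> T \<Longrightarrow> \<exists>w\<in>L K. ae_eq K v w"
  shows "spanned_mod null_functions S"
proof -
  define mono :: "('d \<Rightarrow> nat) \<Rightarrow> real^'d \<Rightarrow> real" where "mono \<alpha> x = (\<Prod>i\<in>UNIV. (x $ i) ^ \<alpha> i)" for \<alpha> x
  define As where "As = {\<alpha> :: 'd \<Rightarrow> nat. (\<Sum>i\<in>UNIV. \<alpha> i) \<le> m}"
  \<comment> \<open>interiors of cells are disjoint, but their boundaries may have positive measure; one cell is selected for each point\<close>
  define cell where "cell y = (SOME K. K \<in> T \<and> y \<in> K)" for y
  define e where "e = (\<lambda>(K, \<alpha>, b) y. if cell y = K then mono \<alpha> (inv_into (Pr K) (F K) y) *\<^sub>R b else (0::'b))"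
  define J where "J = T \<times> As \<times> (Basis :: 'b set)"
  have finJ: "finite J" 
    unfolding J_def As_def by (intro finite_cartesian_product T(1) finite_exponents finite_Basis)
  have cell: "cell y \<in> T" "y \<in> cell y" if "y \<in> \<Omega>" for y
  proof -
    have "\<exists>K. K \<in> T \<and> y \<in> K" using T(2) that by auto
    from someI_ex[OF this] show "cell y \<in> T" "y \<in> cell y" by (simp_all add: cell_def)
  qed
  show ?thesis
  proof (rule spanned_modI[OF finJ, where e = e])
    fix v assume v: "v \<in> S"
    have "\<exists>w c. w \<in> L K \<and> ae_eq K v w \<and> (\<forall>x\<in>Pr K. w (F K x) = (\<Sum>\<alpha>\<in>As. mono \<alpha> x *\<^sub>R c \<alpha>))" if K: "K \<in> T" for K
    proof -
      obtain w where w: "w \<in> L K" "ae_eq K v w" using S[OF v K] by blast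
      obtain w' where "w' \<in> poly_functions m" "\<forall>x\<in>Pr K. w (F K x) = w' x"
        using L[OF K] w(1) by (auto simp: mapped_poly_space_def)
      then show ?thesis using w by (fastforce simp: poly_functions_def As_def mono_def)
    qed
    then obtain w c where w: "\<And>K. K \<in> T \<Longrightarrow> ae_eq K v (w K)"
      and c: "\<And>K x. K \<in> T \<Longrightarrow> x \<in> Pr K \<Longrightarrow> w K (F K x) = (\<Sum>\<alpha>\<in>As. mono \<alpha> x *\<^sub>R c K \<alpha>)" by metis
    have "AE y in lebesgue. \<forall>K\<in>T. y \<in> K \<longrightarrow> v y = w K y"
    proof (rule AE_finite_allI[OF T(1)])
      fix K assume K: "K \<in> T"
      show "AE y in lebesgue. y \<in> K \<longrightarrow> v y = w K y"
        using w[OF K] T(3)[OF K] unfolding ae_eq_def by (subst (asm) AE_restrict_space_iff) auto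
    qed
    then have "AE y in lebesgue. y \<in> \<Omega> \<longrightarrow> (v - (\<Sum>j\<in>J. (case j of (K, \<alpha>, b) \<Rightarrow> c K \<alpha> \<bullet> b) *\<^sub>R e j)) y = 0"
    proof eventually_elim
      fix y assume y: "\<forall>K\<in>T. y \<in> K \<longrightarrow> v y = w K y"
      show "y \<in> \<Omega> \<longrightarrow> (v - (\<Sum>j\<in>J. (case j of (K, \<alpha>, b) \<Rightarrow> c K \<alpha> \<bullet> b) *\<^sub>R e j)) y = 0"
      proof
        assume \<Omega>: "y \<in> \<Omega>"
        define K where "K = cell y"
        have K: "K \<in> T" "y \<in> K" using cell[OF \<Omega>] by (auto simp: K_def)
        define x where "x = inv_into (Pr K) (F K) y"
        have yim: "y \<in> F K ` Pr K" using F[OF K(1)] K(2) by simp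
        have x: "x \<in> Pr K" "F K x = y" unfolding x_def using inv_into_into[OF yim] f_inv_into_f[OF yim] by auto
        have "(\<Sum>j\<in>J. (case j of (K, \<alpha>, b) \<Rightarrow> c K \<alpha> \<bullet> b) *\<^sub>R e j) y
          = (\<Sum>K'\<in>T. \<Sum>\<alpha>\<in>As. \<Sum>b\<in>Basis. (c K' \<alpha> \<bullet> b) *\<^sub>R e (K', \<alpha>, b) y)"
          unfolding J_def sum_fun_apply sum.cartesian_product by (intro sum.cong refl) (auto simp: split_beta)
        also have "\<dots> = (\<Sum>K'\<in>{K}. \<Sum>\<alpha>\<in>As. \<Sum>b\<in>Basis. (c K' \<alpha> \<bullet> b) *\<^sub>R e (K', \<alpha>, b) y)"
        proof (rule sum.mono_neutral_right[OF T(1)])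
          show "\<forall>K'\<in>T - {K}. (\<Sum>\<alpha>\<in>As. \<Sum>b\<in>Basis. (c K' \<alpha> \<bullet> b) *\<^sub>R e (K', \<alpha>, b) y) = 0"
            by (intro ballI sum.neutral) (auto simp: e_def K_def)
        qed (use K(1) in simp)
        also have "\<dots> = (\<Sum>\<alpha>\<in>As. mono \<alpha> x *\<^sub>R (\<Sum>b\<in>Basis. (c K \<alpha> \<bullet> b) *\<^sub>R b))"
          by (simp add: e_def K_def[symmetric] x_def scaleR_sum_right mult.commute)
        also have "\<dots> = w K y" using c[OF K(1) x(1)] x(2) by (simp add: euclidean_representation)
        also have "\<dots> = v y" using y K by simp
        finally show "(v - (\<Sum>j\<in>J. (case j of (K, \<alpha>, b) \<Rightarrow> c K \<alpha> \<bullet> b) *\<^sub>R e j)) y = 0" by simp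
      qed
    qed
    then have "v - (\<Sum>j\<in>J. (case j of (K, \<alpha>, b) \<Rightarrow> c K \<alpha> \<bullet> b) *\<^sub>R e j) \<in> null_functions"
      by (simp add: null_functions_def ae_eq_iff)
    then show "\<exists>c. v - (\<Sum>j\<in>J. c j *\<^sub>R e j) \<in> null_functions" by blast
  qed
qed

end

text \<open>
  Cells are continuous images of polytopes and hence compact, in particular measurable.
\<close>

lemma shape_regular_mesh:
  assumes "shape_regular_family \<Omega> \<F>" "D \<in> \<F>"
  shows "mesh_of \<Omega> D" "K \<in> cells D \<Longrightarrow> compact K"
proof -
  show "mesh_of \<Omega> D" using assms by (simp add: shape_regular_family_def)
  assume K: "K \<in> cells D"
  obtain R \<sigma> where R: "\<forall>P\<in>R. polytope P \<and> interior P \<noteq> {}" "\<forall>D\<in>\<F>. \<forall>K\<in>cells D. ref_cell D K \<in> R \<and>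
          (\<exists>F'. (\<forall>v. continuous_on (ref_cell D K) (\<lambda>x. F' x v)) \<and>
             (\<forall>x\<in>ref_cell D K. (cell_map D K has_derivative F' x) (at x within ref_cell D K) \<and>
                (\<forall>v. diameter K / \<sigma> * norm v \<le> norm (F' x v) \<and> norm (F' x v) \<le> \<sigma> * diameter K * norm v)))"
    using assms(1) unfolding shape_regular_family_def by auto
  then have "polytope (ref_cell D K)" "continuous_on (ref_cell D K) (cell_map D K)"
    using assms(2) K by (blast, metis continuous_on_eq_continuous_within has_derivative_continuous)
  then have "compact (cell_map D K ` ref_cell D K)" by (intro compact_continuous_image polytope_imp_compact)
  then show "compact K" using \<open>mesh_of \<Omega> D\<close> K by (simp add: mesh_of_def)
qed

locale stokes_domain = open_domain \<Omega> for \<Omega> :: "(real^'d) set" +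
  assumes bounded_Omega: "bounded \<Omega>" and nonempty_Omega: "\<Omega> \<noteq> {}"
begin

lemma Omega_lmeasurable: "\<Omega> \<in> lmeasurable"
  using bounded_Omega open_Omega by (simp add: lmeasurable_open)

lemma measure_Omega_pos: "measure lebesgue \<Omega> > 0"
  using open_Omega nonempty_Omega Omega_lmeasurable
  by (metis completion.complete_measure_axioms measure_nonneg negligible_iff_measure0 open_not_negligible order_le_less)

lemma const_l2: "(\<lambda>x. c :: real) \<in> l2_space \<Omega>"
proof -
  have "integrable lebesgue (\<lambda>x. indicator \<Omega> x *\<^sub>R (norm c)\<^sup>2)"
    using Omega_lmeasurable by (auto simp: fmeasurable_def integrable_indicator_iff)
  then show ?thesis by (simp add: l2_space_def integrable_on_iff)
qed

text \<open>
  The integral of a partial derivative of a test function vanishes.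
\<close>

lemma const_weak_deriv: "has_weak_deriv \<Omega> (i # is) (\<lambda>x. c :: real) (\<lambda>x. 0)"
  unfolding has_weak_deriv_def
proof (intro conjI allI impI)
  show "locally_integrable \<Omega> (\<lambda>x. c)" by (intro l2_locally_integrable const_l2)
  show "locally_integrable \<Omega> (\<lambda>x. 0::real)" by (intro l2_locally_integrable const_l2)
  fix \<phi> :: "real^'d \<Rightarrow> real" assume "\<phi> \<in> test_functions \<Omega>"
  then have t: "partials is \<phi> \<in> test_functions \<Omega>" by (rule test_fn_partials)
  define \<psi> where "\<psi> = partials is \<phi>"
  define S where "S = closure {x. \<psi> x \<noteq> 0}"
  have K: "compact S" using t by (simp add: S_def \<psi>_def test_functions_def)
  have 0: "\<psi> x = 0" if "x \<notin> S" for x using partials_outside_support[OF that[unfolded S_def], of "[]"] by simp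
  have c: "continuous_on UNIV (partials [i] \<psi>)" unfolding \<psi>_def by (rule test_fn_continuous[OF t])
  have "(LINT x|lborel. frechet_derivative \<psi> (at x) (axis i 1)) = 0"
  proof (rule integral_partial_derivative_eq_0[OF _ _ K 0])
    show "(\<psi> has_derivative frechet_derivative \<psi> (at x)) (at x)" for x
      using test_fn_has_derivative[OF t, of "[]"] by (simp add: \<psi>_def)
  qed (use c in auto)
  moreover have "(LINT x|lebesgue_on \<Omega>. partials [i] \<psi> x) = (LINT x|lborel. partials [i] \<psi> x)"
    using test_fn_outside[OF t, of _ "[i]"] by (intro integral_Omega_eq c) (simp add: \<psi>_def)
  ultimately have "(LINT x|lebesgue_on \<Omega>. partials (i # is) \<phi> x) = 0" by (simp add: \<psi>_def)
  then show "(LINT x|lebesgue_on \<Omega>. partials (i # is) \<phi> x *\<^sub>R c) = (-1) ^ length (i # is) *\<^sub>R (LINT x|lebesgue_on \<Omega>. \<phi> x *\<^sub>R 0)"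
    by simp
qed

lemma const_sobolev: "(\<lambda>x. c :: real) \<in> sobolev \<Omega> m"
  unfolding sobolev_def
proof (intro CollectI conjI allI impI const_l2)
  fix "is" :: "'d list"
  show "\<exists>g\<in>l2_space \<Omega>. has_weak_deriv \<Omega> is (\<lambda>x. c) g"
    using const_l2[of c] const_l2[of 0] const_weak_deriv has_weak_deriv_Nil[OF l2_locally_integrable[OF const_l2[of c]]]
    by (cases "is") blast+
qed

text \<open>
  A constant is orthogonal to the divergence of functions with zero boundary values; it may be
  subtracted from a pressure without effect on the equations.
\<close>

lemma form_b_const:
  assumes v: "v \<in> sobolev10 \<Omega>"
  shows "form_b \<Omega> v (\<lambda>x. c) = 0"
proof -
  have "ae_eq \<Omega> (\<lambda>x. weak_deriv \<Omega> [i] (\<lambda>x. c) x *\<^sub>R axis i 1 :: real^'d) (\<lambda>x. (0::real) *\<^sub>R axis i 1)" for i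
    by (rule ae_eq_apply[OF weak_deriv_eqI[OF const_weak_deriv]])
  then have "ae_eq \<Omega> (grad_s \<Omega> (\<lambda>x. c)) (\<Sum>i\<in>(UNIV::'d set). (\<lambda>x. (0::real) *\<^sub>R axis i 1))"
    unfolding grad_s_eq by (intro ae_eq_sum) auto
  then have "ae_eq \<Omega> (grad_s \<Omega> (\<lambda>x. c)) 0" by (simp add: zero_fun_def[symmetric])
  then have "l2_inner \<Omega> (grad_s \<Omega> (\<lambda>x. c)) v = l2_inner \<Omega> 0 v"
    by (intro l2_inner_ae_eq grad_s_l2 const_sobolev sobolev_l2[OF sobolev10_sobolev[OF v]] ae_eq_refl)
  also have "\<dots> = 0" by (simp add: l2_inner_def)
  finally show ?thesis using gradient_green[OF const_sobolev v] by simp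
qed

lemma l2_integrable:
  fixes q :: "real^'d \<Rightarrow> real"
  assumes "q \<in> l2_space \<Omega>"
  shows "integrable (lebesgue_on \<Omega>) q"
  using l2_inner_integrable[OF assms const_l2[of 1]] by simp

lemma subspace_pressure_space: "subspace (pressure_space \<Omega>)"
proof (rule subspaceI)
  show "0 \<in> pressure_space \<Omega>" using const_l2[of 0] by (simp add: pressure_space_def zero_fun_def)
  fix p q assume "p \<in> pressure_space \<Omega>" "q \<in> pressure_space \<Omega>"
  then show "p + q \<in> pressure_space \<Omega>"
    using l2.mem_simps(2)[of p q] Bochner_Integration.integral_add[OF l2_integrable[of p] l2_integrable[of q]]
    by (auto simp: pressure_space_def plus_fun_def)
next
  fix c q assume "q \<in> pressure_space \<Omega>"
  then show "c *\<^sub>R q \<in> pressure_space \<Omega>"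
    using l2.mem_simps(4)[of q c] by (auto simp: pressure_space_def scaleR_fun_def)
qed

lemma pressure_l2: "q \<in> pressure_space \<Omega> \<Longrightarrow> q \<in> l2_space \<Omega>"
  by (simp add: pressure_space_def)

lemma subtract_mean:
  assumes q: "q \<in> sobolev \<Omega> m"
  shows "\<exists>c. (\<lambda>x. q x - c) \<in> pressure_space \<Omega> \<inter> sobolev \<Omega> m"
proof -
  define c where "c = (LINT x|lebesgue_on \<Omega>. q x) / measure lebesgue \<Omega>"
  have s: "(\<lambda>x. q x - c) \<in> sobolev \<Omega> m"
    using sob.mem_simps(3)[OF q const_sobolev[of c]] by (simp add: fun_diff_def)
  have "(LINT x|lebesgue_on \<Omega>. q x - c) = (LINT x|lebesgue_on \<Omega>. q x) - (LINT x|lebesgue_on \<Omega>. c)"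
    by (intro Bochner_Integration.integral_diff l2_integrable sobolev_l2[OF q] const_l2)
  also have "(LINT x|lebesgue_on \<Omega>. c) = measure lebesgue \<Omega> * c"
    by (simp add: measure_restrict_space)
  finally have "(LINT x|lebesgue_on \<Omega>. q x - c) = 0" using measure_Omega_pos by (simp add: c_def)
  then show ?thesis using s sobolev_l2[OF s] by (auto simp: pressure_space_def)
qed

lemma coordinate_bound: "\<exists>R\<ge>0. \<forall>x\<in>\<Omega>. \<forall>i. \<bar>x $ i\<bar> \<le> R"
proof -
  obtain R where R: "\<forall>x\<in>\<Omega>. norm x \<le> R" using bounded_Omega by (auto simp: bounded_iff)
  then have "\<forall>x\<in>\<Omega>. \<forall>i. \<bar>x $ i\<bar> \<le> max R 0"
    using component_le_norm_cart order_trans by (metis max.coboundedI1)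
  then show ?thesis by (intro exI[of _ "max R 0"]) auto
qed

text \<open>
  If all cells had diameter zero, the finitely many cells would be single points and could not cover an
  open set.
\<close>

lemma mesh_size_pos:
  assumes D: "mesh_of \<Omega> D"
  shows "mesh_size D > 0"
proof (rule ccontr)
  have fin: "finite (cells D)" "cells D \<noteq> {}" using D by (auto simp: mesh_of_def)
  assume "\<not> mesh_size D > 0"
  then have le: "diameter K \<le> 0" if "K \<in> cells D" for K
    using that fin unfolding mesh_size_def by (meson Max_ge finite_imageI image_eqI not_less order_trans)
  have "finite K" if K: "K \<in> cells D" for K
  proof -
    have "K \<subseteq> closure \<Omega>" using D K by (auto simp: mesh_of_def)
    then have "bounded K" using bounded_closure[OF bounded_Omega] bounded_subset by blast
    then have "dist x y \<le> 0" if "x \<in> K" "y \<in> K" for x y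
      using diameter_bounded_bound[OF _ that] le[OF K] by linarith
    then have "x = y" if "x \<in> K" "y \<in> K" for x y using that by simp
    then have "\<exists>x. K \<subseteq> {x}" by blast
    then show ?thesis using finite_subset by blast
  qed
  then have "finite (\<Union>(cells D))" using fin by auto
  moreover have "\<Omega> \<subseteq> \<Union>(cells D)" using D closure_subset by (auto simp: mesh_of_def)
  ultimately have "finite \<Omega>" by (rule rev_finite_subset)
  then show False using open_Omega nonempty_Omega finite_imp_not_open by blast
qed

lemma form_a_grad_form: "u \<in> sobolev \<Omega> 1 \<Longrightarrow> v \<in> sobolev \<Omega> 1 \<Longrightarrow> form_a \<Omega> u v = grad_form u v"
  by (simp add: form_a_eq grad_form_def)

text \<open>
  The quotients are formed with the full \<open>H\<^sup>1\<close> norm, which dominates the energy norm, so that a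
  bound in terms of the energy norm bounds them. If the norm of \<open>v\<close> is zero, the quotient is zero by
  convention.
\<close>

lemma inf_supD:
  assumes \<beta>: "ereal \<beta> \<le> (INF q \<in> {q \<in> Qh \<Omega> D. \<not> ae_eq \<Omega> q (\<lambda>x. 0)}.
                 SUP v \<in> {v \<in> Vh \<Omega> D. \<not> ae_eq \<Omega> v (\<lambda>x. 0)}.
                   ereal (- l2_inner \<Omega> (divg \<Omega> v) q / (sobolev_norm \<Omega> 1 v * l2_norm \<Omega> q)))"
    and q: "q \<in> Qh \<Omega> D" and M: "0 \<le> M" "\<And>v. v \<in> Vh \<Omega> D \<Longrightarrow> form_b \<Omega> v q \<le> M * nrm grad_form v"
  shows "\<beta> * nrm (l2_inner \<Omega>) q \<le> M"
proof (cases "nrm (l2_inner \<Omega>) q = 0")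
  case True
  then show ?thesis using M by simp
next
  case False
  have ql: "q \<in> l2_space \<Omega>" using q by (auto simp: Qh_def pressure_l2)
  have pos: "nrm (l2_inner \<Omega>) q > 0" using False l2.nrm_nonneg[OF ql] by simp
  have "\<not> ae_eq \<Omega> q (\<lambda>x. 0)" using False l2_null_iff[OF ql] by (auto simp: nrm_def)
  then have "ereal \<beta> \<le> (SUP v \<in> {v \<in> Vh \<Omega> D. \<not> ae_eq \<Omega> v (\<lambda>x. 0)}.
                   ereal (- l2_inner \<Omega> (divg \<Omega> v) q / (sobolev_norm \<Omega> 1 v * l2_norm \<Omega> q)))"
    using q by (intro order_trans[OF \<beta>] INF_lower) auto
  also have "\<dots> \<le> ereal (M / nrm (l2_inner \<Omega>) q)"
  proof (intro SUP_least, elim CollectE conjE)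
    fix v assume v: "v \<in> Vh \<Omega> D"
    then have s: "v \<in> sobolev \<Omega> 1" by (intro sobolev10_sobolev) (simp add: Vh_def)
    have n: "sobolev_norm \<Omega> 1 v = nrm (sob_inner 1) v" by (rule sobolev_norm_eq[OF s])
    have "form_b \<Omega> v q \<le> M * nrm (sob_inner 1) v"
      using M(2)[OF v] mult_left_mono[OF a_le_sob[OF s] M(1)] by linarith
    then have "form_b \<Omega> v q / (nrm (sob_inner 1) v * nrm (l2_inner \<Omega>) q) \<le> M / nrm (l2_inner \<Omega>) q"
      using pos M(1) sob.nrm_nonneg[OF s] by (cases "nrm (sob_inner 1) v = 0") (auto simp: field_simps)
    then show "ereal (- l2_inner \<Omega> (divg \<Omega> v) q / (sobolev_norm \<Omega> 1 v * l2_norm \<Omega> q)) \<le> ereal (M / nrm (l2_inner \<Omega>) q)"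
      unfolding n l2_norm_eq by (simp add: form_b_def)
  qed
  finally show ?thesis using pos by (simp add: field_simps)
qed

lemma discrete_subspace:
  fixes L :: "(real^'d) set \<Rightarrow> (real^'d \<Rightarrow> 'b::euclidean_space) set"
  assumes X: "subspace X" and L: "\<And>K. K \<in> T \<Longrightarrow> function_subspace (L K)"
  shows "subspace {v \<in> X. \<forall>K\<in>T. \<exists>w\<in>L K. ae_eq K v w}"
proof (rule subspaceI)
  show "0 \<in> {v \<in> X. \<forall>K\<in>T. \<exists>w\<in>L K. ae_eq K v w}"
    using subspace_0[OF X] L by (auto simp: function_subspace_def ae_eq_def zero_fun_def intro!: bexI[of _ "\<lambda>x. 0"])
next
  have comb: "\<exists>w\<in>L K. ae_eq K (\<lambda>x. a *\<^sub>R u x + b *\<^sub>R v x) w"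
    if K: "K \<in> T" and u: "\<exists>w\<in>L K. ae_eq K u w" and v: "\<exists>w\<in>L K. ae_eq K v w" for K u v a b
  proof -
    obtain u' v' where u': "u' \<in> L K" "AE x in lebesgue_on K. u x = u' x" and v': "v' \<in> L K" "AE x in lebesgue_on K. v x = v' x"
      using u v by (auto simp: ae_eq_def)
    have "(\<lambda>x. a *\<^sub>R u' x + b *\<^sub>R v' x) \<in> L K" using L[OF K] u'(1) v'(1) by (simp add: function_subspace_def)
    moreover have "AE x in lebesgue_on K. a *\<^sub>R u x + b *\<^sub>R v x = a *\<^sub>R u' x + b *\<^sub>R v' x"
      using u'(2) v'(2) by eventually_elim simp
    ultimately show ?thesis by (auto simp: ae_eq_def)
  qed
  fix u v assume "u \<in> {v \<in> X. \<forall>K\<in>T. \<exists>w\<in>L K. ae_eq K v w}" "v \<in> {v \<in> X. \<forall>K\<in>T. \<exists>w\<in>L K. ae_eq K v w}"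
  then show "u + v \<in> {v \<in> X. \<forall>K\<in>T. \<exists>w\<in>L K. ae_eq K v w}"
    using comb[of _ u v 1 1] subspace_add[OF X] by (auto simp: plus_fun_def)
next
  fix c u assume "u \<in> {v \<in> X. \<forall>K\<in>T. \<exists>w\<in>L K. ae_eq K v w}"
  moreover have "\<exists>w\<in>L K. ae_eq K (\<lambda>x. c *\<^sub>R u x) w" if K: "K \<in> T" and u: "\<exists>w\<in>L K. ae_eq K u w" for K
  proof -
    obtain u' where u': "u' \<in> L K" "AE x in lebesgue_on K. u x = u' x" using u by (auto simp: ae_eq_def)
    have "\<forall>a b. (\<lambda>x. a *\<^sub>R u' x + b *\<^sub>R u' x) \<in> L K" using L[OF K] u'(1) by (simp add: function_subspace_def)
    from this[rule_format, of c 0] have "(\<lambda>x. c *\<^sub>R u' x) \<in> L K" by simp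
    moreover have "AE x in lebesgue_on K. c *\<^sub>R u x = c *\<^sub>R u' x" using u'(2) by eventually_elim simp
    ultimately show ?thesis unfolding ae_eq_def by (intro bexI[of _ "\<lambda>x. c *\<^sub>R u' x"])
  qed
  ultimately show "c *\<^sub>R u \<in> {v \<in> X. \<forall>K\<in>T. \<exists>w\<in>L K. ae_eq K v w}"
    using subspace_scale[OF X] by (auto simp: scaleR_fun_def)
qed

lemma discrete_stokes_instance:
  assumes reg: "shape_regular_family \<Omega> \<F>" and deg: "local_spaces_bounded_degree \<F>" and D: "D \<in> \<F>"
    and \<beta>: "\<beta> > 0" "ereal \<beta> \<le> (INF q \<in> {q \<in> Qh \<Omega> D. \<not> ae_eq \<Omega> q (\<lambda>x. 0)}.
                 SUP v \<in> {v \<in> Vh \<Omega> D. \<not> ae_eq \<Omega> v (\<lambda>x. 0)}.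
                   ereal (- l2_inner \<Omega> (divg \<Omega> v) q / (sobolev_norm \<Omega> 1 v * l2_norm \<Omega> q)))"
    and R: "0 \<le> R" "\<forall>x\<in>\<Omega>. \<forall>i. \<bar>x $ i\<bar> \<le> R"
  shows "discrete_stokes (sobolev10 \<Omega>) (pressure_space \<Omega>) (l2_inner \<Omega>) grad_form (l2_inner \<Omega>) (form_b \<Omega>)
     (Vh \<Omega> D) (Qh \<Omega> D) null_functions null_functions (2 * R) (real CARD('d)) \<beta>"
proof -
  obtain m where m: "\<And>K. K \<in> cells D \<Longrightarrow> mapped_poly_space m (ref_cell D K) (cell_map D K) (local_velocity D K)"
     "\<And>K. K \<in> cells D \<Longrightarrow> mapped_poly_space m (ref_cell D K) (cell_map D K) (local_pressure D K)"
    using deg D by (auto simp: local_spaces_bounded_degree_def)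
  note mesh = shape_regular_mesh[OF reg D]
  have sets: "K \<in> sets lebesgue" if "K \<in> cells D" for K using lmeasurable_compact[OF mesh(2)[OF that]] by (rule fmeasurableD)
  have cov: "finite (cells D)" "\<Omega> \<subseteq> \<Union>(cells D)" "\<And>K. K \<in> cells D \<Longrightarrow> cell_map D K ` ref_cell D K = K"
    using mesh(1) closure_subset[of \<Omega>] by (auto simp: mesh_of_def)
  have sV: "v \<in> sobolev \<Omega> 1" if "v \<in> sobolev10 \<Omega>" for v :: "real^'d \<Rightarrow> real^'d" using that by (rule sobolev10_sobolev)
  have psd1: "psd_form (sobolev10 \<Omega> :: (real^'d \<Rightarrow> real^'d) set) (l2_inner \<Omega>)"
    by (rule l2.psd_form_subspace[OF subspace_sobolev10]) (rule subsetI, rule sobolev_l2, rule sV)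
  have psd2: "psd_form (sobolev10 \<Omega>) grad_form"
    by (rule a.psd_form_subspace[OF subspace_sobolev10]) (rule subsetI, rule sV)
  have psd3: "psd_form (pressure_space \<Omega>) (l2_inner \<Omega>)"
    by (rule l2.psd_form_subspace[OF subspace_pressure_space]) (auto simp: pressure_l2)
  have nullV: "grad_form v v = 0" if "v \<in> Vh \<Omega> D" "v \<in> null_functions" for v
  proof -
    have "weak_deriv \<Omega> is v = weak_deriv \<Omega> is 0" for "is"
      using that(2) by (intro weak_deriv_ae_eq) (simp add: null_functions_def zero_fun_def)
    then have "grad_form v v = grad_form 0 0" by (simp add: grad_form_def)
    then show ?thesis using a.zero[of 0] a.mem_simps(1) by simp
  qed
  have nullQ: "l2_inner \<Omega> q q = 0" if "q \<in> Qh \<Omega> D" "q \<in> null_functions" for q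
    using that l2_null_iff[of q] by (auto simp: null_functions_def Qh_def pressure_l2)
  have spV: "spanned_mod null_functions (Vh \<Omega> D)"
    by (rule piecewise_mapped_poly_spanned[OF cov(1,2) sets cov(3) m(1)]) (auto simp: Vh_def)
  have spQ: "spanned_mod null_functions (Qh \<Omega> D)"
    by (rule piecewise_mapped_poly_spanned[OF cov(1,2) sets cov(3) m(2)]) (auto simp: Qh_def)
  have subV: "subspace (Vh \<Omega> D)" unfolding Vh_def
    by (rule discrete_subspace[OF subspace_sobolev10]) (use m(1) in \<open>auto simp: mapped_poly_space_def\<close>)
  have subQ: "subspace (Qh \<Omega> D)" unfolding Qh_def
    by (rule discrete_subspace[OF subspace_pressure_space]) (use m(2) in \<open>auto simp: mapped_poly_space_def\<close>)
  have b: "\<And>v w q. v \<in> sobolev10 \<Omega> \<Longrightarrow> w \<in> sobolev10 \<Omega> \<Longrightarrow> q \<in> pressure_space \<Omega> \<Longrightarrow> form_b \<Omega> (v + w) q = form_b \<Omega> v q + form_b \<Omega> w q"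
    "\<And>v q c. v \<in> sobolev10 \<Omega> \<Longrightarrow> q \<in> pressure_space \<Omega> \<Longrightarrow> form_b \<Omega> (c *\<^sub>R v) q = c * form_b \<Omega> v q"
    "\<And>v q q'. v \<in> sobolev10 \<Omega> \<Longrightarrow> q \<in> pressure_space \<Omega> \<Longrightarrow> q' \<in> pressure_space \<Omega> \<Longrightarrow> form_b \<Omega> v (q + q') = form_b \<Omega> v q + form_b \<Omega> v q'"
    "\<And>v q c. v \<in> sobolev10 \<Omega> \<Longrightarrow> q \<in> pressure_space \<Omega> \<Longrightarrow> form_b \<Omega> v (c *\<^sub>R q) = c * form_b \<Omega> v q"
    "\<And>v q. v \<in> sobolev10 \<Omega> \<Longrightarrow> q \<in> pressure_space \<Omega> \<Longrightarrow> \<bar>form_b \<Omega> v q\<bar> \<le> real CARD('d) * (nrm grad_form v * nrm (l2_inner \<Omega>) q)"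
    by (intro form_b_add form_b_scale form_b_add_right form_b_scale_right form_b_bound sV pressure_l2; assumption)+
  show ?thesis
    by (rule discrete_stokes.intro[OF psd1 psd2 psd3], unfold_locales)
       (simp_all add: subV subQ subspace_null_functions spV spQ nullV nullQ b
         poincare R \<beta>(1) inf_supD[OF \<beta>(2)], auto simp: Vh_def Qh_def)
qed

end

section \<open>The exact solution at every time\<close>

lemma nrm_deriv_mono:
  assumes A: "psd_form S A" and le: "\<And>x. x \<in> S \<Longrightarrow> \<bar>nrm A' x\<bar> \<le> nrm A x"
    and w: "\<And>s. s \<in> J \<Longrightarrow> w s \<in> S" and t: "t \<in> J" and g: "g \<in> S" and d: "nrm_deriv A J w g t"
  shows "nrm_deriv A' J w g t"
  unfolding nrm_deriv_def
proof (rule Lim_null_comparison[OF _ d[unfolded nrm_deriv_def]])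
  interpret psd_form S A by (rule A)
  show "\<forall>\<^sub>F s in at t within J. norm (nrm A' ((w s - w t) /\<^sub>R (s - t) - g)) \<le> nrm A ((w s - w t) /\<^sub>R (s - t) - g)"
    unfolding eventually_at_topological
    by (intro exI[of _ UNIV]) (use le w t g in \<open>auto intro!: le mem_simps\<close>)
qed

text \<open>
  Difference quotients of \<open>w\<close> lie in \<open>X\<close>, so the derivative is in the closure of \<open>X\<close>. It is used to
  show that \<open>\<partial>\<^sub>t u\<close> is divergence-free.
\<close>

lemma nrm_deriv_approx:
  assumes A: "psd_form S A" and X: "subspace X" "X \<subseteq> S" and w: "\<And>s. s \<in> J \<Longrightarrow> w s \<in> X" and t: "t \<in> J"
    and g: "g \<in> S" and d: "nrm_deriv A J w g t" and nt: "at t within J \<noteq> bot" and e: "0 < e"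
  shows "\<exists>x\<in>X. nrm A (g - x) < e"
proof -
  interpret psd_form S A by (rule A)
  have "\<forall>\<^sub>F s in at t within J. nrm A ((w s - w t) /\<^sub>R (s - t) - g) < e"
    using order_tendstoD(2)[OF d[unfolded nrm_deriv_def] e] .
  moreover have "\<forall>\<^sub>F s in at t within J. s \<in> J" unfolding eventually_at_topological by (intro exI[of _ UNIV]) auto
  ultimately have "\<forall>\<^sub>F s in at t within J. s \<in> J \<and> nrm A ((w s - w t) /\<^sub>R (s - t) - g) < e" by eventually_elim auto
  then obtain s where s: "s \<in> J" "nrm A ((w s - w t) /\<^sub>R (s - t) - g) < e"
    using eventually_happens'[OF nt] by blast
  have x: "(w s - w t) /\<^sub>R (s - t) \<in> X" using w[OF s(1)] w[OF t] by (intro subspace_scale[OF X(1)] subspace_diff[OF X(1)])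
  have "nrm A (g - (w s - w t) /\<^sub>R (s - t)) < e" using s(2) nrm_minus[OF g, of "(w s - w t) /\<^sub>R (s - t)"] x X(2) by auto
  then show ?thesis using x by blast
qed

lemma at_within_interval_nontrivial: "0 < (T::real) \<Longrightarrow> t \<in> {0..T} \<Longrightarrow> at t within {0..T} \<noteq> bot"
  using islimpt_Icc[of 0 T t] by (auto simp: trivial_limit_within)

context open_domain
begin

text \<open>
  The defining property of \<open>time_Ck_sobolev\<close> for given derivatives \<open>W\<close>, in terms of seminorms of
  forms.
\<close>

definition time_derivatives :: "nat \<Rightarrow> nat \<Rightarrow> real \<Rightarrow> (real \<Rightarrow> real^'d \<Rightarrow> 'b::euclidean_space) \<Rightarrow> (nat \<Rightarrow> real \<Rightarrow> real^'d \<Rightarrow> 'b) \<Rightarrow> bool" where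
  "time_derivatives k m T w W \<longleftrightarrow> (\<forall>t\<in>{0..T}. W 0 t = w t) \<and> (\<forall>j\<le>k. \<forall>t\<in>{0..T}. W j t \<in> sobolev \<Omega> m) \<and>
     (\<forall>j\<le>k. \<forall>t\<in>{0..T}. ((\<lambda>s. nrm (sob_inner m) (W j s - W j t)) \<longlongrightarrow> 0) (at t within {0..T})) \<and>
     (\<forall>j<k. \<forall>t\<in>{0..T}. nrm_deriv (sob_inner m) {0..T} (W j) (W (Suc j) t) t)"

lemma time_derivativesD:
  assumes "time_derivatives k m T w W"
  shows "\<And>t. t \<in> {0..T} \<Longrightarrow> W 0 t = w t" "\<And>j t. j \<le> k \<Longrightarrow> t \<in> {0..T} \<Longrightarrow> W j t \<in> sobolev \<Omega> m"
    "\<And>j t. j \<le> k \<Longrightarrow> t \<in> {0..T} \<Longrightarrow> ((\<lambda>s. nrm (sob_inner m) (W j s - W j t)) \<longlongrightarrow> 0) (at t within {0..T})"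
    "\<And>j t. j < k \<Longrightarrow> t \<in> {0..T} \<Longrightarrow> nrm_deriv (sob_inner m) {0..T} (W j) (W (Suc j) t) t"
  using assms unfolding time_derivatives_def by simp_all

lemma time_regular:
  fixes w :: "real \<Rightarrow> real^'d \<Rightarrow> 'b::euclidean_space"
  assumes w: "w \<in> time_Ck_sobolev k m \<Omega> T"
  shows "\<exists>W. time_derivatives k m T w W"
proof -
  obtain W where W: "\<forall>t\<in>{0..T}. W 0 t = w t"
     "\<forall>j\<le>k. (\<forall>t\<in>{0..T}. W j t \<in> sobolev \<Omega> m) \<and> time_continuous_on (sobolev_norm \<Omega> m) {0..T} (W j)"
     "\<forall>j<k. \<forall>t\<in>{0..T}. has_time_deriv (sobolev_norm \<Omega> m) {0..T} (W j) (W (Suc j) t) t"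
    using w unfolding time_Ck_sobolev_def by blast
  have mem: "W j t \<in> sobolev \<Omega> m" if "j \<le> k" "t \<in> {0..T}" for j t using W(2) that by blast
  have ev: "\<forall>\<^sub>F s in at t within {0..T}. s \<in> {0..T}" for t unfolding eventually_at_topological by (intro exI[of _ UNIV]) auto
  show ?thesis
    unfolding time_derivatives_def
  proof (intro exI[of _ W] conjI allI impI ballI)
    fix j t assume j: "j \<le> k" and t: "t \<in> {0..T}"
    have "((\<lambda>s. sobolev_norm \<Omega> m (\<lambda>x. W j s x - W j t x)) \<longlongrightarrow> 0) (at t within {0..T})"
      using W(2) j t by (auto simp: time_continuous_on_def)
    then show "((\<lambda>s. nrm (sob_inner m) (W j s - W j t)) \<longlongrightarrow> 0) (at t within {0..T})"
    proof (rule Lim_transform_eventually)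
      show "\<forall>\<^sub>F s in at t within {0..T}. sobolev_norm \<Omega> m (\<lambda>x. W j s x - W j t x) = nrm (sob_inner m) (W j s - W j t)"
        using ev[of t]
      proof eventually_elim
        fix s assume s: "s \<in> {0..T}"
        show "sobolev_norm \<Omega> m (\<lambda>x. W j s x - W j t x) = nrm (sob_inner m) (W j s - W j t)"
          using sobolev_norm_eq[OF sob.mem_simps(3)[OF mem[OF j s] mem[OF j t]]] by (simp add: fun_diff_def)
      qed
    qed
  next
    fix j t assume j: "j < k" and t: "t \<in> {0..T}"
    have jk: "j \<le> k" "Suc j \<le> k" using j by auto
    have "((\<lambda>s. sobolev_norm \<Omega> m (\<lambda>x. (W j s x - W j t x) /\<^sub>R (s - t) - W (Suc j) t x)) \<longlongrightarrow> 0) (at t within {0..T})"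
      using W(3) j t by (auto simp: has_time_deriv_def)
    then show "nrm_deriv (sob_inner m) {0..T} (W j) (W (Suc j) t) t"
      unfolding nrm_deriv_def
    proof (rule Lim_transform_eventually)
      show "\<forall>\<^sub>F s in at t within {0..T}. sobolev_norm \<Omega> m (\<lambda>x. (W j s x - W j t x) /\<^sub>R (s - t) - W (Suc j) t x)
           = nrm (sob_inner m) ((W j s - W j t) /\<^sub>R (s - t) - W (Suc j) t)"
        using ev[of t]
      proof eventually_elim
        fix s assume s: "s \<in> {0..T}"
        have "(W j s - W j t) /\<^sub>R (s - t) - W (Suc j) t \<in> sobolev \<Omega> m"
          by (intro sob.mem_simps mem jk s t)
        from sobolev_norm_eq[OF this]
        show "sobolev_norm \<Omega> m (\<lambda>x. (W j s x - W j t x) /\<^sub>R (s - t) - W (Suc j) t x)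
           = nrm (sob_inner m) ((W j s - W j t) /\<^sub>R (s - t) - W (Suc j) t)" by (simp add: fun_diff_def scaleR_fun_def)
      qed
    qed
  qed (use W mem in auto)
qed

text \<open>
  The chosen representative of the time derivative agrees with any other derivative in \<open>L\<^sup>2\<close>, such
  as the one in a Sobolev norm.
\<close>

lemma time_deriv_eq:
  fixes u :: "real \<Rightarrow> real^'d \<Rightarrow> 'b::euclidean_space"
  assumes T: "0 < T" "t \<in> {0..T}" and u: "\<And>s. s \<in> {0..T} \<Longrightarrow> u s \<in> l2_space \<Omega>" and g: "g \<in> l2_space \<Omega>"
    and d: "nrm_deriv (l2_inner \<Omega>) {0..T} u g t"
  shows "ae_eq \<Omega> (time_deriv \<Omega> T u t) g"
proof -
  have iff: "has_time_deriv (l2_norm \<Omega>) {0..T} u h t \<longleftrightarrow> nrm_deriv (l2_inner \<Omega>) {0..T} u h t" for h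
    by (simp add: has_time_deriv_def nrm_deriv_def l2_norm_eq fun_diff_def scaleR_fun_def)
  have "time_deriv \<Omega> T u t \<in> l2_space \<Omega> \<and> has_time_deriv (l2_norm \<Omega>) {0..T} u (time_deriv \<Omega> T u t) t"
    unfolding time_deriv_def by (rule someI[of _ g]) (use g d iff in blast)
  then have h: "time_deriv \<Omega> T u t \<in> l2_space \<Omega>" "nrm_deriv (l2_inner \<Omega>) {0..T} u (time_deriv \<Omega> T u t) t"
    using iff by auto
  have "nrm (l2_inner \<Omega>) (time_deriv \<Omega> T u t - g) = 0"
    by (rule l2.nrm_deriv_unique[OF h(2) d u T(2) h(1) g at_within_interval_nontrivial[OF T]])
  then have "ae_eq \<Omega> (time_deriv \<Omega> T u t - g) (\<lambda>x. 0)"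
    using l2_null_iff[OF l2.mem_simps(3)[OF h(1) g]] by (simp add: nrm_def)
  then show ?thesis unfolding ae_eq_def by eventually_elim simp
qed

lemma l2_abs_le_sob:
  fixes v :: "real^'d \<Rightarrow> 'b::euclidean_space"
  assumes "v \<in> sobolev \<Omega> m"
  shows "\<bar>nrm (l2_inner \<Omega>) v\<bar> \<le> nrm (sob_inner m) v"
  using l2_norm_le_sob[OF assms] l2.nrm_nonneg[OF sobolev_l2[OF assms]] by simp

lemma form_continuous:
  fixes w :: "real \<Rightarrow> real^'d \<Rightarrow> 'b::euclidean_space"
  assumes w: "\<And>s. s \<in> J \<Longrightarrow> w s \<in> sobolev \<Omega> m" and t: "t \<in> J"
    and c: "((\<lambda>s. nrm (sob_inner m) (w s - w t)) \<longlongrightarrow> 0) (at t within J)"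
    and A: "psd_form S A" and S: "sobolev \<Omega> m \<subseteq> S" and le: "\<And>v. v \<in> sobolev \<Omega> m \<Longrightarrow> nrm A v \<le> nrm (sob_inner m) v"
    and x: "x \<in> S"
  shows "((\<lambda>s. A (w s) x) \<longlongrightarrow> A (w t) x) (at t within J)"
proof (rule LIM_zero_cancel, rule Lim_null_comparison)
  interpret psd_form S A by (rule A)
  show "((\<lambda>s. nrm (sob_inner m) (w s - w t) * nrm A x) \<longlongrightarrow> 0) (at t within J)" using c by (rule tendsto_mult_left_zero)
  have "norm (A (w s) x - A (w t) x) \<le> nrm (sob_inner m) (w s - w t) * nrm A x" if s: "s \<in> J" for s
  proof -
    have m: "w s \<in> S" "w t \<in> S" using w s t S by auto
    have "norm (A (w s) x - A (w t) x) = \<bar>A (w s - w t) x\<bar>" using m x by (simp add: diff)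
    also have "\<dots> \<le> nrm A (w s - w t) * nrm A x" using m x by (intro cauchy_schwarz) (simp_all add: mem_simps)
    also have "\<dots> \<le> nrm (sob_inner m) (w s - w t) * nrm A x"
      by (intro mult_right_mono le sob.mem_simps w s t nrm_nonneg x)
    finally show ?thesis .
  qed
  then show "\<forall>\<^sub>F s in at t within J. norm (A (w s) x - A (w t) x) \<le> nrm (sob_inner m) (w s - w t) * nrm A x"
    unfolding eventually_at_topological by (intro exI[of _ UNIV]) auto
qed

lemma divfree_iff: "v \<in> velocity_div_space \<Omega> \<longleftrightarrow> v \<in> sobolev10 \<Omega> \<and> (\<forall>q\<in>pressure_space \<Omega>. form_b \<Omega> v q = 0)"
  by (simp add: velocity_div_space_def form_b_def)

lemma weak_equation_iff:
  assumes z: "z \<in> l2_space \<Omega>" and u: "u \<in> sobolev \<Omega> 2" and p: "p \<in> sobolev \<Omega> 1" and f: "f \<in> l2_space \<Omega>" and v: "v \<in> sobolev10 \<Omega>"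
  shows "l2_inner \<Omega> (z - laplacian \<Omega> u + grad_s \<Omega> p - f) v =
     l2_inner \<Omega> z v + grad_form u v + form_b \<Omega> v p - l2_inner \<Omega> f v"
  using z laplacian_l2[OF u] grad_s_l2[OF p] f sobolev_l2[OF sobolev10_sobolev[OF v]] laplacian_green[OF u v] gradient_green[OF p v]
  by (simp add: l2.form_simps)

text \<open>
  Multiplying scalar test functions with basis vectors reduces this to the fundamental lemma.
\<close>

lemma l2_zero_by_testing:
  fixes g :: "real^'d \<Rightarrow> 'b::euclidean_space"
  assumes g: "g \<in> l2_space \<Omega>" and 0: "\<And>\<phi>. \<phi> \<in> test_functions \<Omega> \<Longrightarrow> l2_inner \<Omega> g \<phi> = 0"
  shows "ae_eq \<Omega> g (\<lambda>x. 0)"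
  unfolding ae_eq_def
proof (rule fundamental_lemma[OF open_Omega l2_locally_integrable[OF g]])
  fix \<psi> :: "real^'d \<Rightarrow> real" assume \<psi>: "\<psi> \<in> test_functions \<Omega>"
  show "(LINT x|lebesgue_on \<Omega>. \<psi> x *\<^sub>R g x) = 0"
  proof (rule euclidean_eqI)
    fix b :: 'b
    have t: "(\<lambda>x. \<psi> x *\<^sub>R b) \<in> test_functions \<Omega>" by (rule test_fn_linear_image[OF \<psi> bounded_linear_scaleR_left])
    have "(LINT x|lebesgue_on \<Omega>. \<psi> x *\<^sub>R g x) \<bullet> b = (LINT x|lebesgue_on \<Omega>. (\<psi> x *\<^sub>R g x) \<bullet> b)"
      by (rule integral_inner_left[symmetric]) (intro test_integrable \<psi> l2_locally_integrable g)
    also have "\<dots> = l2_inner \<Omega> g (\<lambda>x. \<psi> x *\<^sub>R b)" by (simp add: l2_inner_def)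
    finally show "(LINT x|lebesgue_on \<Omega>. \<psi> x *\<^sub>R g x) \<bullet> b = 0 \<bullet> b" using 0[OF t] by simp
  qed
qed

end

context stokes_domain
begin

lemma subspace_divfree: "subspace (velocity_div_space \<Omega>)"
proof (rule subspaceI)
  note s = sobolev10_sobolev
  show "0 \<in> velocity_div_space \<Omega>"
    using subspace_0[OF subspace_sobolev10] form_b_scale[of 0 _ 0] s pressure_l2 unfolding divfree_iff
    by (metis mult_zero_left scaleR_zero_left)
  fix v w assume "v \<in> velocity_div_space \<Omega>" "w \<in> velocity_div_space \<Omega>"
  then show "v + w \<in> velocity_div_space \<Omega>"
    using subspace_add[OF subspace_sobolev10, of v w] form_b_add[OF s s pressure_l2, of v w] by (simp add: divfree_iff)
next
  note s = sobolev10_sobolev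
  fix c v assume "v \<in> velocity_div_space \<Omega>"
  then show "c *\<^sub>R v \<in> velocity_div_space \<Omega>"
    using subspace_scale[OF subspace_sobolev10, of v c] form_b_scale[OF s pressure_l2, of v _ c] by (simp add: divfree_iff)
qed

lemma divfree_closed:
  assumes g: "g \<in> sobolev \<Omega> 1" and lim: "\<And>e. 0 < e \<Longrightarrow> \<exists>x\<in>velocity_div_space \<Omega>. nrm (sob_inner 1) (g - x) < e"
  shows "g \<in> velocity_div_space \<Omega>"
  unfolding divfree_iff
proof (intro conjI ballI)
  show "g \<in> sobolev10 \<Omega>" using lim by (intro sobolev10_closed[OF g]) (metis divfree_iff)
  fix q assume q: "q \<in> pressure_space \<Omega>"
  note ql = pressure_l2[OF q]
  define C where "C = real CARD('d) * nrm (l2_inner \<Omega>) q"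
  have C: "0 \<le> C" using l2.nrm_nonneg[OF ql] by (simp add: C_def)
  have "\<bar>form_b \<Omega> g q\<bar> \<le> e" if e: "0 < e" for e
  proof -
    have "0 < e / (C + 1)" using e C by simp
    then obtain x where x: "x \<in> velocity_div_space \<Omega>" "nrm (sob_inner 1) (g - x) < e / (C + 1)" using lim by blast
    have xs: "x \<in> sobolev \<Omega> 1" using x(1) by (intro sobolev10_sobolev) (simp add: divfree_iff)
    have "form_b \<Omega> x q = 0" using x(1) q by (simp add: divfree_iff)
    then have "\<bar>form_b \<Omega> g q\<bar> = \<bar>form_b \<Omega> (g - x) q\<bar>" using form_b_diff[OF g xs ql] by simp
    also have "\<dots> \<le> C * nrm (sob_inner 1) (g - x)"
      unfolding C_def by (rule form_b_bound_sob[OF sob.mem_simps(3)[OF g xs] ql])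
    also have "\<dots> \<le> (C + 1) * nrm (sob_inner 1) (g - x)"
      using sob.nrm_nonneg[OF sob.mem_simps(3)[OF g xs]] by (intro mult_right_mono) auto
    also have "\<dots> \<le> e" using x(2) C by (simp add: field_simps)
    finally show ?thesis .
  qed
  then have "\<bar>form_b \<Omega> g q\<bar> \<le> 0" by (rule field_le_epsilon[of _ 0, simplified])
  then show "form_b \<Omega> g q = 0" by simp
qed

end

context stokes_domain
begin

text \<open>
  The differential equation holds for \<open>t > 0\<close> only, whereas the scheme evaluates it at \<open>t = 0\<close>, too.
  In its weak form all terms depend continuously on time up to \<open>0\<close>, and the equation
  extends. The time derivatives are those in \<open>H\<^sup>k\<close>, with one bound for all that are needed.
\<close>

lemma exact_solution:
  assumes T: "0 < T" and sol: "nonstationary_stokes_solution \<Omega> T f u0 u p"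
    and reg: "regular_data k \<Omega> T f u p" and k: "3 \<le> k"
  obtains U P M where
    "\<And>t. t \<in> {0..T} \<Longrightarrow> U 0 t = u t" "\<And>t. t \<in> {0..T} \<Longrightarrow> P 0 t = p t"
    "\<And>t. t \<in> {0..T} \<Longrightarrow> U 0 t \<in> velocity_div_space \<Omega>" "\<And>t. t \<in> {0..T} \<Longrightarrow> U 1 t \<in> velocity_div_space \<Omega>"
    "\<And>t. t \<in> {0..T} \<Longrightarrow> P 0 t \<in> pressure_space \<Omega>"
    "\<And>j t. j \<le> 3 \<Longrightarrow> t \<in> {0..T} \<Longrightarrow> U j t \<in> sobolev \<Omega> k" "\<And>j t. j \<le> 3 \<Longrightarrow> t \<in> {0..T} \<Longrightarrow> P j t \<in> sobolev \<Omega> k"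
    "\<And>t. t \<in> {0..T} \<Longrightarrow> f t \<in> sobolev \<Omega> k"
    "\<And>j t. j < 3 \<Longrightarrow> t \<in> {0..T} \<Longrightarrow> nrm_deriv (sob_inner k) {0..T} (U j) (U (Suc j) t) t"
    "\<And>j t. j < 3 \<Longrightarrow> t \<in> {0..T} \<Longrightarrow> nrm_deriv (sob_inner k) {0..T} (P j) (P (Suc j) t) t"
    "0 \<le> M" "\<And>j t. j \<le> 3 \<Longrightarrow> t \<in> {0..T} \<Longrightarrow> nrm (sob_inner k) (U j t) \<le> M"
    "\<And>j t. j \<le> 3 \<Longrightarrow> t \<in> {0..T} \<Longrightarrow> nrm (sob_inner k) (P j t) \<le> M"
    "\<And>t v. t \<in> {0..T} \<Longrightarrow> v \<in> sobolev10 \<Omega> \<Longrightarrow>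
       l2_inner \<Omega> (U 1 t) v + grad_form (U 0 t) v + form_b \<Omega> v (P 0 t) = l2_inner \<Omega> (f t) v"
proof -
  have ck: "u \<in> time_Ck_sobolev k k \<Omega> T" "p \<in> time_Ck_sobolev k k \<Omega> T" "f \<in> time_Ck_sobolev k k \<Omega> T"
    using reg by (auto simp: regular_data_def)
  obtain U P Ff where UPF: "time_derivatives k k T u U" "time_derivatives k k T p P" "time_derivatives k k T f Ff"
    using ck[THEN time_regular] by blast
  note U = time_derivativesD[OF UPF(1)]
  note P = time_derivativesD[OF UPF(2)]
  note Ff = time_derivativesD[OF UPF(3)]
  have k1: "1 \<le> k" "2 \<le> k" using k by auto
  have "\<exists>M\<ge>0. j \<le> k \<longrightarrow> (\<forall>t\<in>{0..T}. nrm (sob_inner k) (U j t) \<le> M)" for j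
  proof (cases "j \<le> k")
    case True
    from sob.nrm_continuous_bounded[OF U(2)[OF True] U(3)[OF True]] show ?thesis by blast
  qed auto
  then obtain MU where MU: "\<And>j. 0 \<le> MU j" "\<And>j t. j \<le> k \<Longrightarrow> t \<in> {0..T} \<Longrightarrow> nrm (sob_inner k) (U j t) \<le> MU j" by metis
  have "\<exists>M\<ge>0. j \<le> k \<longrightarrow> (\<forall>t\<in>{0..T}. nrm (sob_inner k) (P j t) \<le> M)" for j
  proof (cases "j \<le> k")
    case True
    from sob.nrm_continuous_bounded[OF P(2)[OF True] P(3)[OF True]] show ?thesis by blast
  qed auto
  then obtain MP where MP: "\<And>j. 0 \<le> MP j" "\<And>j t. j \<le> k \<Longrightarrow> t \<in> {0..T} \<Longrightarrow> nrm (sob_inner k) (P j t) \<le> MP j" by metis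
  define M where "M = (\<Sum>j\<le>3. MU j + MP j)"
  have Mj: "MU j + MP j \<le> M" if "j \<le> 3" for j
    unfolding M_def using that MU(1) MP(1) by (intro member_le_sum) (auto intro: add_nonneg_nonneg)
  have M: "0 \<le> M" "MU j \<le> M" "MP j \<le> M" if "j \<le> 3" for j
    using Mj[OF that] MU(1)[of j] MP(1)[of j] by linarith+
  have nt: "at t within {0..T} \<noteq> bot" if "t \<in> {0..T}" for t using at_within_interval_nontrivial[OF T that] .
  have udiv: "U 0 t \<in> velocity_div_space \<Omega>" "P 0 t \<in> pressure_space \<Omega>" if "t \<in> {0..T}" for t
    using sol that U(1) P(1) by (auto simp: nonstationary_stokes_solution_def)
  have s1: "v \<in> sobolev \<Omega> 1" if "v \<in> sobolev \<Omega> k" for v :: "real^'d \<Rightarrow> real^'d" using sobolev_mono[OF k1(1) that] .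
  have zdiv: "U 1 t \<in> velocity_div_space \<Omega>" if t: "t \<in> {0..T}" for t
  proof (rule divfree_closed[OF s1[OF U(2)[OF k1(1) t]]])
    fix e :: real assume e: "0 < e"
    have d: "nrm_deriv (sob_inner k) {0..T} (U 0) (U 1 t) t" using U(4)[of 0 t] t k by simp
    have sub: "subspace (velocity_div_space \<Omega> \<inter> sobolev \<Omega> k)" by (intro subspace_inter subspace_divfree subspace_sobolev)
    obtain x where x: "x \<in> velocity_div_space \<Omega> \<inter> sobolev \<Omega> k" "nrm (sob_inner k) (U 1 t - x) < e"
      using nrm_deriv_approx[OF sob_psd sub _ _ t U(2)[OF k1(1) t] d nt[OF t] e] udiv(1) U(2)[of 0] by auto
    have "nrm (sob_inner 1) (U 1 t - x) \<le> nrm (sob_inner k) (U 1 t - x)"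
      using x(1) by (intro sob_nrm_mono k1 sob.mem_simps(3) U(2) t) auto
    then have "nrm (sob_inner 1) (U 1 t - x) < e" using x(2) by linarith
    then show "\<exists>x\<in>velocity_div_space \<Omega>. nrm (sob_inner 1) (U 1 t - x) < e" using x(1) by blast
  qed
  have eq_pos: "l2_inner \<Omega> (U 1 t) v + grad_form (U 0 t) v + form_b \<Omega> v (P 0 t) = l2_inner \<Omega> (f t) v"
    if t: "t \<in> {0<..T}" and v: "v \<in> sobolev10 \<Omega>" for t v
  proof -
    have t': "t \<in> {0..T}" using t by auto
    note mem = U(2)[OF _ t', of 0] U(2)[OF k1(1) t'] P(2)[OF _ t', of 0] Ff(2)[OF _ t', of 0]
    have l2: "U 1 t \<in> l2_space \<Omega>" "f t \<in> l2_space \<Omega>" using sobolev_l2[OF mem(2)] sobolev_l2[OF mem(4)] Ff(1)[OF t'] by simp_all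
    have u2: "U 0 t \<in> sobolev \<Omega> 2" and p1: "P 0 t \<in> sobolev \<Omega> 1" using sobolev_mono[OF k1(2) mem(1)] sobolev_mono[OF k1(1) mem(3)] by simp_all
    have d: "nrm_deriv (l2_inner \<Omega>) {0..T} (U 0) (U 1 t) t"
      using nrm_deriv_mono[OF sob_psd l2_abs_le_sob U(2)[of 0] t' mem(2)] U(4)[of 0 t] t' k by simp
    \<comment> \<open>the equation refers to the derivative of \<open>u\<close>, which agrees with \<open>U 0\<close> on the time interval only\<close>
    have d': "nrm_deriv (l2_inner \<Omega>) {0..T} u (U 1 t) t"
      using d unfolding nrm_deriv_def
    proof (rule Lim_transform_eventually)
      show "\<forall>\<^sub>F s in at t within {0..T}. nrm (l2_inner \<Omega>) ((U 0 s - U 0 t) /\<^sub>R (s - t) - U 1 t) = nrm (l2_inner \<Omega>) ((u s - u t) /\<^sub>R (s - t) - U 1 t)"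
        unfolding eventually_at_topological by (intro exI[of _ UNIV]) (use U(1) t' in auto)
    qed
    have ul2: "u s \<in> l2_space \<Omega>" if "s \<in> {0..T}" for s using U(1)[OF that] sobolev_l2[OF U(2)[OF _ that, of 0]] by simp
    have "ae_eq \<Omega> (time_deriv \<Omega> T u t) (U 1 t)" by (rule time_deriv_eq[OF T t' ul2 l2(1) d'])
    moreover have "ae_eq \<Omega> (\<lambda>x. time_deriv \<Omega> T u t x - laplacian \<Omega> (u t) x + grad_s \<Omega> (p t) x) (f t)"
      using sol t by (auto simp: nonstationary_stokes_solution_def)
    ultimately have "ae_eq \<Omega> (U 1 t - laplacian \<Omega> (U 0 t) + grad_s \<Omega> (P 0 t) - f t) 0"
      unfolding ae_eq_def U(1)[OF t'] P(1)[OF t'] by eventually_elim simp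
    then have "l2_inner \<Omega> (U 1 t - laplacian \<Omega> (U 0 t) + grad_s \<Omega> (P 0 t) - f t) v = l2_inner \<Omega> 0 v"
      using l2 laplacian_l2[OF u2] grad_s_l2[OF p1] sobolev_l2[OF sobolev10_sobolev[OF v]]
      by (intro l2_inner_ae_eq) (auto intro!: l2.mem_simps)
    then show ?thesis using weak_equation_iff[OF l2(1) u2 p1 l2(2) v] by (simp add: l2_inner_def)
  qed
  have eq: "l2_inner \<Omega> (U 1 t) v + grad_form (U 0 t) v + form_b \<Omega> v (P 0 t) = l2_inner \<Omega> (f t) v"
    if t: "t \<in> {0..T}" and v: "v \<in> sobolev10 \<Omega>" for t v
  proof (cases "t = 0")
    case False
    then show ?thesis using eq_pos[OF _ v] t by auto
  next
    case True
    define \<Phi> where "\<Phi> s = l2_inner \<Omega> (U 1 s) v + grad_form (U 0 s) v - l2_inner \<Omega> (P 0 s) (divg \<Omega> v) - l2_inner \<Omega> (Ff 0 s) v" for s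
    have z: "0 \<in> {0..T}" using T by auto
    note vs = sobolev10_sobolev[OF v]
    have sub: "sobolev \<Omega> k \<subseteq> (l2_space \<Omega> :: (real^'d \<Rightarrow> 'b::euclidean_space) set)" by (auto intro: sobolev_l2)
    have le: "nrm grad_form w \<le> nrm (sob_inner k) w" if "w \<in> sobolev \<Omega> k" for w
      using a_le_sob[OF s1[OF that]] sob_nrm_mono[OF k1(1) that] by simp
    have "((\<lambda>s. \<Phi> s) \<longlongrightarrow> \<Phi> 0) (at 0 within {0..T})"
      unfolding \<Phi>_def
    proof (intro tendsto_diff tendsto_add)
      show "((\<lambda>s. l2_inner \<Omega> (U 1 s) v) \<longlongrightarrow> l2_inner \<Omega> (U 1 0) v) (at 0 within {0..T})"
        by (rule form_continuous[OF U(2)[OF k1(1)] z U(3)[OF k1(1) z] l2_psd sub l2_norm_le_sob sobolev_l2[OF vs]])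
      show "((\<lambda>s. grad_form (U 0 s) v) \<longlongrightarrow> grad_form (U 0 0) v) (at 0 within {0..T})"
      proof (rule form_continuous[OF U(2) z U(3)[OF _ z] a_psd _ le vs])
        show "sobolev \<Omega> k \<subseteq> (sobolev \<Omega> 1 :: (real^'d \<Rightarrow> real^'d) set)" using s1 by (rule subsetI)
      qed auto
      show "((\<lambda>s. l2_inner \<Omega> (P 0 s) (divg \<Omega> v)) \<longlongrightarrow> l2_inner \<Omega> (P 0 0) (divg \<Omega> v)) (at 0 within {0..T})"
        by (rule form_continuous[OF P(2) z P(3)[OF _ z] l2_psd sub l2_norm_le_sob divg_l2(1)[OF vs]]) auto
      show "((\<lambda>s. l2_inner \<Omega> (Ff 0 s) v) \<longlongrightarrow> l2_inner \<Omega> (Ff 0 0) v) (at 0 within {0..T})"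
        by (rule form_continuous[OF Ff(2) z Ff(3)[OF _ z] l2_psd sub l2_norm_le_sob sobolev_l2[OF vs]]) auto
    qed
    moreover have \<Phi>_eq: "\<Phi> s = l2_inner \<Omega> (U 1 s) v + grad_form (U 0 s) v + form_b \<Omega> v (P 0 s) - l2_inner \<Omega> (f s) v" if "s \<in> {0..T}" for s
      using l2.sym[OF sobolev_l2[OF P(2)[OF _ that, of 0]] divg_l2(1)[OF vs]] Ff(1)[OF that] by (simp add: \<Phi>_def form_b_def)
    have "((\<lambda>s. \<Phi> s) \<longlongrightarrow> 0) (at 0 within {0..T})"
    proof (rule Lim_transform_eventually[OF tendsto_const])
      show "\<forall>\<^sub>F s in at 0 within {0..T}. 0 = \<Phi> s"
        unfolding eventually_at_topological
      proof (intro exI[of _ UNIV] conjI ballI impI)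
        fix s assume "s \<noteq> 0" "s \<in> {0..T}"
        then show "0 = \<Phi> s" using eq_pos[OF _ v, of s] \<Phi>_eq[of s] by auto
      qed auto
    qed
    ultimately have "\<Phi> 0 = 0" using tendsto_unique[OF nt[OF z]] by blast
    then show ?thesis using \<Phi>_eq[OF z] True by simp
  qed
  show ?thesis
  proof (rule that[of U P M])
    show "U j t \<in> sobolev \<Omega> k" "P j t \<in> sobolev \<Omega> k" if "j \<le> 3" "t \<in> {0..T}" for j t
      using U(2) P(2) that k by auto
    show "0 \<le> M" using M(1)[of 0] by simp
    show "f t \<in> sobolev \<Omega> k" if "t \<in> {0..T}" for t using Ff(1,2)[of _] that by (metis le0)
    show "nrm_deriv (sob_inner k) {0..T} (U j) (U (Suc j) t) t" "nrm_deriv (sob_inner k) {0..T} (P j) (P (Suc j) t) t"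
      if "j < 3" "t \<in> {0..T}" for j t using U(4) P(4) that k by auto
    show "nrm (sob_inner k) (U j t) \<le> M" "nrm (sob_inner k) (P j t) \<le> M" if "j \<le> 3" "t \<in> {0..T}" for j t
      using MU(2)[of j t] MP(2)[of j t] M(2,3)[of j] that k by auto
  qed (use U P udiv zdiv eq in auto)
qed

text \<open>
  By the differential equation \<open>f(0) + \<Delta>u\<^sub>0 = \<partial>\<^sub>t u(0) + \<nabla>p(0)\<close>, and \<open>\<langle>\<nabla>\<nabla>p(0), \<nabla>v\<rangle> = \<langle>\<Delta>p(0), \<nabla>\<cdot>v\<rangle>\<close>. The
  contribution of the pressure to the right-hand side of the initial problem thus has the form of a pressure
  gradient, and the solution approximates \<open>\<partial>\<^sub>t u(0)\<close>.
\<close>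

lemma initial_time_derivative:
  assumes z: "z \<in> sobolev10 \<Omega>" "z \<in> sobolev \<Omega> 1" and u: "u \<in> sobolev \<Omega> 3" and p: "p \<in> sobolev \<Omega> 2" and f: "f0 \<in> sobolev \<Omega> 1"
    and eq: "\<And>v. v \<in> sobolev10 \<Omega> \<Longrightarrow> l2_inner \<Omega> z v + grad_form u v + form_b \<Omega> v p = l2_inner \<Omega> f0 v"
    and u0: "ae_eq \<Omega> u u0" and v: "v \<in> sobolev10 \<Omega>"
  shows "l2_inner \<Omega> (grad_v \<Omega> (\<lambda>x. f0 x + laplacian \<Omega> u0 x)) (grad_v \<Omega> v)
    = grad_form z v - form_b \<Omega> v (laplacian_s p)"
proof -
  have u2: "u \<in> sobolev \<Omega> 2" by (rule sobolev_mono[OF _ u]) simp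
  have p1: "p \<in> sobolev \<Omega> 1" by (rule sobolev_mono[OF _ p]) simp
  note vs = sobolev10_sobolev[OF v]
  have l2: "z \<in> l2_space \<Omega>" "f0 \<in> l2_space \<Omega>" using z f by (auto intro: sobolev_l2)
  have "ae_eq \<Omega> (z - laplacian \<Omega> u + grad_s \<Omega> p - f0) (\<lambda>x. 0)"
  proof (rule l2_zero_by_testing)
    show "z - laplacian \<Omega> u + grad_s \<Omega> p - f0 \<in> l2_space \<Omega>"
      by (intro l2.mem_simps l2 laplacian_l2[OF u2] grad_s_l2[OF p1])
    fix \<phi> :: "real^'d \<Rightarrow> real^'d" assume "\<phi> \<in> test_functions \<Omega>"
    then have t: "\<phi> \<in> sobolev10 \<Omega>" by (rule test_fn_sobolev10)
    show "l2_inner \<Omega> (z - laplacian \<Omega> u + grad_s \<Omega> p - f0) \<phi> = 0"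
      using weak_equation_iff[OF l2(1) u2 p1 l2(2) t] eq[OF t] by simp
  qed
  then have "ae_eq \<Omega> (\<lambda>x. f0 x + laplacian \<Omega> u x) (z + grad_s \<Omega> p)"
    unfolding ae_eq_def by eventually_elim (simp add: algebra_simps)
  moreover have "laplacian \<Omega> u0 = laplacian \<Omega> u" unfolding laplacian_def weak_deriv_ae_eq[OF u0] ..
  ultimately have "ae_eq \<Omega> (\<lambda>x. f0 x + laplacian \<Omega> u0 x) (z + grad_s \<Omega> p)" by (simp only:)
  from weak_deriv_ae_eq[OF this] have "grad_v \<Omega> (\<lambda>x. f0 x + laplacian \<Omega> u0 x) = grad_v \<Omega> (z + grad_s \<Omega> p)"
    by (simp add: grad_v_def fun_eq_iff)
  moreover have G: "grad_s \<Omega> p \<in> sobolev \<Omega> 1" using grad_s_sobolev[of p 1] p by (simp add: numeral_2_eq_2)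
  ultimately have "l2_inner \<Omega> (grad_v \<Omega> (\<lambda>x. f0 x + laplacian \<Omega> u0 x)) (grad_v \<Omega> v) = grad_form (z + grad_s \<Omega> p) v"
    using form_a_grad_form[OF sob.mem_simps(2)[OF z(2) G] vs] by (simp add: form_a_def)
  also have "\<dots> = grad_form z v + grad_form (grad_s \<Omega> p) v" by (rule a.add[OF z(2) G vs])
  also have "grad_form (grad_s \<Omega> p) v = - form_b \<Omega> v (laplacian_s p)"
  proof -
    have "laplacian_s p \<in> l2_space \<Omega>" by (rule sobolev_l2[OF laplacian_s_sobolev[of p 0, unfolded add_0, OF p]])
    from l2.sym[OF this divg_l2(1)[OF vs]] show ?thesis using hessian_green[OF p v] by (simp add: form_b_def)
  qed
  finally show ?thesis by simp
qed

end

section \<open>The fully discrete scheme on one subinterval\<close>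

lemma time_polys_affine:
  assumes "w \<in> time_polys 1 J B"
  shows "\<exists>c0\<in>B. \<exists>c1\<in>B. \<forall>s\<in>J. w s = c0 + s *\<^sub>R c1"
proof -
  obtain c where c: "\<forall>i\<le>1. c i \<in> B" "\<forall>s\<in>J. \<forall>x. w s x = (\<Sum>i\<le>1. s ^ i *\<^sub>R c i x)"
    using assms by (auto simp: time_polys_def)
  then have "\<forall>s\<in>J. w s = c 0 + s *\<^sub>R c 1" by (auto simp: fun_eq_iff)
  then show ?thesis using c(1) by (intro bexI[of _ "c 0"] bexI[of _ "c 1"]) auto
qed

text \<open>
  One-sided limits and piecewise derivatives of the discrete functions are computed from an expression \<open>h\<close>
  that is valid on the subinterval and defined for all times.
\<close>

lemma right_limit_eqI:
  fixes w :: "real \<Rightarrow> real^'d \<Rightarrow> 'b::euclidean_space"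
  assumes ab: "a < b" and w: "\<And>s x. s \<in> {a<..b} \<Longrightarrow> w s x = h s x" and h: "\<And>x. continuous_on UNIV (\<lambda>s. h s x)"
  shows "right_limit w a = h a"
proof
  fix x
  have "((\<lambda>s. h s x) \<longlongrightarrow> h a x) (at_right a)"
    using h[of x] by (auto simp: continuous_on_def intro: tendsto_within_subset)
  then have "((\<lambda>s. w s x) \<longlongrightarrow> h a x) (at_right a)"
  proof (rule Lim_transform_eventually)
    show "\<forall>\<^sub>F s in at_right a. h s x = w s x"
      unfolding eventually_at_right_field using ab w by (intro exI[of _ b]) auto
  qed
  then show "right_limit w a x = h a x" unfolding right_limit_def by (intro tendsto_Lim) auto
qed

lemma piece_deriv_eqI:
  fixes w :: "real \<Rightarrow> real^'d \<Rightarrow> 'b::euclidean_space"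
  assumes ab: "a < b" and s: "s \<in> {a<..b}" and w: "\<And>s x. s \<in> {a<..b} \<Longrightarrow> w s x = h s x"
    and h: "((\<lambda>s. h s x) has_vector_derivative h') (at s)"
  shows "piece_deriv {a<..b} w s x = h'"
proof -
  have "at_left s = at s within {(a + s) / 2..s}" using s by (simp add: at_within_Icc_at_left)
  also have "\<dots> \<le> at s within {a<..b}" using s by (intro at_le) auto
  finally have nt: "at s within {a<..b} \<noteq> bot" using trivial_limit_at_left_real[of s] by (metis bot.extremum_unique)
  have "((\<lambda>s. w s x) has_vector_derivative h') (at s within {a<..b})"
    by (rule has_vector_derivative_transform[OF s _ has_vector_derivative_at_within[OF h]]) (simp add: w)
  then show ?thesis unfolding piece_deriv_def by (rule vector_derivative_within[OF nt])
qed

lemma integral_affine: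
  fixes A B :: real
  assumes ab: "a < b" and f: "\<And>s. s \<in> {a<..b} \<Longrightarrow> f s = A + s * B"
  shows "(LINT s:{a<..b}|lebesgue. f s) = (b - a) * (A + (a + b) / 2 * B)"
proof -
  have "(LINT s:{a<..b}|lebesgue. f s) = (LINT s:{a<..b}|lebesgue. A + s * B)"
    by (intro set_lebesgue_integral_cong) (auto simp: f)
  also have "\<dots> = integral {a<..b} (\<lambda>s. A + s * B)"
  proof (rule set_lebesgue_integral_eq_integral(2))
    have "continuous_on {a..b} (\<lambda>s. A + s * B)" by (intro continuous_intros)
    then have "(\<lambda>s. A + s * B) absolutely_integrable_on {a..b}"
      using absolutely_integrable_continuous[of a b] by simp
    then show "(\<lambda>s. A + s * B) absolutely_integrable_on {a<..b}"
      by (rule set_integrable_subset) auto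
  qed
  also have "\<dots> = integral {a..b} (\<lambda>s. A + s * B)"
  proof (rule integral_subset_negligible)
    have "{a..b} - {a<..b} = {a}" using ab by auto
    then show "negligible ({a..b} - {a<..b})" by simp
  qed auto
  also have "\<dots> = (A * b + b\<^sup>2 / 2 * B) - (A * a + a\<^sup>2 / 2 * B)"
  proof (rule integral_unique, rule fundamental_theorem_of_calculus)
    fix x
    show "((\<lambda>s. A * s + s\<^sup>2 / 2 * B) has_vector_derivative A + x * B) (at x within {a..b})"
      unfolding has_real_derivative_iff_has_vector_derivative[symmetric]
      by (auto intro!: derivative_eq_intros)
  qed (use ab in simp)
  also have "\<dots> = (b - a) * (A + (a + b) / 2 * B)" by (simp add: power2_eq_square field_simps)
  finally show ?thesis .
qed

context stokes_domain
begin

text \<open>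
  With \<open>uh s = c0 + s *\<^sub>R c1\<close> the one-sided derivatives of the post-processed velocity are \<open>c1 + c\<close> on
  the left and \<open>c1 - c\<close> on the right, because the derivative of the bubble function is \<open>1\<close> and \<open>- 1\<close> there. The
  equation at the right end point is twice the averaged equation of the scheme minus the
  collocation condition.
\<close>

lemma scheme_on_interval:
  assumes subV: "subspace (Vh \<Omega> D)" and subQ: "subspace (Qh \<Omega> D)"
    and scheme: "scheme_solution \<Omega> D N t f u0h uh ph" and post: "\<exists>\<alpha> c d. \<forall>n\<in>{1..N}. let J = subinterval t n; t' = t (n - 1) in
        deriv (bubble \<alpha> t n) t' = 1 \<and> c n \<in> Vh_div \<Omega> D \<and> d n \<in> Qh \<Omega> D \<and>
        (\<forall>s\<in>J. \<forall>x. uh' s x = uh s x + bubble \<alpha> t n s *\<^sub>R c n x \<and>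
                    ph' s x = ph s x + d n x * deriv (bubble \<alpha> t n) s) \<and>
        (\<forall>v \<in> Vh \<Omega> D.
           l2_inner \<Omega> (right_limit (piece_deriv J uh') t') v +
           form_a \<Omega> (right_limit uh' t') v + form_b \<Omega> v (right_limit ph' t') =
           l2_inner \<Omega> (f t') v)"
    and n: "n < N" and ab: "t n < t (Suc n)" and f: "f (t n) \<in> l2_space \<Omega>" "f (t (Suc n)) \<in> l2_space \<Omega>"
  defines "\<tau> \<equiv> t (Suc n) - t n"
  shows "\<exists>UL UR ZL ZR pL pR c. UL \<in> Vh \<Omega> D \<and> UR \<in> Vh \<Omega> D \<and> pL \<in> Qh \<Omega> D \<and> pR \<in> Qh \<Omega> D \<and> c \<in> Vh_div \<Omega> D \<and>
    ZL - ZR = 2 *\<^sub>R c \<and> UR - UL = (\<tau> / 2) *\<^sub>R (ZL + ZR) \<and> ae_eq \<Omega> UL (uh (t n)) \<and> uh (t (Suc n)) = UR \<and>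
    (\<forall>q\<in>Qh \<Omega> D. form_b \<Omega> (UL + UR) q = 0) \<and>
    (\<forall>v\<in>Vh \<Omega> D. l2_inner \<Omega> ZL v + grad_form UL v + form_b \<Omega> v pL = l2_inner \<Omega> (f (t n)) v) \<and>
    (\<forall>v\<in>Vh \<Omega> D. l2_inner \<Omega> ZR v + grad_form UR v + form_b \<Omega> v pR = l2_inner \<Omega> (f (t (Suc n))) v) \<and>
    (\<forall>s\<in>{t n<..t (Suc n)}. ph' s = ((t (Suc n) - s) / \<tau>) *\<^sub>R pL + ((s - t n) / \<tau>) *\<^sub>R pR)"
proof -
  define a where "a = t n"
  define b where "b = t (Suc n)"
  have ab': "a < b" using ab by (simp add: a_def b_def)
  have \<tau>: "\<tau> = b - a" "\<tau> > 0" using ab by (simp_all add: \<tau>_def a_def b_def)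
  define J where "J = {a<..b}"
  have J: "subinterval t (Suc n) = J" by (simp add: subinterval_def J_def a_def b_def)
  have nN: "Suc n \<in> {1..N}" using n by simp
  have sch: "uh \<in> time_polys 1 J (Vh \<Omega> D)" "ph \<in> time_polys 1 J (Qh \<Omega> D)" "ae_eq \<Omega> (right_limit uh a) (uh a)"
    "\<And>v. v \<in> Vh \<Omega> D \<Longrightarrow> (LINT s:J|lebesgue. l2_inner \<Omega> (piece_deriv J uh s) v + form_a \<Omega> (uh s) v + form_b \<Omega> v (ph s)) =
           \<tau> / 2 * l2_inner \<Omega> (\<lambda>x. f a x + f b x) v"
    "\<And>q. q \<in> Qh \<Omega> D \<Longrightarrow> (LINT s:J|lebesgue. form_b \<Omega> (uh s) q) = 0"
    using bspec[OF conjunct2[OF scheme[unfolded scheme_solution_def]] nN]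
    unfolding Let_def J by (auto simp: a_def b_def \<tau>_def step_def)
  obtain \<alpha> c' d' where "\<forall>n\<in>{1..N}. let J = subinterval t n; t' = t (n - 1) in
        deriv (bubble \<alpha> t n) t' = 1 \<and> c' n \<in> Vh_div \<Omega> D \<and> d' n \<in> Qh \<Omega> D \<and>
        (\<forall>s\<in>J. \<forall>x. uh' s x = uh s x + bubble \<alpha> t n s *\<^sub>R c' n x \<and>
                    ph' s x = ph s x + d' n x * deriv (bubble \<alpha> t n) s) \<and>
        (\<forall>v \<in> Vh \<Omega> D.
           l2_inner \<Omega> (right_limit (piece_deriv J uh') t') v +
           form_a \<Omega> (right_limit uh' t') v + form_b \<Omega> v (right_limit ph' t') =
           l2_inner \<Omega> (f t') v)" using post by blast
  note post' = bspec[OF this nN, unfolded Let_def J]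
  define c where "c = c' (Suc n)"
  define d where "d = d' (Suc n)"
  have pp: "deriv (bubble \<alpha> t (Suc n)) a = 1" "c \<in> Vh_div \<Omega> D" "d \<in> Qh \<Omega> D"
    "\<And>s x. s \<in> J \<Longrightarrow> uh' s x = uh s x + bubble \<alpha> t (Suc n) s *\<^sub>R c x"
    "\<And>s x. s \<in> J \<Longrightarrow> ph' s x = ph s x + d x * deriv (bubble \<alpha> t (Suc n)) s"
    "\<And>v. v \<in> Vh \<Omega> D \<Longrightarrow> l2_inner \<Omega> (right_limit (piece_deriv J uh') a) v +
           form_a \<Omega> (right_limit uh' a) v + form_b \<Omega> v (right_limit ph' a) = l2_inner \<Omega> (f a) v"
    using post' by (simp_all add: a_def c_def d_def)
  have bub: "(bubble \<alpha> t (Suc n) has_real_derivative \<alpha> (Suc n) * (2 * s - a - b)) (at s)" for s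
    unfolding bubble_def[abs_def] a_def b_def by (auto intro!: derivative_eq_intros simp: algebra_simps)
  have dbub: "deriv (bubble \<alpha> t (Suc n)) s = \<alpha> (Suc n) * (2 * s - a - b)" for s by (rule DERIV_imp_deriv[OF bub])
  have \<alpha>: "\<alpha> (Suc n) * (b - a) = - 1" using pp(1) unfolding dbub by (simp add: algebra_simps)
  \<comment> \<open>the normalization of the bubble function determines its factor\<close>
  then have \<alpha>': "\<alpha> (Suc n) = - 1 / (b - a)" using ab' by (simp add: field_simps)
  obtain c0 c1 where c01: "c0 \<in> Vh \<Omega> D" "c1 \<in> Vh \<Omega> D" "\<And>s. s \<in> J \<Longrightarrow> uh s = c0 + s *\<^sub>R c1" using time_polys_affine[OF sch(1)] by blast
  obtain e0 e1 where e01: "e0 \<in> Qh \<Omega> D" "e1 \<in> Qh \<Omega> D" "\<And>s. s \<in> J \<Longrightarrow> ph s = e0 + s *\<^sub>R e1" using time_polys_affine[OF sch(2)] by blast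
  have cV: "c \<in> Vh \<Omega> D" using pp(2) by (simp add: Vh_div_def)
  have uh_deriv: "piece_deriv J uh s = c1" if s: "s \<in> J" for s
  proof
    fix x
    show "piece_deriv J uh s x = c1 x" unfolding J_def
    proof (rule piece_deriv_eqI[OF ab' s[unfolded J_def], where h = "\<lambda>s x. c0 x + s *\<^sub>R c1 x"])
      show "uh s x = c0 x + s *\<^sub>R c1 x" if "s \<in> {a<..b}" for s x using c01(3)[of s] that by (simp add: J_def)
      show "((\<lambda>s. c0 x + s *\<^sub>R c1 x) has_vector_derivative c1 x) (at s)" by (auto intro!: derivative_eq_intros)
    qed
  qed
  have uh'_deriv: "piece_deriv J uh' s x = c1 x + (\<alpha> (Suc n) * (2 * s - a - b)) *\<^sub>R c x" if s: "s \<in> J" for s x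
    unfolding J_def
  proof (rule piece_deriv_eqI[OF ab' s[unfolded J_def], where h = "\<lambda>s x. c0 x + s *\<^sub>R c1 x + bubble \<alpha> t (Suc n) s *\<^sub>R c x"])
    show "uh' s x = c0 x + s *\<^sub>R c1 x + bubble \<alpha> t (Suc n) s *\<^sub>R c x" if "s \<in> {a<..b}" for s x
      using c01(3)[of s] pp(4)[of s x] that by (simp add: J_def)
    have "((\<lambda>s. bubble \<alpha> t (Suc n) s *\<^sub>R c x) has_vector_derivative (\<alpha> (Suc n) * (2 * s - a - b)) *\<^sub>R c x) (at s)"
      using has_vector_derivative_scaleR[OF bub has_vector_derivative_const[of "c x"]] by simp
    moreover have "((\<lambda>s. c0 x + s *\<^sub>R c1 x) has_vector_derivative c1 x) (at s)" by (auto intro!: derivative_eq_intros)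
    ultimately show "((\<lambda>s. c0 x + s *\<^sub>R c1 x + bubble \<alpha> t (Suc n) s *\<^sub>R c x) has_vector_derivative c1 x + (\<alpha> (Suc n) * (2 * s - a - b)) *\<^sub>R c x) (at s)"
      by (intro has_vector_derivative_add)
  qed
  have bubc: "continuous_on UNIV (bubble \<alpha> t (Suc n))" unfolding bubble_def[abs_def] by (intro continuous_intros)
  have rl1: "right_limit uh a = c0 + a *\<^sub>R c1"
    using right_limit_eqI[OF ab', of uh "\<lambda>s x. c0 x + s *\<^sub>R c1 x"] c01(3) by (simp add: J_def fun_eq_iff continuous_intros)
  have rl2: "right_limit (piece_deriv J uh') a = c1 + c"
  proof -
    have "right_limit (piece_deriv J uh') a = (\<lambda>x. c1 x + (\<alpha> (Suc n) * (2 * a - a - b)) *\<^sub>R c x)"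
      by (rule right_limit_eqI[OF ab', where h = "\<lambda>s x. c1 x + (\<alpha> (Suc n) * (2 * s - a - b)) *\<^sub>R c x"])
         (use uh'_deriv in \<open>auto intro!: continuous_intros simp: J_def\<close>)
    also have "\<alpha> (Suc n) * (2 * a - a - b) = 1" using \<alpha> by (simp add: algebra_simps)
    finally show ?thesis by (simp add: fun_eq_iff)
  qed
  have rl3: "right_limit uh' a = c0 + a *\<^sub>R c1"
  proof -
    have "right_limit uh' a = (\<lambda>x. c0 x + a *\<^sub>R c1 x + bubble \<alpha> t (Suc n) a *\<^sub>R c x)"
      by (rule right_limit_eqI[OF ab', where h = "\<lambda>s x. c0 x + s *\<^sub>R c1 x + bubble \<alpha> t (Suc n) s *\<^sub>R c x"])
         (use c01(3) pp(4) bubc in \<open>auto intro!: continuous_intros simp: J_def\<close>)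
    also have "bubble \<alpha> t (Suc n) a = 0" by (simp add: bubble_def a_def)
    finally show ?thesis by (simp add: fun_eq_iff)
  qed
  have ph'_eq: "ph' s x = e0 x + s * e1 x + d x * (\<alpha> (Suc n) * (2 * s - a - b))" if "s \<in> J" for s x
    using pp(5)[OF that, of x] e01(3)[OF that] by (simp add: dbub)
  have rl4: "right_limit ph' a = e0 + a *\<^sub>R e1 + d"
  proof -
    have "right_limit ph' a = (\<lambda>x. e0 x + a * e1 x + d x * (\<alpha> (Suc n) * (2 * a - a - b)))"
      by (rule right_limit_eqI[OF ab', where h = "\<lambda>s x. e0 x + s * e1 x + d x * (\<alpha> (Suc n) * (2 * s - a - b))"])
         (auto intro!: continuous_intros simp: ph'_eq J_def)
    also have "\<alpha> (Suc n) * (2 * a - a - b) = 1" using \<alpha> by (simp add: algebra_simps)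
    finally show ?thesis by (simp add: fun_eq_iff)
  qed
  have Vs: "v \<in> sobolev \<Omega> 1" if "v \<in> Vh \<Omega> D" for v using that by (intro sobolev10_sobolev) (simp add: Vh_def)
  have Ql: "q \<in> l2_space \<Omega>" if "q \<in> Qh \<Omega> D" for q using that by (simp add: Qh_def pressure_l2)
  note s = Vs[OF c01(1)] Vs[OF c01(2)] Vs[OF cV]
  note l = sobolev_l2[OF s(1)] sobolev_l2[OF s(2)] sobolev_l2[OF s(3)]
  note ql = Ql[OF e01(1)] Ql[OF e01(2)] Ql[OF pp(3)]
  define UL where "UL = c0 + a *\<^sub>R c1"
  define UR where "UR = c0 + b *\<^sub>R c1"
  define ZL where "ZL = c1 + c"
  define ZR where "ZR = c1 - c"
  define pL where "pL = e0 + a *\<^sub>R e1 + d"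
  define pR where "pR = e0 + b *\<^sub>R e1 - d"
  have memV: "UL \<in> Vh \<Omega> D" "UR \<in> Vh \<Omega> D" unfolding UL_def UR_def
    by (intro subspace_add[OF subV] subspace_scale[OF subV] c01)+
  have memQ: "pL \<in> Qh \<Omega> D" "pR \<in> Qh \<Omega> D" unfolding pL_def pR_def
    by (intro subspace_add[OF subQ] subspace_diff[OF subQ] subspace_scale[OF subQ] e01 pp(3))+
  have mid: "form_b \<Omega> (UL + UR) q = 0" if q: "q \<in> Qh \<Omega> D" for q
  proof -
    have "(LINT s:J|lebesgue. form_b \<Omega> (uh s) q) = (b - a) * (form_b \<Omega> c0 q + (a + b) / 2 * form_b \<Omega> c1 q)"
      unfolding J_def
    proof (rule integral_affine[OF ab'])
      fix r assume "r \<in> {a<..b}"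
      then show "form_b \<Omega> (uh r) q = form_b \<Omega> c0 q + r * form_b \<Omega> c1 q"
        using c01(3)[of r] s Ql[OF q] by (simp only: J_def form_b_add form_b_scale sob.mem_simps)
    qed
    then have "form_b \<Omega> c0 q + (a + b) / 2 * form_b \<Omega> c1 q = 0" using sch(5)[OF q] ab' by simp
    then show ?thesis using s Ql[OF q] unfolding UL_def UR_def
      by (simp only: form_b_add form_b_scale sob.mem_simps) (simp add: field_simps)
  qed
  have eqL: "l2_inner \<Omega> ZL v + grad_form UL v + form_b \<Omega> v pL = l2_inner \<Omega> (f a) v" if v: "v \<in> Vh \<Omega> D" for v
    using pp(6)[OF v] form_a_grad_form[OF Vs[OF memV(1)] Vs[OF v]] unfolding rl2 rl3 rl4 ZL_def UL_def pL_def by simp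
  have eqR: "l2_inner \<Omega> ZR v + grad_form UR v + form_b \<Omega> v pR = l2_inner \<Omega> (f b) v" if v: "v \<in> Vh \<Omega> D" for v
  proof -
    note vs = Vs[OF v] and vl = sobolev_l2[OF Vs[OF v]]
    define A where "A = l2_inner \<Omega> c1 v + grad_form c0 v + form_b \<Omega> v e0"
    define B where "B = grad_form c1 v + form_b \<Omega> v e1"
    have "(LINT s:J|lebesgue. l2_inner \<Omega> (piece_deriv J uh s) v + form_a \<Omega> (uh s) v + form_b \<Omega> v (ph s)) = (b - a) * (A + (a + b) / 2 * B)"
      unfolding J_def
    proof (rule integral_affine[OF ab'])
      fix r assume r: "r \<in> {a<..b}"
      then have rJ: "r \<in> J" by (simp add: J_def)
      have "c0 + r *\<^sub>R c1 \<in> sobolev \<Omega> 1" using s by (simp only: sob.mem_simps)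
      from form_a_grad_form[OF this vs] have "form_a \<Omega> (uh r) v = grad_form c0 v + r * grad_form c1 v"
        using s vs c01(3)[OF rJ] by (simp only: a.form_simps)
      moreover have "form_b \<Omega> v (ph r) = form_b \<Omega> v e0 + r * form_b \<Omega> v e1"
        using ql vs e01(3)[OF rJ] by (simp only: form_b_add_right form_b_scale_right l2.mem_simps)
      ultimately show "l2_inner \<Omega> (piece_deriv {a<..b} uh r) v + form_a \<Omega> (uh r) v + form_b \<Omega> v (ph r) = A + r * B"
        using uh_deriv[OF rJ] by (simp add: J_def A_def B_def algebra_simps)
    qed
    moreover have "l2_inner \<Omega> (\<lambda>x. f a x + f b x) v = l2_inner \<Omega> (f a) v + l2_inner \<Omega> (f b) v"
      using l2_inner_add[OF f vl] by (simp add: plus_fun_def a_def b_def)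
    ultimately have "(b - a) * (A + (a + b) / 2 * B) = (b - a) / 2 * (l2_inner \<Omega> (f a) v + l2_inner \<Omega> (f b) v)"
      using sch(4)[OF v] unfolding \<tau>(1) by (simp only:)
    moreover have "(b - a) * (A + (a + b) / 2 * B) * 2 = (b - a) * (2 * A + (a + b) * B)"
      by (simp add: field_simps del: mult_cancel_left mult_cancel_right)
    ultimately have "(b - a) * (2 * A + (a + b) * B) = (b - a) * (l2_inner \<Omega> (f a) v + l2_inner \<Omega> (f b) v)" by linarith
    then have AB: "2 * A + (a + b) * B = l2_inner \<Omega> (f a) v + l2_inner \<Omega> (f b) v" using ab' by simp
    have "l2_inner \<Omega> ZL v = l2_inner \<Omega> c1 v + l2_inner \<Omega> c v" "l2_inner \<Omega> ZR v = l2_inner \<Omega> c1 v - l2_inner \<Omega> c v"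
      unfolding ZL_def ZR_def using l vl by (simp_all only: l2.form_simps)
    moreover have "grad_form UL v = grad_form c0 v + a * grad_form c1 v" "grad_form UR v = grad_form c0 v + b * grad_form c1 v"
      unfolding UL_def UR_def using s vs by (simp_all only: a.form_simps)
    moreover have "form_b \<Omega> v pL = form_b \<Omega> v e0 + a * form_b \<Omega> v e1 + form_b \<Omega> v d"
      unfolding pL_def using ql vs by (simp only: form_b_add_right form_b_scale_right l2.mem_simps)
    moreover have "form_b \<Omega> v pR = form_b \<Omega> v e0 + b * form_b \<Omega> v e1 - form_b \<Omega> v d"
    proof -
      have "form_b \<Omega> v (e0 + b *\<^sub>R e1 + (-1) *\<^sub>R d) = form_b \<Omega> v e0 + b * form_b \<Omega> v e1 + (-1) * form_b \<Omega> v d"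
        using ql vs by (simp only: form_b_add_right form_b_scale_right l2.mem_simps)
      then show ?thesis by (simp add: pR_def)
    qed
    ultimately show ?thesis using eqL[OF v] AB unfolding A_def B_def by (simp add: algebra_simps)
  qed
  have zlr: "ZL - ZR = 2 *\<^sub>R c" by (simp add: ZL_def ZR_def fun_eq_iff scaleR_2)
  have inc: "UR - UL = (\<tau> / 2) *\<^sub>R (ZL + ZR)"
  proof -
    have "ZL + ZR = 2 *\<^sub>R c1" by (simp add: ZL_def ZR_def scaleR_2)
    then have "(\<tau> / 2) *\<^sub>R (ZL + ZR) = \<tau> *\<^sub>R c1" by simp
    then show ?thesis by (simp add: UL_def UR_def \<tau>(1) scaleR_diff_left)
  qed
  have uR: "uh b = UR" using c01(3)[of b] ab' by (simp add: J_def UR_def)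
  have uL: "ae_eq \<Omega> UL (uh a)" using sch(3) unfolding rl1 UL_def .
  have lin: "ph' s = ((b - s) / \<tau>) *\<^sub>R pL + ((s - a) / \<tau>) *\<^sub>R pR" if s: "s \<in> {a<..b}" for s
  proof
    fix x
    have "(b - s) * (e0 x + a * e1 x + d x) + (s - a) * (e0 x + b * e1 x - d x)
        = (b - a) * (e0 x + s * e1 x) + d x * (a + b - 2 * s)" by (simp add: algebra_simps)
    then have "((b - s) / (b - a)) * (e0 x + a * e1 x + d x) + ((s - a) / (b - a)) * (e0 x + b * e1 x - d x)
        = e0 x + s * e1 x + d x * (- 1 / (b - a) * (2 * s - a - b))"
      using ab' by (simp add: divide_simps) (simp add: algebra_simps)?
    then show "ph' s x = (((b - s) / \<tau>) *\<^sub>R pL + ((s - a) / \<tau>) *\<^sub>R pR) x"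
      using ph'_eq[of s x] s by (simp add: J_def \<alpha>' \<tau>(1) pL_def pR_def)
  qed
  show ?thesis
    unfolding a_def[symmetric] b_def[symmetric]
    by (intro exI[of _ UL] exI[of _ UR] exI[of _ ZL] exI[of _ ZR] exI[of _ pL] exI[of _ pR] exI[of _ c] conjI ballI;
        (rule memV memQ pp(2) zlr inc uL uR mid eqL eqR lin; assumption?))
qed

end

section \<open>Convergence of the post-processed pressure\<close>

lemma mesh_points_mono:
  assumes t: "\<And>n. n < N \<Longrightarrow> t n < t (Suc n)" and "i \<le> j" "j \<le> N"
  shows "t i \<le> (t j :: real)"
  using assms(2,3) by (induction rule: dec_induct) (use t in \<open>auto intro: order_trans[OF _ less_imp_le]\<close>)

lemma mesh_interval_exists:
  assumes N: "t 0 = 0" "t N = T" and s: "0 < s" "s \<le> (T::real)"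
  shows "\<exists>n<N. s \<in> {t n<..t (Suc n)}"
proof -
  define i where "i = (LEAST i. s \<le> t i)"
  have i: "s \<le> t i" "i \<le> N" unfolding i_def using s N by (auto intro: LeastI[of _ N] Least_le)
  then obtain n where n: "i = Suc n" using N s by (cases i) auto
  have "\<not> s \<le> t n" using not_less_Least[of n "\<lambda>i. s \<le> t i"] n by (simp add: i_def[symmetric])
  then show ?thesis using i n by (intro exI[of _ n]) auto
qed

text \<open>
  If the square of \<open>g\<close> is not integrable, its integral is zero by convention and satisfies the bound.
\<close>

lemma sqrt_integral_square_le:
  fixes g :: "real \<Rightarrow> real"
  assumes T: "0 < T" and g: "\<And>s. s \<in> {0<..T} \<Longrightarrow> 0 \<le> g s \<and> g s \<le> B" and B: "0 \<le> B"
  shows "sqrt (LINT s:{0..T}|lebesgue. (g s)\<^sup>2) \<le> sqrt T * B"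
proof -
  have "(LINT s:{0..T}|lebesgue. (g s)\<^sup>2) \<le> T * B\<^sup>2"
  proof (cases "set_integrable lebesgue {0..T} (\<lambda>s. (g s)\<^sup>2)")
    case True
    have "{0} \<in> null_sets (lebesgue :: real measure)" using negligible_iff_null_sets by blast
    then have ae: "AE s in lebesgue. s \<notin> {0::real}" by (rule AE_not_in)
    have "(LINT s:{0..T}|lebesgue. (g s)\<^sup>2) \<le> (LINT s|lebesgue. indicator {0..T} s *\<^sub>R B\<^sup>2)"
      unfolding set_lebesgue_integral_def
    proof (rule integral_mono_AE)
      show "integrable lebesgue (\<lambda>s. indicator {0..T} s *\<^sub>R B\<^sup>2)"
        by (intro integrable_scaleR_left integrable_real_indicator) (simp_all add: emeasure_lborel_Icc_eq)
      show "AE s in lebesgue. indicator {0..T} s *\<^sub>R (g s)\<^sup>2 \<le> indicator {0..T} s *\<^sub>R B\<^sup>2"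
        using ae
      proof eventually_elim
        fix s :: real assume "s \<notin> {0}"
        then show "indicator {0..T} s *\<^sub>R (g s)\<^sup>2 \<le> indicator {0..T} s *\<^sub>R B\<^sup>2"
          using g[of s] by (auto simp: indicator_def intro: power_mono)
      qed
    qed (use True in \<open>simp add: set_integrable_def\<close>)
    also have "\<dots> = T * B\<^sup>2" using T by simp
    finally show ?thesis .
  next
    case False
    then show ?thesis using T unfolding set_lebesgue_integral_def set_integrable_def by (simp add: not_integrable_integral_eq)
  qed
  then have "sqrt (LINT s:{0..T}|lebesgue. (g s)\<^sup>2) \<le> sqrt (T * B\<^sup>2)" by (rule real_sqrt_le_mono)
  also have "\<dots> = sqrt T * B" using B by (simp add: real_sqrt_mult)
  finally show ?thesis .
qed

context stokes_domain
begin

text \<open>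
  Dividing the approximation property of velocities by the mesh size leaves the order \<open>h\<^sup>r\<close> in the
  energy norm.
\<close>

lemma best_approximation:
  assumes ap: "approximation_order r \<Omega> \<F>" and shape: "shape_regular_family \<Omega> \<F>"
  obtains Ca where "0 \<le> Ca"
    "\<And>D v. D \<in> \<F> \<Longrightarrow> v \<in> sobolev10 \<Omega> \<Longrightarrow> v \<in> sobolev \<Omega> (r + 1) \<Longrightarrow>
       \<exists>v'\<in>Vh \<Omega> D. nrm grad_form (v - v') \<le> Ca * mesh_size D ^ r * nrm (sob_inner (r + 1)) v"
    "\<And>D q. D \<in> \<F> \<Longrightarrow> q \<in> pressure_space \<Omega> \<Longrightarrow> q \<in> sobolev \<Omega> r \<Longrightarrow>
       \<exists>q'\<in>Qh \<Omega> D. nrm (l2_inner \<Omega>) (q - q') \<le> Ca * mesh_size D ^ r * nrm (sob_inner r) q"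
proof -
  note mesh = shape_regular_mesh(1)[OF shape]
  obtain C where C: "\<forall>D\<in>\<F>.
     (\<forall>v \<in> velocity_space \<Omega> \<inter> sobolev \<Omega> (r + 1). \<exists>v' \<in> Vh \<Omega> D.
        l2_norm \<Omega> (\<lambda>x. v x - v' x) + mesh_size D * l2_norm \<Omega> (grad_v \<Omega> (\<lambda>x. v x - v' x))
          \<le> C * mesh_size D ^ (r + 1) * sobolev_norm \<Omega> (r + 1) v) \<and>
     (\<forall>q \<in> pressure_space \<Omega> \<inter> sobolev \<Omega> r. \<exists>q' \<in> Qh \<Omega> D.
        l2_norm \<Omega> (\<lambda>x. q x - q' x) \<le> C * mesh_size D ^ r * sobolev_norm \<Omega> r q)"
    using ap unfolding approximation_order_def by (elim exE)
  show ?thesis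
  proof (rule that[of "max C 0"])
    fix D and v :: "real^'d \<Rightarrow> real^'d"
    assume D: "D \<in> \<F>" and v: "v \<in> sobolev10 \<Omega>" "v \<in> sobolev \<Omega> (r + 1)"
    define h where "h = mesh_size D"
    have h: "0 < h" unfolding h_def by (rule mesh_size_pos[OF mesh[OF D]])
    obtain v' where v': "v' \<in> Vh \<Omega> D" "l2_norm \<Omega> (\<lambda>x. v x - v' x) + h * l2_norm \<Omega> (grad_v \<Omega> (\<lambda>x. v x - v' x))
          \<le> C * h ^ (r + 1) * sobolev_norm \<Omega> (r + 1) v"
      using bspec[OF conjunct1[OF bspec[OF C D]] IntI[OF v]] unfolding h_def by (elim bexE)
    have e: "(\<lambda>x. v x - v' x) = v - v'" by (simp add: fun_eq_iff)
    have s: "v - v' \<in> sobolev \<Omega> 1"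
      using v'(1) by (intro sob.mem_simps(3) sobolev10_sobolev v) (simp add: Vh_def)
    define E where "E = nrm grad_form (v - v')"
    define S where "S = nrm (sob_inner (r + 1)) v"
    have nE: "l2_norm \<Omega> (grad_v \<Omega> (v - v')) = E"
      using form_a_grad_form[OF s s] by (simp add: E_def l2_norm_def form_a_def nrm_def)
    have "0 \<le> l2_norm \<Omega> (v - v')" using l2.nrm_nonneg[OF sobolev_l2[OF s]] by (simp add: l2_norm_eq)
    then have "h * E \<le> C * h ^ (r + 1) * S"
      using v'(2)[unfolded e nE sobolev_norm_eq[OF v(2)]] unfolding S_def by linarith
    then have "h * E \<le> h * (C * h ^ r * S)" by (simp add: mult_ac)
    then have "E \<le> C * h ^ r * S" using h by simp
    also have "\<dots> \<le> max C 0 * h ^ r * S" unfolding S_def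
      using h sob.nrm_nonneg[OF v(2)] by (intro mult_right_mono) auto
    finally show "\<exists>v'\<in>Vh \<Omega> D. nrm grad_form (v - v') \<le> max C 0 * mesh_size D ^ r * nrm (sob_inner (r + 1)) v"
      using v'(1) unfolding E_def S_def h_def by (intro bexI[of _ v'])
  next
    fix D and q :: "real^'d \<Rightarrow> real"
    assume D: "D \<in> \<F>" and q: "q \<in> pressure_space \<Omega>" "q \<in> sobolev \<Omega> r"
    obtain q' where q': "q' \<in> Qh \<Omega> D" "l2_norm \<Omega> (\<lambda>x. q x - q' x) \<le> C * mesh_size D ^ r * sobolev_norm \<Omega> r q"
      using bspec[OF conjunct2[OF bspec[OF C D]] IntI[OF q]] by (elim bexE)
    have e: "(\<lambda>x. q x - q' x) = q - q'" by (simp add: fun_eq_iff)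
    have "C * mesh_size D ^ r * nrm (sob_inner r) q \<le> max C 0 * mesh_size D ^ r * nrm (sob_inner r) q"
      using mesh_size_pos[OF mesh[OF D]] sob.nrm_nonneg[OF q(2)] by (intro mult_right_mono) auto
    then have "nrm (l2_inner \<Omega>) (q - q') \<le> max C 0 * mesh_size D ^ r * nrm (sob_inner r) q"
      using q'(2)[unfolded e l2_norm_eq sobolev_norm_eq[OF q(2)]] by linarith
    then show "\<exists>q'\<in>Qh \<Omega> D. nrm (l2_inner \<Omega>) (q - q') \<le> max C 0 * mesh_size D ^ r * nrm (sob_inner r) q"
      using q'(1) by (intro bexI[of _ q'])
  qed simp
qed

lemma grad_form_null:
  assumes v: "v \<in> sobolev10 \<Omega>" and 0: "l2_inner \<Omega> v v = 0"
  shows "grad_form v v = 0"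
proof -
  have "ae_eq \<Omega> v (\<lambda>x. 0)" using l2_null_iff[OF sobolev_l2[OF sobolev10_sobolev[OF v]]] 0 by simp
  then have "weak_deriv \<Omega> is v = weak_deriv \<Omega> is 0" for "is"
    by (intro weak_deriv_ae_eq) (simp add: zero_fun_def)
  then have "grad_form v v = grad_form 0 0" by (simp add: grad_form_def)
  then show ?thesis using a.zero[of 0] a.mem_simps(1) by simp
qed

lemma l2_inner_diff_ae_zero:
  fixes v w :: "real^'d \<Rightarrow> 'b::euclidean_space"
  assumes "v \<in> l2_space \<Omega>" "w \<in> l2_space \<Omega>" and e: "ae_eq \<Omega> v w"
  shows "l2_inner \<Omega> (v - w) (v - w) = 0"
proof -
  have "ae_eq \<Omega> (v - w) (\<lambda>x. 0)" using e unfolding ae_eq_def by eventually_elim simp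
  then show ?thesis using l2_null_iff[OF l2.mem_simps(3)[OF assms(1,2)]] by simp
qed

lemma scheme_nodal_form:
  assumes subV: "subspace (Vh \<Omega> D)" and subQ: "subspace (Qh \<Omega> D)"
    and scheme: "scheme_solution \<Omega> D N t f u0h uh ph" and post: "collocation_postprocessing \<Omega> D N t f uh ph uh' ph'"
    and mesh: "\<forall>n<N. t n < t (Suc n)" and f: "\<forall>n\<le>N. f (t n) \<in> l2_space \<Omega>"
  obtains UL UR pL pR c ZL ZR where
    "\<And>n. n < N \<Longrightarrow> UL n \<in> Vh \<Omega> D" "\<And>n. n < N \<Longrightarrow> UR n \<in> Vh \<Omega> D" "\<And>n. n < N \<Longrightarrow> pL n \<in> Qh \<Omega> D" "\<And>n. n < N \<Longrightarrow> pR n \<in> Qh \<Omega> D"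
    "\<And>n. n < N \<Longrightarrow> c n \<in> Vh_div \<Omega> D" "\<And>n. n < N \<Longrightarrow> ZL n - ZR n = 2 *\<^sub>R c n"
    "\<And>n. n < N \<Longrightarrow> UR n - UL n = ((t (Suc n) - t n) / 2) *\<^sub>R (ZL n + ZR n)"
    "\<And>n. n < N \<Longrightarrow> ae_eq \<Omega> (UL n) (uh (t n))" "\<And>n. n < N \<Longrightarrow> uh (t (Suc n)) = UR n"
    "\<And>n q. n < N \<Longrightarrow> q \<in> Qh \<Omega> D \<Longrightarrow> form_b \<Omega> (UL n + UR n) q = 0"
    "\<And>n v. n < N \<Longrightarrow> v \<in> Vh \<Omega> D \<Longrightarrow> l2_inner \<Omega> (ZL n) v + grad_form (UL n) v + form_b \<Omega> v (pL n) = l2_inner \<Omega> (f (t n)) v"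
    "\<And>n v. n < N \<Longrightarrow> v \<in> Vh \<Omega> D \<Longrightarrow> l2_inner \<Omega> (ZR n) v + grad_form (UR n) v + form_b \<Omega> v (pR n) = l2_inner \<Omega> (f (t (Suc n))) v"
    "\<And>n s. n < N \<Longrightarrow> s \<in> {t n<..t (Suc n)} \<Longrightarrow>
       ph' s = ((t (Suc n) - s) / (t (Suc n) - t n)) *\<^sub>R pL n + ((s - t n) / (t (Suc n) - t n)) *\<^sub>R pR n"
proof -
  have "\<forall>n\<in>{..<N}. \<exists>UL UR ZL ZR pL pR c. UL \<in> Vh \<Omega> D \<and> UR \<in> Vh \<Omega> D \<and> pL \<in> Qh \<Omega> D \<and> pR \<in> Qh \<Omega> D \<and> c \<in> Vh_div \<Omega> D \<and>
    ZL - ZR = 2 *\<^sub>R c \<and> UR - UL = ((t (Suc n) - t n) / 2) *\<^sub>R (ZL + ZR) \<and> ae_eq \<Omega> UL (uh (t n)) \<and> uh (t (Suc n)) = UR \<and>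
    (\<forall>q\<in>Qh \<Omega> D. form_b \<Omega> (UL + UR) q = 0) \<and>
    (\<forall>v\<in>Vh \<Omega> D. l2_inner \<Omega> ZL v + grad_form UL v + form_b \<Omega> v pL = l2_inner \<Omega> (f (t n)) v) \<and>
    (\<forall>v\<in>Vh \<Omega> D. l2_inner \<Omega> ZR v + grad_form UR v + form_b \<Omega> v pR = l2_inner \<Omega> (f (t (Suc n))) v) \<and>
    (\<forall>s\<in>{t n<..t (Suc n)}. ph' s = ((t (Suc n) - s) / (t (Suc n) - t n)) *\<^sub>R pL + ((s - t n) / (t (Suc n) - t n)) *\<^sub>R pR)"
  proof (rule ballI, unfold lessThan_iff)
    fix n assume n: "n < N"
    show "\<exists>UL UR ZL ZR pL pR c. UL \<in> Vh \<Omega> D \<and> UR \<in> Vh \<Omega> D \<and> pL \<in> Qh \<Omega> D \<and> pR \<in> Qh \<Omega> D \<and> c \<in> Vh_div \<Omega> D \<and>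
    ZL - ZR = 2 *\<^sub>R c \<and> UR - UL = ((t (Suc n) - t n) / 2) *\<^sub>R (ZL + ZR) \<and> ae_eq \<Omega> UL (uh (t n)) \<and> uh (t (Suc n)) = UR \<and>
    (\<forall>q\<in>Qh \<Omega> D. form_b \<Omega> (UL + UR) q = 0) \<and>
    (\<forall>v\<in>Vh \<Omega> D. l2_inner \<Omega> ZL v + grad_form UL v + form_b \<Omega> v pL = l2_inner \<Omega> (f (t n)) v) \<and>
    (\<forall>v\<in>Vh \<Omega> D. l2_inner \<Omega> ZR v + grad_form UR v + form_b \<Omega> v pR = l2_inner \<Omega> (f (t (Suc n))) v) \<and>
    (\<forall>s\<in>{t n<..t (Suc n)}. ph' s = ((t (Suc n) - s) / (t (Suc n) - t n)) *\<^sub>R pL + ((s - t n) / (t (Suc n) - t n)) *\<^sub>R pR)"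
      using scheme_on_interval[OF subV subQ scheme post[unfolded collocation_postprocessing_def] n] mesh f n by (simp only: Suc_leI less_imp_le)
  qed
  then obtain UL UR ZL ZR pL pR c where *: "\<forall>n\<in>{..<N}. UL n \<in> Vh \<Omega> D \<and> UR n \<in> Vh \<Omega> D \<and> pL n \<in> Qh \<Omega> D \<and> pR n \<in> Qh \<Omega> D \<and> c n \<in> Vh_div \<Omega> D \<and>
    ZL n - ZR n = 2 *\<^sub>R c n \<and> UR n - UL n = ((t (Suc n) - t n) / 2) *\<^sub>R (ZL n + ZR n) \<and> ae_eq \<Omega> (UL n) (uh (t n)) \<and> uh (t (Suc n)) = UR n \<and>
    (\<forall>q\<in>Qh \<Omega> D. form_b \<Omega> (UL n + UR n) q = 0) \<and>
    (\<forall>v\<in>Vh \<Omega> D. l2_inner \<Omega> (ZL n) v + grad_form (UL n) v + form_b \<Omega> v (pL n) = l2_inner \<Omega> (f (t n)) v) \<and>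
    (\<forall>v\<in>Vh \<Omega> D. l2_inner \<Omega> (ZR n) v + grad_form (UR n) v + form_b \<Omega> v (pR n) = l2_inner \<Omega> (f (t (Suc n))) v) \<and>
    (\<forall>s\<in>{t n<..t (Suc n)}. ph' s = ((t (Suc n) - s) / (t (Suc n) - t n)) *\<^sub>R pL n + ((s - t n) / (t (Suc n) - t n)) *\<^sub>R pR n)"
    unfolding bchoice_iff by (elim exE) (rule that)
  show ?thesis
    by (rule that[of UL UR pL pR c ZL ZR]; use * in \<open>simp only: lessThan_iff\<close>)
qed

end

context stokes_domain
begin

text \<open>
  The abstract estimate is applied to the values of the exact solution at the nodes, with \<open>\<delta>\<close> of
  order \<open>h\<^sup>r\<close> and \<open>\<kappa>\<close> of order \<open>\<tau>\<^sup>2\<close>. Three time derivatives are needed for the trapezoidal rule, and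
  two further space derivatives of the pressure than its approximation needs, since \<open>- \<Delta> p(0)\<close> is the
  pressure of the initial problem; hence regularity of order \<open>r + 3\<close> suffices.
\<close>

lemma pressure_error_pointwise:
  assumes T: "0 < T" and sol: "nonstationary_stokes_solution \<Omega> T f u0 u p" and reg: "regular_data (r + 3) \<Omega> T f u p"
    and shape: "shape_regular_family \<Omega> \<F>" and deg: "local_spaces_bounded_degree \<F>"
    and infsup: "uniform_inf_sup \<Omega> \<F>" and approx: "approximation_order r \<Omega> \<F>"
  obtains C where "0 \<le> C"
    "\<And>D N t u0h uh ph uh' ph' s. D \<in> \<F> \<Longrightarrow> time_mesh T N t \<Longrightarrow> discrete_initial_velocity \<Omega> D (f 0) u0 u0h \<Longrightarrow>
       scheme_solution \<Omega> D N t f u0h uh ph \<Longrightarrow> collocation_postprocessing \<Omega> D N t f uh ph uh' ph' \<Longrightarrow> s \<in> {0<..T} \<Longrightarrow>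
       l2_norm \<Omega> (\<lambda>x. p s x - ph' s x) \<le> C * ((max_step N t)\<^sup>2 + mesh_size D ^ r)"
proof -
  define k where "k = r + 3"
  have k: "3 \<le> k" "r \<le> k" "r + 1 \<le> k" "1 \<le> k" "2 \<le> k" by (simp_all add: k_def)
  obtain U P M where E: "\<And>t. t \<in> {0..T} \<Longrightarrow> U 0 t = u t" "\<And>t. t \<in> {0..T} \<Longrightarrow> P 0 t = p t"
    "\<And>t. t \<in> {0..T} \<Longrightarrow> U 0 t \<in> velocity_div_space \<Omega>" "\<And>t. t \<in> {0..T} \<Longrightarrow> U 1 t \<in> velocity_div_space \<Omega>"
    "\<And>t. t \<in> {0..T} \<Longrightarrow> P 0 t \<in> pressure_space \<Omega>"
    and Us: "\<And>j t. j \<le> 3 \<Longrightarrow> t \<in> {0..T} \<Longrightarrow> U j t \<in> sobolev \<Omega> k" and Ps: "\<And>j t. j \<le> 3 \<Longrightarrow> t \<in> {0..T} \<Longrightarrow> P j t \<in> sobolev \<Omega> k"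
    and fs: "\<And>t. t \<in> {0..T} \<Longrightarrow> f t \<in> sobolev \<Omega> k"
    and dU: "\<And>j t. j < 3 \<Longrightarrow> t \<in> {0..T} \<Longrightarrow> nrm_deriv (sob_inner k) {0..T} (U j) (U (Suc j) t) t"
    and dP: "\<And>j t. j < 3 \<Longrightarrow> t \<in> {0..T} \<Longrightarrow> nrm_deriv (sob_inner k) {0..T} (P j) (P (Suc j) t) t"
    and M0: "0 \<le> M" and MU: "\<And>j t. j \<le> 3 \<Longrightarrow> t \<in> {0..T} \<Longrightarrow> nrm (sob_inner k) (U j t) \<le> M"
    and MP: "\<And>j t. j \<le> 3 \<Longrightarrow> t \<in> {0..T} \<Longrightarrow> nrm (sob_inner k) (P j t) \<le> M"
    and eq: "\<And>t v. t \<in> {0..T} \<Longrightarrow> v \<in> sobolev10 \<Omega> \<Longrightarrow>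
       l2_inner \<Omega> (U 1 t) v + grad_form (U 0 t) v + form_b \<Omega> v (P 0 t) = l2_inner \<Omega> (f t) v"
    by (fact exact_solution[OF T sol reg[folded k_def] k(1)])
  have Ux: "U 0 t \<in> sobolev10 \<Omega>" "U 1 t \<in> sobolev10 \<Omega>" if "t \<in> {0..T}" for t
    using E(3,4)[OF that] by (simp_all add: divfree_iff)
  obtain Ca where Ca: "0 \<le> Ca"
    "\<And>D v. D \<in> \<F> \<Longrightarrow> v \<in> sobolev10 \<Omega> \<Longrightarrow> v \<in> sobolev \<Omega> (r + 1) \<Longrightarrow>
       \<exists>v'\<in>Vh \<Omega> D. nrm grad_form (v - v') \<le> Ca * mesh_size D ^ r * nrm (sob_inner (r + 1)) v"
    "\<And>D q. D \<in> \<F> \<Longrightarrow> q \<in> pressure_space \<Omega> \<Longrightarrow> q \<in> sobolev \<Omega> r \<Longrightarrow>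
       \<exists>q'\<in>Qh \<Omega> D. nrm (l2_inner \<Omega>) (q - q') \<le> Ca * mesh_size D ^ r * nrm (sob_inner r) q"
    by (fact best_approximation[OF approx shape])
  obtain \<beta> where \<beta>: "\<beta> > 0" "\<And>D. D \<in> \<F> \<Longrightarrow> ereal \<beta> \<le> (INF q \<in> {q \<in> Qh \<Omega> D. \<not> ae_eq \<Omega> q (\<lambda>x. 0)}.
                 SUP v \<in> {v \<in> Vh \<Omega> D. \<not> ae_eq \<Omega> v (\<lambda>x. 0)}.
                   ereal (- l2_inner \<Omega> (divg \<Omega> v) q / (sobolev_norm \<Omega> 1 v * l2_norm \<Omega> q)))"
    using infsup unfolding uniform_inf_sup_def by (elim exE conjE) (rule that, assumption, rule bspec)
  obtain R where R: "0 \<le> R" "\<forall>x\<in>\<Omega>. \<forall>i. \<bar>x $ i\<bar> \<le> R" using coordinate_bound by (elim exE conjE)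
  have z: "0 \<in> {0..T}" using T by simp
  have p03: "P 0 0 \<in> sobolev \<Omega> (r + 2)" by (rule sobolev_mono[OF _ Ps[OF _ z]]) (simp_all add: k_def)
  define \<sigma>0 where "\<sigma>0 = laplacian_s (P 0 0)"
  have \<sigma>0: "\<sigma>0 \<in> sobolev \<Omega> r" unfolding \<sigma>0_def by (rule laplacian_s_sobolev[OF p03])
  obtain c0 where c0: "(\<lambda>x. \<sigma>0 x - c0) \<in> pressure_space \<Omega> \<inter> sobolev \<Omega> r" using subtract_mean[OF \<sigma>0] by (elim exE)
  \<comment> \<open>the mean value is removed, since pressures are approximated in \<open>Q\<close> only\<close>
  define \<sigma> where "\<sigma> = (-1) *\<^sub>R (\<lambda>x. \<sigma>0 x - c0)"
  have \<sigma>: "\<sigma> \<in> pressure_space \<Omega>" "\<sigma> \<in> sobolev \<Omega> r"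
    unfolding \<sigma>_def by (rule subspace_scale[OF subspace_pressure_space IntD1[OF c0]], rule sob.mem_simps(4)[OF IntD2[OF c0]])
  have \<sigma>b: "form_b \<Omega> v \<sigma> = - form_b \<Omega> v \<sigma>0" if v: "v \<in> sobolev10 \<Omega>" for v
  proof -
    have s: "v \<in> sobolev \<Omega> 1" by (rule sobolev10_sobolev[OF v])
    have e: "\<sigma> = (-1) *\<^sub>R \<sigma>0 + (\<lambda>x. c0)" by (simp add: \<sigma>_def fun_eq_iff)
    have "form_b \<Omega> v \<sigma> = form_b \<Omega> v ((-1) *\<^sub>R \<sigma>0) + form_b \<Omega> v (\<lambda>x. c0)"
      unfolding e by (rule form_b_add_right[OF s l2.mem_simps(4)[OF sobolev_l2[OF \<sigma>0]] const_l2])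
    then show ?thesis using form_b_scale_right[OF s sobolev_l2[OF \<sigma>0], of "-1"] form_b_const[OF v] by simp
  qed
  \<comment> \<open>one bound for everything that has to be approximated in space\<close>
  define M' where "M' = M + nrm (sob_inner r) \<sigma>"
  have M': "M \<le> M'" "nrm (sob_inner r) \<sigma> \<le> M'" "0 \<le> M'" using M0 sob.nrm_nonneg[OF \<sigma>(2)] by (auto simp: M'_def)
  define Cp where "Cp = 2 * R"
  define Cb where "Cb = real CARD('d)"
  define L where "L = 2 * (1 + Cb / \<beta>) + Cb"
  define A1 where "A1 = L * (1 + 1 / \<beta>) + 2 * Cp / \<beta> * ((sqrt T + Cp) * ((Cp\<^sup>2 + 1 + T + Cb) * L))"
  define A2 where "A2 = 2 * Cp / \<beta> * (sqrt T + Cp)"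
  have pos: "0 \<le> Cp" "0 \<le> Cb" "0 \<le> L" using R \<beta>(1) by (auto simp: Cp_def Cb_def L_def)
  have A: "0 \<le> A1" "0 \<le> A2" using pos T \<beta>(1) unfolding A1_def A2_def
    by (auto intro!: add_nonneg_nonneg mult_nonneg_nonneg divide_nonneg_nonneg)
  define C where "C = A1 * Ca * M' + A2 * M + M"
  have C0: "0 \<le> C" using A Ca(1) M0 M' by (simp add: C_def)
  show ?thesis
  proof (rule that[OF C0])
    fix D N t u0h uh ph uh' ph' s
    assume D: "D \<in> \<F>" and mesh: "time_mesh T N t" and init: "discrete_initial_velocity \<Omega> D (f 0) u0 u0h"
      and scheme: "scheme_solution \<Omega> D N t f u0h uh ph" and post: "collocation_postprocessing \<Omega> D N t f uh ph uh' ph'"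
      and s: "s \<in> {0<..T}"
    define h where "h = mesh_size D"
    define \<mu> where "\<mu> = max_step N t"
    define \<delta> where "\<delta> = Ca * h ^ r * M'"
    define \<kappa> where "\<kappa> = M * \<mu>\<^sup>2"
    define \<tau> where "\<tau> n = t (Suc n) - t n" for n
    have h: "0 < h" unfolding h_def by (rule mesh_size_pos[OF shape_regular_mesh(1)[OF shape D]])
    note inst = discrete_stokes_instance[OF shape deg D \<beta>(1) \<beta>(2)[OF D] R, folded Cp_def Cb_def]
    note Vdiv_def = discrete_stokes.Vdiv_def[OF inst]
    have t0: "t 0 = 0" "t N = T" and steps: "\<forall>n\<in>{1..N}. t (n - 1) < t n"
      using mesh unfolding time_mesh_def by blast+
    have step: "t n < t (Suc n)" if "n < N" for n using bspec[OF steps, of "Suc n"] that by simp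
    have tJ: "t n \<in> {0..T}" if "n \<le> N" for n
      using mesh_points_mono[of N t 0 n] mesh_points_mono[of N t n N] step t0 that by simp
    have sub: "{t n..t (Suc n)} \<subseteq> {0..T}" if "n < N" for n using tJ[of n] tJ[of "Suc n"] that by auto
    have \<tau>: "0 < \<tau> n" "\<tau> n \<le> \<mu>" if "n < N" for n
    proof -
      show "0 < \<tau> n" using step[OF that] by (simp add: \<tau>_def)
      have "step t (Suc n) \<le> \<mu>" unfolding \<mu>_def max_step_def using that by (intro Max_ge) auto
      then show "\<tau> n \<le> \<mu>" by (simp add: \<tau>_def step_def)
    qed
    have sumT: "(\<Sum>n<N. \<tau> n) \<le> T" unfolding \<tau>_def using sum_lessThan_telescope[of t N] t0 by simp
    have AV: "\<exists>y\<in>Vh \<Omega> D. nrm grad_form (v - y) \<le> \<delta>" if v: "v \<in> sobolev10 \<Omega>" "v \<in> sobolev \<Omega> k" "nrm (sob_inner k) v \<le> M" for v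
    proof -
      from Ca(2)[OF D v(1) sobolev_mono[OF k(3) v(2)]]
      obtain y where y: "y \<in> Vh \<Omega> D" "nrm grad_form (v - y) \<le> Ca * h ^ r * nrm (sob_inner (r + 1)) v" unfolding h_def by (elim bexE)
      have "nrm (sob_inner (r + 1)) v \<le> M'" using sob_nrm_mono[OF k(3) v(2)] v(3) M'(1) by linarith
      then have "Ca * h ^ r * nrm (sob_inner (r + 1)) v \<le> \<delta>" unfolding \<delta>_def using Ca(1) h by (intro mult_left_mono) auto
      then show ?thesis using y by (intro bexI[of _ y]) auto
    qed
    have AQ: "\<exists>j\<in>Qh \<Omega> D. nrm (l2_inner \<Omega>) (q - j) \<le> \<delta>" if q: "q \<in> pressure_space \<Omega>" "q \<in> sobolev \<Omega> r" "nrm (sob_inner r) q \<le> M'" for q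
    proof -
      from Ca(3)[OF D q(1,2)]
      obtain j where j: "j \<in> Qh \<Omega> D" "nrm (l2_inner \<Omega>) (q - j) \<le> Ca * h ^ r * nrm (sob_inner r) q" unfolding h_def by (elim bexE)
      have "Ca * h ^ r * nrm (sob_inner r) q \<le> \<delta>" unfolding \<delta>_def using Ca(1) h q(3) by (intro mult_left_mono) auto
      then show ?thesis using j by (intro bexI[of _ j]) auto
    qed
    have AQk: "\<exists>j\<in>Qh \<Omega> D. nrm (l2_inner \<Omega>) (q - j) \<le> \<delta>" if q: "q \<in> pressure_space \<Omega>" "q \<in> sobolev \<Omega> k" "nrm (sob_inner k) q \<le> M" for q
      using AQ[OF q(1) sobolev_mono[OF k(2) q(2)]] sob_nrm_mono[OF k(2) q(2)] q(3) M'(1) by linarith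
    have trap: "nrm grad_form (U 0 (t (Suc n)) - U 0 (t n) - (\<tau> n / 2) *\<^sub>R (U 1 (t (Suc n)) + U 1 (t n))) \<le> \<tau> n * \<kappa>" if n: "n < N" for n
    proof -
      define w where "w = U 0 (t (Suc n)) - U 0 (t n) - (\<tau> n / 2) *\<^sub>R (U 1 (t n) + U 1 (t (Suc n)))"
      have J: "t n \<in> {0..T}" "t (Suc n) \<in> {0..T}" using tJ n by auto
      have w: "w \<in> sobolev \<Omega> k" unfolding w_def using Us[OF _ J(1)] Us[OF _ J(2)] by (intro sob.mem_simps) simp_all
      have "nrm (sob_inner k) w \<le> M * (\<tau> n) ^ 3"
        unfolding w_def \<tau>_def
        by (rule sob.trapezoid_error[where J = "{0..T}" and ?w1.0 = "U 1" and ?w2.0 = "U 2" and ?w3.0 = "U 3"])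
           (use step[OF n] sub[OF n] Us dU[of 0] dU[of 1] dU[of 2] MU[of 3] in \<open>simp_all add: numeral_3_eq_3 numeral_2_eq_2\<close>)
      also have "\<dots> \<le> \<tau> n * \<kappa>"
        unfolding \<kappa>_def using mult_left_mono[OF power_mono[OF \<tau>(2)[OF n], of 2], of "M * \<tau> n"] \<tau>(1)[OF n] M0
        by (simp add: power3_eq_cube power2_eq_square mult_ac)
      finally have "nrm grad_form w \<le> \<tau> n * \<kappa>"
        using a_le_sob[OF sobolev_mono[OF k(4) w]] sob_nrm_mono[OF k(4) w] by linarith
      then show ?thesis by (simp add: w_def add.commute)
    qed
    have quot: "nrm (sob_inner k) ((1 / \<tau> n) *\<^sub>R (w (t (Suc n)) - w (t n))) \<le> M"
      if n: "n < N" and w: "\<And>t. t \<in> {0..T} \<Longrightarrow> w t \<in> sobolev \<Omega> k" "\<And>t. t \<in> {0..T} \<Longrightarrow> w1 t \<in> sobolev \<Omega> k"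
        "\<And>t. t \<in> {0..T} \<Longrightarrow> nrm_deriv (sob_inner k) {0..T} w (w1 t) t" "\<And>t. t \<in> {0..T} \<Longrightarrow> nrm (sob_inner k) (w1 t) \<le> M"
      for n w and w1 :: "real \<Rightarrow> real^'d \<Rightarrow> 'b::euclidean_space"
    proof -
      have J: "t n \<in> {0..T}" "t (Suc n) \<in> {0..T}" using tJ n by auto
      have "nrm (sob_inner k) (w (t (Suc n)) - w (t n)) \<le> M * \<tau> n" unfolding \<tau>_def
        by (rule sob.mean_value_bound[OF _ sub[OF n] w]) (use step[OF n] in auto)
      then have "(1 / \<tau> n) * nrm (sob_inner k) (w (t (Suc n)) - w (t n)) \<le> M" using \<tau>(1)[OF n] by (simp add: field_simps)
      then show ?thesis
        using \<tau>(1)[OF n] by (simp only: sob.nrm_scale[OF sob.mem_simps(3)[OF w(1)[OF J(2)] w(1)[OF J(1)]]] abs_of_pos divide_pos_pos zero_less_one)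
    qed
    have fl2: "f (t n) \<in> l2_space \<Omega>" if "n \<le> N" for n using sobolev_l2[OF fs[OF tJ[OF that]]] .
    have step': "\<forall>n<N. t n < t (Suc n)" and fl2': "\<forall>n\<le>N. f (t n) \<in> l2_space \<Omega>" using step fl2 by simp_all
    obtain UL UR ZL ZR pL pR c where nod:
      "\<And>n. n < N \<Longrightarrow> UL n \<in> Vh \<Omega> D" "\<And>n. n < N \<Longrightarrow> UR n \<in> Vh \<Omega> D" "\<And>n. n < N \<Longrightarrow> pL n \<in> Qh \<Omega> D" "\<And>n. n < N \<Longrightarrow> pR n \<in> Qh \<Omega> D"
      "\<And>n. n < N \<Longrightarrow> c n \<in> Vh_div \<Omega> D" "\<And>n. n < N \<Longrightarrow> ZL n - ZR n = 2 *\<^sub>R c n"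
      "\<And>n. n < N \<Longrightarrow> UR n - UL n = ((t (Suc n) - t n) / 2) *\<^sub>R (ZL n + ZR n)"
      "\<And>n. n < N \<Longrightarrow> ae_eq \<Omega> (UL n) (uh (t n))" "\<And>n. n < N \<Longrightarrow> uh (t (Suc n)) = UR n"
      "\<And>n q. n < N \<Longrightarrow> q \<in> Qh \<Omega> D \<Longrightarrow> form_b \<Omega> (UL n + UR n) q = 0"
      "\<And>n v. n < N \<Longrightarrow> v \<in> Vh \<Omega> D \<Longrightarrow> l2_inner \<Omega> (ZL n) v + grad_form (UL n) v + form_b \<Omega> v (pL n) = l2_inner \<Omega> (f (t n)) v"
      "\<And>n v. n < N \<Longrightarrow> v \<in> Vh \<Omega> D \<Longrightarrow> l2_inner \<Omega> (ZR n) v + grad_form (UR n) v + form_b \<Omega> v (pR n) = l2_inner \<Omega> (f (t (Suc n))) v"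
      "\<And>n s. n < N \<Longrightarrow> s \<in> {t n<..t (Suc n)} \<Longrightarrow>
         ph' s = ((t (Suc n) - s) / (t (Suc n) - t n)) *\<^sub>R pL n + ((s - t n) / (t (Suc n) - t n)) *\<^sub>R pR n"
      by (fact scheme_nodal_form[OF discrete_stokes.Vh(1)[OF inst] discrete_stokes.Qh(1)[OF inst] scheme post step' fl2'])
    have VX: "v \<in> sobolev10 \<Omega>" if "v \<in> Vh \<Omega> D" for v using that by (simp add: Vh_def)
    have Vs: "v \<in> sobolev \<Omega> 1" if "v \<in> Vh \<Omega> D" for v by (rule sobolev10_sobolev[OF VX[OF that]])
    obtain a0h sh p0h where ini: "a0h \<in> Vh \<Omega> D" "sh \<in> Qh \<Omega> D" "p0h \<in> Qh \<Omega> D"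
      "\<forall>v \<in> Vh \<Omega> D. form_a \<Omega> a0h v + form_b \<Omega> v sh = l2_inner \<Omega> (grad_v \<Omega> (\<lambda>x. f 0 x + laplacian \<Omega> u0 x)) (grad_v \<Omega> v)"
      "\<forall>q \<in> Qh \<Omega> D. form_b \<Omega> a0h q = 0" "u0h \<in> Vh_div \<Omega> D"
      "\<forall>v \<in> Vh \<Omega> D. form_a \<Omega> u0h v + form_b \<Omega> v p0h = l2_inner \<Omega> (\<lambda>x. f 0 x - a0h x) v"
      "\<forall>q \<in> Qh \<Omega> D. form_b \<Omega> u0h q = 0"
      using init unfolding discrete_initial_velocity_def by (elim exE bexE conjE) (rule that)
    define Vd where "Vd = discrete_stokes.Vdiv (form_b \<Omega>) (Vh \<Omega> D) (Qh \<Omega> D)"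
    have Vd: "v \<in> Vd \<longleftrightarrow> v \<in> Vh \<Omega> D \<and> (\<forall>q\<in>Qh \<Omega> D. form_b \<Omega> v q = 0)" for v unfolding Vd_def Vdiv_def by simp
    have Vhdiv: "v \<in> Vd" if "v \<in> Vh_div \<Omega> D" for v using that by (auto simp: Vd Vh_div_def form_b_def)
    have u0V: "u0h \<in> Vh \<Omega> D" using ini(6) by (simp add: Vh_div_def)
    have init3: "l2_inner \<Omega> a0h v + grad_form u0h v = l2_inner \<Omega> (f (t 0)) v" if v: "v \<in> Vd" for v
    proof -
      have v': "v \<in> Vh \<Omega> D" "form_b \<Omega> v p0h = 0" using v ini(3) by (simp_all add: Vd)
      have e: "(\<lambda>x. f 0 x - a0h x) = f 0 - a0h" by (simp add: fun_eq_iff)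
      have "l2_inner \<Omega> (f 0 - a0h) v = l2_inner \<Omega> (f 0) v - l2_inner \<Omega> a0h v"
        by (rule l2.diff[OF sobolev_l2[OF fs[OF z]] sobolev_l2[OF Vs[OF ini(1)]] sobolev_l2[OF Vs[OF v'(1)]]])
      then show ?thesis using bspec[OF ini(7) v'(1)] form_a_grad_form[OF Vs[OF u0V] Vs[OF v'(1)]] v'(2) unfolding e t0 by linarith
    qed
    have z1: "U 1 0 \<in> sobolev \<Omega> 1" by (rule sobolev10_sobolev[OF Ux(2)[OF z]])
    have init4: "grad_form (a0h - U 1 (t 0)) v = form_b \<Omega> v \<sigma>" if v: "v \<in> Vd" for v
    proof -
      have v': "v \<in> Vh \<Omega> D" "form_b \<Omega> v sh = 0" using v ini(2) by (simp_all add: Vd)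
      have u0: "ae_eq \<Omega> (U 0 0) u0" using sol E(1)[OF z] by (simp add: nonstationary_stokes_solution_def)
      have "l2_inner \<Omega> (grad_v \<Omega> (\<lambda>x. f 0 x + laplacian \<Omega> u0 x)) (grad_v \<Omega> v) = grad_form (U 1 0) v - form_b \<Omega> v \<sigma>0"
        unfolding \<sigma>0_def
        by (rule initial_time_derivative[OF Ux(2)[OF z] z1 sobolev_mono[OF k(1) Us[OF _ z]] sobolev_mono[OF k(5) Ps[OF _ z]]
              sobolev_mono[OF k(4) fs[OF z]] eq[OF z] u0 VX[OF v'(1)]]) simp_all
      then have "grad_form a0h v = grad_form (U 1 0) v - form_b \<Omega> v \<sigma>0"
        using bspec[OF ini(4) v'(1)] form_a_grad_form[OF Vs[OF ini(1)] Vs[OF v'(1)]] v'(2) by linarith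
      then show ?thesis using a.diff[OF Vs[OF ini(1)] z1 Vs[OF v'(1)]] \<sigma>b[OF VX[OF v'(1)]] unfolding t0 by linarith
    qed
    have cont1: "l2_inner \<Omega> (UL 0 - u0h) (UL 0 - u0h) = 0" if N: "0 < N"
    proof (rule l2_inner_diff_ae_zero[OF sobolev_l2[OF Vs[OF nod(1)[OF N]]] sobolev_l2[OF Vs[OF u0V]]])
      have "ae_eq \<Omega> (UL 0) (uh 0)" using nod(8)[OF N] by (simp add: t0)
      moreover have "ae_eq \<Omega> (uh 0) u0h" using scheme by (simp add: scheme_solution_def)
      ultimately show "ae_eq \<Omega> (UL 0) u0h" unfolding ae_eq_def by eventually_elim simp
    qed
    have cont2: "l2_inner \<Omega> (UL (Suc n) - UR n) (UL (Suc n) - UR n) = 0" if n: "Suc n < N" for n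
      using l2_inner_diff_ae_zero[OF sobolev_l2[OF Vs[OF nod(1)[OF n]]] sobolev_l2[OF Vs[OF nod(2)[OF Suc_lessD[OF n]]]]]
        nod(8)[OF n] nod(9)[OF Suc_lessD[OF n]] by simp
    have K: "nrm (l2_inner \<Omega>) (P 0 (t n) - pL n) \<le> A1 * \<delta> + A2 * \<kappa>" "nrm (l2_inner \<Omega>) (P 0 (t (Suc n)) - pR n) \<le> A1 * \<delta> + A2 * \<kappa>"
      if n: "n < N" for n
    proof -
      have Az: "\<exists>y\<in>Vh \<Omega> D. nrm grad_form ((1 / \<tau> n) *\<^sub>R (U 1 (t (Suc n)) - U 1 (t n)) - y) \<le> \<delta>" if n: "n < N" for n
      proof (rule AV)
        show "(1 / \<tau> n) *\<^sub>R (U 1 (t (Suc n)) - U 1 (t n)) \<in> sobolev10 \<Omega>"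
          by (intro subspace_scale[OF subspace_sobolev10] subspace_diff[OF subspace_sobolev10] Ux tJ) (use n in auto)
        show "(1 / \<tau> n) *\<^sub>R (U 1 (t (Suc n)) - U 1 (t n)) \<in> sobolev \<Omega> k"
          by (intro sob.mem_simps Us tJ) (use n in auto)
        show "nrm (sob_inner k) ((1 / \<tau> n) *\<^sub>R (U 1 (t (Suc n)) - U 1 (t n))) \<le> M"
          by (rule quot[OF n, of "U 1" "U 2"]) (use Us dU[of 1] MU in \<open>simp_all add: numeral_2_eq_2\<close>)
      qed
      have Adp: "\<exists>j\<in>Qh \<Omega> D. nrm (l2_inner \<Omega>) ((1 / \<tau> n) *\<^sub>R (P 0 (t (Suc n)) - P 0 (t n)) - j) \<le> \<delta>" if n: "n < N" for n
      proof (rule AQk)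
        show "(1 / \<tau> n) *\<^sub>R (P 0 (t (Suc n)) - P 0 (t n)) \<in> pressure_space \<Omega>"
          by (intro subspace_scale[OF subspace_pressure_space] subspace_diff[OF subspace_pressure_space] E(5) tJ) (use n in auto)
        show "(1 / \<tau> n) *\<^sub>R (P 0 (t (Suc n)) - P 0 (t n)) \<in> sobolev \<Omega> k"
          by (intro sob.mem_simps Ps tJ) (use n in auto)
        show "nrm (sob_inner k) ((1 / \<tau> n) *\<^sub>R (P 0 (t (Suc n)) - P 0 (t n))) \<le> M"
          by (rule quot[OF n, of "P 0" "P 1"]) (use Ps dP[of 0] MP in simp_all)
      qed
      have bnd: "L * \<delta> * (1 + 1 / \<beta>) + 2 * Cp / \<beta> * ((sqrt T + Cp) * ((Cp\<^sup>2 + 1 + T + Cb) * (L * \<delta>) + \<kappa>)) = A1 * \<delta> + A2 * \<kappa>"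
        unfolding A1_def A2_def by (simp add: algebra_simps add_divide_distrib)
      have ex: "\<And>n. n \<le> N \<Longrightarrow> U 0 (t n) \<in> sobolev10 \<Omega>" "\<And>n. n \<le> N \<Longrightarrow> U 1 (t n) \<in> sobolev10 \<Omega>" "\<And>n. n \<le> N \<Longrightarrow> P 0 (t n) \<in> pressure_space \<Omega>"
        using Ux tJ E(5) by auto
      have exdiv: "\<And>n q. n \<le> N \<Longrightarrow> q \<in> Qh \<Omega> D \<Longrightarrow> form_b \<Omega> (U 0 (t n)) q = 0" "\<And>n q. n \<le> N \<Longrightarrow> q \<in> Qh \<Omega> D \<Longrightarrow> form_b \<Omega> (U 1 (t n)) q = 0"
        using E(3,4) tJ by (auto simp: divfree_iff Qh_def)
      have exact: "\<And>n v. n \<le> N \<Longrightarrow> v \<in> Vh \<Omega> D \<Longrightarrow> l2_inner \<Omega> (U 1 (t n)) v + grad_form (U 0 (t n)) v + form_b \<Omega> v (P 0 (t n)) = l2_inner \<Omega> (f (t n)) v"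
        using eq tJ VX by simp
      have Au: "\<And>n. n \<le> N \<Longrightarrow> \<exists>y\<in>Vh \<Omega> D. nrm grad_form (U 0 (t n) - y) \<le> \<delta>"
        by (rule AV[OF ex(1) Us[OF _ tJ] MU[OF _ tJ]]) simp_all
      have Ap: "\<And>n. n \<le> N \<Longrightarrow> \<exists>j\<in>Qh \<Omega> D. nrm (l2_inner \<Omega>) (P 0 (t n) - j) \<le> \<delta>"
        by (rule AQk[OF ex(3) Ps[OF _ tJ] MP[OF _ tJ]]) simp_all
      have Az0: "\<exists>y\<in>Vh \<Omega> D. nrm grad_form (U 1 (t 0) - y) \<le> \<delta>"
        by (rule AV[OF ex(2) Us[OF _ tJ] MU[OF _ tJ]]) simp_all
      have \<kappa>0: "0 \<le> \<kappa>" using M0 by (simp add: \<kappa>_def)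
      have a0V: "a0h \<in> Vd" "u0h \<in> Vd" using ini(1,5) Vhdiv[OF ini(6)] by (simp_all add: Vd)
      note main = discrete_stokes.nodal_pressure_errors[OF inst, where N = N and \<tau> = \<tau> and T = T and u = "\<lambda>n. U 0 (t n)"
          and z = "\<lambda>n. U 1 (t n)" and p = "\<lambda>n. P 0 (t n)" and F = "\<lambda>n. l2_inner \<Omega> (f (t n))" and \<kappa> = \<kappa> and \<delta> = \<delta> and \<sigma> = \<sigma>
          and ?U0.0 = u0h and ?Z0.0 = a0h and UL = UL and UR = UR and pL = pL and pR = pR and c = c and ZL = ZL and ZR = ZR and n = n,
          folded Vd_def L_def, unfolded bnd]
      note facts = grad_form_null \<tau>(1) sumT ex exdiv exact trap \<kappa>0 Au Ap Az Adp Az0 AQ[OF \<sigma> M'(2)] \<sigma>(1)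
          a0V init3 init4 nod(1-4) Vhdiv[OF nod(5)] nod(6) nod(7)[folded \<tau>_def] nod(10) cont1 cont2 nod(11,12) n
      show "nrm (l2_inner \<Omega>) (P 0 (t n) - pL n) \<le> A1 * \<delta> + A2 * \<kappa>"
        by (rule main(1); rule facts; assumption)
      show "nrm (l2_inner \<Omega>) (P 0 (t (Suc n)) - pR n) \<le> A1 * \<delta> + A2 * \<kappa>"
        by (rule main(2); rule facts; assumption)
    qed
    obtain n where n: "n < N" "s \<in> {t n<..t (Suc n)}" using mesh_interval_exists[of t N T s] t0 s by auto
    have sJ: "s \<in> {0..T}" and J: "t n \<in> {0..T}" "t (Suc n) \<in> {0..T}" using s tJ n by auto
    define \<alpha> where "\<alpha> = (t (Suc n) - s) / (t (Suc n) - t n)"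
    define \<gamma> where "\<gamma> = (s - t n) / (t (Suc n) - t n)"
    have wts: "0 \<le> \<alpha>" "0 \<le> \<gamma>" "\<alpha> + \<gamma> = 1"
      using n step[OF n(1)] by (auto simp: \<alpha>_def \<gamma>_def add_divide_distrib[symmetric])
    note pl = sobolev_l2[OF Ps[OF _ sJ, of 0]] sobolev_l2[OF Ps[OF _ J(1), of 0]] sobolev_l2[OF Ps[OF _ J(2), of 0]]
    have ql: "pL n \<in> l2_space \<Omega>" "pR n \<in> l2_space \<Omega>" using nod(3,4)[OF n(1)] by (auto simp: Qh_def pressure_l2)
    define e0 where "e0 = P 0 s - (\<alpha> *\<^sub>R P 0 (t n) + \<gamma> *\<^sub>R P 0 (t (Suc n)))"
    define e1 where "e1 = P 0 (t n) - pL n"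
    define e2 where "e2 = P 0 (t (Suc n)) - pR n"
    have e0s: "e0 \<in> sobolev \<Omega> k" unfolding e0_def using Ps[OF _ sJ] Ps[OF _ J(1)] Ps[OF _ J(2)] by (intro sob.mem_simps) simp_all
    have el: "e1 \<in> l2_space \<Omega>" "e2 \<in> l2_space \<Omega>" unfolding e1_def e2_def by (intro l2.mem_simps pl ql; simp)+
    have "nrm (sob_inner k) e0 \<le> M * (t (Suc n) - t n)\<^sup>2"
      unfolding e0_def \<alpha>_def \<gamma>_def
      by (rule sob.linear_interpolation_error[where J = "{0..T}" and ?w1.0 = "P 1" and ?w2.0 = "P 2"])
         (use n(2) step[OF n(1)] sub[OF n(1)] Ps dP[of 0] dP[of 1] MP[of 2] in \<open>simp_all add: numeral_2_eq_2\<close>)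
    also have "\<dots> \<le> \<kappa>" unfolding \<kappa>_def using \<tau>[OF n(1)] M0 by (intro mult_left_mono power_mono) (simp_all add: \<tau>_def)
    finally have n0: "nrm (l2_inner \<Omega>) e0 \<le> \<kappa>" using l2_norm_le_sob[OF e0s] by linarith
    have "(\<lambda>x. p s x - ph' s x) = e0 + (\<alpha> *\<^sub>R e1 + \<gamma> *\<^sub>R e2)"
      unfolding e0_def e1_def e2_def nod(13)[OF n] E(2)[OF sJ, symmetric] \<alpha>_def[symmetric] \<gamma>_def[symmetric]
      by (simp add: fun_eq_iff algebra_simps)
    then have "l2_norm \<Omega> (\<lambda>x. p s x - ph' s x) = nrm (l2_inner \<Omega>) (e0 + (\<alpha> *\<^sub>R e1 + \<gamma> *\<^sub>R e2))" by (simp add: l2_norm_eq)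
    also have "\<dots> \<le> nrm (l2_inner \<Omega>) e0 + nrm (l2_inner \<Omega>) (\<alpha> *\<^sub>R e1 + \<gamma> *\<^sub>R e2)"
      by (intro l2.nrm_add sobolev_l2[OF e0s] l2.mem_simps el)
    also have "nrm (l2_inner \<Omega>) (\<alpha> *\<^sub>R e1 + \<gamma> *\<^sub>R e2) \<le> \<alpha> * nrm (l2_inner \<Omega>) e1 + \<gamma> * nrm (l2_inner \<Omega>) e2"
      using l2.nrm_add[OF l2.mem_simps(4)[OF el(1), of \<alpha>] l2.mem_simps(4)[OF el(2), of \<gamma>]] l2.nrm_scale[OF el(1), of \<alpha>] l2.nrm_scale[OF el(2), of \<gamma>] wts by simp
    also have "\<alpha> * nrm (l2_inner \<Omega>) e1 + \<gamma> * nrm (l2_inner \<Omega>) e2 \<le> \<alpha> * (A1 * \<delta> + A2 * \<kappa>) + \<gamma> * (A1 * \<delta> + A2 * \<kappa>)"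
      using K[OF n(1)] wts unfolding e1_def e2_def by (intro add_mono mult_left_mono) auto
    also have "\<dots> = A1 * \<delta> + A2 * \<kappa>" using wts(3) by (simp add: distrib_right[symmetric])
    finally have "l2_norm \<Omega> (\<lambda>x. p s x - ph' s x) \<le> \<kappa> + (A1 * \<delta> + A2 * \<kappa>)" using n0 by linarith
    also have "\<dots> = (A1 * Ca * M') * h ^ r + (A2 * M + M) * \<mu>\<^sup>2" by (simp add: \<kappa>_def \<delta>_def algebra_simps)
    also have "\<dots> \<le> C * h ^ r + C * \<mu>\<^sup>2"
      using A Ca(1) M0 M' h unfolding C_def by (intro add_mono mult_right_mono) (auto intro!: add_nonneg_nonneg mult_nonneg_nonneg)
    finally show "l2_norm \<Omega> (\<lambda>x. p s x - ph' s x) \<le> C * ((max_step N t)\<^sup>2 + mesh_size D ^ r)"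
      unfolding \<mu>_def[symmetric] h_def[symmetric] by (simp add: algebra_simps)
  qed
qed

end

theorem corollary4p14:
  fixes r :: nat
  assumes "CARD('d::finite) = 2 \<or> CARD('d) = 3"
  shows "\<exists>k. \<forall>(\<Omega> :: (real^'d) set) T f u0 u p \<F>.
    bounded_domain \<Omega> \<longrightarrow> T > 0 \<longrightarrow>
    nonstationary_stokes_solution \<Omega> T f u0 u p \<longrightarrow>
    regular_data k \<Omega> T f u p \<longrightarrow>
    stokes_H2_regular \<Omega> \<longrightarrow>
    shape_regular_family \<Omega> \<F> \<longrightarrow>
    local_spaces_bounded_degree \<F> \<longrightarrow>
    uniform_inf_sup \<Omega> \<F> \<longrightarrow>
    approximation_order r \<Omega> \<F> \<longrightarrow>
    (\<exists>C>0. \<forall>D\<in>\<F>. \<forall>N t u0h uh ph uh' ph'.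
       time_mesh T N t \<longrightarrow>
       discrete_initial_velocity \<Omega> D (f 0) u0 u0h \<longrightarrow>
       scheme_solution \<Omega> D N t f u0h uh ph \<longrightarrow>
       collocation_postprocessing \<Omega> D N t f uh ph uh' ph' \<longrightarrow>
       sqrt (LINT s:{0..T}|lebesgue. (l2_norm \<Omega> (\<lambda>x. p s x - ph' s x))\<^sup>2)
         \<le> C * ((max_step N t)\<^sup>2 + mesh_size D ^ r))"
proof (intro exI[of _ "r + 3"] allI impI)
  fix \<Omega> :: "(real^'d) set" and T f u0 u p \<F>
  assume dom: "bounded_domain \<Omega>" and T: "T > 0" and sol: "nonstationary_stokes_solution \<Omega> T f u0 u p"
    and reg: "regular_data (r + 3) \<Omega> T f u p" and shape: "shape_regular_family \<Omega> \<F>"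
    and deg: "local_spaces_bounded_degree \<F>" and infsup: "uniform_inf_sup \<Omega> \<F>" and approx: "approximation_order r \<Omega> \<F>"
  interpret stokes_domain \<Omega>
    using dom by unfold_locales (auto simp: bounded_domain_def)
  obtain C where C: "0 \<le> C"
    "\<And>D N t u0h uh ph uh' ph' s. D \<in> \<F> \<Longrightarrow> time_mesh T N t \<Longrightarrow> discrete_initial_velocity \<Omega> D (f 0) u0 u0h \<Longrightarrow>
       scheme_solution \<Omega> D N t f u0h uh ph \<Longrightarrow> collocation_postprocessing \<Omega> D N t f uh ph uh' ph' \<Longrightarrow> s \<in> {0<..T} \<Longrightarrow>
       l2_norm \<Omega> (\<lambda>x. p s x - ph' s x) \<le> C * ((max_step N t)\<^sup>2 + mesh_size D ^ r)"
    by (fact pressure_error_pointwise[OF T sol reg shape deg infsup approx])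
  show "\<exists>C>0. \<forall>D\<in>\<F>. \<forall>N t u0h uh ph uh' ph'.
       time_mesh T N t \<longrightarrow> discrete_initial_velocity \<Omega> D (f 0) u0 u0h \<longrightarrow> scheme_solution \<Omega> D N t f u0h uh ph \<longrightarrow>
       collocation_postprocessing \<Omega> D N t f uh ph uh' ph' \<longrightarrow>
       sqrt (LINT s:{0..T}|lebesgue. (l2_norm \<Omega> (\<lambda>x. p s x - ph' s x))\<^sup>2) \<le> C * ((max_step N t)\<^sup>2 + mesh_size D ^ r)"
  proof (intro exI[of _ "sqrt T * C + 1"] conjI ballI allI impI)
    show "0 < sqrt T * C + 1" using T C(1) by (intro add_nonneg_pos mult_nonneg_nonneg) auto
    fix D N t u0h uh ph uh' ph'
    assume D: "D \<in> \<F>" and A: "time_mesh T N t" "discrete_initial_velocity \<Omega> D (f 0) u0 u0h"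
      "scheme_solution \<Omega> D N t f u0h uh ph" "collocation_postprocessing \<Omega> D N t f uh ph uh' ph'"
    define B where "B = (max_step N t)\<^sup>2 + mesh_size D ^ r"
    have B: "0 \<le> B" using mesh_size_pos[OF shape_regular_mesh(1)[OF shape D]] by (simp add: B_def)
    have "sqrt (LINT s:{0..T}|lebesgue. (l2_norm \<Omega> (\<lambda>x. p s x - ph' s x))\<^sup>2) \<le> sqrt T * (C * B)"
    proof (rule sqrt_integral_square_le[OF T])
      fix s assume "s \<in> {0<..T}"
      then show "0 \<le> l2_norm \<Omega> (\<lambda>x. p s x - ph' s x) \<and> l2_norm \<Omega> (\<lambda>x. p s x - ph' s x) \<le> C * B"
        using C(2)[OF D A] unfolding B_def by (simp add: l2_norm_def l2_inner_def)
    qed (use C(1) B in simp)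
    also have "\<dots> \<le> (sqrt T * C + 1) * B" using B by (simp add: algebra_simps)
    finally show "sqrt (LINT s:{0..T}|lebesgue. (l2_norm \<Omega> (\<lambda>x. p s x - ph' s x))\<^sup>2)
       \<le> (sqrt T * C + 1) * ((max_step N t)\<^sup>2 + mesh_size D ^ r)" unfolding B_def .
  qed
qed

end
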